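(* Let $d\ge3$ and let $V(x,\omega)=\mathfrak V(\tau_{-x}\omega)$ be a real-valued, bounded, mean-zero, stationary ergodic random field on $\mathbb R^d$ (in the setting described in the context), with correlation function $R$ and power spectrum $\hat R$. Assume that $R\in L^1(\mathbb R^d)$ and that there is a function $\eta:\mathbb R_+\to\mathbb R_+$, integrable in the sense that $x\mapsto\eta(|x|)$ belongs to $L^1(\mathbb R^d)$, such that for all $(x_1,x_2,x_3,x_4)\in(\mathbb R^d)^4$, $$\Big|\mathbb E\Big\{\prod_{j=1}^4V(x_j)\Big\}-R(x_1-x_2)R(x_3-x_4)\Big|\le\eta(|x_1-x_3|)\,\eta(|x_2-x_4|)+\eta(|x_1-x_4|)\,\eta(|x_2-x_3|).$$ Let $\rho:=\int_{\mathbb R^d}\frac{\hat R(\xi)}{|\xi|^2}\,d\xi$ and let $f\in L^2(\mathbb R^d)$ be deterministic. For $\varepsilon>0$ let $u_\varepsilon$ be the unique solution in $H^1(\mathbb R^d)$ ($\mathbb P$-a.s.) of $$\Big(-\Delta+1-\frac{i}{\varepsilon}V\big(\tfrac{x}{\varepsilon},\omega\big)\Big)u_\varepsilon(x)=f(x),\qquad x\in\mathbb R^d,$$ and let $u$ be the unique solution in $H^1(\mathbb R^d)$ of $-\Delta u+(1+\rho)u=f$ on $\mathbb R^d$. Then $u_\varepsilon$ converges to $u$ as $\varepsilon\to0$ and, moreover, there is a constant $C$ independent of $\varepsilon$ such that for all sufficiently small $\varepsilon>0$, $$\|u_\varepsilon-u\|_{L^2(\mathbb R^d;\mathcal H)}\le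 C\begin{cases}\sqrt{\varepsilon}, & d=3,\\ \varepsilon\sqrt{|\ln\varepsilon|}, & d=4,\\ \varepsilon, & d>4.\end{cases}$$
   Context: Setting. $i=\sqrt{-1}$. $(\Omega,\mathcal F,\mathbb P)$ is a probability space with expectation $\mathbb E$, and $\mathcal H=L^2(\Omega,\mathcal F,\mathbb P)$ (complex-valued). There is a translation group $\tau_x:\Omega\to\Omega$, $x\in\mathbb R^d$, leaving $\mathbb P$ invariant and ergodic: if $A\in\mathcal F$ satisfies $\tau_xA\subset A$ for all $x\in\mathbb R^d$, then $\mathbb P(A)=0$ or $\mathbb P(A)=1$. For $\mathfrak f\in\mathcal H$ set $T_x\mathfrak f(\omega)=\mathfrak f(\tau_{-x}\omega)$; these are unitary operators on $\mathcal H$, and the group admits a spectral resolution $T_x=\int_{\mathbb R^d}e^{i\xi\cdot x}\,U(d\xi)$ with $U$ a projection-valued measure. $\mathfrak V$ is a bounded measurable function on $\Omega$, and $V(x,\omega)=T_x\mathfrak V(\omega)=\mathfrak V(\tau_{-x}\omega)$; we write $V(x)$ for $V(x,\cdot)$. The correlation function is $R(x)=\mathbb E\{\mathfrak V\,T_x\mathfrak V\}=\mathbb E\{V(0,\cdot)V(x,\cdot)\}$. The power spectrum $\hat R$ is the rescaled Fourier transform of $R$, defined by $(2\pi)^d\hat R(\xi)=\int_{\mathbb R^d}e^{-i\xi\cdot x}R(x)\,dx$. Function spaces are complex-valued. $L^2(\mathbb R^d;\mathcal H)$ has norm $\|v\|_{L^2(\mathbb R^d;\mathcal H)}=\big(\mathbb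 E\int_{\mathbb R^d}|v|^2dx\big)^{1/2}$. *)

theory Defs
  imports "HOL-Probability.Probability"
begin

section \<open>Complex \<open>L\<^sup>2\<close> spaces\<close>

text \<open>Elements are functions, not classes modulo null sets.  The space is used for \<open>\<Omega>\<close>
  (giving \<open>\<H>\<close>), for Lebesgue measure on \<open>\<real>\<^sup>d\<close> (every class has a Borel representative),
  and for the product of the two.\<close>

definition L2 :: "'a measure \<Rightarrow> ('a \<Rightarrow> complex) set" where
  "L2 N = {f. f \<in> borel_measurable N \<and> integrable N (\<lambda>x. (cmod (f x))\<^sup>2)}"

definition L2_inner :: "'a measure \<Rightarrow> ('a \<Rightarrow> complex) \<Rightarrow> ('a \<Rightarrow> complex) \<Rightarrow> complex" where
  "L2_inner N f g = (\<integral>x. f x * cnj (g x) \<partial>N)"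

definition L2_field :: "'w measure \<Rightarrow> (real^'d \<Rightarrow> 'w \<Rightarrow> complex) set" where
  "L2_field M = {v. (\<lambda>(x, \<omega>). v x \<omega>) \<in> L2 (lborel \<Otimes>\<^sub>M M)}"

definition L2_field_norm :: "'w measure \<Rightarrow> (real^'d \<Rightarrow> 'w \<Rightarrow> complex) \<Rightarrow> real" where
  "L2_field_norm M v = sqrt (\<integral>\<omega>. (\<integral>x. (cmod (v x \<omega>))\<^sup>2 \<partial>lborel) \<partial>M)"

section \<open>Projection-valued measures on \<open>\<real>\<^sup>d\<close>\<close>

text \<open>An everywhere defined symmetric map is linear modulo null functions, and respects almost
  everywhere equality; hence neither property is listed.  Likewise multiplicativity
  \<open>U(A \<inter> B) = U(A) U(B)\<close> follows from additivity, as a sum of two orthogonal projections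
  is a projection only if their product vanishes.\<close>

definition orthogonal_projection :: "'w measure \<Rightarrow> (('w \<Rightarrow> complex) \<Rightarrow> 'w \<Rightarrow> complex) \<Rightarrow> bool" where
  "orthogonal_projection M P \<longleftrightarrow>
     (\<forall>f\<in>L2 M. P f \<in> L2 M) \<and>
     (\<forall>f\<in>L2 M. AE \<omega> in M. P (P f) \<omega> = P f \<omega>) \<and>
     (\<forall>f\<in>L2 M. \<forall>g\<in>L2 M. L2_inner M (P f) g = L2_inner M f (P g))"

definition projection_valued_measure ::
    "'w measure \<Rightarrow> ((real^'d) set \<Rightarrow> ('w \<Rightarrow> complex) \<Rightarrow> 'w \<Rightarrow> complex) \<Rightarrow> bool" where
  "projection_valued_measure M U \<longleftrightarrow>
     (\<forall>B\<in>sets borel. orthogonal_projection M (U B)) \<and>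
     (\<forall>f\<in>L2 M. AE \<omega> in M. U UNIV f \<omega> = f \<omega>) \<and>
     (\<forall>A :: nat \<Rightarrow> (real^'d) set. range A \<subseteq> sets borel \<longrightarrow> disjoint_family A \<longrightarrow>
        (\<forall>f\<in>L2 M. \<forall>g\<in>L2 M.
           (\<lambda>n. L2_inner M (U (A n) f) g) sums L2_inner M (U (\<Union>n. A n) f) g))"

text \<open>The finite positive measure \<open>B \<mapsto> \<langle>U(B) f, f\<rangle>\<close>.\<close>

definition spectral_measure ::
    "'w measure \<Rightarrow> ((real^'d) set \<Rightarrow> ('w \<Rightarrow> complex) \<Rightarrow> 'w \<Rightarrow> complex)
       \<Rightarrow> ('w \<Rightarrow> complex) \<Rightarrow> (real^'d) measure" where
  "spectral_measure M U f =
     measure_of UNIV (sets borel) (\<lambda>B. ennreal (Re (L2_inner M (U B f) f)))"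

section \<open>Stationary random fields\<close>

definition translate :: "(real^'d \<Rightarrow> 'w \<Rightarrow> 'w) \<Rightarrow> real^'d \<Rightarrow> ('w \<Rightarrow> 'b) \<Rightarrow> 'w \<Rightarrow> 'b" where
  "translate \<tau> x f = (\<lambda>\<omega>. f (\<tau> (- x) \<omega>))"

text \<open>Joint measurability makes \<open>(x, \<omega>) \<mapsto> V(x, \<omega>)\<close> a measurable random field.
  The assumption \<open>spectral_resolution\<close> is \<open>T\<^sub>x = \<integral> e\<^bsup>i\<xi>\<cdot>x\<^esup> U(d\<xi>)\<close>, stated through
  quadratic forms, which determine the operators by polarisation.\<close>

locale ergodic_translation_group = prob_space M
  for M :: "'w measure"
    and \<tau> :: "real^'d \<Rightarrow> 'w \<Rightarrow> 'w"
    and U :: "(real^'d) set \<Rightarrow> ('w \<Rightarrow> complex) \<Rightarrow> 'w \<Rightarrow> complex" +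
  assumes jointly_measurable: "(\<lambda>(x, \<omega>). \<tau> x \<omega>) \<in> borel \<Otimes>\<^sub>M M \<rightarrow>\<^sub>M M"
    and translation_zero: "\<And>\<omega>. \<omega> \<in> space M \<Longrightarrow> \<tau> 0 \<omega> = \<omega>"
    and translation_add: "\<And>x y \<omega>. \<omega> \<in> space M \<Longrightarrow> \<tau> (x + y) \<omega> = \<tau> x (\<tau> y \<omega>)"
    and invariant: "\<And>x. distr M M (\<tau> x) = M"
    and ergodic: "\<And>A. A \<in> sets M \<Longrightarrow> (\<And>x. \<tau> x ` A \<subseteq> A) \<Longrightarrow> prob A = 0 \<or> prob A = 1"
    and projection_valued: "projection_valued_measure M U"
    and spectral_resolution: "\<And>x f. f \<in> L2 M \<Longrightarrow>
          L2_inner M (translate \<tau> x f) f = (\<integral>\<xi>. cis (\<xi> \<bullet> x) \<partial>spectral_measure M U f)"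

definition correlation ::
    "'w measure \<Rightarrow> (real^'d \<Rightarrow> 'w \<Rightarrow> 'w) \<Rightarrow> ('w \<Rightarrow> real) \<Rightarrow> real^'d \<Rightarrow> real" where
  "correlation M \<tau> v x = (\<integral>\<omega>. v \<omega> * translate \<tau> x v \<omega> \<partial>M)"

definition power_spectrum :: "(real^'d \<Rightarrow> real) \<Rightarrow> real^'d \<Rightarrow> complex" where
  "power_spectrum R \<xi> =
     (\<integral>x. cis (- (\<xi> \<bullet> x)) * complex_of_real (R x) \<partial>lborel) / of_real ((2 * pi) ^ CARD('d))"

definition effective_potential :: "(real^'d \<Rightarrow> real) \<Rightarrow> complex" where
  "effective_potential R = (\<integral>\<xi>. power_spectrum R \<xi> / of_real ((norm \<xi>)\<^sup>2) \<partial>lborel)"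

section \<open>Weak solutions in \<open>H\<^sup>1\<close>\<close>

text \<open>\<open>D [i\<^sub>1, \<dots>, i\<^sub>k]\<close> is the iterated partial derivative of \<open>\<phi>\<close>; all of them
  being Frechet differentiable is smoothness.\<close>

definition smooth :: "(real^'d \<Rightarrow> complex) \<Rightarrow> bool" where
  "smooth \<phi> \<longleftrightarrow> (\<exists>D :: 'd list \<Rightarrow> real^'d \<Rightarrow> complex. D [] = \<phi> \<and>
     (\<forall>l x. (D l has_derivative (\<lambda>h. \<Sum>i\<in>UNIV. h $ i *\<^sub>R D (i # l) x)) (at x)))"

definition test_function :: "(real^'d \<Rightarrow> complex) \<Rightarrow> bool" where
  "test_function \<phi> \<longleftrightarrow> smooth \<phi> \<and> (\<exists>K. compact K \<and> (\<forall>x. x \<notin> K \<longrightarrow> \<phi> x = 0))"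

definition partial_deriv :: "'d \<Rightarrow> (real^'d \<Rightarrow> complex) \<Rightarrow> real^'d \<Rightarrow> complex" where
  "partial_deriv i \<phi> x = frechet_derivative \<phi> (at x) (axis i 1)"

definition weak_partial_deriv ::
    "'d \<Rightarrow> (real^'d \<Rightarrow> complex) \<Rightarrow> (real^'d \<Rightarrow> complex) \<Rightarrow> bool" where
  "weak_partial_deriv i u g \<longleftrightarrow> (\<forall>\<phi>. test_function \<phi> \<longrightarrow>
     (\<integral>x. u x * partial_deriv i \<phi> x \<partial>lborel) = - (\<integral>x. g x * \<phi> x \<partial>lborel))"

text \<open>\<open>u\<close> belongs to \<open>H\<^sup>1(\<real>\<^sup>d)\<close> and has weak gradient \<open>G\<close>.\<close>

definition H1_with_gradient :: "(real^'d \<Rightarrow> complex) \<Rightarrow> ('d \<Rightarrow> real^'d \<Rightarrow> complex) \<Rightarrow> bool" where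
  "H1_with_gradient u G \<longleftrightarrow>
     u \<in> L2 lborel \<and> (\<forall>i. G i \<in> L2 lborel \<and> weak_partial_deriv i u (G i))"

text \<open>\<open>u \<in> H\<^sup>1(\<real>\<^sup>d)\<close> solves \<open>- \<Delta> u + q u = f\<close>, in the variational formulation: integrated
  against the conjugate of an arbitrary \<open>v \<in> H\<^sup>1(\<real>\<^sup>d)\<close>.\<close>

definition H1_solution ::
    "(real^'d \<Rightarrow> complex) \<Rightarrow> (real^'d \<Rightarrow> complex) \<Rightarrow> (real^'d \<Rightarrow> complex) \<Rightarrow> bool" where
  "H1_solution q f u \<longleftrightarrow> (\<exists>G. H1_with_gradient u G \<and>
     (\<forall>v H. H1_with_gradient v H \<longrightarrow>
        (\<Sum>i\<in>UNIV. L2_inner lborel (G i) (H i)) + L2_inner lborel (\<lambda>x. q x * u x) v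
          = L2_inner lborel f v))"

end

theory Submission
  imports Defs
begin

text \<open>The proof is a two-scale expansion with correctors cut off at the macroscopic scale, followed
  by an energy estimate.

  Let \<open>p\<^sub>t\<close> be the heat kernel and \<open>K\<close> its integral over the times \<open>t\<close> between a tiny \<open>\<delta>\<close> and
  \<open>T = 1 / \<epsilon>\<^sup>2\<close>. The heat equation gives \<open>- \<Delta> K = p\<^sub>\<delta> - p\<^sub>T\<close>. So the stationary field \<open>\<phi> = K * V\<close>
  satisfies \<open>- \<Delta> \<phi> = V\<close> up to \<open>p\<^sub>\<delta> * V - V\<close>, which is as small in mean square as one likes, because
  the correlation is continuous, and up to \<open>p\<^sub>T * V\<close>, whose second moment is at most
  \<open>T\<^bsup>-d/2\<^esup>\<close> times the \<open>L\<^sup>1\<close> norm of \<open>R\<close>. A truncated kernel avoids a corrector that is stationary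
  only in high dimension: \<open>\<phi>\<close> is bounded for every \<open>\<epsilon>\<close>, and only its second moment may grow.

  Put \<open>e(x) = u\<^sub>\<epsilon>(x) - u(x) - i \<epsilon> \<phi>(x/\<epsilon>) u(x)\<close>. In the equation of \<open>e\<close> the term of order \<open>1/\<epsilon>\<close> cancels,
  and the potential acting on the corrector leaves \<open>V \<phi> u\<close>. Its mean \<open>m = E(V \<phi>)\<close> is the integral of
  \<open>K R\<close>, which is \<open>\<rho>\<close> up to \<open>O(\<epsilon>)\<close> (lemma \<open>effective_potential_approx\<close>). The fluctuation
  \<open>W = V \<phi> - m\<close> is not small, but it oscillates: with \<open>\<psi> = K' * W\<close>, for the same kind of kernel, it is
  \<open>- \<Delta> \<psi>\<close> up to small errors, and an integration by parts moves one derivative onto \<open>e\<close> and \<open>u\<close> at the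
  price of \<open>\<epsilon> \<nabla>\<psi>\<close>. The potential \<open>- (i/\<epsilon>) V\<close> is purely imaginary, so the real part of the energy of
  \<open>e\<close> is its full \<open>H\<^sup>1\<close> norm, whatever the size of \<open>1/\<epsilon>\<close>. This bounds \<open>e\<close> in \<open>L\<^sup>2\<close> by the
  remainders, for almost every \<open>\<omega>\<close> (lemma \<open>two_scale_estimate\<close>).

  It remains to take expectations. Every remainder is a product of a stationary field at \<open>x/\<epsilon>\<close> with a
  deterministic \<open>L\<^sup>2\<close> function, so by stationarity only second moments are needed:
  those of \<open>\<phi>\<close> and of \<open>\<nabla>\<psi>\<close>. The first is controlled by the \<open>L\<^sup>2\<close> norm of \<open>K\<close>
  (lemma \<open>near_far_moments\<close>), the second by the variance of \<open>W\<close> and by the \<open>L\<^sup>1\<close> norm of the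
  correlation of \<open>W\<close> (lemma \<open>corrector_gradient\<close>); the fourth moment condition bounds the
  latter (lemma \<open>corrector_covariance\<close>). All these bounds grow with \<open>T\<close> like the squared \<open>L\<^sup>2\<close> norm of
  the Green function on the ball of radius \<open>\<surd>T = 1/\<epsilon>\<close>, which is \<open>\<surd>T\<close> for \<open>d = 3\<close>, \<open>ln T\<close> for
  \<open>d = 4\<close> and bounded for \<open>d > 4\<close>. Multiplication by \<open>\<epsilon>\<^sup>2\<close> gives the square of the rate.\<close>

section \<open>The space \<open>L\<^sup>2\<close>\<close>

lemma L2_measurable [measurable_dest]: "f \<in> L2 N \<Longrightarrow> f \<in> borel_measurable N"
  by (simp add: L2_def)

lemma L2_square_integrable: "f \<in> L2 N \<Longrightarrow> integrable N (\<lambda>x. (cmod (f x))\<^sup>2)"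
  by (simp add: L2_def)

text \<open>Weights turn products of norms into sums of squares, with the large factor given the small weight;
  in this form the Cauchy-Schwarz inequality needs no square roots of integrals.\<close>

lemma weighted_product_le:
  fixes a b c :: real
  assumes "c > 0"
  shows "a * b \<le> (c * a\<^sup>2 + b\<^sup>2 / c) / 2"
proof -
  have "0 \<le> (c * a - b)\<^sup>2 / c" using assms by simp
  also have "\<dots> = c * a\<^sup>2 + b\<^sup>2 / c - 2 * (a * b)"
    using assms by (simp add: field_simps power2_eq_square)
  finally show ?thesis by simp
qed

lemma square_sum_le: "(a + b)\<^sup>2 \<le> 2 * a\<^sup>2 + 2 * (b::real)\<^sup>2"
  using sum_squares_bound[of a b] by (simp add: power2_sum)

lemma cmod_add_square_le: "(cmod (a + b))\<^sup>2 \<le> 2 * (cmod a)\<^sup>2 + 2 * (cmod b)\<^sup>2"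
  by (rule order_trans[OF power_mono[OF norm_triangle_ineq] square_sum_le]) auto

lemma L2_add [intro]:
  assumes "f \<in> L2 N" "g \<in> L2 N"
  shows "(\<lambda>x. f x + g x) \<in> L2 N"
proof -
  note [measurable] = assms[THEN L2_measurable]
  have "integrable N (\<lambda>x. 2 * (cmod (f x))\<^sup>2 + 2 * (cmod (g x))\<^sup>2)"
    using assms[THEN L2_square_integrable] by simp
  then have "integrable N (\<lambda>x. (cmod (f x + g x))\<^sup>2)"
    by (rule Bochner_Integration.integrable_bound) (auto simp: cmod_add_square_le)
  then show ?thesis by (simp add: L2_def)
qed

lemma L2_bounded_mult:
  assumes f: "f \<in> L2 N" and [measurable]: "g \<in> borel_measurable N"
    and g: "\<And>x. x \<in> space N \<Longrightarrow> cmod (g x) \<le> B"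
  shows "(\<lambda>x. g x * f x) \<in> L2 N"
proof -
  note [measurable] = f[THEN L2_measurable]
  have "integrable N (\<lambda>x. B\<^sup>2 * (cmod (f x))\<^sup>2)"
    using f[THEN L2_square_integrable] by simp
  then have "integrable N (\<lambda>x. (cmod (g x * f x))\<^sup>2)"
    by (rule Bochner_Integration.integrable_bound)
      (auto simp: norm_mult power_mult_distrib g intro!: AE_I2 mult_right_mono power_mono)
  then show ?thesis by (simp add: L2_def)
qed

lemma L2_scale [intro]: "f \<in> L2 N \<Longrightarrow> (\<lambda>x. c * f x) \<in> L2 N"
  by (rule L2_bounded_mult[where B = "cmod c"]) auto

lemma L2_uminus [intro]: "f \<in> L2 N \<Longrightarrow> (\<lambda>x. - f x) \<in> L2 N"
  using L2_scale[of f N "-1"] by simp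

lemma L2_diff [intro]: "f \<in> L2 N \<Longrightarrow> g \<in> L2 N \<Longrightarrow> (\<lambda>x. f x - g x) \<in> L2 N"
  using L2_add[of f N "\<lambda>x. - g x"] by auto

lemma L2_zero [intro]: "(\<lambda>x. 0) \<in> L2 N"
  by (simp add: L2_def)

lemma L2_sum [intro]: "(\<And>i. i \<in> I \<Longrightarrow> f i \<in> L2 N) \<Longrightarrow> (\<lambda>x. \<Sum>i\<in>I. f i x) \<in> L2 N"
  by (induction I rule: infinite_finite_induct) auto

lemma borel_measurable_cnj [measurable]: "cnj \<in> borel_measurable borel"
  by (intro borel_measurable_continuous_onI continuous_intros)

lemma L2_cnj [intro]: "f \<in> L2 N \<Longrightarrow> (\<lambda>x. cnj (f x)) \<in> L2 N"
  unfolding L2_def by auto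

lemma L2_mult_integrable:
  assumes "f \<in> L2 N" "g \<in> L2 N"
  shows "integrable N (\<lambda>x. f x * g x)"
proof -
  note [measurable] = assms[THEN L2_measurable]
  have "integrable N (\<lambda>x. (cmod (f x))\<^sup>2 + (cmod (g x))\<^sup>2)"
    using assms[THEN L2_square_integrable] by simp
  then show ?thesis
  proof (rule Bochner_Integration.integrable_bound)
    show "AE x in N. norm (f x * g x) \<le> norm ((cmod (f x))\<^sup>2 + (cmod (g x))\<^sup>2)"
    proof (rule AE_I2)
      fix x
      have "cmod (f x) * cmod (g x) \<le> (cmod (f x))\<^sup>2 + (cmod (g x))\<^sup>2"
        using sum_squares_bound[of "cmod (f x)" "cmod (g x)"]
          mult_nonneg_nonneg[OF norm_ge_zero norm_ge_zero, of "f x" "g x"] by linarith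
      then show "norm (f x * g x) \<le> norm ((cmod (f x))\<^sup>2 + (cmod (g x))\<^sup>2)"
        by (simp add: norm_mult)
    qed
  qed measurable
qed

lemma L2_inner_integrable:
  "f \<in> L2 N \<Longrightarrow> g \<in> L2 N \<Longrightarrow> integrable N (\<lambda>x. f x * cnj (g x))"
  by (intro L2_mult_integrable L2_cnj)

lemma L2_inner_add_left:
  "f \<in> L2 N \<Longrightarrow> g \<in> L2 N \<Longrightarrow> h \<in> L2 N
    \<Longrightarrow> L2_inner N (\<lambda>x. f x + g x) h = L2_inner N f h + L2_inner N g h"
  by (simp add: L2_inner_def distrib_right L2_inner_integrable)

lemma L2_inner_diff_left:
  "f \<in> L2 N \<Longrightarrow> g \<in> L2 N \<Longrightarrow> h \<in> L2 N
    \<Longrightarrow> L2_inner N (\<lambda>x. f x - g x) h = L2_inner N f h - L2_inner N g h"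
  by (simp add: L2_inner_def left_diff_distrib L2_inner_integrable)

lemma L2_inner_add_right:
  "f \<in> L2 N \<Longrightarrow> g \<in> L2 N \<Longrightarrow> h \<in> L2 N
    \<Longrightarrow> L2_inner N f (\<lambda>x. g x + h x) = L2_inner N f g + L2_inner N f h"
  by (simp add: L2_inner_def distrib_left L2_inner_integrable)

lemma L2_inner_scale_left: "L2_inner N (\<lambda>x. c * f x) h = c * L2_inner N f h"
  by (simp add: L2_inner_def mult.assoc)

lemma L2_inner_sum_left:
  "(\<And>i. i \<in> I \<Longrightarrow> f i \<in> L2 N) \<Longrightarrow> h \<in> L2 N
    \<Longrightarrow> L2_inner N (\<lambda>x. \<Sum>i\<in>I. f i x) h = (\<Sum>i\<in>I. L2_inner N (f i) h)"
  by (simp add: L2_inner_def sum_distrib_right Bochner_Integration.integral_sum L2_inner_integrable)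

lemma L2_inner_move_real:
  "L2_inner N f (\<lambda>x. of_real (a x) * g x) = L2_inner N (\<lambda>x. of_real (a x) * f x) g"
  by (simp add: L2_inner_def mult_ac)

lemma L2_inner_self: "L2_inner N f f = of_real (\<integral>x. (cmod (f x))\<^sup>2 \<partial>N)"
  by (simp add: L2_inner_def complex_norm_square[symmetric] del: of_real_power)

lemma L2_inner_bound_weighted:
  assumes f: "f \<in> L2 N" and g: "g \<in> L2 N" and c: "c > 0"
  shows "cmod (L2_inner N f g)
    \<le> (c * (\<integral>x. (cmod (f x))\<^sup>2 \<partial>N) + (\<integral>x. (cmod (g x))\<^sup>2 \<partial>N) / c) / 2"
proof -
  have "cmod (L2_inner N f g) \<le> (\<integral>x. cmod (f x * cnj (g x)) \<partial>N)"
    unfolding L2_inner_def by (rule integral_norm_bound)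
  also have "\<dots> \<le> (\<integral>x. (c * (cmod (f x))\<^sup>2 + (cmod (g x))\<^sup>2 / c) / 2 \<partial>N)"
    using f g by (intro integral_mono integrable_norm L2_inner_integrable)
      (auto simp: L2_square_integrable norm_mult intro: weighted_product_le[OF c] simp del: divide_le_eq_numeral1 le_divide_eq_numeral1)
  also have "\<dots> = (c * (\<integral>x. (cmod (f x))\<^sup>2 \<partial>N) + (\<integral>x. (cmod (g x))\<^sup>2 \<partial>N) / c) / 2"
    using f g by (simp add: L2_square_integrable)
  finally show ?thesis .
qed

section \<open>Translations\<close>

lemma lborel_reflect_eq: "distr lborel borel (\<lambda>x. c - x) = (lborel :: 'a::euclidean_space measure)"
proof -
  have "lborel = density (distr lborel borel (\<lambda>x. c + (-1) *\<^sub>R x)) (\<lambda>_. ennreal (\<bar>-1\<bar>^DIM('a)))"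
    by (rule lborel_affine) auto
  then show ?thesis by (simp add: density_1)
qed

lemma
  fixes f :: "'a::euclidean_space \<Rightarrow> 'b::{banach, second_countable_topology}"
  assumes [measurable]: "f \<in> borel_measurable borel"
  shows lborel_integral_translate: "(\<integral>x. f (c + x) \<partial>lborel) = (\<integral>x. f x \<partial>lborel)"
    and lborel_integrable_translate: "integrable lborel (\<lambda>x. f (c + x)) \<longleftrightarrow> integrable lborel f"
    and lborel_integral_reflect: "(\<integral>x. f (c - x) \<partial>lborel) = (\<integral>x. f x \<partial>lborel)"
    and lborel_integrable_reflect: "integrable lborel (\<lambda>x. f (c - x)) \<longleftrightarrow> integrable lborel f"
  subgoal by (subst (2) lborel_distr_plus[of c, symmetric], subst integral_distr) auto
  subgoal by (subst (2) lborel_distr_plus[of c, symmetric], subst integrable_distr_eq) auto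
  subgoal by (subst (2) lborel_reflect_eq[of c, symmetric], subst integral_distr) auto
  subgoal by (subst (2) lborel_reflect_eq[of c, symmetric], subst integrable_distr_eq) auto
  done

lemma
  fixes f :: "'a::euclidean_space \<Rightarrow> ennreal"
  assumes [measurable]: "f \<in> borel_measurable borel"
  shows lborel_nn_integral_translate: "(\<integral>\<^sup>+x. f (c + x) \<partial>lborel) = (\<integral>\<^sup>+x. f x \<partial>lborel)"
    and lborel_nn_integral_reflect: "(\<integral>\<^sup>+x. f (c - x) \<partial>lborel) = (\<integral>\<^sup>+x. f x \<partial>lborel)"
  subgoal by (subst (2) lborel_distr_plus[of c, symmetric], subst nn_integral_distr) auto
  subgoal by (subst (2) lborel_reflect_eq[of c, symmetric], subst nn_integral_distr) auto
  done

lemma L2_translate: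
  fixes f :: "'a::euclidean_space \<Rightarrow> complex"
  assumes f: "f \<in> L2 lborel"
  shows "(\<lambda>x. f (c + x)) \<in> L2 lborel"
    and "(\<integral>x. (cmod (f (c + x)))\<^sup>2 \<partial>lborel) = (\<integral>x. (cmod (f x))\<^sup>2 \<partial>lborel)"
proof -
  have [measurable]: "f \<in> borel_measurable borel" using f[THEN L2_measurable] by simp
  show "(\<lambda>x. f (c + x)) \<in> L2 lborel"
    using f lborel_integrable_translate[of "\<lambda>x. (cmod (f x))\<^sup>2" c] by (simp add: L2_def)
  show "(\<integral>x. (cmod (f (c + x)))\<^sup>2 \<partial>lborel) = (\<integral>x. (cmod (f x))\<^sup>2 \<partial>lborel)"
    by (rule lborel_integral_translate[where f = "\<lambda>x. (cmod (f x))\<^sup>2"]) measurable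
qed

section \<open>Continuity of correlations of \<open>L\<^sup>2\<close> functions\<close>

lemma isCont_uniform_approx:
  fixes F :: "'a::metric_space \<Rightarrow> 'b::metric_space"
  assumes "\<And>e. e > 0 \<Longrightarrow> \<exists>G. isCont G x0 \<and> (\<forall>x. dist (F x) (G x) \<le> e)"
  shows "isCont F x0"
  unfolding continuous_at_eps_delta
proof (intro allI impI)
  fix e :: real assume e: "e > 0"
  obtain G where G: "isCont G x0" "\<And>x. dist (F x) (G x) \<le> e / 4"
    using assms[of "e / 4"] e by auto
  obtain d where d: "d > 0" "\<And>x. dist x x0 < d \<Longrightarrow> dist (G x) (G x0) < e / 4"
    using G(1) e unfolding continuous_at_eps_delta by (metis zero_less_divide_iff zero_less_numeral)
  show "\<exists>d>0. \<forall>x'. dist x' x0 < d \<longrightarrow> dist (F x') (F x0) < e"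
  proof (intro exI[of _ d] conjI allI impI)
    fix x assume "dist x x0 < d"
    then have "dist (G x) (G x0) < e / 4" by (rule d(2))
    moreover have "dist (F x) (F x0) \<le> dist (F x) (G x) + dist (G x) (G x0) + dist (F x0) (G x0)"
      by (metis add.commute add_left_mono dist_commute dist_triangle dist_triangle2 order_trans
          add_right_mono)
    ultimately show "dist (F x) (F x0) < e" using G(2)[of x] G(2)[of x0] e by linarith
  qed (use d in auto)
qed

lemma integrable_indicator_complex:
  assumes "S \<in> sets N" "emeasure N S < \<infinity>"
  shows "integrable N (indicator S :: 'a \<Rightarrow> complex)"
proof -
  have "integrable N (\<lambda>x. complex_of_real (indicator S x))"
    using assms by (intro integrable_of_real integrable_real_indicator)
  then show ?thesis by (rule back_subst[where P = "integrable N"]) (auto simp: indicator_def)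
qed

text \<open>Replacing \<open>b\<close> by a function that is close to it in \<open>L\<^sup>1\<close> changes the correlation with a bounded
  function by little, uniformly in the shift. So continuity passes to \<open>L\<^sup>1\<close> limits.\<close>

lemma isCont_correlation_L1_limit:
  fixes a b :: "'a::euclidean_space \<Rightarrow> complex"
  assumes [measurable]: "a \<in> borel_measurable borel" and a: "\<And>x. cmod (a x) \<le> A"
    and b: "integrable lborel b"
    and approx: "\<And>e. e > 0 \<Longrightarrow> \<exists>g. integrable lborel g \<and> (\<integral>x. cmod (b x - g x) \<partial>lborel) \<le> e
                   \<and> isCont (\<lambda>y. \<integral>x. a x * g (x + y) \<partial>lborel) y0"
  shows "isCont (\<lambda>y. \<integral>x. a x * b (x + y) \<partial>lborel) y0"
proof (rule isCont_uniform_approx)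
  fix e :: real assume e: "e > 0"
  have A: "A \<ge> 0" using a[of 0] norm_ge_zero order_trans by blast
  obtain g where g: "integrable lborel g" and *: "(\<integral>x. cmod (b x - g x) \<partial>lborel) \<le> e / (A + 1)"
      and cont: "isCont (\<lambda>y. \<integral>x. a x * g (x + y) \<partial>lborel) y0"
    using approx[of "e / (A + 1)"] e A by auto
  have [measurable]: "b \<in> borel_measurable borel" "g \<in> borel_measurable borel"
    using b g by auto
  have int: "integrable lborel (\<lambda>x. a x * h (x + y))" if "integrable lborel h" for h y
  proof (rule Bochner_Integration.integrable_bound)
    have [measurable]: "h \<in> borel_measurable borel" using that by auto
    show "integrable lborel (\<lambda>x. A * cmod (h (x + y)))"
      using lborel_integrable_translate[of "\<lambda>x. cmod (h x)" y] that by (auto simp: add.commute)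
    show "AE x in lborel. norm (a x * h (x + y)) \<le> norm (A * cmod (h (x + y)))"
      using a A by (auto simp: norm_mult intro!: mult_right_mono)
    show "(\<lambda>x. a x * h (x + y)) \<in> borel_measurable lborel" by simp
  qed
  have "dist (\<integral>x. a x * b (x + y) \<partial>lborel) (\<integral>x. a x * g (x + y) \<partial>lborel) \<le> e" for y
  proof -
    have "dist (\<integral>x. a x * b (x + y) \<partial>lborel) (\<integral>x. a x * g (x + y) \<partial>lborel)
        = cmod (\<integral>x. a x * (b (x + y) - g (x + y)) \<partial>lborel)"
      using int b g by (simp add: dist_norm right_diff_distrib)
    also have "\<dots> \<le> (\<integral>x. cmod (a x * (b (x + y) - g (x + y))) \<partial>lborel)"
      by (rule integral_norm_bound)
    also have "\<dots> \<le> (\<integral>x. A * cmod (b (x + y) - g (x + y)) \<partial>lborel)"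
    proof (rule integral_mono)
      show "integrable lborel (\<lambda>x. cmod (a x * (b (x + y) - g (x + y))))"
        using int[OF Bochner_Integration.integrable_diff[OF b g], of y] by simp
      show "integrable lborel (\<lambda>x. A * cmod (b (x + y) - g (x + y)))"
        using lborel_integrable_translate[of "\<lambda>x. cmod (b x - g x)" y] b g
        by (auto simp: add.commute)
      show "cmod (a x * (b (x + y) - g (x + y))) \<le> A * cmod (b (x + y) - g (x + y))" for x
        using a by (auto simp: norm_mult intro!: mult_right_mono)
    qed
    also have "\<dots> = A * (\<integral>x. cmod (b x - g x) \<partial>lborel)"
      using lborel_integral_translate[of "\<lambda>x. cmod (b x - g x)" y] by (simp add: add.commute)
    also have "\<dots> \<le> A * (e / (A + 1))" using * A by (intro mult_left_mono) auto
    also have "\<dots> \<le> e" using A e by (simp add: field_simps)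
    finally show ?thesis .
  qed
  with cont show "\<exists>G. isCont G y0 \<and> (\<forall>y. dist (\<integral>x. a x * b (x + y) \<partial>lborel) (G y) \<le> e)"
    by blast
qed

lemma isCont_correlation_continuous:
  fixes a g :: "'a::euclidean_space \<Rightarrow> complex"
  assumes a: "integrable lborel a" and g: "continuous_on UNIV g" "\<And>x. cmod (g x) \<le> B"
  shows "isCont (\<lambda>y. \<integral>x. a x * g (x + y) \<partial>lborel) y0"
  unfolding continuous_at_sequentially
proof (intro allI impI)
  fix X assume X: "X \<longlonglongrightarrow> y0"
  have [measurable]: "a \<in> borel_measurable borel" "g \<in> borel_measurable borel"
    using a borel_measurable_continuous_onI[OF g(1)] by auto
  have B: "B \<ge> 0" using g(2)[of 0] norm_ge_zero order_trans by blast
  have "(\<lambda>n. \<integral>x. a x * g (x + X n) \<partial>lborel) \<longlonglongrightarrow> (\<integral>x. a x * g (x + y0) \<partial>lborel)"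
  proof (rule integral_dominated_convergence[where w = "\<lambda>x. B * cmod (a x)"])
    show "AE x in lborel. (\<lambda>n. a x * g (x + X n)) \<longlonglongrightarrow> a x * g (x + y0)"
      using X by (auto intro!: tendsto_intros continuous_on_tendsto_compose[OF g(1)])
    show "AE x in lborel. norm (a x * g (x + X n)) \<le> B * cmod (a x)" for n
      using g(2) by (auto simp: norm_mult mult.commute[of B] intro!: mult_left_mono)
  qed (use a in auto)
  then show "((\<lambda>y. \<integral>x. a x * g (x + y) \<partial>lborel) \<circ> X) \<longlonglongrightarrow> (\<integral>x. a x * g (x + y0) \<partial>lborel)"
    by (simp add: comp_def)
qed

text \<open>An open set of finite measure is an increasing limit of the continuous functions
  \<open>min 1 (n dist(x, -S))\<close>.\<close>

lemma isCont_correlation_open: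
  fixes a :: "'a::euclidean_space \<Rightarrow> complex"
  assumes a: "integrable lborel a" "\<And>x. cmod (a x) \<le> A"
    and S: "open S" "emeasure lborel S < \<infinity>"
  shows "isCont (\<lambda>y. \<integral>x. a x * indicator S (x + y) \<partial>lborel) y0"
proof (cases "S = UNIV")
  case True
  then show ?thesis by simp
next
  case False
  have [measurable]: "a \<in> borel_measurable borel" "S \<in> sets borel" using a S by auto
  define g where "g n x = complex_of_real (min 1 (real n * setdist {x} (- S)))" for n x
  have gS: "g n x = 0" if "x \<notin> S" for n x using that by (auto simp: g_def setdist_eq_0I)
  have g1: "cmod (g n x) \<le> 1" for n x by (auto simp: g_def setdist_pos_le)
  have gc: "continuous_on UNIV (g n)" for n
    unfolding g_def by (intro continuous_intros continuous_on_setdist)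
  have [measurable]: "g n \<in> borel_measurable borel" for n
    by (rule borel_measurable_continuous_onI[OF gc])
  have gi: "cmod (g n x) \<le> indicator S x" for n x using gS g1 by (cases "x \<in> S") auto
  have Si: "integrable lborel (indicator S :: 'a \<Rightarrow> real)" using S by simp
  have SiC: "integrable lborel (indicator S :: 'a \<Rightarrow> complex)"
    using S by (intro integrable_indicator_complex) auto
  have gint: "integrable lborel (g n)" for n
    by (rule Bochner_Integration.integrable_bound[OF Si]) (use gi in auto)
  have lim: "(\<lambda>n. g n x) \<longlonglongrightarrow> indicator S x" for x
  proof (cases "x \<in> S")
    case True
    have pos: "setdist {x} (- S) > 0"
    proof -
      have "setdist {x} (- S) \<noteq> 0"
        using True \<open>open S\<close> \<open>S \<noteq> UNIV\<close> setdist_eq_0_sing_1[of x "- S"]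
        by (auto simp: closure_closed closed_Compl)
      then show ?thesis using setdist_pos_le[of "{x}" "- S"] by linarith
    qed
    obtain N where "real N * setdist {x} (- S) > 1" using ex_less_of_nat_mult[OF pos] by blast
    then have "g n x = 1" if "n \<ge> N" for n
    proof -
      have "real N * setdist {x} (- S) \<le> real n * setdist {x} (- S)"
        using that pos by (intro mult_right_mono) auto
      with \<open>real N * _ > 1\<close> show ?thesis by (simp add: g_def)
    qed
    then show ?thesis using True by (intro tendsto_eventually) (auto simp: eventually_sequentially)
  qed (simp add: gS)
  show ?thesis
  proof (rule isCont_correlation_L1_limit[OF _ a(2) SiC])
    fix e :: real assume e: "e > 0"
    have "(\<lambda>n. \<integral>x. cmod (indicator S x - g n x) \<partial>lborel) \<longlonglongrightarrow> (\<integral>x. 0 \<partial>(lborel :: 'a measure))"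
    proof (rule integral_dominated_convergence[where w = "\<lambda>x. 2 * indicator S x"])
      show "AE x in lborel. (\<lambda>n. cmod (indicator S x - g n x)) \<longlonglongrightarrow> 0"
      proof (rule AE_I2)
        fix x :: 'a
        show "(\<lambda>n. cmod (indicator S x - g n x)) \<longlonglongrightarrow> 0"
          using tendsto_norm[OF tendsto_diff[OF tendsto_const[of "indicator S x"] lim[of x]]] by simp
      qed
      show "AE x in lborel. norm (cmod (indicator S x - g n x)) \<le> 2 * indicator S x" for n
      proof (rule AE_I2)
        fix x
        have "cmod (indicator S x - g n x) \<le> cmod (indicator S x) + cmod (g n x)"
          by (rule norm_triangle_ineq4)
        then show "norm (cmod (indicator S x - g n x)) \<le> 2 * indicator S x"
          using gi[of n x] by (auto simp: indicator_def split: if_splits)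
      qed
    qed (use Si in auto)
    then have "eventually (\<lambda>n. (\<integral>x. cmod (indicator S x - g n x) \<partial>lborel) < e) sequentially"
      using e by (simp add: order_tendsto_iff)
    then obtain n where "(\<integral>x. cmod (indicator S x - g n x) \<partial>lborel) < e"
      using eventually_happens'[OF sequentially_bot] by blast
    then show "\<exists>g. integrable lborel g \<and> (\<integral>x. cmod (indicator S x - g x) \<partial>lborel) \<le> e
        \<and> isCont (\<lambda>y. \<integral>x. a x * g (x + y) \<partial>lborel) y0"
      using gint isCont_correlation_continuous[OF a(1) gc g1] by (intro exI[of _ "g n"]) auto
  qed simp
qed

text \<open>The induction over integrable functions reaches \<open>b\<close> from indicators of Borel sets, and outer
  regularity reaches these from indicators of open sets.\<close>

lemma isCont_correlation_L1:
  fixes a b :: "'a::euclidean_space \<Rightarrow> complex"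
  assumes a: "integrable lborel a" "\<And>x. cmod (a x) \<le> A" and b: "integrable lborel b"
  shows "isCont (\<lambda>y. \<integral>x. a x * b (x + y) \<partial>lborel) y0"
  using b
proof (induction rule: integrable_induct)
  case (base S c)
  have [measurable]: "a \<in> borel_measurable borel" "S \<in> sets borel" using a base by auto
  have fin: "integrable lborel (indicator S :: 'a \<Rightarrow> complex)"
    using base by (intro integrable_indicator_complex) auto
  have "isCont (\<lambda>y. \<integral>x. a x * indicator S (x + y) \<partial>lborel) y0"
  proof (rule isCont_correlation_L1_limit[OF _ a(2) fin])
    fix e :: real assume e: "e > 0"
    obtain T where T: "open T" "S \<subseteq> T" "emeasure lborel (T - S) < ennreal e"
    proof -
      obtain T where T: "open T" "S \<subseteq> T" "emeasure lebesgue (T - S) < ennreal e"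
        using sets_lebesgue_outer_open[of S e] e by (metis \<open>S \<in> sets borel\<close> sets_completionI_sets sets_lborel)
      then have "emeasure lebesgue (T - S) = emeasure lborel (T - S)" by simp
      with T that show ?thesis by auto
    qed
    have TS: "emeasure lborel T < \<infinity>"
    proof -
      have "emeasure lborel T \<le> emeasure lborel S + emeasure lborel (T - S)"
        using emeasure_subadditive[of S lborel "T - S"] T base by (simp add: Un_absorb1)
      also have "\<dots> < \<infinity>" using T(3) base
        by (metis ennreal_add_less_top ennreal_less_top infinity_ennreal_def order_less_trans)
      finally show ?thesis .
    qed
    have eq: "cmod (indicator S x - indicator T x) = indicator (T - S) x" for x
      using T by (auto simp: indicator_def)
    have "integrable lborel (indicator T :: 'a \<Rightarrow> complex)"
      using T TS by (intro integrable_indicator_complex) auto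
    moreover have "(\<integral>x. cmod (indicator S x - indicator T x) \<partial>lborel) \<le> e"
    proof -
      have "enn2real (emeasure lborel (T - S)) \<le> e" using T(3) e by (intro enn2real_leI) auto
      then show ?thesis unfolding eq by (simp add: measure_def)
    qed
    ultimately show "\<exists>g. integrable lborel g \<and> (\<integral>x. cmod (indicator S x - g x) \<partial>lborel) \<le> e
        \<and> isCont (\<lambda>y. \<integral>x. a x * g (x + y) \<partial>lborel) y0"
      using isCont_correlation_open[OF a T(1) TS] by blast
  qed simp
  then have "isCont (\<lambda>y. (\<integral>x. a x * indicator S (x + y) \<partial>lborel) * c) y0"
    by (intro continuous_intros)
  moreover have "(\<integral>x. a x * indicator S (x + y) \<partial>lborel) * c
      = (\<integral>x. a x * (indicat_real S (x + y) *\<^sub>R c) \<partial>lborel)" for y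
  proof -
    have "(\<lambda>x. a x * (indicat_real S (x + y) *\<^sub>R c)) = (\<lambda>x. (a x * indicator S (x + y)) * c)"
      by (auto simp: fun_eq_iff indicator_def)
    then show ?thesis by (simp only: Bochner_Integration.integral_mult_left_zero)
  qed
  ultimately show ?case by simp
next
  case (add f g)
  have int: "integrable lborel (\<lambda>x. a x * h (x + y))" if "integrable lborel h" for h y
  proof (rule Bochner_Integration.integrable_bound)
    have [measurable]: "h \<in> borel_measurable borel" "a \<in> borel_measurable borel" using that a by auto
    show "integrable lborel (\<lambda>x. A * cmod (h (x + y)))"
      using lborel_integrable_translate[of "\<lambda>x. cmod (h x)" y] that by (auto simp: add.commute)
    show "AE x in lborel. norm (a x * h (x + y)) \<le> norm (A * cmod (h (x + y)))"
      using a(2) order_trans[OF norm_ge_zero a(2)]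
      by (auto simp: norm_mult intro!: mult_right_mono)
    show "(\<lambda>x. a x * h (x + y)) \<in> borel_measurable lborel" by simp
  qed
  show ?case using add continuous_add[OF add(3,4)] by (simp add: distrib_left int)
next
  case (lim f s)
  have [measurable]: "f \<in> borel_measurable borel" "\<And>i. s i \<in> borel_measurable borel"
    using lim by auto
  show ?case
  proof (rule isCont_correlation_L1_limit[OF _ a(2) lim(4)])
    show "a \<in> borel_measurable borel" using a by auto
    fix e :: real assume e: "e > 0"
    have "(\<lambda>n. \<integral>x. cmod (f x - s n x) \<partial>lborel) \<longlonglongrightarrow> (\<integral>x. 0 \<partial>(lborel :: 'a measure))"
    proof (rule integral_dominated_convergence[where w = "\<lambda>x. 3 * cmod (f x)"])
      have "(\<lambda>n. cmod (f x - s n x)) \<longlonglongrightarrow> 0" for x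
        using tendsto_norm[OF tendsto_diff[OF tendsto_const[of "f x"] lim(2)[of x]]] by simp
      then show "AE x in lborel. (\<lambda>n. cmod (f x - s n x)) \<longlonglongrightarrow> 0" by simp
      show "AE x in lborel. norm (cmod (f x - s n x)) \<le> 3 * cmod (f x)" for n
      proof (rule AE_I2)
        fix x
        show "norm (cmod (f x - s n x)) \<le> 3 * cmod (f x)"
          using norm_triangle_ineq4[of "f x" "s n x"] lim(3)[of x n] by simp
      qed
    qed (use lim in auto)
    then have "eventually (\<lambda>n. (\<integral>x. cmod (f x - s n x) \<partial>lborel) < e) sequentially"
      using e by (simp add: order_tendsto_iff)
    then obtain n where "(\<integral>x. cmod (f x - s n x) \<partial>lborel) < e"
      using eventually_happens'[OF sequentially_bot] by blast
    then show "\<exists>g. integrable lborel g \<and> (\<integral>x. cmod (f x - g x) \<partial>lborel) \<le> e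
        \<and> isCont (\<lambda>y. \<integral>x. a x * g (x + y) \<partial>lborel) y0"
      using lim(1,5) by (intro exI[of _ "s n"]) auto
  qed
qed

text \<open>Cutting an \<open>L\<^sup>2\<close> function off, both in space and in size, approximates it in \<open>L\<^sup>2\<close> by
  bounded integrable functions.\<close>

lemma L2_truncation:
  fixes b :: "'a::euclidean_space \<Rightarrow> complex"
  assumes b: "b \<in> L2 lborel" and e: "e > 0"
  obtains g N where "g \<in> L2 lborel" "integrable lborel g" "\<And>x. cmod (g x) \<le> N"
    "(\<integral>x. (cmod (b x - g x))\<^sup>2 \<partial>lborel) \<le> e"
    "(\<integral>x. (cmod (g x))\<^sup>2 \<partial>lborel) \<le> (\<integral>x. (cmod (b x))\<^sup>2 \<partial>lborel)"
proof -
  have [measurable]: "b \<in> borel_measurable borel" using b[THEN L2_measurable] by simp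
  define S where "S n = {x. cmod (b x) \<le> real n \<and> norm x \<le> real n}" for n
  have [measurable]: "S n \<in> sets borel" for n unfolding S_def by measurable
  define g where "g n x = indicator (S n) x * b x" for n x
  have [measurable]: "g n \<in> borel_measurable borel" for n unfolding g_def by measurable
  have gb: "cmod (g n x) \<le> cmod (b x)" for n x by (auto simp: g_def indicator_def)
  have gL: "g n \<in> L2 lborel" for n unfolding g_def
    by (rule L2_bounded_mult[OF b, where B = 1]) (auto simp: indicator_def)
  have gN: "cmod (g n x) \<le> real n" for n x by (auto simp: g_def S_def indicator_def)
  have gi: "integrable lborel (g n)" for n
  proof (rule Bochner_Integration.integrable_bound)
    show "integrable lborel (\<lambda>x::'a. real n * indicator (cball 0 (real n)) x)"
      using emeasure_bounded_finite[OF bounded_cball, of "0::'a" "real n"]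
      by (intro integrable_mult_right integrable_real_indicator) auto
    show "AE x in lborel. norm (g n x) \<le> norm (real n * indicator (cball 0 (real n)) x)"
      by (auto simp: g_def S_def indicator_def)
  qed simp
  have "(\<lambda>n. \<integral>x. (cmod (b x - g n x))\<^sup>2 \<partial>lborel) \<longlonglongrightarrow> (\<integral>x. 0 \<partial>(lborel :: 'a measure))"
  proof (rule integral_dominated_convergence[where w = "\<lambda>x. (cmod (b x))\<^sup>2"])
    show "AE x in lborel. (\<lambda>n. (cmod (b x - g n x))\<^sup>2) \<longlonglongrightarrow> 0"
    proof (rule AE_I2)
      fix x
      obtain N where N: "max (cmod (b x)) (norm x) \<le> real N" using real_arch_simple by blast
      then have "\<And>n. n \<ge> N \<Longrightarrow> (cmod (b x - g n x))\<^sup>2 = 0" by (auto simp: g_def S_def indicator_def)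
      then show "(\<lambda>n. (cmod (b x - g n x))\<^sup>2) \<longlonglongrightarrow> 0"
        by (intro tendsto_eventually) (auto simp: eventually_sequentially)
    qed
    show "AE x in lborel. norm ((cmod (b x - g n x))\<^sup>2) \<le> (cmod (b x))\<^sup>2" for n
      by (auto simp: g_def indicator_def)
  qed (use b L2_square_integrable in auto)
  then have "eventually (\<lambda>n. (\<integral>x. (cmod (b x - g n x))\<^sup>2 \<partial>lborel) < e) sequentially"
    using e by (simp add: order_tendsto_iff)
  then obtain n where "(\<integral>x. (cmod (b x - g n x))\<^sup>2 \<partial>lborel) < e"
    using eventually_happens'[OF sequentially_bot] by blast
  moreover have "(\<integral>x. (cmod (g n x))\<^sup>2 \<partial>lborel) \<le> (\<integral>x. (cmod (b x))\<^sup>2 \<partial>lborel)"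
    using gL b by (intro integral_mono L2_square_integrable power_mono gb) auto
  ultimately show ?thesis using gL gi gN by (intro that[of "g n" "real n"]) auto
qed

text \<open>This is what the integration by parts below needs: correlations of \<open>L\<^sup>2\<close> functions have a value at
  \<open>0\<close> that can be recovered by mollification.\<close>

lemma isCont_correlation_L2:
  fixes a b :: "'a::euclidean_space \<Rightarrow> complex"
  assumes a: "a \<in> L2 lborel" and b: "b \<in> L2 lborel"
  shows "isCont (\<lambda>y. \<integral>x. a x * cnj (b (x + y)) \<partial>lborel) y0"
proof (rule isCont_uniform_approx)
  fix e :: real assume e: "e > 0"
  define Q where "Q = (\<integral>x. (cmod (a x))\<^sup>2 \<partial>lborel) + (\<integral>x. (cmod (b x))\<^sup>2 \<partial>lborel)"
  have ab: "(\<integral>x. (cmod (a x))\<^sup>2 \<partial>lborel) \<le> Q" "(\<integral>x. (cmod (b x))\<^sup>2 \<partial>lborel) \<le> Q" and Q: "Q \<ge> 0"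
    by (auto simp: Q_def)
  \<comment> \<open>Weight the small differences by \<open>c\<close> and the norms, which are at most \<open>Q\<close>, by \<open>1 / c\<close>.\<close>
  define c where "c = (2 * Q + 1) / e"
  have c: "c > 0" using Q e by (simp add: c_def add_nonneg_pos)
  have ec: "e / (2 * c) > 0" using e c by simp
  obtain f N where f: "f \<in> L2 lborel" "integrable lborel f" "\<And>x. cmod (f x) \<le> N"
    "(\<integral>x. (cmod (a x - f x))\<^sup>2 \<partial>lborel) \<le> e / (2 * c)"
    "(\<integral>x. (cmod (f x))\<^sup>2 \<partial>lborel) \<le> (\<integral>x. (cmod (a x))\<^sup>2 \<partial>lborel)"
    by (rule L2_truncation[OF a ec]) blast
  obtain g N' where g: "g \<in> L2 lborel" "integrable lborel g" "\<And>x. cmod (g x) \<le> N'"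
    "(\<integral>x. (cmod (b x - g x))\<^sup>2 \<partial>lborel) \<le> e / (2 * c)"
    by (rule L2_truncation[OF b ec]) blast
  have Qc: "Q / c \<le> e / 2" using e Q by (simp add: c_def field_simps)
  have "dist (\<integral>x. a x * cnj (b (x + y)) \<partial>lborel) (\<integral>x. f x * cnj (g (x + y)) \<partial>lborel) \<le> e" for y
  proof -
    have bs: "(\<lambda>x. b (x + y)) \<in> L2 lborel"
        "(\<integral>x. (cmod (b (x + y)))\<^sup>2 \<partial>lborel) = (\<integral>x. (cmod (b x))\<^sup>2 \<partial>lborel)"
      using L2_translate[OF b, of y] by (auto simp: add.commute)
    have gy: "(\<lambda>x. g (x + y)) \<in> L2 lborel" "(\<lambda>x. b (x + y) - g (x + y)) \<in> L2 lborel"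
        "(\<integral>x. (cmod (b (x + y) - g (x + y)))\<^sup>2 \<partial>lborel) = (\<integral>x. (cmod (b x - g x))\<^sup>2 \<partial>lborel)"
      using L2_translate[OF g(1), of y] L2_translate[OF L2_diff[OF b g(1)], of y]
      by (auto simp: add.commute)
    have "(\<integral>x. a x * cnj (b (x + y)) \<partial>lborel) - (\<integral>x. f x * cnj (g (x + y)) \<partial>lborel)
        = L2_inner lborel (\<lambda>x. a x - f x) (\<lambda>x. b (x + y))
          + L2_inner lborel f (\<lambda>x. b (x + y) - g (x + y))"
      unfolding L2_inner_diff_left[OF a f(1) bs(1)]
      using L2_inner_add_right[OF f(1) gy(1) gy(2)] by (simp add: L2_inner_def)
    then have "dist (\<integral>x. a x * cnj (b (x + y)) \<partial>lborel) (\<integral>x. f x * cnj (g (x + y)) \<partial>lborel)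
        \<le> cmod (L2_inner lborel (\<lambda>x. a x - f x) (\<lambda>x. b (x + y)))
          + cmod (L2_inner lborel f (\<lambda>x. b (x + y) - g (x + y)))"
      by (simp add: dist_norm norm_triangle_ineq)
    moreover have "c * (\<integral>x. (cmod (a x - f x))\<^sup>2 \<partial>lborel) \<le> e / 2"
      using mult_left_mono[OF f(4), of c] c by simp
    moreover have "(\<integral>x. (cmod (b (x + y)))\<^sup>2 \<partial>lborel) / c \<le> e / 2"
      unfolding bs(2) by (rule order_trans[OF divide_right_mono[OF ab(2)] Qc]) (use c in simp)
    moreover have "inverse c * (\<integral>x. (cmod (f x))\<^sup>2 \<partial>lborel) \<le> e / 2"
      unfolding mult.commute[of "inverse c"] divide_inverse[symmetric]
      by (rule order_trans[OF divide_right_mono[OF order_trans[OF f(5) ab(1)]] Qc]) (use c in simp)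
    moreover have "(\<integral>x. (cmod (b (x + y) - g (x + y)))\<^sup>2 \<partial>lborel) / inverse c \<le> e / 2"
    proof -
      have "X / inverse c = c * X" for X by (simp add: field_simps)
      then show ?thesis using mult_left_mono[OF g(4), of c] c unfolding gy(3) by simp
    qed
    moreover have sum: "d \<le> m + n \<Longrightarrow> A \<le> e / 2 \<Longrightarrow> B \<le> e / 2 \<Longrightarrow> C \<le> e / 2 \<Longrightarrow> D \<le> e / 2
        \<Longrightarrow> m \<le> (A + B) / 2 \<Longrightarrow> n \<le> (C + D) / 2 \<Longrightarrow> d \<le> e" for d m n A B C D :: real
      by argo
    moreover have ci: "inverse c > 0" using c by simp
    ultimately show ?thesis
      by (intro sum[OF _ _ _ _ _ L2_inner_bound_weighted[OF L2_diff[OF a f(1)] bs(1) c]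
        L2_inner_bound_weighted[OF f(1) gy(2) ci]])
  qed
  moreover have "integrable lborel (\<lambda>x. cnj (g x))" using g(2) by simp
  then have "isCont (\<lambda>y. \<integral>x. f x * cnj (g (x + y)) \<partial>lborel) y0"
    by (rule isCont_correlation_L1[OF f(2,3)])
  ultimately show "\<exists>G. isCont G y0 \<and> (\<forall>y. dist (\<integral>x. a x * cnj (b (x + y)) \<partial>lborel) (G y) \<le> e)"
    by blast
qed

section \<open>Smooth bump functions\<close>

text \<open>Smoothness asks for all iterated derivatives at once. It suffices to find a class of functions
  that contains the partial derivatives of each of its members.\<close>

lemma smooth_coinduct:
  fixes \<phi> :: "real^'d \<Rightarrow> complex"
  assumes "P \<phi>"
    and step: "\<And>g. P g \<Longrightarrow> \<exists>G. (\<forall>i. P (G i)) \<and>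
                 (\<forall>x. (g has_derivative (\<lambda>h. \<Sum>i\<in>UNIV. h $ i *\<^sub>R G i x)) (at x))"
  shows "smooth \<phi>"
proof -
  define S where "S g = (SOME G. (\<forall>i. P (G i)) \<and>
    (\<forall>x. (g has_derivative (\<lambda>h. \<Sum>i\<in>UNIV. h $ i *\<^sub>R G i x)) (at x)))" for g
  have S: "P (S g i)" "(g has_derivative (\<lambda>h. \<Sum>i\<in>UNIV. h $ i *\<^sub>R S g i x)) (at x)" if "P g" for g i x
    using someI_ex[OF step[OF that]] unfolding S_def[symmetric] by auto
  define D where "D = rec_list \<phi> (\<lambda>i l r. S r i)"
  have D: "D [] = \<phi>" "\<And>i l. D (i # l) = S (D l) i" by (auto simp: D_def)
  have "P (D l)" for l by (induction l) (auto simp: D S assms)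
  then show ?thesis unfolding smooth_def using S(2) by (intro exI[of _ D]) (simp add: D)
qed

text \<open>The derivatives of \<open>exp (- 1 / t)\<close> are of this form, with a polynomial in \<open>1 / t\<close> as prefactor.\<close>

definition flat_exp :: "real poly \<Rightarrow> real \<Rightarrow> real" where
  "flat_exp p t = (if t > 0 then poly p (1 / t) * exp (- (1 / t)) else 0)"

lemma poly_times_exp_minus_tendsto: "((\<lambda>s. poly p s * exp (- s)) \<longlongrightarrow> (0::real)) at_top"
proof -
  have "((\<lambda>s. \<Sum>i\<le>degree p. coeff p i * (s ^ i / exp s)) \<longlongrightarrow> (\<Sum>i\<le>degree p. coeff p i * 0)) at_top"
    by (intro tendsto_sum tendsto_mult tendsto_const tendsto_power_div_exp_0)
  then show ?thesis by (simp add: poly_altdef sum_distrib_right exp_minus divide_inverse mult.assoc)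
qed

lemma flat_exp_has_derivative:
  "(flat_exp p has_real_derivative flat_exp ([:0, 0, 1:] * (p - pderiv p)) t) (at t)"
proof -
  consider "t > 0" | "t < 0" | "t = 0" by linarith
  then show ?thesis
  proof cases
    case 1
    have "((\<lambda>t. poly p (1 / t) * exp (- (1 / t))) has_real_derivative
            flat_exp ([:0, 0, 1:] * (p - pderiv p)) t) (at t)"
      using 1 by (auto intro!: derivative_eq_intros simp: flat_exp_def field_simps power2_eq_square)
    then show ?thesis
      by (rule has_field_derivative_transform_within[OF _ 1]) (auto simp: flat_exp_def dist_real_def)
  next
    case 2
    have "((\<lambda>t. 0) has_real_derivative flat_exp ([:0, 0, 1:] * (p - pderiv p)) t) (at t)"
      using 2 by (auto simp: flat_exp_def)
    then show ?thesis
      by (rule has_field_derivative_transform_within[of _ _ _ _ "- t"]) (use 2 in \<open>auto simp: flat_exp_def dist_real_def\<close>)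
  next
    case 3
    have "((\<lambda>h. poly ([:0, 1:] * p) (inverse h) * exp (- inverse h)) \<longlongrightarrow> 0) (at_right 0)"
      by (rule filterlim_compose[OF poly_times_exp_minus_tendsto filterlim_inverse_at_top_right])
    moreover have "\<forall>\<^sub>F h in at_right 0. poly ([:0, 1:] * p) (inverse h) * exp (- inverse h) = flat_exp p h / h"
      unfolding eventually_at_right[OF zero_less_one]
      by (auto intro!: exI[of _ 1] simp: flat_exp_def divide_inverse)
    ultimately have r: "((\<lambda>h. flat_exp p h / h) \<longlongrightarrow> 0) (at_right 0)"
      by (rule Lim_transform_eventually)
    have l: "((\<lambda>h. flat_exp p h / h) \<longlongrightarrow> 0) (at_left 0)"
    proof (rule tendsto_eventually)
      show "\<forall>\<^sub>F h in at_left 0. flat_exp p h / h = 0"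
        unfolding eventually_at_left[OF neg_less_0_iff_less[THEN iffD2, OF zero_less_one]]
        by (auto intro!: exI[of _ "-1"] simp: flat_exp_def)
    qed
    from l r have "((\<lambda>h. flat_exp p h / h) \<longlongrightarrow> 0) (at 0)" by (simp add: filterlim_at_split)
    then show ?thesis using 3 by (simp add: DERIV_def flat_exp_def)
  qed
qed

text \<open>A class that is closed under partial derivatives and contains the bump around \<open>c\<close>.\<close>

inductive bump_family :: "real^'d \<Rightarrow> real \<Rightarrow> (real^'d \<Rightarrow> complex) \<Rightarrow> bool" for c r where
  "bump_family c r (\<lambda>x. of_real (flat_exp p (r - (x - c) \<bullet> (x - c))))"
| "bump_family c r g \<Longrightarrow> bump_family c r (\<lambda>x. of_real k * g x)"
| "bump_family c r g \<Longrightarrow> bump_family c r (\<lambda>x. of_real ((x - c) $ i) * g x)"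
| "bump_family c r g \<Longrightarrow> bump_family c r h \<Longrightarrow> bump_family c r (\<lambda>x. g x + h x)"

lemma vec_nth_has_derivative: "((\<lambda>x::real^'d. (x - c) $ i) has_derivative (\<lambda>h. h $ i)) (at x)"
  by (auto intro!: derivative_eq_intros bounded_linear.has_derivative[OF bounded_linear_vec_nth])

lemma flat_bump_has_derivative:
  fixes c :: "real^'d"
  shows "((\<lambda>x. flat_exp p (r - (x - c) \<bullet> (x - c))) has_derivative
     (\<lambda>h. \<Sum>i\<in>UNIV. h $ i *\<^sub>R (- 2 * (x - c) $ i * flat_exp ([:0, 0, 1:] * (p - pderiv p)) (r - (x - c) \<bullet> (x - c)))))
     (at x)"
proof -
  have "((\<lambda>x. r - (x - c) \<bullet> (x - c)) has_derivative (\<lambda>h. - (2 * ((x - c) \<bullet> h)))) (at x)"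
    by (auto intro!: derivative_eq_intros simp: inner_commute)
  from has_derivative_compose[OF this flat_exp_has_derivative[unfolded has_field_derivative_def]]
  show ?thesis
  proof (rule has_derivative_eq_rhs)
    have "k * (- (2 * ((x - c) \<bullet> h))) = (\<Sum>i\<in>UNIV. h $ i *\<^sub>R (- 2 * (x - c) $ i * k))" for k h
    proof -
      have "(\<Sum>i\<in>UNIV. h $ i *\<^sub>R (- 2 * (x - c) $ i * k)) = (\<Sum>i\<in>UNIV. (- 2 * k) * ((x - c) $ i * h $ i))"
        by (intro sum.cong) (auto simp: algebra_simps)
      also have "\<dots> = (- 2 * k) * ((x - c) \<bullet> h)" by (simp only: sum_distrib_left inner_vec_def inner_real_def)
      finally show ?thesis by simp
    qed
    then show "(\<lambda>h. flat_exp ([:0, 0, 1:] * (p - pderiv p)) (r - (x - c) \<bullet> (x - c)) * (- (2 * ((x - c) \<bullet> h))))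
      = (\<lambda>h. \<Sum>i\<in>UNIV. h $ i *\<^sub>R (- 2 * (x - c) $ i * flat_exp ([:0, 0, 1:] * (p - pderiv p)) (r - (x - c) \<bullet> (x - c))))"
      by (intro ext)
  qed
qed

lemma bump_family_step:
  assumes "bump_family c r g"
  shows "\<exists>G. (\<forall>i. bump_family c r (G i)) \<and>
           (\<forall>x. (g has_derivative (\<lambda>h. \<Sum>i\<in>UNIV. h $ i *\<^sub>R G i x)) (at x))"
  using assms
proof induction
  case (1 p)
  define q where "q = [:0, 0, 1:] * (p - pderiv p)"
  let ?G = "\<lambda>i x. complex_of_real (- 2) * (of_real ((x - c) $ i) * of_real (flat_exp q (r - (x - c) \<bullet> (x - c))))"
  have "((\<lambda>x. complex_of_real (flat_exp p (r - (x - c) \<bullet> (x - c)))) has_derivative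
          (\<lambda>h. \<Sum>i\<in>UNIV. h $ i *\<^sub>R ?G i x)) (at x)" for x
    by (rule has_derivative_eq_rhs[OF has_derivative_of_real[OF flat_bump_has_derivative]])
      (auto simp only: q_def scaleR_conv_of_real of_real_sum of_real_mult mult.assoc of_real_eq_id id_apply intro!: ext)
  moreover have "bump_family c r (?G i)" for i by (intro bump_family.intros)
  ultimately show ?case by (intro exI[of _ ?G]) blast
next
  case (2 g k)
  then obtain G where G: "\<And>i. bump_family c r (G i)"
    "\<And>x. (g has_derivative (\<lambda>h. \<Sum>i\<in>UNIV. h $ i *\<^sub>R G i x)) (at x)" by blast
  have "((\<lambda>x. complex_of_real k * g x) has_derivative (\<lambda>h. \<Sum>i\<in>UNIV. h $ i *\<^sub>R (of_real k * G i x))) (at x)" for x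
    by (rule has_derivative_eq_rhs[OF has_derivative_mult_right[OF G(2)]])
      (simp add: sum_distrib_left)
  then show ?case using G(1) by (intro exI[of _ "\<lambda>i x. of_real k * G i x"]) (auto intro: bump_family.intros)
next
  case (3 g j)
  then obtain G where G: "\<And>i. bump_family c r (G i)"
    "\<And>x. (g has_derivative (\<lambda>h. \<Sum>i\<in>UNIV. h $ i *\<^sub>R G i x)) (at x)" by blast
  let ?G = "\<lambda>i x. of_real (if i = j then 1 else 0) * g x + of_real ((x - c) $ j) * G i x"
  have "((\<lambda>x. complex_of_real ((x - c) $ j) * g x) has_derivative (\<lambda>h. \<Sum>i\<in>UNIV. h $ i *\<^sub>R ?G i x)) (at x)" for x
  proof (rule has_derivative_eq_rhs[OF has_derivative_mult[OF has_derivative_of_real[OF vec_nth_has_derivative] G(2)]])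
    have "(\<Sum>i\<in>UNIV. h $ i *\<^sub>R ?G i x)
      = (\<Sum>i\<in>UNIV. if i = j then of_real (h $ i) * g x else 0) + (\<Sum>i\<in>UNIV. of_real ((x - c) $ j) * (h $ i *\<^sub>R G i x))" for h
      unfolding sum.distrib[symmetric] by (intro sum.cong) (auto simp: scaleR_conv_of_real algebra_simps)
    then show "(\<lambda>h. of_real ((x - c) $ j) * (\<Sum>i\<in>UNIV. h $ i *\<^sub>R G i x) + of_real (h $ j) * g x)
        = (\<lambda>h. \<Sum>i\<in>UNIV. h $ i *\<^sub>R ?G i x)"
      by (simp add: sum_distrib_left add.commute)
  qed
  moreover have "bump_family c r (?G i)" for i
    by (rule bump_family.intros(4)[OF bump_family.intros(2)[OF 3(1)] bump_family.intros(3)[OF G(1)]])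
  ultimately show ?case by (intro exI[of _ ?G]) blast
next
  case (4 g h)
  then obtain G H where G: "\<And>i. bump_family c r (G i)"
    "\<And>x. (g has_derivative (\<lambda>h. \<Sum>i\<in>UNIV. h $ i *\<^sub>R G i x)) (at x)"
    and H: "\<And>i. bump_family c r (H i)"
    "\<And>x. (h has_derivative (\<lambda>h. \<Sum>i\<in>UNIV. h $ i *\<^sub>R H i x)) (at x)" by blast
  have "((\<lambda>x. g x + h x) has_derivative (\<lambda>h. \<Sum>i\<in>UNIV. h $ i *\<^sub>R (G i x + H i x))) (at x)" for x
    by (rule has_derivative_eq_rhs[OF has_derivative_add[OF G(2) H(2)]])
      (simp add: sum.distrib scaleR_add_right)
  then show ?case using G(1) H(1) by (intro exI[of _ "\<lambda>i x. G i x + H i x"]) (auto intro: bump_family.intros)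
qed

definition bump :: "real \<Rightarrow> real^'d \<Rightarrow> real" where
  "bump r y = flat_exp 1 (r - y \<bullet> y)"

definition bump_deriv :: "real \<Rightarrow> 'd \<Rightarrow> real^'d \<Rightarrow> real" where
  "bump_deriv r i y = - 2 * y $ i * flat_exp [:0, 0, 1:] (r - y \<bullet> y)"

lemma bump_test_function: "test_function (\<lambda>x. complex_of_real (bump r (x - c)))"
  unfolding test_function_def
proof
  show "smooth (\<lambda>x. complex_of_real (bump r (x - c)))" unfolding bump_def
    by (rule smooth_coinduct[of "bump_family c r"]) (auto intro: bump_family.intros bump_family_step)
  have "bump r (x - c) = 0" if "x \<notin> cball c (sqrt r)" for x
  proof -
    have "sqrt r < norm (x - c)" using that by (simp add: dist_norm norm_minus_commute)
    then have "r < (x - c) \<bullet> (x - c)" by (metis norm_eq_sqrt_inner real_sqrt_less_iff)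
    then show ?thesis by (simp add: bump_def flat_exp_def)
  qed
  then show "\<exists>K. compact K \<and> (\<forall>x. x \<notin> K \<longrightarrow> complex_of_real (bump r (x - c)) = 0)"
    by (intro exI[of _ "cball c (sqrt r)"]) auto
qed

lemma partial_deriv_eq:
  assumes "(\<phi> has_derivative (\<lambda>h. \<Sum>i\<in>UNIV. h $ i *\<^sub>R G i)) (at x)"
  shows "partial_deriv i \<phi> x = G i"
proof -
  have "partial_deriv i \<phi> x = (\<Sum>j\<in>UNIV. (axis i 1 $ j) *\<^sub>R G j)"
    by (simp add: partial_deriv_def frechet_derivative_at[OF assms, symmetric])
  also have "\<dots> = (\<Sum>j\<in>UNIV. if j = i then G j else 0)"
    by (intro sum.cong) (auto simp: axis_def)
  finally show ?thesis by simp
qed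

lemma bump_partial_deriv:
  "partial_deriv i (\<lambda>x. complex_of_real (bump r (x - c))) x = of_real (bump_deriv r i (x - c))"
proof -
  have "((\<lambda>x. complex_of_real (bump r (x - c))) has_derivative
          (\<lambda>h. \<Sum>i\<in>UNIV. h $ i *\<^sub>R complex_of_real (bump_deriv r i (x - c)))) (at x)"
    using has_derivative_of_real[OF flat_bump_has_derivative[of 1 r c x]]
    by (simp add: bump_def bump_deriv_def pderiv_1 scaleR_conv_of_real)
  then show ?thesis by (rule partial_deriv_eq)
qed

lemma bump_even: "bump r (- y) = bump r y" "bump_deriv r i (- y) = - bump_deriv r i y"
  by (auto simp: bump_def bump_deriv_def)

lemma continuous_flat_exp: "continuous_on UNIV (flat_exp p)"
  by (intro continuous_at_imp_continuous_on ballI DERIV_isCont[OF flat_exp_has_derivative])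

lemma continuous_bump [continuous_intros]:
  "continuous_on UNIV (bump r)" "continuous_on UNIV (bump_deriv r i)"
  unfolding bump_def bump_deriv_def
  by (intro continuous_intros continuous_on_compose2[OF continuous_flat_exp]; simp)+

lemma bump_zero: "y \<notin> cball 0 (sqrt r) \<Longrightarrow> bump r y = 0 \<and> bump_deriv r i y = 0"
proof -
  assume "y \<notin> cball 0 (sqrt r)"
  then have "r < y \<bullet> y" by (metis mem_cball_0 norm_eq_sqrt_inner not_le real_sqrt_le_iff)
  then show ?thesis by (simp add: bump_def bump_deriv_def flat_exp_def)
qed

lemma bump_nonneg: "bump r y \<ge> 0"
  by (simp add: bump_def flat_exp_def)

lemma integrable_continuous_compact_support:
  fixes f :: "'a::euclidean_space \<Rightarrow> 'b::{banach, second_countable_topology}"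
  assumes f: "continuous_on UNIV f" and K: "compact K" "\<And>x. x \<notin> K \<Longrightarrow> f x = 0"
  shows "integrable lborel f"
proof -
  have "integrable lborel (\<lambda>x. indicator K x *\<^sub>R f x)"
    by (intro borel_integrable_compact K continuous_on_subset[OF f]) auto
  then show ?thesis by (rule back_subst[where P = "integrable lborel"]) (use K in \<open>auto simp: indicator_def\<close>)
qed

lemma bump_integrable: "integrable lborel (bump r)" "integrable lborel (bump_deriv r i)"
  by (rule integrable_continuous_compact_support[OF continuous_bump(1) compact_cball[of 0 "sqrt r"]],
      use bump_zero in blast)
    (rule integrable_continuous_compact_support[OF continuous_bump(2) compact_cball[of 0 "sqrt r"]],
      use bump_zero in blast)

lemma bump_integral_pos:
  assumes r: "r > 0"
  shows "(\<integral>y. bump r (y::real^'d) \<partial>lborel) > 0"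
proof (rule ccontr)
  assume "\<not> ?thesis"
  then have "(\<integral>y. bump r (y::real^'d) \<partial>lborel) = 0"
    using Bochner_Integration.integral_nonneg[of lborel "bump r :: real^'d \<Rightarrow> real", OF bump_nonneg] by simp
  then have "AE y in lborel. bump r (y::real^'d) = 0"
    using integral_nonneg_eq_0_iff_AE[OF bump_integrable(1)] bump_nonneg by auto
  moreover have "bump r y \<noteq> 0" if "y \<in> ball 0 (sqrt r)" for y :: "real^'d"
  proof -
    have "norm y < sqrt r" using that by simp
    then have "y \<bullet> y < r" by (metis norm_eq_sqrt_inner real_sqrt_less_iff)
    then show ?thesis by (simp add: bump_def flat_exp_def)
  qed
  ultimately have "AE y in lborel. (y :: real^'d) \<notin> ball 0 (sqrt r)" by fastforce
  moreover have "ball (0 :: real^'d) (sqrt r) = {y. norm y < sqrt r}" by auto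
  ultimately have "emeasure lborel (ball (0 :: real^'d) (sqrt r)) = 0"
    by (subst (asm) AE_iff_measurable[OF _ refl]) auto
  then have "ball (0::real^'d) (sqrt r) = {}"
    using open_not_negligible[OF open_ball, of "0::real^'d" "sqrt r"]
    by (auto simp: negligible_iff_emeasure0)
  then show False using r by simp
qed

text \<open>On the support of a small bump around \<open>0\<close>, the values of \<open>F\<close> are close to \<open>F 0\<close>, and a bump
  is nonnegative with positive integral.\<close>

lemma bump_orthogonal_imp_zero:
  fixes F :: "real^'d \<Rightarrow> complex"
  assumes F: "isCont F 0" and int: "\<And>r. r > 0 \<Longrightarrow> integrable lborel (\<lambda>y. of_real (bump r y) * F y)"
    and zero: "\<And>r. r > 0 \<Longrightarrow> (\<integral>y. of_real (bump r y) * F y \<partial>lborel) = 0"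
  shows "F 0 = 0"
proof (rule ccontr)
  assume nz: "F 0 \<noteq> 0"
  then obtain s where s: "s > 0" "\<And>y. norm y < s \<Longrightarrow> cmod (F y - F 0) < cmod (F 0) / 2"
  proof -
    have "cmod (F 0) / 2 > 0" using nz by simp
    then obtain s where "s > 0" "\<And>y. dist y 0 < s \<Longrightarrow> dist (F y) (F 0) < cmod (F 0) / 2"
      using F unfolding continuous_at_eps_delta by meson
    with that show ?thesis by (simp add: dist_norm)
  qed
  define r where "r = (s / 2)\<^sup>2"
  have r: "r > 0" "sqrt r < s" using s(1) by (auto simp: r_def)
  let ?I = "\<integral>y. bump r (y :: real^'d) \<partial>lborel"
  have I: "?I > 0" by (rule bump_integral_pos[OF r(1)])
  have bF: "integrable lborel (\<lambda>y::real^'d. complex_of_real (bump r y) * F 0)"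
    using bump_integrable(1)[of r] by (intro integrable_mult_left integrable_of_real)
  have "of_real ?I * F 0 = (\<integral>y. complex_of_real (bump r (y :: real^'d)) * F 0 \<partial>lborel)"
    by simp
  also have "\<dots> = (\<integral>y. of_real (bump r y) * F 0 - of_real (bump r y) * F y \<partial>lborel)"
    using bF int[OF r(1)] zero[OF r(1)] by (subst Bochner_Integration.integral_diff) auto
  finally have "?I * cmod (F 0) = cmod (\<integral>y. of_real (bump r y) * F 0 - of_real (bump r y) * F y \<partial>lborel)"
    using I by (metis norm_mult norm_of_real abs_of_pos)
  also have "\<dots> \<le> (\<integral>y. cmod (of_real (bump r y) * F 0 - of_real (bump r y) * F y) \<partial>lborel)"
    by (rule integral_norm_bound)
  also have "\<dots> \<le> (\<integral>y. bump r (y :: real^'d) * (cmod (F 0) / 2) \<partial>lborel)"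
  proof (rule integral_mono)
    show "integrable lborel (\<lambda>y. cmod (of_real (bump r y) * F 0 - of_real (bump r y) * F y))"
      using bF int[OF r(1)] by auto
    show "integrable lborel (\<lambda>y::real^'d. bump r y * (cmod (F 0) / 2))"
      using bump_integrable(1)[of r] by auto
    fix y
    show "cmod (of_real (bump r y) * F 0 - of_real (bump r y) * F y) \<le> bump r y * (cmod (F 0) / 2)"
    proof (cases "norm y < s")
      case True
      then show ?thesis using s(2)[of y] bump_nonneg[of r y]
        by (auto simp: right_diff_distrib[symmetric] norm_mult norm_minus_commute intro!: mult_left_mono simp del: times_divide_eq_right)
    next
      case False
      then have "y \<notin> cball 0 (sqrt r)" using r by auto
      then show ?thesis using bump_zero[of y r] by auto
    qed
  qed
  also have "\<dots> = ?I * (cmod (F 0) / 2)" by simp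
  finally show False using I nz by (simp add: field_simps)
qed

section \<open>Integration by parts in \<open>H\<^sup>1\<close>\<close>

lemma integrable_shear:
  fixes f k :: "'a::euclidean_space \<Rightarrow> 'b::{banach, second_countable_topology, real_normed_field}"
  assumes f: "integrable lborel f" and k: "integrable lborel k"
  shows "integrable (lborel \<Otimes>\<^sub>M lborel) (\<lambda>(x, z). f x * k (z - x))"
proof -
  have [measurable]: "f \<in> borel_measurable borel" "k \<in> borel_measurable borel" using f k by auto
  have n: "(\<integral>z. norm (f x * k (z - x)) \<partial>lborel) = norm (f x) * (\<integral>z. norm (k z) \<partial>lborel)" for x
    using lborel_integral_translate[of "\<lambda>z. norm (k z)" "- x"] by (simp add: norm_mult)
  have i: "integrable lborel (\<lambda>z. f x * k (z - x))" for x
    using lborel_integrable_translate[of k "- x"] k by simp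
  show ?thesis
    by (rule lborel_pair.Fubini_integrable) (use f i n in auto)
qed

text \<open>By \<open>|a b| \<le> |a|\<^sup>2 + |b|\<^sup>2\<close> the integrand is dominated by two products of integrable functions
  of \<open>x\<close>, or \<open>z\<close>, and \<open>z - x\<close>.\<close>

lemma integrable_L2_kernel:
  fixes a b :: "'a::euclidean_space \<Rightarrow> complex" and k :: "'a \<Rightarrow> real"
  assumes a: "a \<in> L2 lborel" and b: "b \<in> L2 lborel" and k: "integrable lborel k"
  shows "integrable (lborel \<Otimes>\<^sub>M lborel) (\<lambda>(x, z). a x * cnj (b z) * of_real (k (z - x)))"
proof (rule Bochner_Integration.integrable_bound)
  have [measurable]: "a \<in> borel_measurable borel" "b \<in> borel_measurable borel" "k \<in> borel_measurable borel"
    using a[THEN L2_measurable] b[THEN L2_measurable] k by auto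
  have k': "integrable lborel (\<lambda>x. \<bar>k (- x)\<bar>)"
    using lborel_integrable_reflect[of "\<lambda>x. \<bar>k x\<bar>" 0] k by simp
  have "integrable (lborel \<Otimes>\<^sub>M lborel) (\<lambda>(x, z). (cmod (a x))\<^sup>2 * \<bar>k (z - x)\<bar>)"
    using integrable_shear[OF L2_square_integrable[OF a], of "\<lambda>x. \<bar>k x\<bar>"] k by simp
  moreover have "integrable (lborel \<Otimes>\<^sub>M lborel) (\<lambda>(x, z). (cmod (b z))\<^sup>2 * \<bar>k (z - x)\<bar>)"
    using lborel_pair.integrable_product_swap[OF integrable_shear[OF L2_square_integrable[OF b] k']]
    by (simp add: case_prod_unfold)
  ultimately show "integrable (lborel \<Otimes>\<^sub>M lborel)
      (\<lambda>p. (case p of (x, z) \<Rightarrow> (cmod (a x))\<^sup>2 * \<bar>k (z - x)\<bar>) + (case p of (x, z) \<Rightarrow> (cmod (b z))\<^sup>2 * \<bar>k (z - x)\<bar>))"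
    by (rule Bochner_Integration.integrable_add)
  show "AE p in lborel \<Otimes>\<^sub>M lborel. norm (case p of (x, z) \<Rightarrow> a x * cnj (b z) * of_real (k (z - x)))
      \<le> norm ((case p of (x, z) \<Rightarrow> (cmod (a x))\<^sup>2 * \<bar>k (z - x)\<bar>) + (case p of (x, z) \<Rightarrow> (cmod (b z))\<^sup>2 * \<bar>k (z - x)\<bar>))"
  proof (rule AE_I2, clarify)
    fix x z :: 'a
    have "cmod (a x) * cmod (b z) \<le> (cmod (a x))\<^sup>2 + (cmod (b z))\<^sup>2"
      using sum_squares_bound[of "cmod (a x)" "cmod (b z)"]
        mult_nonneg_nonneg[OF norm_ge_zero norm_ge_zero, of "a x" "b z"] by linarith
    then have "cmod (a x) * cmod (b z) * \<bar>k (z - x)\<bar> \<le> ((cmod (a x))\<^sup>2 + (cmod (b z))\<^sup>2) * \<bar>k (z - x)\<bar>"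
      by (rule mult_right_mono) auto
    then show "norm (a x * cnj (b z) * of_real (k (z - x)))
      \<le> norm ((cmod (a x))\<^sup>2 * \<bar>k (z - x)\<bar> + (cmod (b z))\<^sup>2 * \<bar>k (z - x)\<bar>)"
      by (simp add: norm_mult distrib_right)
  qed
  show "(\<lambda>(x, z). a x * cnj (b z) * of_real (k (z - x))) \<in> borel_measurable (lborel \<Otimes>\<^sub>M lborel)"
    by measurable
qed

text \<open>Three ways to integrate \<open>a(x) b(z) k(z - x)\<close>: first over \<open>z\<close>, first over \<open>x\<close>, or first along the
  lines \<open>z - x = y\<close>. Each of the first two lets a weak derivative act on one factor only.\<close>

lemma L2_kernel_correlation:
  fixes a b :: "'a::euclidean_space \<Rightarrow> complex" and k :: "'a \<Rightarrow> real"
  assumes a: "a \<in> L2 lborel" and b: "b \<in> L2 lborel" and k: "integrable lborel k"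
  defines "J \<equiv> (\<integral>y. of_real (k y) * (\<integral>x. a x * cnj (b (x + y)) \<partial>lborel) \<partial>lborel)"
  shows "(\<integral>x. a x * cnj (\<integral>z. b z * of_real (k (z - x)) \<partial>lborel) \<partial>lborel) = J"
    and "(\<integral>z. cnj (b z) * (\<integral>x. a x * of_real (k (z - x)) \<partial>lborel) \<partial>lborel) = J"
    and "integrable lborel (\<lambda>y. of_real (k y) * (\<integral>x. a x * cnj (b (x + y)) \<partial>lborel))"
proof -
  have [measurable]: "a \<in> borel_measurable borel" "b \<in> borel_measurable borel" "k \<in> borel_measurable borel"
    using a[THEN L2_measurable] b[THEN L2_measurable] k by auto
  note I = integrable_L2_kernel[OF a b k]
  have x: "(\<integral>z. a x * cnj (b z) * of_real (k (z - x)) \<partial>lborel)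
      = a x * cnj (\<integral>z. b z * of_real (k (z - x)) \<partial>lborel)" for x
    using Bochner_Integration.integral_cnj[of lborel "\<lambda>z. b z * of_real (k (z - x))"] by (simp add: mult.assoc)
  have z: "(\<integral>x. a x * cnj (b z) * of_real (k (z - x)) \<partial>lborel)
      = cnj (b z) * (\<integral>x. a x * of_real (k (z - x)) \<partial>lborel)" for z
    by (subst Bochner_Integration.integral_mult_right_zero[symmetric]) (simp add: mult_ac)
  have 1: "(\<integral>x. a x * cnj (\<integral>z. b z * of_real (k (z - x)) \<partial>lborel) \<partial>lborel)
      = (\<integral>z. cnj (b z) * (\<integral>x. a x * of_real (k (z - x)) \<partial>lborel) \<partial>lborel)"
    using lborel_pair.Fubini_integral[OF I] unfolding x z by simp
  have y: "(\<integral>z. a x * cnj (b z) * of_real (k (z - x)) \<partial>lborel)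
      = (\<integral>y. a x * cnj (b (x + y)) * of_real (k y) \<partial>lborel)" for x
    using lborel_integral_translate[of "\<lambda>z. a x * cnj (b z) * of_real (k (z - x))" x] by simp
  have I2: "integrable (lborel \<Otimes>\<^sub>M lborel) (\<lambda>(x, y). a x * cnj (b (x + y)) * of_real (k y))"
  proof (rule lborel_pair.Fubini_integrable)
    have "(\<integral>y. norm (a x * cnj (b (x + y)) * of_real (k y)) \<partial>lborel)
        = (\<integral>z. norm (a x * cnj (b z) * of_real (k (z - x))) \<partial>lborel)" for x
      using lborel_integral_translate[of "\<lambda>z. norm (a x * cnj (b z) * of_real (k (z - x)))" x] by simp
    then show "integrable lborel (\<lambda>x. \<integral>y. norm (case (x, y) of (x, y) \<Rightarrow> a x * cnj (b (x + y)) * of_real (k y)) \<partial>lborel)"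
      using lborel_pair.integrable_fst'[OF integrable_norm[OF I]] by simp
    have "integrable lborel (\<lambda>z. a x * cnj (b z) * of_real (k (z - x))) \<Longrightarrow>
        integrable lborel (\<lambda>y. a x * cnj (b (x + y)) * of_real (k y))" for x
      using lborel_integrable_translate[of "\<lambda>z. a x * cnj (b z) * of_real (k (z - x))" x] by simp
    then show "AE x in lborel. integrable lborel (\<lambda>y. case (x, y) of (x, y) \<Rightarrow> a x * cnj (b (x + y)) * of_real (k y))"
      using lborel_pair.AE_integrable_fst[OF I] by auto
  qed measurable
  have e: "(\<integral>x. a x * cnj (b (x + y)) * of_real (k y) \<partial>lborel)
      = of_real (k y) * (\<integral>x. a x * cnj (b (x + y)) \<partial>lborel)" for y by simp
  show 2: "(\<integral>x. a x * cnj (\<integral>z. b z * of_real (k (z - x)) \<partial>lborel) \<partial>lborel) = J"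
    using lborel_pair.Fubini_integral[OF I2] unfolding J_def x[symmetric] y e by simp
  show "(\<integral>z. cnj (b z) * (\<integral>x. a x * of_real (k (z - x)) \<partial>lborel) \<partial>lborel) = J"
    using 1 2 by simp
  show "integrable lborel (\<lambda>y. of_real (k y) * (\<integral>x. a x * cnj (b (x + y)) \<partial>lborel))"
    using lborel_pair.integrable_snd[OF I2] unfolding e by simp
qed

text \<open>Mollifying with a bump shows that the correlation of \<open>w\<close> with \<open>\<partial>\<^sub>i e\<close> and minus the correlation
  of \<open>\<partial>\<^sub>i w\<close> with \<open>e\<close> are the same distribution, the derivative of the correlation of \<open>w\<close> with \<open>e\<close>.
  As both are continuous, they agree at \<open>0\<close>.\<close>

lemma H1_integration_by_parts:
  fixes w e :: "real^'d \<Rightarrow> complex"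
  assumes w: "H1_with_gradient w A" and e: "H1_with_gradient e E"
  shows "L2_inner lborel w (E i) = - L2_inner lborel (A i) e"
proof -
  have L: "w \<in> L2 lborel" "A i \<in> L2 lborel" "e \<in> L2 lborel" "E i \<in> L2 lborel"
    and W: "weak_partial_deriv i w (A i)" "weak_partial_deriv i e (E i)"
    using w e by (auto simp: H1_with_gradient_def)
  define F where "F y = (\<integral>x. w x * cnj (E i (x + y)) \<partial>lborel) + (\<integral>x. A i x * cnj (e (x + y)) \<partial>lborel)" for y
  have "F 0 = 0"
  proof (rule bump_orthogonal_imp_zero)
    show "isCont F 0" unfolding F_def
      by (intro continuous_add isCont_correlation_L2 L)
    fix r :: real
    note k = bump_integrable(1)[of r] and k' = bump_integrable(2)[of r i]
    have 1: "(\<integral>z. e z * of_real (bump_deriv r i (z - x)) \<partial>lborel)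
        = - (\<integral>z. E i z * of_real (bump r (z - x)) \<partial>lborel)" for x
      using W(2)[unfolded weak_partial_deriv_def, rule_format, OF bump_test_function[of r x]]
      unfolding bump_partial_deriv .
    have 2: "(\<integral>x. w x * of_real (bump_deriv r i (z - x)) \<partial>lborel)
        = (\<integral>x. A i x * of_real (bump r (z - x)) \<partial>lborel)" for z
    proof -
      have "bump r (z - x) = bump r (x - z)" "bump_deriv r i (z - x) = - bump_deriv r i (x - z)" for x
        using bump_even[where y = "x - z"] by auto
      then show ?thesis
        using W(1)[unfolded weak_partial_deriv_def, rule_format, OF bump_test_function[of r z]]
        unfolding bump_partial_deriv by simp
    qed
    show "integrable lborel (\<lambda>y. of_real (bump r y) * F y)"
      unfolding F_def distrib_left
      by (intro Bochner_Integration.integrable_add L2_kernel_correlation(3) L k)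
    have "(\<integral>y. of_real (bump r y) * F y \<partial>lborel)
      = (\<integral>x. w x * cnj (\<integral>z. E i z * of_real (bump r (z - x)) \<partial>lborel) \<partial>lborel)
        + (\<integral>z. cnj (e z) * (\<integral>x. A i x * of_real (bump r (z - x)) \<partial>lborel) \<partial>lborel)"
      unfolding F_def distrib_left L2_kernel_correlation(1)[OF L(1,4) k] L2_kernel_correlation(2)[OF L(2,3) k]
      by (intro Bochner_Integration.integral_add L2_kernel_correlation(3) L k)
    also have "\<dots> = - (\<integral>x. w x * cnj (\<integral>z. e z * of_real (bump_deriv r i (z - x)) \<partial>lborel) \<partial>lborel)
        + (\<integral>z. cnj (e z) * (\<integral>x. w x * of_real (bump_deriv r i (z - x)) \<partial>lborel) \<partial>lborel)"
      unfolding 1 2 by simp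
    also have "\<dots> = 0"
      unfolding L2_kernel_correlation(1)[OF L(1,3) k'] L2_kernel_correlation(2)[OF L(1,3) k'] by simp
    finally show "(\<integral>y. of_real (bump r y) * F y \<partial>lborel) = 0" .
  qed
  then show ?thesis by (simp add: F_def L2_inner_def add_eq_0_iff)
qed

section \<open>Products of \<open>H\<^sup>1\<close> functions with bounded \<open>C\<^sup>1\<close> functions\<close>

definition C1_bounded :: "(real^'d \<Rightarrow> complex) \<Rightarrow> ('d \<Rightarrow> real^'d \<Rightarrow> complex) \<Rightarrow> bool" where
  "C1_bounded F P \<longleftrightarrow>
     (\<forall>x. (F has_derivative (\<lambda>h. \<Sum>i\<in>UNIV. h $ i *\<^sub>R P i x)) (at x)) \<and>
     (\<forall>i. P i \<in> borel_measurable borel) \<and>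
     (\<exists>B. \<forall>x. cmod (F x) \<le> B \<and> (\<forall>i. cmod (P i x) \<le> B))"

definition compactly_supported :: "(real^'d \<Rightarrow> complex) \<Rightarrow> bool" where
  "compactly_supported F \<longleftrightarrow> (\<exists>K. compact K \<and> (\<forall>x. x \<notin> K \<longrightarrow> F x = 0))"

lemma C1_bounded_continuous: "C1_bounded F P \<Longrightarrow> continuous_on UNIV F"
  unfolding C1_bounded_def by (meson has_derivative_continuous continuous_at_imp_continuous_on)

lemma C1_bounded_measurable:
  assumes "C1_bounded F P"
  shows "F \<in> borel_measurable borel" "P i \<in> borel_measurable borel"
  using borel_measurable_continuous_onI[OF C1_bounded_continuous[OF assms]] assms
  by (auto simp: C1_bounded_def)

lemma derivative_zero_outside_support:
  assumes d: "(F has_derivative (\<lambda>h. \<Sum>i\<in>UNIV. h $ i *\<^sub>R P i)) (at x)"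
    and K: "closed K" "\<And>x. x \<notin> K \<Longrightarrow> F x = 0" "x \<notin> K"
  shows "P i = (0 :: complex)"
proof -
  have "((\<lambda>x. 0::complex) has_derivative (\<lambda>h. 0)) (at x)" by simp
  moreover have "eventually (\<lambda>y. y \<in> - K) (nhds x)"
    using K by (intro eventually_nhds_in_open) auto
  then have "\<forall>\<^sub>F y in at x. (0::complex) = F y"
    unfolding eventually_at_filter by (rule eventually_mono) (use K in auto)
  ultimately have "(F has_derivative (\<lambda>h. 0)) (at x)"
    by (rule has_derivative_transform_eventually) (use K in auto)
  then have "(\<lambda>h. 0) = (\<lambda>h. \<Sum>i\<in>UNIV. h $ i *\<^sub>R P i)"
    using d has_derivative_unique by blast
  then have "0 = (\<Sum>j\<in>UNIV. (axis i 1 $ j :: real) *\<^sub>R P j)" by meson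
  also have "\<dots> = (\<Sum>j\<in>UNIV. if j = i then P j else 0)"
    by (intro sum.cong) (auto simp: axis_def)
  finally show ?thesis by simp
qed

lemma C1_partial_compactly_supported:
  assumes "C1_bounded F P" "compactly_supported F"
  shows "compactly_supported (P i)"
proof -
  obtain K where K: "compact K" "\<And>x. x \<notin> K \<Longrightarrow> F x = 0"
    using assms(2) by (auto simp: compactly_supported_def)
  have "P i x = 0" if "x \<notin> K" for x
    using derivative_zero_outside_support[of F "\<lambda>i. P i x" x K i] assms(1) K that compact_imp_closed
    by (auto simp: C1_bounded_def)
  with K show ?thesis by (auto simp: compactly_supported_def)
qed

lemma compactly_supported_integrable_L2:
  assumes F: "compactly_supported F" and [measurable]: "F \<in> borel_measurable borel"
    and B: "\<And>x. cmod (F x) \<le> B"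
  shows "integrable lborel F" "F \<in> L2 lborel"
proof -
  obtain K where K: "compact K" "\<And>x. x \<notin> K \<Longrightarrow> F x = 0"
    using F by (auto simp: compactly_supported_def)
  have [measurable]: "K \<in> sets borel" using K by (intro borel_closed compact_imp_closed)
  have Kf: "emeasure lborel K < \<infinity>" using emeasure_bounded_finite[OF compact_imp_bounded[OF K(1)]] .
  have i: "integrable lborel (\<lambda>x. C * indicator K x :: real)" for C
    using Kf by (intro integrable_mult_right integrable_real_indicator) auto
  show "integrable lborel F"
    by (rule Bochner_Integration.integrable_bound[OF i[of B]])
      (use B K order_trans[OF norm_ge_zero B] in \<open>auto simp: indicator_def intro: order_trans[OF B abs_ge_self]\<close>)
  have "integrable lborel (\<lambda>x. (cmod (F x))\<^sup>2)"
    by (rule Bochner_Integration.integrable_bound[OF i[of "B\<^sup>2"]])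
      (use B K in \<open>auto simp: indicator_def intro!: power_mono\<close>)
  then show "F \<in> L2 lborel" by (simp add: L2_def)
qed

lemma C1_bounded_bounds:
  assumes "C1_bounded F P"
  obtains B where "B \<ge> 0" "\<And>x. cmod (F x) \<le> B" "\<And>i x. cmod (P i x) \<le> B"
proof -
  obtain B where "\<forall>x. cmod (F x) \<le> B \<and> (\<forall>i. cmod (P i x) \<le> B)"
    using assms by (auto simp: C1_bounded_def)
  moreover from this have "B \<ge> 0" using norm_ge_zero order_trans by blast
  ultimately show ?thesis using that by blast
qed

lemma C1_compact_L2:
  assumes "C1_bounded F P" "compactly_supported F"
  shows "F \<in> L2 lborel" "P i \<in> L2 lborel" "integrable lborel F" "integrable lborel (P i)"
proof -
  obtain B where B: "\<And>x. cmod (F x) \<le> B" "\<And>i x. cmod (P i x) \<le> B"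
    using C1_bounded_bounds[OF assms(1)] by metis
  note m = C1_bounded_measurable[OF assms(1)]
  show "F \<in> L2 lborel" "P i \<in> L2 lborel" "integrable lborel F" "integrable lborel (P i)"
    using compactly_supported_integrable_L2[OF assms(2) m(1) B(1)]
      compactly_supported_integrable_L2[OF C1_partial_compactly_supported[OF assms] m(2) B(2)] by auto
qed

lemma C1_bounded_mult:
  assumes F: "C1_bounded F P" and G: "C1_bounded G Q"
  shows "C1_bounded (\<lambda>x. F x * G x) (\<lambda>i x. P i x * G x + F x * Q i x)"
proof -
  obtain B where B: "B \<ge> 0" "\<And>x. cmod (F x) \<le> B" "\<And>i x. cmod (P i x) \<le> B"
    using C1_bounded_bounds[OF F] by metis
  obtain C where C: "C \<ge> 0" "\<And>x. cmod (G x) \<le> C" "\<And>i x. cmod (Q i x) \<le> C"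
    using C1_bounded_bounds[OF G] by metis
  note [measurable] = C1_bounded_measurable[OF F] C1_bounded_measurable[OF G]
  have "((\<lambda>x. F x * G x) has_derivative (\<lambda>h. \<Sum>i\<in>UNIV. h $ i *\<^sub>R (P i x * G x + F x * Q i x))) (at x)" for x
  proof (rule has_derivative_eq_rhs)
    show "((\<lambda>x. F x * G x) has_derivative (\<lambda>h. F x * (\<Sum>i\<in>UNIV. h $ i *\<^sub>R Q i x)
        + (\<Sum>i\<in>UNIV. h $ i *\<^sub>R P i x) * G x)) (at x)"
      by (rule has_derivative_mult) (use F G in \<open>auto simp: C1_bounded_def\<close>)
    show "(\<lambda>h. F x * (\<Sum>i\<in>UNIV. h $ i *\<^sub>R Q i x) + (\<Sum>i\<in>UNIV. h $ i *\<^sub>R P i x) * G x)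
        = (\<lambda>h. \<Sum>i\<in>UNIV. h $ i *\<^sub>R (P i x * G x + F x * Q i x))"
      by (simp add: sum_distrib_left sum_distrib_right sum.distrib scaleR_add_right add.commute)
  qed
  moreover have "cmod (F x * G x) \<le> 2 * (B * C) \<and> (\<forall>i. cmod (P i x * G x + F x * Q i x) \<le> 2 * (B * C))" for x
  proof -
    have "cmod (F x * G x) \<le> B * C" "\<And>i. cmod (P i x * G x) \<le> B * C" "\<And>i. cmod (F x * Q i x) \<le> B * C"
      unfolding norm_mult using B C by (auto intro!: mult_mono)
    moreover have "0 \<le> B * C" using B C by simp
    ultimately show ?thesis by (smt (verit) norm_triangle_ineq)
  qed
  ultimately show ?thesis unfolding C1_bounded_def by (auto intro!: exI[of _ "2 * (B * C)"])
qed

lemma test_function_C1: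
  assumes "test_function \<psi>"
  shows "C1_bounded \<psi> (\<lambda>i. partial_deriv i \<psi>)" "compactly_supported \<psi>"
proof -
  obtain D where D: "D [] = \<psi>" "\<And>l x. (D l has_derivative (\<lambda>h. \<Sum>i\<in>UNIV. h $ i *\<^sub>R D (i # l) x)) (at x)"
    using assms unfolding test_function_def smooth_def by blast
  show c: "compactly_supported \<psi>" using assms by (auto simp: test_function_def compactly_supported_def)
  then obtain K where K: "compact K" "\<And>x. x \<notin> K \<Longrightarrow> \<psi> x = 0" by (auto simp: compactly_supported_def)
  have d: "(\<psi> has_derivative (\<lambda>h. \<Sum>i\<in>UNIV. h $ i *\<^sub>R D [i] x)) (at x)" for x
    using D(2)[of "[]"] by (simp add: D(1))
  have p: "partial_deriv i \<psi> = D [i]" for i using partial_deriv_eq[OF d] by auto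
  have cont: "continuous_on UNIV (D l)" for l
    using D(2) by (meson has_derivative_continuous continuous_at_imp_continuous_on)
  have bounded: "\<exists>B. \<forall>x. cmod (f x) \<le> B" if "continuous_on UNIV f" "\<And>x. x \<notin> K \<Longrightarrow> f x = 0" for f :: "real^'a \<Rightarrow> complex"
  proof -
    have "bounded (f ` K)"
      by (intro compact_imp_bounded compact_continuous_image K continuous_on_subset[OF that(1)]) auto
    then obtain B where B: "\<forall>y\<in>f ` K. cmod y \<le> B" by (auto simp: bounded_iff)
    have "cmod (f x) \<le> max B 0" for x
    proof (cases "x \<in> K")
      case True
      then have "cmod (f x) \<le> B" using B by auto
      then show ?thesis by simp
    qed (use that in simp)
    then show ?thesis by blast
  qed
  obtain b where b: "\<And>x. cmod (\<psi> x) \<le> b" using bounded[OF cont[of "[]"]] K D(1) by metis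
  have "\<exists>b. \<forall>x. cmod (D [i] x) \<le> b" for i
    using derivative_zero_outside_support[OF d compact_imp_closed[OF K(1)] K(2)]
    by (intro bounded cont) auto
  then obtain B where B: "\<And>i x. cmod (D [i] x) \<le> B i" by metis
  have "cmod (D [i] x) \<le> max b (Max (range B))" for i x
    by (rule order_trans[OF B order_trans[OF Max_ge max.cobounded2]]) auto
  moreover have "cmod (\<psi> x) \<le> max b (Max (range B))" for x using b[of x] by simp
  ultimately show "C1_bounded \<psi> (\<lambda>i. partial_deriv i \<psi>)"
    using d cont unfolding C1_bounded_def p
    by (auto intro!: borel_measurable_continuous_onI exI[of _ "max b (Max (range B))"])
qed

text \<open>By translation invariance of Lebesgue measure the integral of a difference quotient vanishes;
  the Lipschitz bound allows passing to the limit.\<close>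

lemma integral_partial_zero:
  assumes F: "C1_bounded F P" and K: "compactly_supported F"
  shows "(\<integral>x. P i x \<partial>lborel) = 0"
proof -
  note [measurable] = C1_bounded_measurable[OF F]
  note int = C1_compact_L2(3,4)[OF F K]
  obtain B where B: "B \<ge> 0" "\<And>x. cmod (F x) \<le> B" "\<And>i x. cmod (P i x) \<le> B"
    using C1_bounded_bounds[OF F] by metis
  obtain S where S: "compact S" "\<And>x. x \<notin> S \<Longrightarrow> F x = 0" using K by (auto simp: compactly_supported_def)
  obtain r where r: "\<And>x. x \<in> S \<Longrightarrow> norm x \<le> r" using compact_imp_bounded[OF S(1)] by (auto simp: bounded_iff)
  define s where "s n = inverse (real (Suc n))" for n
  have s: "s n > 0" "s n \<le> 1" for n by (auto simp: s_def field_simps)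
  define e where "e = (axis i 1 :: real^'a)"
  have e: "norm e = 1" by (simp add: e_def)
  define q where "q n x = (F (s n *\<^sub>R e + x) - F x) /\<^sub>R s n" for n x
  let ?C = "real CARD('a) * B"
  have lip: "cmod (F (s n *\<^sub>R e + x) - F x) \<le> ?C * s n" for n x
  proof -
    have "norm (F (s n *\<^sub>R e + x) - F x) \<le> ?C * norm ((s n *\<^sub>R e + x) - x)"
    proof (rule differentiable_bound[OF convex_UNIV])
      fix x :: "real^'a"
      show "(F has_derivative (\<lambda>h. \<Sum>i\<in>UNIV. h $ i *\<^sub>R P i x)) (at x within UNIV)"
        using F by (simp add: C1_bounded_def)
      show "onorm (\<lambda>h. \<Sum>i\<in>UNIV. h $ i *\<^sub>R P i x) \<le> ?C"
      proof (rule onorm_le)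
        fix h :: "real^'a"
        have "norm (\<Sum>i\<in>UNIV. h $ i *\<^sub>R P i x) \<le> (\<Sum>i\<in>(UNIV::'a set). norm h * B)"
          by (intro sum_norm_le) (auto intro!: mult_mono B component_le_norm_cart)
        then show "norm (\<Sum>i\<in>UNIV. h $ i *\<^sub>R P i x) \<le> ?C * norm h" by (simp add: mult_ac)
      qed
    qed auto
    then show ?thesis using e s[of n] by simp
  qed
  have "(\<integral>x. q n x \<partial>lborel) = 0" for n
    unfolding q_def using int(1) lborel_integrable_translate[of F "s n *\<^sub>R e"]
      lborel_integral_translate[of F "s n *\<^sub>R e"] by simp
  moreover have "(\<lambda>n. \<integral>x. q n x \<partial>lborel) \<longlonglongrightarrow> (\<integral>x. P i x \<partial>lborel)"
  proof (rule integral_dominated_convergence[where w = "\<lambda>x. ?C * indicator (cball 0 (r + 1)) x"])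
    show "integrable lborel (\<lambda>x::real^'a. ?C * indicator (cball 0 (r + 1)) x)"
      using emeasure_bounded_finite[OF bounded_cball, of "0::real^'a" "r + 1"]
      by (intro integrable_mult_right integrable_real_indicator) auto
    show "AE x in lborel. norm (q n x) \<le> ?C * indicator (cball 0 (r + 1)) x" for n
    proof (rule AE_I2)
      fix x
      show "norm (q n x) \<le> ?C * indicator (cball 0 (r + 1)) x"
      proof (cases "norm x \<le> r + 1")
        case True
        have "norm (q n x) = cmod (F (s n *\<^sub>R e + x) - F x) / s n"
          using s[of n] by (simp add: q_def divide_inverse mult.commute)
        also have "\<dots> \<le> ?C" using lip[of n x] s[of n] by (simp add: field_simps)
        finally show ?thesis using True by simp
      next
        case False
        have "norm x \<le> norm (s n *\<^sub>R e + x) + norm (s n *\<^sub>R e)"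
          using norm_triangle_ineq4[of "s n *\<^sub>R e + x" "s n *\<^sub>R e"] by simp
        then have "norm (s n *\<^sub>R e + x) > r" using False e s[of n] by simp
        then have "s n *\<^sub>R e + x \<notin> S" "x \<notin> S" using r False by force+
        then show ?thesis using S B by (simp add: q_def)
      qed
    qed
    show "AE x in lborel. (\<lambda>n. q n x) \<longlonglongrightarrow> P i x"
    proof (rule AE_I2)
      fix x
      have d: "(F has_derivative (\<lambda>h. \<Sum>i\<in>UNIV. h $ i *\<^sub>R P i x)) (at x)"
        using F by (simp add: C1_bounded_def)
      have De: "(\<Sum>j\<in>UNIV. (t *\<^sub>R e) $ j *\<^sub>R P j x) = t *\<^sub>R P i x" for t
      proof -
        have "(\<Sum>j\<in>UNIV. (t *\<^sub>R e) $ j *\<^sub>R P j x) = (\<Sum>j\<in>UNIV. if j = i then t *\<^sub>R P j x else 0)"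
          by (intro sum.cong) (auto simp: e_def axis_def)
        then show ?thesis by simp
      qed
      have s0: "(\<lambda>n. s n *\<^sub>R e) \<longlonglongrightarrow> 0"
        unfolding s_def using tendsto_scaleR[OF LIMSEQ_inverse_real_of_nat tendsto_const, of e] by simp
      have "filterlim (\<lambda>n. s n *\<^sub>R e) (at 0) sequentially"
      proof -
        have "s n *\<^sub>R e \<noteq> 0" for n using s(1)[of n] e by auto
        then show ?thesis unfolding filterlim_at using s0 by simp
      qed
      from filterlim_compose[OF d[unfolded has_derivative_at, THEN conjunct2] this]
      have "(\<lambda>n. norm (F (x + s n *\<^sub>R e) - F x - s n *\<^sub>R P i x) / norm (s n *\<^sub>R e)) \<longlonglongrightarrow> 0"
        unfolding De .
      moreover have "norm (s n *\<^sub>R e) = s n" for n using s(1)[of n] e by simp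
      ultimately have "(\<lambda>n. norm (F (x + s n *\<^sub>R e) - F x - s n *\<^sub>R P i x) / s n) \<longlonglongrightarrow> 0" by simp
      moreover have "norm (F (x + s n *\<^sub>R e) - F x - s n *\<^sub>R P i x) / s n = norm (q n x - P i x)" for n
      proof -
        have "q n x - P i x = (F (x + s n *\<^sub>R e) - F x - s n *\<^sub>R P i x) /\<^sub>R s n"
          using s[of n] by (simp add: q_def scaleR_diff_right add.commute)
        then show ?thesis using s[of n] by (simp add: divide_inverse mult.commute)
      qed
      ultimately have "(\<lambda>n. norm (q n x - P i x)) \<longlonglongrightarrow> 0" by simp
      then show "(\<lambda>n. q n x) \<longlonglongrightarrow> P i x"
        by (rule LIM_zero_cancel[OF tendsto_norm_zero_cancel])
    qed
    show "q n \<in> borel_measurable lborel" for n unfolding q_def by measurable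
  qed auto
  ultimately show ?thesis by (simp add: LIMSEQ_const_iff)
qed

text \<open>The product with a test function has compact support, so its partial derivative has integral \<open>0\<close>.\<close>

lemma C1_compact_H1:
  assumes F: "C1_bounded F P" and K: "compactly_supported F"
  shows "H1_with_gradient F P"
  unfolding H1_with_gradient_def weak_partial_deriv_def
proof (intro conjI allI impI C1_compact_L2[OF F K])
  fix i and \<psi> :: "real^'a \<Rightarrow> complex" assume "test_function \<psi>"
  note \<psi> = test_function_C1[OF this]
  have K': "compactly_supported (\<lambda>x. F x * \<psi> x)"
    using K by (auto simp: compactly_supported_def)
  have "(\<integral>x. P i x * \<psi> x + F x * partial_deriv i \<psi> x \<partial>lborel) = 0"
    by (rule integral_partial_zero[OF C1_bounded_mult[OF F \<psi>(1)] K'])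
  moreover have "integrable lborel (\<lambda>x. P i x * \<psi> x)" "integrable lborel (\<lambda>x. F x * partial_deriv i \<psi> x)"
    by (intro L2_mult_integrable C1_compact_L2[OF F K] C1_compact_L2[OF \<psi>])+
  ultimately show "(\<integral>x. F x * partial_deriv i \<psi> x \<partial>lborel) = - (\<integral>x. P i x * \<psi> x \<partial>lborel)"
    by (simp add: add_eq_0_iff)
qed

lemma C1_bounded_cnj:
  assumes "C1_bounded F P"
  shows "C1_bounded (\<lambda>x. cnj (F x)) (\<lambda>i x. cnj (P i x))"
proof -
  note [measurable] = C1_bounded_measurable[OF assms]
  have "((\<lambda>x. cnj (F x)) has_derivative (\<lambda>h. \<Sum>i\<in>UNIV. h $ i *\<^sub>R cnj (P i x))) (at x)" for x
    by (rule has_derivative_eq_rhs[OF bounded_linear.has_derivative[OF bounded_linear_cnj]])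
      (use assms in \<open>auto simp: C1_bounded_def\<close>)
  then show ?thesis using assms by (auto simp: C1_bounded_def)
qed

text \<open>A test function times a bounded \<open>C\<^sup>1\<close> function is no longer a test function, but it is an
  \<open>H\<^sup>1\<close> function, and integration by parts holds for any two of these.\<close>

lemma H1_mult:
  fixes \<phi> :: "real^'d \<Rightarrow> complex"
  assumes \<phi>: "C1_bounded \<phi> D" and u: "H1_with_gradient u G"
  shows "H1_with_gradient (\<lambda>x. \<phi> x * u x) (\<lambda>i x. D i x * u x + \<phi> x * G i x)"
  unfolding H1_with_gradient_def
proof (intro conjI allI)
  obtain B where B: "B \<ge> 0" "\<And>x. cmod (\<phi> x) \<le> B" "\<And>i x. cmod (D i x) \<le> B"
    using C1_bounded_bounds[OF \<phi>] by metis
  note m [measurable] = C1_bounded_measurable[OF \<phi>]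
  have L: "u \<in> L2 lborel" "G i \<in> L2 lborel" for i using u by (auto simp: H1_with_gradient_def)
  have b: "(\<lambda>x. \<phi> x * w x) \<in> L2 lborel" "(\<lambda>x. D i x * w x) \<in> L2 lborel" if "w \<in> L2 lborel" for w i
    using that B by (auto intro!: L2_bounded_mult)
  show "(\<lambda>x. \<phi> x * u x) \<in> L2 lborel" by (intro b L)
  fix i
  show "(\<lambda>x. D i x * u x + \<phi> x * G i x) \<in> L2 lborel" by (intro L2_add b L)
  show "weak_partial_deriv i (\<lambda>x. \<phi> x * u x) (\<lambda>x. D i x * u x + \<phi> x * G i x)"
    unfolding weak_partial_deriv_def
  proof (intro allI impI)
    fix \<psi> :: "real^'d \<Rightarrow> complex" assume "test_function \<psi>"
    note \<psi> = test_function_C1[OF this]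
    note \<psi>L = C1_compact_L2[OF \<psi>]
    let ?e = "\<lambda>x. cnj (\<phi> x * \<psi> x)" and ?E = "\<lambda>i x. cnj (D i x * \<psi> x + \<phi> x * partial_deriv i \<psi> x)"
    have K: "compactly_supported ?e" using \<psi>(2) by (auto simp: compactly_supported_def)
    have "H1_with_gradient ?e ?E"
      by (rule C1_compact_H1[OF C1_bounded_cnj[OF C1_bounded_mult[OF \<phi> \<psi>(1)]] K])
    from H1_integration_by_parts[OF u this, of i]
    have eq: "(\<integral>x. u x * (D i x * \<psi> x + \<phi> x * partial_deriv i \<psi> x) \<partial>lborel) = - (\<integral>x. G i x * (\<phi> x * \<psi> x) \<partial>lborel)"
      by (simp add: L2_inner_def)
    have I: "integrable lborel (\<lambda>x. D i x * u x * \<psi> x)" "integrable lborel (\<lambda>x. \<phi> x * u x * partial_deriv i \<psi> x)"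
        "integrable lborel (\<lambda>x. \<phi> x * G i x * \<psi> x)"
      by (intro L2_mult_integrable b L \<psi>L)+
    have "(\<integral>x. u x * (D i x * \<psi> x + \<phi> x * partial_deriv i \<psi> x) \<partial>lborel)
        = (\<integral>x. D i x * u x * \<psi> x \<partial>lborel) + (\<integral>x. \<phi> x * u x * partial_deriv i \<psi> x \<partial>lborel)"
      by (subst Bochner_Integration.integral_add[OF I(1,2), symmetric]) (simp add: algebra_simps)
    moreover have "(\<integral>x. (D i x * u x + \<phi> x * G i x) * \<psi> x \<partial>lborel)
        = (\<integral>x. D i x * u x * \<psi> x \<partial>lborel) + (\<integral>x. \<phi> x * G i x * \<psi> x \<partial>lborel)"
      by (subst Bochner_Integration.integral_add[OF I(1,3), symmetric]) (simp add: algebra_simps)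
    moreover have "(\<integral>x. G i x * (\<phi> x * \<psi> x) \<partial>lborel) = (\<integral>x. \<phi> x * G i x * \<psi> x \<partial>lborel)"
      by (simp add: mult_ac)
    ultimately show "(\<integral>x. \<phi> x * u x * partial_deriv i \<psi> x \<partial>lborel)
        = - (\<integral>x. (D i x * u x + \<phi> x * G i x) * \<psi> x \<partial>lborel)"
      using eq by (simp add: algebra_simps eq_neg_iff_add_eq_0)
  qed
qed

lemma H1_diff:
  assumes u: "H1_with_gradient u G" and w: "H1_with_gradient w H"
  shows "H1_with_gradient (\<lambda>x. u x - w x) (\<lambda>i x. G i x - H i x)"
  unfolding H1_with_gradient_def weak_partial_deriv_def
proof (intro conjI allI impI)
  have L: "u \<in> L2 lborel" "w \<in> L2 lborel" "G i \<in> L2 lborel" "H i \<in> L2 lborel" for i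
    using u w by (auto simp: H1_with_gradient_def)
  show "(\<lambda>x. u x - w x) \<in> L2 lborel" "(\<lambda>x. G i x - H i x) \<in> L2 lborel" for i by (intro L2_diff L)+
  fix i and \<psi> :: "real^'a \<Rightarrow> complex" assume t: "test_function \<psi>"
  note \<psi>L = C1_compact_L2[OF test_function_C1[OF t]]
  have "(\<integral>x. u x * partial_deriv i \<psi> x \<partial>lborel) = - (\<integral>x. G i x * \<psi> x \<partial>lborel)"
    "(\<integral>x. w x * partial_deriv i \<psi> x \<partial>lborel) = - (\<integral>x. H i x * \<psi> x \<partial>lborel)"
    using u w t by (auto simp: H1_with_gradient_def weak_partial_deriv_def)
  then show "(\<integral>x. (u x - w x) * partial_deriv i \<psi> x \<partial>lborel) = - (\<integral>x. (G i x - H i x) * \<psi> x \<partial>lborel)"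
    using L \<psi>L by (simp add: left_diff_distrib L2_mult_integrable)
qed

lemma H1_scale: "H1_with_gradient u G \<Longrightarrow> H1_with_gradient (\<lambda>x. c * u x) (\<lambda>i x. c * G i x)"
  unfolding H1_with_gradient_def weak_partial_deriv_def by (auto simp: mult.assoc)

section \<open>Gaussian integrals\<close>

text \<open>A rescaling of the characteristic function of the standard normal distribution.\<close>

lemma gaussian_fourier_real:
  fixes s \<xi> :: real
  assumes s: "s > 0"
  shows "integrable lborel (\<lambda>x. exp (- s * x\<^sup>2))"
    and "(\<integral>x. cis (\<xi> * x) * of_real (exp (- s * x\<^sup>2)) \<partial>lborel) = of_real (sqrt (pi / s) * exp (- \<xi>\<^sup>2 / (4 * s)))"
proof -
  define c where "c = sqrt (2 * s)"
  have c: "c > 0" "c\<^sup>2 = 2 * s" using s by (auto simp: c_def)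
  have sd: "std_normal_density (c * x) = exp (- s * x\<^sup>2) / sqrt (2 * pi)" for x
    using c by (simp add: std_normal_density_def power_mult_distrib)
  define g where "g x = cis (\<xi> * x) * complex_of_real (exp (- s * x\<^sup>2))" for x
  define I where "I = (\<integral>x. g x \<partial>lborel)"
  have i: "integrable lborel (\<lambda>x. std_normal_density (0 + c * x))"
    using lborel_integrable_real_affine[OF integrable_normal_density[of 1 0], of c 0] c by simp
  have "integrable lborel (\<lambda>x. std_normal_density (0 + c * x) * sqrt (2 * pi))"
    using i by (rule integrable_mult_left)
  then show "integrable lborel (\<lambda>x. exp (- s * x\<^sup>2))" by (simp add: sd)
  have "of_real (exp (- (\<xi> / c)\<^sup>2 / 2)) = char std_normal_distribution (\<xi> / c)"
    by (simp add: char_std_normal_distribution)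
  also have "\<dots> = (\<integral>x. std_normal_density x *\<^sub>R iexp (\<xi> / c * x) \<partial>lborel)"
    unfolding char_def by (subst integral_density) (auto simp: normal_density_nonneg)
  also have "\<dots> = c *\<^sub>R (\<integral>x. std_normal_density (0 + c * x) *\<^sub>R iexp (\<xi> / c * (0 + c * x)) \<partial>lborel)"
    using c by (subst lborel_integral_real_affine[of c _ 0]) auto
  also have "\<dots> = c *\<^sub>R (\<integral>x. g x / of_real (sqrt (2 * pi)) \<partial>lborel)"
  proof (intro arg_cong2[where f = scaleR] refl Bochner_Integration.integral_cong)
    fix x
    have "\<xi> / c * (0 + c * x) = \<xi> * x" using c by simp
    moreover have "0 + c * x = c * x" by simp
    ultimately show "std_normal_density (0 + c * x) *\<^sub>R iexp (\<xi> / c * (0 + c * x)) = g x / of_real (sqrt (2 * pi))"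
      by (simp only: sd g_def cis_conv_exp scaleR_conv_of_real of_real_divide times_divide_eq_left times_divide_eq_right mult.commute)
  qed
  also have "\<dots> = of_real (c / sqrt (2 * pi)) * I"
    by (simp only: Bochner_Integration.integral_divide_zero I_def[symmetric] scaleR_conv_of_real of_real_divide
        times_divide_eq_left times_divide_eq_right)
  finally have eq: "of_real (exp (- (\<xi> / c)\<^sup>2 / 2)) = of_real (c / sqrt (2 * pi)) * I" .
  have "sqrt (pi / s) * (c / sqrt (2 * pi)) = sqrt ((pi / s) * ((2 * s) / (2 * pi)))"
    by (simp only: c_def real_sqrt_mult real_sqrt_divide)
  also have "\<dots> = 1" using s by simp
  finally have 1: "sqrt (pi / s) * (c / sqrt (2 * pi)) = 1" .
  have "(\<xi> / c)\<^sup>2 / 2 = \<xi>\<^sup>2 / (4 * s)" using c by (simp add: power_divide)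
  then have "of_real (sqrt (pi / s) * exp (- \<xi>\<^sup>2 / (4 * s)))
     = of_real (sqrt (pi / s)) * (of_real (exp (- (\<xi> / c)\<^sup>2 / 2)) :: complex)"
    by simp
  also have "\<dots> = of_real (sqrt (pi / s) * (c / sqrt (2 * pi))) * I"
    unfolding eq by (simp only: of_real_mult mult.assoc)
  finally show "(\<integral>x. cis (\<xi> * x) * of_real (exp (- s * x\<^sup>2)) \<partial>lborel) = of_real (sqrt (pi / s) * exp (- \<xi>\<^sup>2 / (4 * s)))"
    unfolding 1 I_def g_def by simp
qed

lemma borel_measurable_cis [measurable]: "cis \<in> borel_measurable borel"
  by (intro borel_measurable_continuous_onI continuous_intros)

lemma cis_sum: "finite I \<Longrightarrow> cis (\<Sum>i\<in>I. f i) = (\<Prod>i\<in>I. cis (f i))"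
  by (induction I rule: finite_induct) (auto simp: cis_mult[symmetric])

text \<open>Lebesgue measure is a product measure and the integrand factorises over the coordinates.\<close>

lemma
  fixes \<xi> :: "'a::euclidean_space"
  assumes s: "s > 0"
  shows gaussian_integrable: "integrable lborel (\<lambda>x::'a. exp (- s * (norm x)\<^sup>2))"
    and gaussian_fourier: "(\<integral>x. cis (\<xi> \<bullet> x) * of_real (exp (- s * (norm x)\<^sup>2)) \<partial>lborel)
           = of_real (sqrt (pi / s) ^ DIM('a) * exp (- (norm \<xi>)\<^sup>2 / (4 * s)))"
proof -
  interpret product_sigma_finite "\<lambda>_::'a. lborel :: real measure"
    by standard
  let ?\<Phi> = "\<lambda>f. \<Sum>b\<in>Basis. f b *\<^sub>R (b::'a)"
  let ?P = "\<Pi>\<^sub>M b\<in>(Basis::'a set). (lborel :: real measure)"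
  have m [measurable]: "?\<Phi> \<in> ?P \<rightarrow>\<^sub>M borel" by simp
  have norm2: "(norm y)\<^sup>2 = (\<Sum>b\<in>Basis. (y \<bullet> b)\<^sup>2)" for y :: 'a
    using euclidean_inner[of y y] by (simp only: power2_norm_eq_inner) (simp add: power2_eq_square)
  have \<Phi>: "?\<Phi> f \<bullet> b = f b" if "b \<in> Basis" for f b using that by simp
  have e: "exp (- s * (norm (?\<Phi> f))\<^sup>2) = (\<Prod>b\<in>Basis. exp (- s * (f b)\<^sup>2))" for f
  proof -
    have "(norm (?\<Phi> f))\<^sup>2 = (\<Sum>b\<in>Basis. (f b)\<^sup>2)"
      unfolding norm2 by (intro sum.cong refl) (simp only: \<Phi>)
    then show ?thesis by (simp only: exp_sum[OF finite_Basis, symmetric] sum_distrib_left)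
  qed
  have c: "cis (\<xi> \<bullet> ?\<Phi> f) = (\<Prod>b\<in>Basis. cis ((\<xi> \<bullet> b) * f b))" for f
  proof -
    have "\<xi> \<bullet> ?\<Phi> f = (\<Sum>b\<in>Basis. (\<xi> \<bullet> b) * f b)"
      by (simp only: inner_sum_right inner_scaleR_right mult.commute)
    then show ?thesis by (simp only: cis_sum[OF finite_Basis])
  qed
  have "integrable ?P (\<lambda>f. \<Prod>b\<in>Basis. exp (- s * (f b)\<^sup>2))"
    using gaussian_fourier_real(1)[OF s] by (intro product_integrable_prod) auto
  then show "integrable lborel (\<lambda>x::'a. exp (- s * (norm x)\<^sup>2))"
    unfolding e[symmetric] by (subst lborel_eq, subst integrable_distr_eq) auto
  have "(\<integral>x. cis (\<xi> \<bullet> x) * of_real (exp (- s * (norm x)\<^sup>2)) \<partial>lborel)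
      = (\<integral>f. cis (\<xi> \<bullet> ?\<Phi> f) * of_real (exp (- s * (norm (?\<Phi> f))\<^sup>2)) \<partial>?P)"
    by (subst lborel_eq, subst integral_distr) auto
  also have "\<dots> = (\<integral>f. (\<Prod>b\<in>Basis. cis ((\<xi> \<bullet> b) * f b) * of_real (exp (- s * (f b)\<^sup>2))) \<partial>?P)"
    unfolding e c prod.distrib of_real_prod ..
  also have "\<dots> = (\<Prod>b\<in>Basis. \<integral>x. cis ((\<xi> \<bullet> b) * x) * of_real (exp (- s * x\<^sup>2)) \<partial>lborel)"
  proof (rule product_integral_prod)
    fix b :: 'a
    have "integrable lborel (\<lambda>x. complex_of_real (exp (- s * x\<^sup>2)))"
      using gaussian_fourier_real(1)[OF s] by simp
    then show "integrable lborel (\<lambda>x. cis ((\<xi> \<bullet> b) * x) * of_real (exp (- s * x\<^sup>2)))"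
      by (rule Bochner_Integration.integrable_bound) (auto simp: norm_mult)
  qed auto
  also have "\<dots> = (\<Prod>b\<in>Basis. of_real (sqrt (pi / s) * exp (- (\<xi> \<bullet> b)\<^sup>2 / (4 * s))))"
    by (simp only: gaussian_fourier_real(2)[OF s])
  also have "\<dots> = of_real (sqrt (pi / s) ^ DIM('a) * exp (- (norm \<xi>)\<^sup>2 / (4 * s)))"
    unfolding of_real_prod[symmetric] prod.distrib norm2[of \<xi>]
    by (simp add: exp_sum[symmetric] sum_negf sum_divide_distrib)
  finally show "(\<integral>x. cis (\<xi> \<bullet> x) * of_real (exp (- s * (norm x)\<^sup>2)) \<partial>lborel)
           = of_real (sqrt (pi / s) ^ DIM('a) * exp (- (norm \<xi>)\<^sup>2 / (4 * s)))" .
qed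

section \<open>The heat kernel\<close>

definition heat :: "real \<Rightarrow> real^'d \<Rightarrow> real" where
  "heat t x = (4 * pi * t) powr (- (real CARD('d) / 2)) * exp (- (norm x)\<^sup>2 / (4 * t))"

text \<open>The partial derivatives of the heat kernel of first and second order.\<close>

definition heat1 :: "'d \<Rightarrow> real \<Rightarrow> real^'d \<Rightarrow> real" where
  "heat1 i t x = - (x $ i / (2 * t)) * heat t x"

definition heat2 :: "'d \<Rightarrow> 'd \<Rightarrow> real \<Rightarrow> real^'d \<Rightarrow> real" where
  "heat2 i j t x = (x $ i * x $ j / (4 * t\<^sup>2) - (if i = j then 1 / (2 * t) else 0)) * heat t x"

lemma powr_minus_half_power:
  fixes a :: real
  assumes a: "a > 0"
  shows "a powr (- (real n / 2)) = (1 / sqrt a) ^ n"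
proof -
  have "a powr (- (real n / 2)) = inverse ((a powr (1 / 2)) powr real n)"
    by (simp only: powr_powr powr_minus) simp
  also have "\<dots> = inverse (sqrt a ^ n)"
    using a by (simp add: powr_half_sqrt powr_realpow)
  also have "\<dots> = (1 / sqrt a) ^ n" by (simp add: power_one_over inverse_eq_divide)
  finally show ?thesis .
qed

lemma heat_nonneg: "heat t x \<ge> 0" by (simp add: heat_def)

lemma borel_measurable_vec_nth [measurable]: "(\<lambda>x::real^'d. x $ i) \<in> borel_measurable borel"
  by (intro borel_measurable_continuous_onI continuous_intros)

lemma heat_measurable [measurable]:
  "(\<lambda>p. heat (fst p) (snd p)) \<in> borel_measurable (borel \<Otimes>\<^sub>M borel)"
  "(\<lambda>p. heat1 i (fst p) (snd p)) \<in> borel_measurable (borel \<Otimes>\<^sub>M borel)"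
  "(\<lambda>p. heat2 i j (fst p) (snd p)) \<in> borel_measurable (borel \<Otimes>\<^sub>M borel)"
  unfolding heat1_def heat2_def heat_def by measurable

lemma heat_measurable' [measurable (raw)]:
  assumes "f \<in> borel_measurable N" "g \<in> borel_measurable N"
  shows "(\<lambda>p. heat (f p) (g p)) \<in> borel_measurable N"
    "(\<lambda>p. heat1 i (f p) (g p)) \<in> borel_measurable N"
    "(\<lambda>p. heat2 i j (f p) (g p)) \<in> borel_measurable N"
  using measurable_compose[OF measurable_Pair[OF assms] heat_measurable(1)]
    measurable_compose[OF measurable_Pair[OF assms] heat_measurable(2)]
    measurable_compose[OF measurable_Pair[OF assms] heat_measurable(3)] by simp_all

lemma heat_le:
  fixes x :: "real^'d"
  assumes t: "t > 0"
  shows "heat t x \<le> t powr (- (real CARD('d) / 2))"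
proof -
  have "(4 * pi * t) powr (- (real CARD('d) / 2)) \<le> t powr (- (real CARD('d) / 2))"
    using t pi_ge_two by (intro powr_mono2') auto
  then have "heat t x \<le> t powr (- (real CARD('d) / 2)) * 1"
    unfolding heat_def using t by (intro mult_mono) auto
  then show ?thesis by simp
qed

lemma
  assumes t: "t > 0"
  shows heat_integrable: "integrable lborel (heat t :: real^'d \<Rightarrow> real)"
    and heat_integral: "(\<integral>x. heat t (x :: real^'d) \<partial>lborel) = 1"
proof -
  have s: "1 / (4 * t) > 0" using t by simp
  have h: "heat t x = (4 * pi * t) powr (- (real CARD('d) / 2)) * exp (- (1 / (4 * t)) * (norm x)\<^sup>2)" for x :: "real^'d"
    by (simp add: heat_def)
  show "integrable lborel (heat t :: real^'d \<Rightarrow> real)"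
    unfolding h[abs_def] by (intro integrable_mult_right gaussian_integrable s)
  have "complex_of_real (\<integral>x. exp (- (1 / (4 * t)) * (norm (x :: real^'d))\<^sup>2) \<partial>lborel) = of_real (sqrt (4 * pi * t) ^ CARD('d))"
    using gaussian_fourier[OF s, of "0 :: real^'d"] t by (simp add: mult_ac)
  then have "(\<integral>x. exp (- (1 / (4 * t)) * (norm (x :: real^'d))\<^sup>2) \<partial>lborel) = sqrt (4 * pi * t) ^ CARD('d)"
    using of_real_eq_iff by blast
  moreover have "(4 * pi * t) powr (- (real CARD('d) / 2)) * sqrt (4 * pi * t) ^ CARD('d) = 1"
    using t by (subst powr_minus_half_power) (auto simp: power_mult_distrib[symmetric])
  ultimately show "(\<integral>x. heat t (x :: real^'d) \<partial>lborel) = 1"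
    unfolding h by simp
qed

text \<open>The heat kernel is the Fourier transform of a Gaussian. It is used in this direction, from
  frequencies to space, to convert the power spectrum into averages of the correlation.\<close>

lemma heat_fourier:
  fixes x :: "real^'d"
  assumes t: "t > 0"
  shows "(\<integral>\<xi>. cis (- (\<xi> \<bullet> x)) * of_real (exp (- t * (norm \<xi>)\<^sup>2)) \<partial>lborel)
     = of_real ((2 * pi) ^ CARD('d) * heat t x)"
proof -
  have "(\<integral>\<xi>. cis (- (\<xi> \<bullet> x)) * of_real (exp (- t * (norm \<xi>)\<^sup>2)) \<partial>lborel)
      = of_real (sqrt (pi / t) ^ CARD('d) * exp (- (norm x)\<^sup>2 / (4 * t)))"
    using gaussian_fourier[OF t, of "- x"]
    by (simp only: inner_minus_left norm_minus_cancel inner_commute[of x] DIM_cart DIM_real mult_1_right)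
  also have "sqrt (pi / t) = 2 * pi * (1 / sqrt (4 * pi * t))"
  proof -
    have "sqrt (pi / t) * sqrt (4 * pi * t) = sqrt ((2 * pi)\<^sup>2)"
      unfolding real_sqrt_mult[symmetric] using t by (simp add: power2_eq_square)
    also have "\<dots> = 2 * pi" by (subst real_sqrt_abs) simp
    finally have "sqrt (pi / t) = 2 * pi / sqrt (4 * pi * t)"
      using t by (subst nonzero_eq_divide_eq) auto
    then show ?thesis by (simp only: times_divide_eq_right mult_1_right)
  qed
  also have "(2 * pi * (1 / sqrt (4 * pi * t))) ^ CARD('d) * exp (- (norm x)\<^sup>2 / (4 * t))
      = (2 * pi) ^ CARD('d) * heat t x"
  proof -
    have pos: "4 * pi * t > 0" using t by simp
    show ?thesis
      unfolding heat_def powr_minus_half_power[OF pos] power_mult_distrib[of "2 * pi" "1 / sqrt (4 * pi * t)"]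
      by (rule mult.assoc)
  qed
  finally show ?thesis .
qed

lemma heat_has_derivative:
  fixes x :: "real^'d"
  assumes t: "t > 0"
  shows "(heat t has_derivative (\<lambda>h. \<Sum>i\<in>UNIV. h $ i *\<^sub>R heat1 i t x)) (at x)"
proof -
  have q: "((\<lambda>x. - (norm x)\<^sup>2 / (4 * t)) has_derivative (\<lambda>h. - (x \<bullet> h) / (2 * t))) (at x)"
    unfolding power2_norm_eq_inner using t
    by (auto intro!: derivative_eq_intros simp: inner_commute field_simps)
  have "(heat t has_derivative (\<lambda>h. (4 * pi * t) powr (- (real CARD('d) / 2)) * (exp (- (norm x)\<^sup>2 / (4 * t)) * (- (x \<bullet> h) / (2 * t))))) (at x)"
    unfolding heat_def[abs_def]
    by (rule has_derivative_eq_rhs[OF has_derivative_mult_right[OF has_derivative_exp[OF q]]])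
      (simp add: mult.commute)
  then show ?thesis
    by (rule has_derivative_eq_rhs)
      (auto simp: inner_vec_def heat1_def heat_def sum_distrib_left sum_divide_distrib sum_negf[symmetric]
         mult_ac intro!: sum.cong)
qed

lemma heat1_has_derivative:
  fixes x :: "real^'d"
  assumes t: "t > 0"
  shows "(heat1 i t has_derivative (\<lambda>h. \<Sum>j\<in>UNIV. h $ j *\<^sub>R heat2 i j t x)) (at x)"
proof -
  have l: "((\<lambda>x. - (x $ i / (2 * t))) has_derivative (\<lambda>h. - (h $ i / (2 * t)))) (at x)"
    using t by (auto intro!: derivative_eq_intros bounded_linear.has_derivative[OF bounded_linear_vec_nth])
  have "(\<Sum>j\<in>UNIV. h $ j *\<^sub>R heat2 i j t x)
      = (\<Sum>j\<in>UNIV. - (x $ i / (2 * t)) * (h $ j *\<^sub>R heat1 j t x)) + (\<Sum>j\<in>UNIV. if i = j then - (h $ j / (2 * t)) * heat t x else 0)" for h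
    unfolding sum.distrib[symmetric]
    by (intro sum.cong) (auto simp: heat2_def heat1_def power2_eq_square algebra_simps)
  then have "(\<Sum>j\<in>UNIV. h $ j *\<^sub>R heat2 i j t x)
      = - (x $ i / (2 * t)) * (\<Sum>j\<in>UNIV. h $ j *\<^sub>R heat1 j t x) + - (h $ i / (2 * t)) * heat t x" for h
    unfolding sum_distrib_left by simp
  then show ?thesis
    unfolding heat1_def[abs_def]
    by (intro has_derivative_eq_rhs[OF has_derivative_mult[OF l heat_has_derivative[OF t]]])
      (auto simp: heat1_def)
qed

lemma heat_time_derivative:
  fixes x :: "real^'d"
  assumes t: "t > 0"
  shows "((\<lambda>t. heat t x) has_real_derivative (\<Sum>i\<in>UNIV. heat2 i i t x)) (at t)"
proof -
  let ?a = "- (real CARD('d) / 2)"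
  have p: "((\<lambda>t. (4 * pi * t) powr ?a) has_real_derivative ?a / t * (4 * pi * t) powr ?a) (at t)"
  proof (rule DERIV_cong[OF DERIV_chain2[OF has_real_derivative_powr]])
    show "((\<lambda>t. 4 * pi * t) has_real_derivative 4 * pi) (at t)" by (auto intro!: derivative_eq_intros)
    show "?a * (4 * pi * t) powr (?a - 1) * (4 * pi) = ?a / t * (4 * pi * t) powr ?a"
      using t unfolding powr_diff by simp
  qed (use t in simp)
  have e: "((\<lambda>t. exp (- (norm x)\<^sup>2 / (4 * t))) has_real_derivative
      (norm x)\<^sup>2 / (4 * t\<^sup>2) * exp (- (norm x)\<^sup>2 / (4 * t))) (at t)"
    using t by (auto intro!: derivative_eq_intros simp: field_simps power2_eq_square)
  have "(\<Sum>i\<in>UNIV. heat2 i i t x) = ((norm x)\<^sup>2 / (4 * t\<^sup>2) + ?a / t) * heat t x"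
  proof -
    have "(\<Sum>i\<in>UNIV. heat2 i i t x) = (\<Sum>i\<in>(UNIV::'d set). (x $ i * x $ i / (4 * t\<^sup>2) - 1 / (2 * t)) * heat t x)"
      by (simp add: heat2_def)
    also have "\<dots> = ((\<Sum>i\<in>UNIV. x $ i * x $ i) / (4 * t\<^sup>2) - real CARD('d) * (1 / (2 * t))) * heat t x"
      by (simp add: sum_distrib_right[symmetric] sum_subtractf sum_divide_distrib)
    also have "(\<Sum>i\<in>UNIV. x $ i * x $ i) = (norm x)\<^sup>2"
      by (simp add: power2_norm_eq_inner inner_vec_def)
    finally show ?thesis by simp
  qed
  then show ?thesis
    unfolding heat_def[abs_def]
    by (intro DERIV_cong[OF DERIV_mult[OF p e]]) (simp add: heat_def algebra_simps)
qed

section \<open>Differentiation under the integral sign\<close>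

lemma has_derivative_integral_param:
  fixes F :: "real^'d \<Rightarrow> 'n \<Rightarrow> real"
  assumes der: "\<And>x n. n \<in> space N \<Longrightarrow>
      ((\<lambda>x. F x n) has_derivative (\<lambda>h. \<Sum>i\<in>UNIV. h $ i *\<^sub>R F' i x n)) (at x)"
    and dom: "\<And>i x n. norm (x - x0) \<le> 1 \<Longrightarrow> n \<in> space N \<Longrightarrow> \<bar>F' i x n\<bar> \<le> D n"
    and D: "integrable N D" and F': "\<And>i. F' i x0 \<in> borel_measurable N" and F: "\<And>x. integrable N (F x)"
  shows "((\<lambda>x. \<integral>n. F x n \<partial>N) has_derivative (\<lambda>h. \<Sum>i\<in>UNIV. h $ i *\<^sub>R (\<integral>n. F' i x0 n \<partial>N))) (at x0)"
proof -
  have F'i: "integrable N (F' i x0)" for i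
    by (rule Bochner_Integration.integrable_bound[OF D F'])
      (use dom[of x0] in \<open>force intro: order_trans\<close>)
  define q where "q h n = F (x0 + h) n - F x0 n - (\<Sum>i\<in>UNIV. h $ i *\<^sub>R F' i x0 n)" for h n
  have qi: "integrable N (q h)" for h
    unfolding q_def using F F'i by (intro Bochner_Integration.integrable_diff Bochner_Integration.integrable_sum integrable_scaleR_right) auto
  let ?C = "2 * real CARD('d)"
  have comb: "norm (\<Sum>i\<in>UNIV. h $ i *\<^sub>R F' i x n) \<le> real CARD('d) * D n * norm h"
    if "norm (x - x0) \<le> 1" "n \<in> space N" for h x n
  proof -
    have "norm (\<Sum>i\<in>UNIV. h $ i *\<^sub>R F' i x n) \<le> (\<Sum>i\<in>(UNIV::'d set). norm h * D n)"
      using dom[OF that] by (intro sum_norm_le) (auto intro!: mult_mono component_le_norm_cart simp: abs_mult)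
    then show ?thesis by (simp add: mult_ac)
  qed
  have q: "\<bar>q h n\<bar> \<le> ?C * D n * norm h" if "norm h \<le> 1" "n \<in> space N" for h n
  proof -
    have "norm (F (x0 + h) n - F x0 n) \<le> real CARD('d) * D n * norm ((x0 + h) - x0)"
    proof (rule differentiable_bound[of "cball x0 1" "\<lambda>x. F x n"])
      fix x assume x: "x \<in> cball x0 1"
      show "((\<lambda>x. F x n) has_derivative (\<lambda>h. \<Sum>i\<in>UNIV. h $ i *\<^sub>R F' i x n)) (at x within cball x0 1)"
        by (rule has_derivative_at_withinI[OF der[OF that(2)]])
      show "onorm (\<lambda>h. \<Sum>i\<in>UNIV. h $ i *\<^sub>R F' i x n) \<le> real CARD('d) * D n"
        using x by (intro onorm_le comb that) (simp add: dist_norm norm_minus_commute)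
    qed (use that in \<open>auto simp: dist_norm\<close>)
    moreover have "norm (\<Sum>i\<in>UNIV. h $ i *\<^sub>R F' i x0 n) \<le> real CARD('d) * D n * norm h"
      using that by (intro comb) auto
    ultimately show ?thesis
      using norm_triangle_ineq4[of "F (x0 + h) n - F x0 n" "\<Sum>i\<in>UNIV. h $ i *\<^sub>R F' i x0 n"]
      by (simp add: q_def)
  qed
  have q0: "((\<lambda>h. q h n / norm h) \<longlongrightarrow> 0) (at 0)" if "n \<in> space N" for n
  proof -
    have "((\<lambda>h. norm (q h n) / norm h) \<longlongrightarrow> 0) (at 0)"
      using der[OF that, of x0] unfolding has_derivative_at q_def by simp
    then have "((\<lambda>h. norm (q h n / norm h)) \<longlongrightarrow> 0) (at 0)" by simp
    then show ?thesis by (rule tendsto_norm_zero_cancel)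
  qed
  have "((\<lambda>h. (\<integral>n. q h n / norm h \<partial>N)) \<longlongrightarrow> 0) (at 0)"
    unfolding tendsto_at_iff_sequentially
  proof (intro allI impI, unfold comp_def)
    fix X :: "nat \<Rightarrow> real^'d" assume X: "\<forall>i. X i \<in> UNIV - {0}" "X \<longlonglongrightarrow> 0"
    obtain k where k: "\<And>n. n \<ge> k \<Longrightarrow> norm (X n) < 1"
      using LIMSEQ_D[OF X(2), of 1] by auto
    have "(\<lambda>m. \<integral>n. q (X (m + k)) n / norm (X (m + k)) \<partial>N) \<longlonglongrightarrow> (\<integral>n. 0 \<partial>N)"
    proof (rule integral_dominated_convergence[where w = "\<lambda>n. ?C * D n"])
      have "filterlim X (at 0) sequentially" using X by (simp add: filterlim_at)
      then have "filterlim (\<lambda>m. X (m + k)) (at 0) sequentially"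
        by (rule filterlim_compose[OF _ filterlim_add_const_nat_at_top])
      then show "AE n in N. (\<lambda>m. q (X (m + k)) n / norm (X (m + k))) \<longlonglongrightarrow> 0"
        using filterlim_compose[OF q0] by auto
      show "AE n in N. norm (q (X (m + k)) n / norm (X (m + k))) \<le> ?C * D n" for m
      proof (rule AE_I2)
        fix n assume n: "n \<in> space N"
        have pos: "norm (X (m + k)) > 0" using X by auto
        then show "norm (q (X (m + k)) n / norm (X (m + k))) \<le> ?C * D n"
          using q[OF less_imp_le[OF k[of "m + k"]] n] by (simp add: divide_le_eq)
      qed
    qed (use D qi in auto)
    then show "(\<lambda>m. \<integral>n. q (X m) n / norm (X m) \<partial>N) \<longlonglongrightarrow> 0"
      unfolding Bochner_Integration.integral_zero
      by (rule LIMSEQ_offset[where f = "\<lambda>m. \<integral>n. q (X m) n / norm (X m) \<partial>N" and k = k])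
  qed
  moreover have "norm (\<integral>n. q h n / norm h \<partial>N)
      = norm ((\<integral>n. F (x0 + h) n \<partial>N) - (\<integral>n. F x0 n \<partial>N) - (\<Sum>i\<in>UNIV. h $ i *\<^sub>R (\<integral>n. F' i x0 n \<partial>N))) / norm h" for h
  proof -
    have s: "integrable N (\<lambda>n. \<Sum>i\<in>UNIV. h $ i *\<^sub>R F' i x0 n)"
      by (intro Bochner_Integration.integrable_sum integrable_scaleR_right F'i)
    have "(\<integral>n. (\<Sum>i\<in>UNIV. h $ i *\<^sub>R F' i x0 n) \<partial>N) = (\<Sum>i\<in>UNIV. h $ i *\<^sub>R (\<integral>n. F' i x0 n \<partial>N))"
      using F'i by (subst Bochner_Integration.integral_sum) auto
    then have "(\<integral>n. q h n \<partial>N) = (\<integral>n. F (x0 + h) n \<partial>N) - (\<integral>n. F x0 n \<partial>N) - (\<Sum>i\<in>UNIV. h $ i *\<^sub>R (\<integral>n. F' i x0 n \<partial>N))"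
      unfolding q_def
      by (simp only: Bochner_Integration.integral_diff[OF Bochner_Integration.integrable_diff[OF F F] s]
          Bochner_Integration.integral_diff[OF F F])
    then show ?thesis by (simp only: Bochner_Integration.integral_divide_zero real_norm_def abs_divide abs_norm_cancel)
  qed
  ultimately have "((\<lambda>h. norm ((\<integral>n. F (x0 + h) n \<partial>N) - (\<integral>n. F x0 n \<partial>N) - (\<Sum>i\<in>UNIV. h $ i *\<^sub>R (\<integral>n. F' i x0 n \<partial>N))) / norm h) \<longlongrightarrow> 0) (at 0)"
    using tendsto_norm_zero[of "\<lambda>h. \<integral>n. q h n / norm h \<partial>N"] by (simp only:)
  moreover have "bounded_linear (\<lambda>h::real^'d. \<Sum>i\<in>UNIV. h $ i *\<^sub>R (\<integral>n. F' i x0 n \<partial>N))"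
    by (intro bounded_linear_sum bounded_linear_compose[OF bounded_linear_scaleR_left bounded_linear_vec_nth])
  ultimately show ?thesis unfolding has_derivative_at by blast
qed

text \<open>The bound by a single integrable function on unit balls is what differentiation under the integral
  needs for the convolution of \<open>K\<close> with a bounded function.\<close>

definition C1_kernel :: "(real^'d \<Rightarrow> real) \<Rightarrow> ('d \<Rightarrow> real^'d \<Rightarrow> real) \<Rightarrow> (real^'d \<Rightarrow> real) \<Rightarrow> bool" where
  "C1_kernel K P D \<longleftrightarrow>
     (\<forall>x. (K has_derivative (\<lambda>h. \<Sum>i\<in>UNIV. h $ i *\<^sub>R P i x)) (at x)) \<and> integrable lborel K \<and>
     (\<forall>i. P i \<in> borel_measurable borel) \<and> integrable lborel D \<and>
     (\<forall>x h i. norm h \<le> 1 \<longrightarrow> \<bar>P i (x + h)\<bar> \<le> D x)"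

lemma C1_kernel_partial_integrable:
  assumes "C1_kernel K P D"
  shows "integrable lborel (P i)"
proof (rule Bochner_Integration.integrable_bound)
  show "integrable lborel D" "P i \<in> borel_measurable lborel" using assms by (auto simp: C1_kernel_def)
  have "\<bar>P i x\<bar> \<le> D x" for x using assms unfolding C1_kernel_def by (metis add.right_neutral norm_zero zero_le_one)
  then show "AE x in lborel. norm (P i x) \<le> norm (D x)" by (auto intro: order_trans[OF _ abs_ge_self])
qed

lemma integrable_mult_bounded:
  fixes f g :: "'a \<Rightarrow> real"
  assumes f: "integrable N f" and [measurable]: "g \<in> borel_measurable N"
    and B: "\<And>x. x \<in> space N \<Longrightarrow> \<bar>g x\<bar> \<le> B"
  shows "integrable N (\<lambda>x. f x * g x)"
proof (rule Bochner_Integration.integrable_bound)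
  show "integrable N (\<lambda>x. \<bar>B\<bar> * \<bar>f x\<bar>)" using f by auto
  show "AE x in N. norm (f x * g x) \<le> norm (\<bar>B\<bar> * \<bar>f x\<bar>)"
  proof (rule AE_I2)
    fix x assume "x \<in> space N"
    then have "\<bar>f x\<bar> * \<bar>g x\<bar> \<le> \<bar>f x\<bar> * \<bar>B\<bar>" using B by (intro mult_left_mono) force+
    then show "norm (f x * g x) \<le> norm (\<bar>B\<bar> * \<bar>f x\<bar>)" by (simp add: abs_mult mult.commute)
  qed
qed (use f in measurable)

lemma convolution_has_derivative:
  fixes W :: "real^'d \<Rightarrow> real"
  assumes K: "C1_kernel K P D" and W [measurable]: "W \<in> borel_measurable borel" and B: "\<And>y. \<bar>W y\<bar> \<le> B"
  shows "((\<lambda>x. \<integral>y. K y * W (x - y) \<partial>lborel) has_derivative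
      (\<lambda>h. \<Sum>i\<in>UNIV. h $ i *\<^sub>R (\<integral>y. P i y * W (x - y) \<partial>lborel))) (at x)"
proof -
  have [measurable]: "K \<in> borel_measurable borel" "P i \<in> borel_measurable borel" "D \<in> borel_measurable borel" for i
    using K by (auto simp: C1_kernel_def)
  have Kd: "norm h \<le> 1 \<Longrightarrow> \<bar>P i (x + h)\<bar> \<le> D x" for i x h using K by (simp add: C1_kernel_def)
  have r: "(\<integral>y. f y * W (x - y) \<partial>lborel) = (\<integral>y. f (x - y) * W y \<partial>lborel)"
    if [measurable]: "f \<in> borel_measurable borel" for f x
    using lborel_integral_reflect[of "\<lambda>y. f y * W (x - y)" x] by simp
  have "((\<lambda>x. \<integral>y. K (x - y) * W y \<partial>lborel) has_derivative
      (\<lambda>h. \<Sum>i\<in>UNIV. h $ i *\<^sub>R (\<integral>y. P i (x - y) * W y \<partial>lborel))) (at x)"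
  proof (rule has_derivative_integral_param[where D = "\<lambda>y. B * D (x - y)"])
    fix x y :: "real^'d"
    have "((\<lambda>x. x - y) has_derivative (\<lambda>h. h)) (at x)" by (auto intro!: derivative_eq_intros)
    then have "((\<lambda>x. K (x - y)) has_derivative (\<lambda>h. \<Sum>i\<in>UNIV. h $ i *\<^sub>R P i (x - y))) (at x)"
      using has_derivative_compose[of "\<lambda>x. x - y" "\<lambda>h. h" x UNIV K "\<lambda>h. \<Sum>i\<in>UNIV. h $ i *\<^sub>R P i (x - y)"] K
      by (auto simp: C1_kernel_def)
    from has_derivative_mult_left[OF this, of "W y"]
    show "((\<lambda>x. K (x - y) * W y) has_derivative (\<lambda>h. \<Sum>i\<in>UNIV. h $ i *\<^sub>R (P i (x - y) * W y))) (at x)"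
      by (simp add: sum_distrib_right mult.assoc)
  next
    fix i z y assume "norm (z - x) \<le> 1"
    then have P: "\<bar>P i ((x - y) + (z - x))\<bar> \<le> D (x - y)" by (rule Kd)
    then have D0: "0 \<le> D (x - y)" using abs_ge_zero order_trans by blast
    have "\<bar>P i (z - y)\<bar> * \<bar>W y\<bar> \<le> D (x - y) * B"
      using P B[of y] D0 by (intro mult_mono) auto
    then show "\<bar>P i (z - y) * W y\<bar> \<le> B * D (x - y)"
      by (simp only: abs_mult mult.commute)
  next
    show "integrable lborel (\<lambda>y. B * D (x - y))"
      using K lborel_integrable_reflect[of D x] by (auto simp: C1_kernel_def)
    show "integrable lborel (\<lambda>y. K (x - y) * W y)" for x
      using K lborel_integrable_reflect[of K x] B
      by (intro integrable_mult_bounded[where B = B]) (auto simp: C1_kernel_def)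
  qed measurable
  then show ?thesis by (simp add: r)
qed

section \<open>The truncated Green kernel\<close>

text \<open>As \<open>a\<close> tends to \<open>0\<close> and \<open>b\<close> to infinity, this tends to the fundamental solution of the negative
  Laplacian. The truncation makes it smooth and integrable.\<close>

definition green :: "real \<Rightarrow> real \<Rightarrow> real^'d \<Rightarrow> real" where
  "green a b x = (\<integral>t. indicator {a..b} t * heat t x \<partial>lborel)"

definition green1 :: "real \<Rightarrow> real \<Rightarrow> 'd \<Rightarrow> real^'d \<Rightarrow> real" where
  "green1 a b i x = (\<integral>t. indicator {a..b} t * heat1 i t x \<partial>lborel)"

definition green2 :: "real \<Rightarrow> real \<Rightarrow> 'd \<Rightarrow> 'd \<Rightarrow> real^'d \<Rightarrow> real" where
  "green2 a b i j x = (\<integral>t. indicator {a..b} t * heat2 i j t x \<partial>lborel)"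

lemma green_measurable [measurable]:
  "green a b \<in> borel_measurable borel" "green1 a b i \<in> borel_measurable borel"
  "green2 a b i j \<in> borel_measurable borel"
  unfolding green_def green1_def green2_def by measurable

text \<open>For times in a compact interval, the polynomial prefactors and the shift by \<open>h\<close> cost only a part
  of the Gaussian exponent: \<open>1 / (4 b)\<close> becomes \<open>1 / (8 b)\<close> and then \<open>1 / (16 b)\<close>.\<close>

lemma heat_derivatives_dominated:
  assumes a: "0 < a"
  obtains C where "C \<ge> 0"
    "\<And>t (x::real^'d) h i j. t \<in> {a..b} \<Longrightarrow> norm h \<le> 1 \<Longrightarrow>
      \<bar>heat t (x + h)\<bar> \<le> C * exp (- (1 / (16 * b)) * (norm x)\<^sup>2) \<and>
      \<bar>heat1 i t (x + h)\<bar> \<le> C * exp (- (1 / (16 * b)) * (norm x)\<^sup>2) \<and>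
      \<bar>heat2 i j t (x + h)\<bar> \<le> C * exp (- (1 / (16 * b)) * (norm x)\<^sup>2)"
proof (cases "a \<le> b")
  case False
  then show ?thesis using that[of 0] by auto
next
  case True
  define A where "A = (4 * pi * a) powr (- (real CARD('d) / 2))"
  define Q where "Q = 1 + 1 / (2 * a) + 1 / (4 * a\<^sup>2)"
  define C where "C = Q * (A * ((1 + 8 * b) * exp (1 / (8 * b))))"
  have b: "b > 0" using True a by simp
  have A: "A \<ge> 0" and Q: "Q \<ge> 1" and C: "C \<ge> 0" using a b by (auto simp: A_def Q_def C_def)
  have main: "\<bar>k * heat t (x + h)\<bar> \<le> C * exp (- (1 / (16 * b)) * (norm x)\<^sup>2)"
    if t: "t \<in> {a..b}" and h: "norm h \<le> 1" and k: "\<bar>k\<bar> \<le> Q * (1 + (norm (x + h))\<^sup>2)"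
    for t k and x h :: "real^'d"
  proof -
    let ?r = "(norm (x + h))\<^sup>2"
    have t0: "t > 0" using t a by auto
    have "(4 * pi * t) powr (- (real CARD('d) / 2)) \<le> A"
      unfolding A_def using t a by (intro powr_mono2') auto
    moreover have "- ?r / (4 * t) \<le> - ?r / (4 * b)"
      using t t0 b by (simp add: divide_left_mono)
    ultimately have "heat t (x + h) \<le> A * exp (- ?r / (4 * b))"
      unfolding heat_def by (intro mult_mono) (auto simp: A)
    then have "\<bar>k * heat t (x + h)\<bar> \<le> (Q * (1 + ?r)) * (A * exp (- ?r / (4 * b)))"
      unfolding abs_mult using k heat_nonneg[of t "x + h"] Q by (intro mult_mono) auto
    also have "\<dots> \<le> (Q * ((1 + 8 * b) * exp (?r / (8 * b)))) * (A * exp (- ?r / (4 * b)))"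
    proof -
      have "1 + ?r / (8 * b) \<le> exp (?r / (8 * b))" by (rule exp_ge_add_one_self)
      then have "8 * b * (1 + ?r / (8 * b)) \<le> 8 * b * exp (?r / (8 * b))"
        using b by (intro mult_left_mono) auto
      moreover have "8 * b * (1 + ?r / (8 * b)) = 8 * b + ?r" using b by (simp add: distrib_left)
      moreover have "1 \<le> exp (?r / (8 * b))" using b by simp
      ultimately have "1 + ?r \<le> exp (?r / (8 * b)) + 8 * b * exp (?r / (8 * b))" using b by linarith
      then have "1 + ?r \<le> (1 + 8 * b) * exp (?r / (8 * b))" by (simp add: distrib_right)
      then show ?thesis using Q A by (intro mult_right_mono mult_left_mono) auto
    qed
    also have "\<dots> = Q * (A * ((1 + 8 * b) * (exp (?r / (8 * b)) * exp (- ?r / (4 * b)))))"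
      by simp
    also have "exp (?r / (8 * b)) * exp (- ?r / (4 * b)) = exp (- ?r / (8 * b))"
      using b by (simp add: exp_add[symmetric] field_simps)
    also have "exp (- ?r / (8 * b)) \<le> exp (1 / (8 * b)) * exp (- (1 / (16 * b)) * (norm x)\<^sup>2)"
    proof -
      have "norm x \<le> norm (x + h) + norm h" using norm_triangle_ineq4[of "x + h" h] by simp
      then have "(norm x)\<^sup>2 \<le> (norm (x + h) + norm h)\<^sup>2" by (intro power_mono) auto
      also have "\<dots> \<le> 2 * ?r + 2 * (norm h)\<^sup>2" by (rule square_sum_le)
      also have "(norm h)\<^sup>2 \<le> 1" using h by (simp add: power_le_one)
      finally have "- ?r / (8 * b) \<le> (1 - (norm x)\<^sup>2 / 2) / (8 * b)"
        using b by (intro divide_right_mono) auto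
      also have "\<dots> = 1 / (8 * b) + - (1 / (16 * b)) * (norm x)\<^sup>2" using b by (simp add: field_simps)
      finally show ?thesis by (simp only: exp_add[symmetric] exp_le_cancel_iff)
    qed
    finally show ?thesis using Q A b unfolding C_def
      by (simp add: mult_left_mono mult.assoc)
  qed
  show ?thesis
  proof (rule that[OF C])
    fix t and x h :: "real^'d" and i j
    assume t: "t \<in> {a..b}" and h: "norm h \<le> 1"
    let ?z = "x + h"
    have t0: "t > 0" "a \<le> t" using t a by auto
    have zi: "\<bar>?z $ l\<bar> \<le> norm ?z" for l by (rule component_le_norm_cart)
    have z1: "norm ?z \<le> 1 + (norm ?z)\<^sup>2"
      using sum_squares_bound[of "norm ?z" 1] by (simp add: power2_eq_square) (smt (verit) zero_le_mult_iff)
    have inv: "1 / (2 * t) \<le> 1 / (2 * a)" "1 / (4 * t\<^sup>2) \<le> 1 / (4 * a\<^sup>2)"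
      using t0 a by (auto intro!: divide_left_mono mult_mono power_mono)
    have 1: "\<bar>1\<bar> \<le> Q * (1 + (norm ?z)\<^sup>2)"
      using mult_mono[of 1 Q 1 "1 + (norm ?z)\<^sup>2"] Q by simp
    have "\<bar>- (?z $ i / (2 * t))\<bar> = \<bar>?z $ i\<bar> * (1 / (2 * t))" using t0 by (simp add: abs_mult)
    also have "\<dots> \<le> (1 + (norm ?z)\<^sup>2) * (1 / (2 * a))"
      using order_trans[OF zi z1] inv t0 by (intro mult_mono) auto
    also have "\<dots> \<le> (1 + (norm ?z)\<^sup>2) * Q"
      using a by (intro mult_left_mono) (auto simp: Q_def)
    finally have 2: "\<bar>- (?z $ i / (2 * t))\<bar> \<le> Q * (1 + (norm ?z)\<^sup>2)" by (simp add: mult.commute)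
    have "\<bar>?z $ i * ?z $ j / (4 * t\<^sup>2) - (if i = j then 1 / (2 * t) else 0)\<bar>
        \<le> \<bar>?z $ i * ?z $ j / (4 * t\<^sup>2)\<bar> + \<bar>if i = j then 1 / (2 * t) else 0\<bar>" by (rule abs_triangle_ineq4)
    also have "\<bar>?z $ i * ?z $ j / (4 * t\<^sup>2)\<bar> = (\<bar>?z $ i\<bar> * \<bar>?z $ j\<bar>) * (1 / (4 * t\<^sup>2))"
      by (simp add: abs_mult)
    also have "\<dots> \<le> (norm ?z * norm ?z) * (1 / (4 * a\<^sup>2))"
      using zi inv by (intro mult_mono) auto
    also have "\<bar>if i = j then 1 / (2 * t) else 0\<bar> \<le> 1 / (2 * a)" using inv t0 a by simp
    also have "norm ?z * norm ?z * (1 / (4 * a\<^sup>2)) + 1 / (2 * a) \<le> (1 + (norm ?z)\<^sup>2) * Q"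
      using a by (simp add: Q_def algebra_simps power2_eq_square)
    finally have 3: "\<bar>?z $ i * ?z $ j / (4 * t\<^sup>2) - (if i = j then 1 / (2 * t) else 0)\<bar> \<le> Q * (1 + (norm ?z)\<^sup>2)"
      by (simp add: mult.commute)
    show "\<bar>heat t ?z\<bar> \<le> C * exp (- (1 / (16 * b)) * (norm x)\<^sup>2) \<and>
      \<bar>heat1 i t ?z\<bar> \<le> C * exp (- (1 / (16 * b)) * (norm x)\<^sup>2) \<and>
      \<bar>heat2 i j t ?z\<bar> \<le> C * exp (- (1 / (16 * b)) * (norm x)\<^sup>2)"
      using main[OF t h 1] main[OF t h 2] main[OF t h 3] by (simp add: heat1_def heat2_def)
  qed
qed

lemma
  assumes a: "0 < a" and b: "a \<le> b"
  shows green_C1_kernel: "\<exists>D. C1_kernel (green a b :: real^'d \<Rightarrow> real) (green1 a b) D"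
    and green1_C1_kernel: "\<exists>D. C1_kernel (green1 a b i :: real^'d \<Rightarrow> real) (green2 a b i) D"
proof -
  obtain C where C: "C \<ge> 0" and bd: "\<And>t (x::real^'d) h i j. t \<in> {a..b} \<Longrightarrow> norm h \<le> 1 \<Longrightarrow>
      \<bar>heat t (x + h)\<bar> \<le> C * exp (- (1 / (16 * b)) * (norm x)\<^sup>2) \<and>
      \<bar>heat1 i t (x + h)\<bar> \<le> C * exp (- (1 / (16 * b)) * (norm x)\<^sup>2) \<and>
      \<bar>heat2 i j t (x + h)\<bar> \<le> C * exp (- (1 / (16 * b)) * (norm x)\<^sup>2)"
    using heat_derivatives_dominated[OF a] by metis
  define E where "E x = C * exp (- (1 / (16 * b)) * (norm x)\<^sup>2)" for x :: "real^'d"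
  have EC: "E x \<le> C" for x using C a b mult_left_mono[of "exp (- (1 / (16 * b)) * (norm x)\<^sup>2)" 1 C]
    by (simp add: E_def)
  have E0: "E x \<ge> 0" for x using C by (simp add: E_def)
  have s: "1 / (16 * b) > 0" using a b by simp
  have Ei: "integrable lborel E" unfolding E_def by (intro integrable_mult_right gaussian_integrable s)
  have ind: "integrable lborel (\<lambda>t. indicator {a..b} t * c :: real)" for c
    by (intro integrable_mult_left integrable_real_indicator) (auto simp: emeasure_lborel_Icc_eq)
  have tint: "integrable lborel (\<lambda>t. indicator {a..b} t * f t)"
    and tbd: "\<bar>\<integral>t. indicator {a..b} t * f t \<partial>lborel\<bar> \<le> (b - a) * c"
    if [measurable]: "f \<in> borel_measurable borel" and f: "\<And>t. t \<in> {a..b} \<Longrightarrow> \<bar>f t\<bar> \<le> c"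
    for f :: "real \<Rightarrow> real" and c
  proof -
    show i: "integrable lborel (\<lambda>t. indicator {a..b} t * f t)"
      by (rule Bochner_Integration.integrable_bound[OF ind[of c]])
        (use f in \<open>auto simp: indicator_def intro: order_trans[OF _ abs_ge_self]\<close>)
    have "\<bar>\<integral>t. indicator {a..b} t * f t \<partial>lborel\<bar> \<le> (\<integral>t. indicator {a..b} t * c \<partial>lborel)"
    proof -
      have "\<bar>\<integral>t. indicator {a..b} t * f t \<partial>lborel\<bar> \<le> (\<integral>t. \<bar>indicator {a..b} t * f t\<bar> \<partial>lborel)"
        using integral_norm_bound[of lborel "\<lambda>t. indicator {a..b} t * f t"] by simp
      also have "\<dots> \<le> (\<integral>t. indicator {a..b} t * c \<partial>lborel)"
        by (rule integral_mono[OF integrable_abs[OF i] ind]) (use f in \<open>auto simp: indicator_def\<close>)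
      finally show ?thesis .
    qed
    also have "\<dots> = (b - a) * c" using b by simp
    finally show "\<bar>\<integral>t. indicator {a..b} t * f t \<partial>lborel\<bar> \<le> (b - a) * c" .
  qed
  have Di: "integrable lborel (\<lambda>x. (b - a) * E x)" using Ei by simp
  have bnd: "\<bar>green a b (x + h)\<bar> \<le> (b - a) * E x" "\<bar>green1 a b i (x + h)\<bar> \<le> (b - a) * E x"
    "\<bar>green2 a b i j (x + h)\<bar> \<le> (b - a) * E x" if "norm h \<le> 1" for x h i j
    unfolding green_def green1_def green2_def using bd[OF _ that, folded E_def] by (auto intro!: tbd)
  have gi: "integrable lborel (green a b :: real^'d \<Rightarrow> real)" "integrable lborel (green1 a b i :: real^'d \<Rightarrow> real)" for i
    by (rule Bochner_Integration.integrable_bound[OF Di],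
      use bnd[of 0] E0 b in \<open>auto\<close>)+
  have ti: "integrable lborel (\<lambda>t. indicator {a..b} t * heat t x)"
      "integrable lborel (\<lambda>t. indicator {a..b} t * heat1 i t x)" for x :: "real^'d" and i
    using bd[of _ 0 x, folded E_def] by (auto intro!: tint[where c = "E x"])
  have d1: "(green a b has_derivative (\<lambda>h. \<Sum>i\<in>UNIV. h $ i *\<^sub>R green1 a b i x)) (at x)" for x :: "real^'d"
    unfolding green_def green1_def
  proof (rule has_derivative_integral_param[where D = "\<lambda>t. indicator {a..b} t * C"])
    show "((\<lambda>x. indicator {a..b} t * heat t x) has_derivative (\<lambda>h. \<Sum>i\<in>UNIV. h $ i *\<^sub>R (indicator {a..b} t * heat1 i t x))) (at x)"
      for t and x :: "real^'d"
    proof (cases "t \<in> {a..b}")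
      case True
      then have "t > 0" using a by auto
      then show ?thesis using True heat_has_derivative[of t x] by simp
    qed simp
    show "\<bar>indicator {a..b} t * heat1 i t z\<bar> \<le> indicator {a..b} t * C" for t i and z :: "real^'d"
      using bd[of t 0 z, folded E_def] EC[of z] by (auto simp: indicator_def intro: order_trans)
  qed (use ind ti in auto)
  have d2: "(green1 a b i has_derivative (\<lambda>h. \<Sum>j\<in>UNIV. h $ j *\<^sub>R green2 a b i j x)) (at x)" for x :: "real^'d"
    unfolding green1_def green2_def
  proof (rule has_derivative_integral_param[where D = "\<lambda>t. indicator {a..b} t * C"])
    show "((\<lambda>x. indicator {a..b} t * heat1 i t x) has_derivative (\<lambda>h. \<Sum>j\<in>UNIV. h $ j *\<^sub>R (indicator {a..b} t * heat2 i j t x))) (at x)"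
      for t and x :: "real^'d"
    proof (cases "t \<in> {a..b}")
      case True
      then have "t > 0" using a by auto
      then show ?thesis using True heat1_has_derivative[of t i x] by simp
    qed simp
    show "\<bar>indicator {a..b} t * heat2 i j t z\<bar> \<le> indicator {a..b} t * C" for t j and z :: "real^'d"
      using bd[of t 0 z, folded E_def] EC[of z] by (auto simp: indicator_def intro: order_trans)
  qed (use ind ti in auto)
  show "\<exists>D. C1_kernel (green a b :: real^'d \<Rightarrow> real) (green1 a b) D"
    unfolding C1_kernel_def using d1 gi(1) Di bnd(2) by (intro exI[of _ "\<lambda>x. (b - a) * E x"]) auto
  show "\<exists>D. C1_kernel (green1 a b i :: real^'d \<Rightarrow> real) (green2 a b i) D"
    unfolding C1_kernel_def using d2 gi(2) Di bnd(3) by (intro exI[of _ "\<lambda>x. (b - a) * E x"]) auto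
qed

lemma heat2_isCont:
  fixes x :: "real^'d"
  assumes t: "t > 0"
  shows "isCont (\<lambda>t. heat2 i j t x) t"
proof -
  have "4 * pi * t \<noteq> 0" "4 * t \<noteq> 0" "4 * t\<^sup>2 \<noteq> 0" "2 * t \<noteq> 0" using t by auto
  then show ?thesis
    unfolding heat2_def heat_def
    by (cases "i = j") (simp_all only: if_True if_False, (intro continuous_intros; simp)+)
qed

text \<open>By the heat equation the integrand is the time derivative of the heat kernel.\<close>

lemma green_laplacian:
  fixes x :: "real^'d"
  assumes a: "0 < a" and b: "a \<le> b"
  shows "(\<Sum>i\<in>UNIV. green2 a b i i x) = heat b x - heat a x"
proof -
  have pos: "t > 0" if "t \<in> {a..b}" for t using that a by auto
  have c: "continuous_on {a..b} (\<lambda>t. heat2 i i t x)" for i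
    by (intro continuous_at_imp_continuous_on ballI heat2_isCont pos)
  have int: "integrable lborel (\<lambda>t. indicator {a..b} t * heat2 i i t x)" for i
    using borel_integrable_atLeastAtMost'[OF c] by (simp add: set_integrable_def)
  have "(\<Sum>i\<in>UNIV. green2 a b i i x) = (\<integral>t. (\<Sum>i\<in>UNIV. heat2 i i t x) * indicator {a..b} t \<partial>lborel)"
  proof -
    have "(\<Sum>i\<in>UNIV. green2 a b i i x) = (\<integral>t. (\<Sum>i\<in>UNIV. indicator {a..b} t * heat2 i i t x) \<partial>lborel)"
      unfolding green2_def by (rule Bochner_Integration.integral_sum[symmetric]) (rule int)
    also have "\<dots> = (\<integral>t. (\<Sum>i\<in>UNIV. heat2 i i t x) * indicator {a..b} t \<partial>lborel)"
      by (simp only: sum_distrib_left[symmetric] mult.commute)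
    finally show ?thesis .
  qed
  also have "\<dots> = heat b x - heat a x"
  proof (rule integral_FTC_Icc_real[OF b])
    show "DERIV (\<lambda>t. heat t x) t :> (\<Sum>i\<in>UNIV. heat2 i i t x)" if "a \<le> t" "t \<le> b" for t
      using that a by (intro heat_time_derivative) auto
    show "isCont (\<lambda>t. \<Sum>i\<in>UNIV. heat2 i i t x) t" if "a \<le> t" "t \<le> b" for t
      using that a by (intro continuous_intros heat2_isCont) auto
  qed
  finally show ?thesis .
qed

section \<open>Size of the Green kernel\<close>

text \<open>The growth in \<open>T\<close> of the squared \<open>L\<^sup>2\<close> norm of the Green function, truncated to times between
  \<open>1\<close> and \<open>T\<close>.\<close>

definition growth :: "nat \<Rightarrow> real \<Rightarrow> real" where
  "growth d T = (if d = 3 then sqrt T else if d = 4 then 1 + ln T else 1)"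

text \<open>The heat kernel decays in time with exponent \<open>d / 2\<close>. Beyond \<open>d = 5\<close> a faster decay gains nothing,
  and capping the exponent leaves three cases to integrate.\<close>

definition decay :: "nat \<Rightarrow> real" where
  "decay d = (if d = 3 then 3 / 2 else if d = 4 then 2 else 5 / 2)"

lemma growth_ge_1: "T \<ge> 1 \<Longrightarrow> growth d T \<ge> 1"
  by (auto simp: growth_def)

lemma heat_decay:
  fixes x :: "real^'d"
  assumes "CARD('d) \<ge> 3" "t \<ge> 1"
  shows "heat t x \<le> t powr (- decay CARD('d))"
proof -
  have "heat t x \<le> t powr (- (real CARD('d) / 2))" using assms by (intro heat_le) auto
  also have "\<dots> \<le> t powr (- decay CARD('d))"
    using assms by (intro powr_mono) (auto simp: decay_def)
  finally show ?thesis .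
qed

lemma nn_integral_powr:
  assumes x: "0 < x" "x \<le> y" and p: "p \<noteq> 0"
  shows "(\<integral>\<^sup>+t. ennreal (t powr (p - 1)) * indicator {x..y} t \<partial>lborel) = ennreal ((y powr p - x powr p) / p)"
proof -
  have "(\<integral>\<^sup>+t. ennreal (t powr (p - 1)) * indicator {x..y} t \<partial>lborel) = ennreal (y powr p / p - x powr p / p)"
  proof (rule nn_integral_FTC_Icc[where F = "\<lambda>t. t powr p / p", OF _ _ _ x(2)])
    fix t assume "t \<in> {x..y}"
    then have "t > 0" using x by auto
    from DERIV_cdivide[OF has_real_derivative_powr[OF this, of p], of p]
    show "((\<lambda>t. t powr p / p) has_real_derivative t powr (p - 1)) (at t)"
      using p by simp
  qed auto
  then show ?thesis by (simp add: diff_divide_distrib)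
qed

lemma nn_integral_powr_tail:
  assumes x: "0 < x" "x \<le> y" and a: "a \<ge> 3 / 2"
  shows "(\<integral>\<^sup>+t. ennreal (t powr (- a)) * indicator {x..y} t \<partial>lborel) \<le> ennreal (2 * x powr (1 - a))"
proof -
  have "(\<integral>\<^sup>+t. ennreal (t powr (- a)) * indicator {x..y} t \<partial>lborel) = ennreal ((y powr (1 - a) - x powr (1 - a)) / (1 - a))"
    using nn_integral_powr[OF x, of "1 - a"] a by simp
  also have "\<dots> \<le> ennreal (2 * x powr (1 - a))"
  proof (rule ennreal_leI)
    have "(y powr (1 - a) - x powr (1 - a)) / (1 - a) = (x powr (1 - a) - y powr (1 - a)) / (a - 1)"
      using a by (simp add: field_simps)
    also have "\<dots> \<le> x powr (1 - a) / (a - 1)" using a by (intro divide_right_mono) auto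
    also have "\<dots> \<le> x powr (1 - a) / (1 / 2)" using a x by (intro divide_left_mono) auto
    finally show "(y powr (1 - a) - x powr (1 - a)) / (1 - a) \<le> 2 * x powr (1 - a)" by simp
  qed
  finally show ?thesis .
qed

text \<open>The minimum is constant for \<open>s \<le> t\<close> and decays from there on, so both parts are of the order of
  \<open>t\<close> times the value at \<open>t\<close>.\<close>

lemma nn_integral_min_powr:
  assumes t: "1 \<le> t" "t \<le> T" and a: "a \<ge> 3 / 2"
  shows "(\<integral>\<^sup>+s. ennreal (min (t powr (- a)) (s powr (- a))) * indicator {1..T} s \<partial>lborel) \<le> ennreal (3 * t powr (1 - a))"
proof -
  have "(\<integral>\<^sup>+s. ennreal (min (t powr (- a)) (s powr (- a))) * indicator {1..T} s \<partial>lborel)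
      \<le> (\<integral>\<^sup>+s. ennreal (t powr (- a)) * indicator {0..t} s + ennreal (s powr (- a)) * indicator {t..T} s \<partial>lborel)"
  proof (rule nn_integral_mono)
    fix s :: real
    consider "s \<in> {1..T}" "s \<le> t" | "s \<in> {1..T}" "s \<ge> t" | "s \<notin> {1..T}" by linarith
    then show "ennreal (min (t powr (- a)) (s powr (- a))) * indicator {1..T} s
      \<le> ennreal (t powr (- a)) * indicator {0..t} s + ennreal (s powr (- a)) * indicator {t..T} s"
    proof cases
      case 1
      then have "ennreal (min (t powr (- a)) (s powr (- a))) * indicator {1..T} s \<le> ennreal (t powr (- a)) * indicator {0..t} s"
        by (auto intro!: ennreal_leI)
      then show ?thesis by (rule order_trans) simp
    next
      case 2
      then have "ennreal (min (t powr (- a)) (s powr (- a))) * indicator {1..T} s \<le> ennreal (s powr (- a)) * indicator {t..T} s"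
        by (auto intro!: ennreal_leI)
      then show ?thesis by (rule order_trans) simp
    qed simp
  qed
  also have "\<dots> = (\<integral>\<^sup>+s. ennreal (t powr (- a)) * indicator {0..t} s \<partial>lborel) + (\<integral>\<^sup>+s. ennreal (s powr (- a)) * indicator {t..T} s \<partial>lborel)"
    by (rule nn_integral_add) auto
  also have "\<dots> \<le> ennreal (t powr (1 - a)) + ennreal (2 * t powr (1 - a))"
  proof (rule add_mono)
    have "t powr (- a) * t = t powr (1 - a)"
      using t powr_mult_base[of t "- a"] by (simp add: mult.commute)
    then show "(\<integral>\<^sup>+s. ennreal (t powr (- a)) * indicator {0..t} s \<partial>lborel) \<le> ennreal (t powr (1 - a))"
      using t by (simp add: nn_integral_cmult_indicator ennreal_mult'[symmetric])
    show "(\<integral>\<^sup>+s. ennreal (s powr (- a)) * indicator {t..T} s \<partial>lborel) \<le> ennreal (2 * t powr (1 - a))"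
      using t a by (intro nn_integral_powr_tail) auto
  qed
  also have "\<dots> = ennreal (3 * t powr (1 - a))"
    by (subst ennreal_plus[symmetric]) auto
  finally show ?thesis .
qed

lemma nn_integral_growth:
  assumes T: "T \<ge> 1"
  shows "(\<integral>\<^sup>+t. ennreal (3 * t powr (1 - decay d)) * indicator {1..T} t \<partial>lborel) \<le> ennreal (6 * growth d T)"
proof -
  have "(\<integral>\<^sup>+t. ennreal (t powr (1 - decay d)) * indicator {1..T} t \<partial>lborel) \<le> ennreal (2 * growth d T)"
  proof (cases "d = 4")
    case True
    have "(\<integral>\<^sup>+t. ennreal (t powr (1 - decay d)) * indicator {1..T} t \<partial>lborel)
        = (\<integral>\<^sup>+t. ennreal (1 / t) * indicator {1..T} t \<partial>lborel)"
      using True by (intro nn_integral_cong) (auto simp: decay_def indicator_def powr_minus_divide)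
    also have "\<dots> = ennreal (ln T - ln 1)"
      by (rule nn_integral_FTC_Icc[where F = ln, OF _ _ _ T]) (auto intro!: derivative_eq_intros)
    also have "\<dots> \<le> ennreal (2 * growth d T)" using True T by (intro ennreal_leI) (simp add: growth_def)
    finally show ?thesis .
  next
    case False
    define p where "p = 2 - decay d"
    have p: "p \<noteq> 0" "p - 1 = 1 - decay d" using False by (auto simp: p_def decay_def)
    have "(\<integral>\<^sup>+t. ennreal (t powr (1 - decay d)) * indicator {1..T} t \<partial>lborel) = ennreal ((T powr p - 1 powr p) / p)"
      using nn_integral_powr[of 1 T p] T p by simp
    also have "\<dots> \<le> ennreal (2 * growth d T)"
    proof (rule ennreal_leI)
      show "(T powr p - 1 powr p) / p \<le> 2 * growth d T"
      proof (cases "d = 3")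
        case True
        then have p: "p = 1 / 2" by (simp add: p_def decay_def)
        show ?thesis unfolding p using True T by (simp add: growth_def powr_half_sqrt)
      next
        case F: False
        then have p: "p = - (1 / 2)" using False by (simp add: p_def decay_def)
        show ?thesis unfolding p using F False T by (simp add: growth_def)
      qed
    qed
    finally show ?thesis .
  qed
  then have "3 * (\<integral>\<^sup>+t. ennreal (t powr (1 - decay d)) * indicator {1..T} t \<partial>lborel) \<le> 3 * ennreal (2 * growth d T)"
    by (intro mult_left_mono) auto
  moreover have "(\<integral>\<^sup>+t. ennreal (3 * t powr (1 - decay d)) * indicator {1..T} t \<partial>lborel)
      = 3 * (\<integral>\<^sup>+t. ennreal (t powr (1 - decay d)) * indicator {1..T} t \<partial>lborel)"
    by (subst nn_integral_cmult[symmetric]) (auto simp: ennreal_mult mult.assoc)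
  moreover have "3 * ennreal (2 * growth d T) = ennreal (6 * growth d T)"
    using growth_ge_1[OF T, of d] by (simp add: ennreal_mult mult.assoc[symmetric])
  ultimately show ?thesis by simp
qed

lemma heat_nn_integral: "t > 0 \<Longrightarrow> (\<integral>\<^sup>+x. ennreal (heat t (x::real^'d)) \<partial>lborel) = 1"
  by (subst nn_integral_eq_integral) (auto simp: heat_integrable heat_integral heat_nonneg)

lemma green_integrand_integrable:
  fixes x :: "real^'d"
  assumes a: "0 < a"
  shows "integrable lborel (\<lambda>t. indicator {a..b} t * heat t x)"
proof (rule Bochner_Integration.integrable_bound)
  let ?m = "a powr (- (real CARD('d) / 2))"
  show "integrable lborel (\<lambda>t. indicator {a..b} t * ?m)"
    by (intro integrable_mult_left integrable_real_indicator) (auto simp: emeasure_lborel_Icc_eq)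
  have "heat t x \<le> ?m" if "a \<le> t" for t
    using heat_le[of t x] powr_mono2'[of "- (real CARD('d) / 2)" a t] that a by simp
  then show "AE t in lborel. norm (indicator {a..b} t * heat t x) \<le> norm (indicator {a..b} t * ?m)"
    by (auto simp: indicator_def heat_nonneg)
qed measurable

lemma green_nonneg: "green a b x \<ge> 0"
  unfolding green_def by (intro Bochner_Integration.integral_nonneg) (auto simp: heat_nonneg)

lemma ennreal_green:
  assumes a: "0 < a"
  shows "ennreal (green a b x) = (\<integral>\<^sup>+t. ennreal (heat t x) * indicator {a..b} t \<partial>lborel)"
proof -
  have "(\<integral>\<^sup>+t. ennreal (indicator {a..b} t * heat t x) \<partial>lborel) = ennreal (green a b x)"
    unfolding green_def using green_integrand_integrable[OF a]
    by (intro nn_integral_eq_integral) (auto simp: heat_nonneg)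
  moreover have "ennreal (indicator {a..b} t * heat t x) = ennreal (heat t x) * indicator {a..b} t" for t
    by (auto simp: indicator_def)
  ultimately show ?thesis by simp
qed

lemma green_add:
  assumes a: "0 < a" and c: "a \<le> c" "c \<le> b"
  shows "green a b x = green a c x + green c b x"
proof -
  have "green a b x = (\<integral>t. indicator {a..c} t * heat t x + indicator {c..b} t * heat t x \<partial>lborel)"
    unfolding green_def
  proof (rule integral_cong_AE)
    have "AE t in lborel. t \<noteq> c" by (rule AE_lborel_singleton)
    then show "AE t in lborel. indicator {a..b} t * heat t x = indicator {a..c} t * heat t x + indicator {c..b} t * heat t x"
      by eventually_elim (use c in \<open>auto simp: indicator_def\<close>)
  qed measurable
  also have "\<dots> = green a c x + green c b x"
    unfolding green_def using green_integrand_integrable[of a] green_integrand_integrable[of c] a c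
    by (intro Bochner_Integration.integral_add) auto
  finally show ?thesis .
qed

lemma
  assumes a: "0 < a" and b: "a \<le> b"
  shows green_integrable: "integrable lborel (green a b :: real^'d \<Rightarrow> real)"
    and green_integral: "(\<integral>x. green a b (x :: real^'d) \<partial>lborel) = b - a"
proof -
  have "(\<integral>\<^sup>+x. ennreal (green a b (x :: real^'d)) \<partial>lborel)
      = (\<integral>\<^sup>+x. (\<integral>\<^sup>+t. ennreal (heat t (x :: real^'d)) * indicator {a..b} t \<partial>lborel) \<partial>lborel)"
    by (simp add: ennreal_green[OF a])
  also have "\<dots> = (\<integral>\<^sup>+t. (\<integral>\<^sup>+x. ennreal (heat t (x :: real^'d)) * indicator {a..b} t \<partial>lborel) \<partial>lborel)"
    by (rule lborel_pair.Fubini') measurable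
  also have "\<dots> = (\<integral>\<^sup>+t. indicator {a..b} t \<partial>lborel)"
    using a by (intro nn_integral_cong) (auto simp: nn_integral_multc heat_nn_integral indicator_def)
  finally have n: "(\<integral>\<^sup>+x. ennreal (green a b (x :: real^'d)) \<partial>lborel) = ennreal (b - a)"
    using b by simp
  show i: "integrable lborel (green a b :: real^'d \<Rightarrow> real)"
    by (rule integrableI_nonneg) (auto simp: n green_nonneg)
  show "(\<integral>x. green a b (x :: real^'d) \<partial>lborel) = b - a"
    using n b by (subst integral_eq_nn_integral) (auto simp: green_nonneg)
qed

lemma green_le:
  fixes x :: "real^'d"
  assumes d: "CARD('d) \<ge> 3" and T: "T \<ge> 1"
  shows "green 1 T x \<le> 2"
proof -
  have dec: "decay CARD('d) \<ge> 3 / 2" by (auto simp: decay_def)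
  have "ennreal (green 1 T x) \<le> (\<integral>\<^sup>+t. ennreal (t powr (- decay CARD('d))) * indicator {1..T} t \<partial>lborel)"
    unfolding ennreal_green[OF zero_less_one]
    by (intro nn_integral_mono) (auto simp: indicator_def intro!: ennreal_leI heat_decay[OF d])
  also have "\<dots> \<le> ennreal (2 * 1 powr (1 - decay CARD('d)))"
    by (rule nn_integral_powr_tail) (use T dec in auto)
  finally show ?thesis using ennreal_le_iff[of 2 "green 1 T x"] by simp
qed

text \<open>The squared norm is the double time integral of the \<open>L\<^sup>2\<close> products of heat kernels at times \<open>t\<close> and \<open>s\<close>.
  One kernel has integral \<open>1\<close> and the other is bounded by its decay, and the roles may be exchanged.\<close>

lemma
  assumes d: "CARD('d) \<ge> 3" and T: "T \<ge> 1"
  shows green_square_integrable: "integrable lborel (\<lambda>x::real^'d. (green 1 T x)\<^sup>2)"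
    and green_square_integral: "(\<integral>x. (green 1 T (x :: real^'d))\<^sup>2 \<partial>lborel) \<le> 6 * growth CARD('d) T"
proof -
  let ?m = "\<lambda>t. t powr (- decay CARD('d))"
  have dec: "decay CARD('d) \<ge> 3 / 2" by (auto simp: decay_def)
  have two: "(\<integral>\<^sup>+x. ennreal (heat t x) * ennreal (heat s x) \<partial>(lborel :: (real^'d) measure)) \<le> ennreal (min (?m t) (?m s))"
    if "t \<ge> 1" "s \<ge> 1" for s t
  proof -
    have *: "(\<integral>\<^sup>+x. ennreal (heat t x) * ennreal (heat s x) \<partial>(lborel :: (real^'d) measure)) \<le> ennreal (?m s)"
      if "t \<ge> 1" "s \<ge> 1" for s t
    proof -
      have "(\<integral>\<^sup>+x. ennreal (heat t x) * ennreal (heat s x) \<partial>(lborel :: (real^'d) measure))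
          \<le> (\<integral>\<^sup>+x. ennreal (heat t x) * ennreal (?m s) \<partial>(lborel :: (real^'d) measure))"
        using that by (intro nn_integral_mono mult_left_mono ennreal_leI heat_decay[OF d]) auto
      also have "\<dots> = ennreal (?m s)" using that by (simp add: nn_integral_multc heat_nn_integral)
      finally show ?thesis .
    qed
    from *[OF that] *[OF that(2,1)] show ?thesis by (simp add: min_def mult.commute)
  qed
  have inner: "(\<integral>\<^sup>+x. ennreal (heat t x) * ennreal (green 1 T x) \<partial>(lborel :: (real^'d) measure))
      \<le> ennreal (3 * t powr (1 - decay CARD('d)))" if t: "1 \<le> t" "t \<le> T" for t
  proof -
    have "(\<integral>\<^sup>+x. ennreal (heat t x) * ennreal (green 1 T x) \<partial>(lborel :: (real^'d) measure))
        = (\<integral>\<^sup>+x. (\<integral>\<^sup>+s. ennreal (heat t x) * (ennreal (heat s x) * indicator {1..T} s) \<partial>lborel) \<partial>(lborel :: (real^'d) measure))"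
      by (simp add: ennreal_green nn_integral_cmult)
    also have "\<dots> = (\<integral>\<^sup>+s. (\<integral>\<^sup>+x. ennreal (heat t x) * (ennreal (heat s x) * indicator {1..T} s) \<partial>(lborel :: (real^'d) measure)) \<partial>lborel)"
      by (rule lborel_pair.Fubini') measurable
    also have "\<dots> = (\<integral>\<^sup>+s. (\<integral>\<^sup>+x. ennreal (heat t x) * ennreal (heat s x) \<partial>(lborel :: (real^'d) measure)) * indicator {1..T} s \<partial>lborel)"
      by (simp add: nn_integral_multc mult.assoc[symmetric])
    also have "\<dots> \<le> (\<integral>\<^sup>+s. ennreal (min (?m t) (?m s)) * indicator {1..T} s \<partial>lborel)"
      using two t by (intro nn_integral_mono) (auto simp: indicator_def)
    also have "\<dots> \<le> ennreal (3 * t powr (1 - decay CARD('d)))"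
      by (rule nn_integral_min_powr[OF t dec])
    finally show ?thesis .
  qed
  have "(\<integral>\<^sup>+x. ennreal ((green 1 T x)\<^sup>2) \<partial>(lborel :: (real^'d) measure))
      = (\<integral>\<^sup>+x. (\<integral>\<^sup>+t. (ennreal (heat t x) * indicator {1..T} t) * ennreal (green 1 T x) \<partial>lborel) \<partial>(lborel :: (real^'d) measure))"
    by (simp add: nn_integral_multc ennreal_green[symmetric] power2_eq_square ennreal_mult' green_nonneg)
  also have "\<dots> = (\<integral>\<^sup>+t. (\<integral>\<^sup>+x. (ennreal (heat t x) * indicator {1..T} t) * ennreal (green 1 T x) \<partial>(lborel :: (real^'d) measure)) \<partial>lborel)"
    by (rule lborel_pair.Fubini') measurable
  also have "\<dots> = (\<integral>\<^sup>+t. (\<integral>\<^sup>+x. ennreal (heat t x) * ennreal (green 1 T x) \<partial>(lborel :: (real^'d) measure)) * indicator {1..T} t \<partial>lborel)"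
    by (subst nn_integral_multc[symmetric]) (auto simp: mult_ac)
  also have "\<dots> \<le> (\<integral>\<^sup>+t. ennreal (3 * t powr (1 - decay CARD('d))) * indicator {1..T} t \<partial>lborel)"
    using inner by (intro nn_integral_mono) (auto simp: indicator_def)
  also have "\<dots> \<le> ennreal (6 * growth CARD('d) T)" by (rule nn_integral_growth[OF T])
  finally have n: "(\<integral>\<^sup>+x. ennreal ((green 1 T x)\<^sup>2) \<partial>(lborel :: (real^'d) measure)) \<le> ennreal (6 * growth CARD('d) T)" .
  show i: "integrable lborel (\<lambda>x::real^'d. (green 1 T x)\<^sup>2)"
    by (rule integrableI_nonneg) (use n in \<open>auto intro: order_le_less_trans\<close>)
  have "ennreal (\<integral>x. (green 1 T (x :: real^'d))\<^sup>2 \<partial>lborel) \<le> ennreal (6 * growth CARD('d) T)"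
    using n by (subst nn_integral_eq_integral[OF i, symmetric]) auto
  then show "(\<integral>x. (green 1 T (x :: real^'d))\<^sup>2 \<partial>lborel) \<le> 6 * growth CARD('d) T"
    using growth_ge_1[OF T, of "CARD('d)"] by (simp add: ennreal_le_iff)
qed

section \<open>Averages of a stationary field\<close>

context ergodic_translation_group
begin

definition bounded_rv :: "real \<Rightarrow> ('w \<Rightarrow> real) \<Rightarrow> bool" where
  "bounded_rv B w \<longleftrightarrow> w \<in> borel_measurable M \<and> B \<ge> 0 \<and> (\<forall>\<omega>\<in>space M. \<bar>w \<omega>\<bar> \<le> B)"

text \<open>The value at the origin of the convolution of \<open>k\<close> with the field \<open>x \<mapsto> w (\<tau> (- x) \<omega>)\<close>. As a random
  variable, it generates a stationary field again.\<close>

definition avg :: "(real^'d \<Rightarrow> real) \<Rightarrow> ('w \<Rightarrow> real) \<Rightarrow> 'w \<Rightarrow> real" where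
  "avg k w \<omega> = (\<integral>y. k y * w (\<tau> y \<omega>) \<partial>lborel)"

abbreviation corr :: "('w \<Rightarrow> real) \<Rightarrow> real^'d \<Rightarrow> real" where
  "corr w \<equiv> correlation M \<tau> w"

lemma bounded_rvD:
  assumes "bounded_rv B w"
  shows "w \<in> borel_measurable M" "B \<ge> 0" "\<And>\<omega>. \<omega> \<in> space M \<Longrightarrow> \<bar>w \<omega>\<bar> \<le> B"
  using assms by (auto simp: bounded_rv_def)

lemma shift_space: "\<omega> \<in> space M \<Longrightarrow> \<tau> x \<omega> \<in> space M"
  using measurable_space[OF jointly_measurable, of "(x, \<omega>)"] by (simp add: space_pair_measure)

lemma field_measurable [measurable (raw)]:
  assumes [measurable]: "f \<in> borel_measurable N" "g \<in> N \<rightarrow>\<^sub>M M"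
  shows "(\<lambda>p. \<tau> (f p) (g p)) \<in> N \<rightarrow>\<^sub>M M"
  using measurable_compose[OF measurable_Pair[OF assms] jointly_measurable] by simp

lemma bounded_rv_shift: "bounded_rv B w \<Longrightarrow> bounded_rv B (\<lambda>\<omega>. w (\<tau> x \<omega>))"
  unfolding bounded_rv_def by (auto simp: shift_space)

lemma bounded_rv_mult:
  assumes X: "bounded_rv A X" and w: "bounded_rv B w"
  shows "bounded_rv (A * B) (\<lambda>\<omega>. X \<omega> * w \<omega>)"
  using X w unfolding bounded_rv_def by (auto simp: abs_mult intro!: mult_mono)

lemma bounded_rv_add:
  assumes X: "bounded_rv A X" and w: "bounded_rv B w"
  shows "bounded_rv (A + B) (\<lambda>\<omega>. X \<omega> + w \<omega>)" "bounded_rv (A + B) (\<lambda>\<omega>. X \<omega> - w \<omega>)"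
proof -
  have "\<bar>X \<omega> + w \<omega>\<bar> \<le> A + B" "\<bar>X \<omega> - w \<omega>\<bar> \<le> A + B" if "\<omega> \<in> space M" for \<omega>
    using bounded_rvD(3)[OF X that] bounded_rvD(3)[OF w that] by auto
  then show "bounded_rv (A + B) (\<lambda>\<omega>. X \<omega> + w \<omega>)" "bounded_rv (A + B) (\<lambda>\<omega>. X \<omega> - w \<omega>)"
    using X w unfolding bounded_rv_def by auto
qed

lemma bounded_rv_const: "bounded_rv \<bar>c\<bar> (\<lambda>\<omega>. c)"
  by (simp add: bounded_rv_def)

lemma bounded_rv_integrable: "bounded_rv B w \<Longrightarrow> integrable M w"
  by (rule integrable_const_bound[of _ B]) (auto simp: bounded_rv_def)

lemma bounded_rv_expectation_bound:
  assumes "bounded_rv B w"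
  shows "\<bar>\<integral>\<omega>. w \<omega> \<partial>M\<bar> \<le> B"
proof -
  have "\<bar>\<integral>\<omega>. w \<omega> \<partial>M\<bar> \<le> (\<integral>\<omega>. \<bar>w \<omega>\<bar> \<partial>M)"
    using integral_norm_bound[of M w] by simp
  also have "\<dots> \<le> (\<integral>\<omega>. B \<partial>M)"
    using bounded_rvD[OF assms] bounded_rv_integrable[OF assms] by (intro integral_mono) auto
  finally show ?thesis by (simp add: prob_space)
qed

lemma shift_expectation:
  assumes [measurable]: "g \<in> borel_measurable M"
  shows "(\<integral>\<omega>. g (\<tau> x \<omega>) \<partial>M) = (\<integral>\<omega>. g \<omega> \<partial>M :: real)"
  using integral_distr[of "\<tau> x" M M g] invariant[of x] by simp

lemma avg_integrand_integrable:
  assumes w: "bounded_rv B w" and k: "integrable lborel k" and \<omega>: "\<omega> \<in> space M"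
  shows "integrable lborel (\<lambda>y. k y * w (\<tau> y \<omega>))"
proof (rule integrable_mult_bounded[OF k])
  note [measurable] = bounded_rvD(1)[OF w] \<omega>
  show "(\<lambda>y. w (\<tau> y \<omega>)) \<in> borel_measurable lborel" by measurable
  show "\<bar>w (\<tau> y \<omega>)\<bar> \<le> B" for y using bounded_rvD(3)[OF w] \<omega> shift_space by blast
qed

lemma avg_bounded:
  assumes w: "bounded_rv B w" and k: "integrable lborel k"
  shows "bounded_rv (B * (\<integral>y. \<bar>k y\<bar> \<partial>lborel)) (avg k w)"
  unfolding bounded_rv_def
proof (intro conjI ballI)
  note [measurable] = bounded_rvD(1)[OF w]
  have [measurable]: "k \<in> borel_measurable borel" using k by auto
  show "avg k w \<in> borel_measurable M" unfolding avg_def by measurable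
  show "0 \<le> B * (\<integral>y. \<bar>k y\<bar> \<partial>lborel)" using bounded_rvD(2)[OF w] by simp
  fix \<omega> assume \<omega>: "\<omega> \<in> space M"
  have "\<bar>avg k w \<omega>\<bar> \<le> (\<integral>y. \<bar>k y * w (\<tau> y \<omega>)\<bar> \<partial>lborel)"
    unfolding avg_def using integral_norm_bound[of lborel "\<lambda>y. k y * w (\<tau> y \<omega>)"] by simp
  also have "\<dots> \<le> (\<integral>y. B * \<bar>k y\<bar> \<partial>lborel)"
  proof (rule integral_mono)
    show "integrable lborel (\<lambda>y. \<bar>k y * w (\<tau> y \<omega>)\<bar>)"
      by (intro integrable_abs avg_integrand_integrable[OF w k \<omega>])
    show "\<bar>k y * w (\<tau> y \<omega>)\<bar> \<le> B * \<bar>k y\<bar>" for y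
      using mult_left_mono[OF bounded_rvD(3)[OF w shift_space[OF \<omega>, of y]] abs_ge_zero[of "k y"]]
      by (simp add: abs_mult mult.commute)
  qed (use k in auto)
  finally show "\<bar>avg k w \<omega>\<bar> \<le> B * (\<integral>y. \<bar>k y\<bar> \<partial>lborel)" by simp
qed

lemma avg_add:
  assumes w: "bounded_rv B w" and k: "integrable lborel k" and l: "integrable lborel l" and \<omega>: "\<omega> \<in> space M"
  shows "avg (\<lambda>y. k y + l y) w \<omega> = avg k w \<omega> + avg l w \<omega>"
    and "avg (\<lambda>y. k y - l y) w \<omega> = avg k w \<omega> - avg l w \<omega>"
  unfolding avg_def
  using avg_integrand_integrable[OF w k \<omega>] avg_integrand_integrable[OF w l \<omega>]
  by (simp_all add: distrib_right left_diff_distrib)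

text \<open>Along the orbit of \<open>\<omega>\<close> an average is a convolution.\<close>

lemma avg_shift:
  assumes \<omega>: "\<omega> \<in> space M"
  shows "avg k w (\<tau> (- x) \<omega>) = (\<integral>y. k y * w (\<tau> (- (x - y)) \<omega>) \<partial>lborel)"
  unfolding avg_def using translation_add[OF \<omega>, of _ "- x"] by simp

text \<open>Fubini, by the joint measurability of the translations. All moment formulas are instances of this
  one.\<close>

lemma avg_expectation:
  assumes X: "bounded_rv A X" and w: "bounded_rv B w" and l: "integrable lborel l"
  shows "(\<integral>\<omega>. X \<omega> * avg l w \<omega> \<partial>M) = (\<integral>z. l z * (\<integral>\<omega>. X \<omega> * w (\<tau> z \<omega>) \<partial>M) \<partial>lborel)"
    and "integrable lborel (\<lambda>z. l z * (\<integral>\<omega>. X \<omega> * w (\<tau> z \<omega>) \<partial>M))"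
proof -
  interpret P: pair_sigma_finite "lborel :: (real^'d) measure" M by standard
  note [measurable] = bounded_rvD(1)[OF w] bounded_rvD(1)[OF X]
  have [measurable]: "l \<in> borel_measurable borel" using l by auto
  have Xw: "bounded_rv (A * B) (\<lambda>\<omega>. X \<omega> * w (\<tau> z \<omega>))" for z
    by (intro bounded_rv_mult X bounded_rv_shift w)
  have I: "integrable (lborel \<Otimes>\<^sub>M M) (\<lambda>(z, \<omega>). l z * (X \<omega> * w (\<tau> z \<omega>)))"
  proof (rule P.Fubini_integrable)
    show "AE z in lborel. integrable M (\<lambda>\<omega>. case (z, \<omega>) of (z, \<omega>) \<Rightarrow> l z * (X \<omega> * w (\<tau> z \<omega>)))"
      using bounded_rv_integrable[OF Xw] by simp
    show "integrable lborel (\<lambda>z. \<integral>\<omega>. norm (case (z, \<omega>) of (z, \<omega>) \<Rightarrow> l z * (X \<omega> * w (\<tau> z \<omega>))) \<partial>M)"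
    proof (rule Bochner_Integration.integrable_bound)
      show "integrable lborel (\<lambda>z. l z * (A * B))" using l by simp
      show "AE z in lborel. norm (\<integral>\<omega>. norm (case (z, \<omega>) of (z, \<omega>) \<Rightarrow> l z * (X \<omega> * w (\<tau> z \<omega>))) \<partial>M)
          \<le> norm (l z * (A * B))"
      proof (rule AE_I2)
        fix z
        have "bounded_rv (\<bar>l z\<bar> * (A * B)) (\<lambda>\<omega>. l z * (X \<omega> * w (\<tau> z \<omega>)))"
          by (intro bounded_rv_mult bounded_rv_const Xw)
        then have "bounded_rv (\<bar>l z\<bar> * (A * B)) (\<lambda>\<omega>. \<bar>l z * (X \<omega> * w (\<tau> z \<omega>))\<bar>)"
          by (simp add: bounded_rv_def)
        from bounded_rv_expectation_bound[OF this]
        show "norm (\<integral>\<omega>. norm (case (z, \<omega>) of (z, \<omega>) \<Rightarrow> l z * (X \<omega> * w (\<tau> z \<omega>))) \<partial>M)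
          \<le> norm (l z * (A * B))"
          using bounded_rvD(2)[OF X] bounded_rvD(2)[OF w] by (simp add: abs_mult)
      qed
    qed measurable
  qed measurable
  have e: "(\<integral>\<omega>. l z * (X \<omega> * w (\<tau> z \<omega>)) \<partial>M) = l z * (\<integral>\<omega>. X \<omega> * w (\<tau> z \<omega>) \<partial>M)" for z by simp
  show "integrable lborel (\<lambda>z. l z * (\<integral>\<omega>. X \<omega> * w (\<tau> z \<omega>) \<partial>M))"
    using P.integrable_fst[OF I] by simp
  have "(\<integral>\<omega>. X \<omega> * avg l w \<omega> \<partial>M) = (\<integral>\<omega>. (\<integral>z. l z * (X \<omega> * w (\<tau> z \<omega>)) \<partial>lborel) \<partial>M)"
    unfolding avg_def by (subst Bochner_Integration.integral_mult_right_zero[symmetric]) (simp add: mult_ac)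
  also have "\<dots> = (\<integral>z. (\<integral>\<omega>. l z * (X \<omega> * w (\<tau> z \<omega>)) \<partial>M) \<partial>lborel)"
    by (rule P.Fubini_integral[OF I])
  finally show "(\<integral>\<omega>. X \<omega> * avg l w \<omega> \<partial>M) = (\<integral>z. l z * (\<integral>\<omega>. X \<omega> * w (\<tau> z \<omega>) \<partial>M) \<partial>lborel)"
    by simp
qed

lemma corr_eq:
  assumes w: "bounded_rv B w"
  shows "(\<integral>\<omega>. w (\<tau> y \<omega>) * w (\<tau> z \<omega>) \<partial>M) = corr w (y - z)"
proof -
  note [measurable] = bounded_rvD(1)[OF w]
  have "w (\<tau> z \<omega>) = w (\<tau> (- (y - z)) (\<tau> y \<omega>))" if "\<omega> \<in> space M" for \<omega>
    using translation_add[OF that, of "- (y - z)" y] by simp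
  then have "(\<integral>\<omega>. w (\<tau> y \<omega>) * w (\<tau> z \<omega>) \<partial>M) = (\<integral>\<omega>. w (\<tau> y \<omega>) * w (\<tau> (- (y - z)) (\<tau> y \<omega>)) \<partial>M)"
    by (intro Bochner_Integration.integral_cong) auto
  also have "\<dots> = (\<integral>\<omega>. w \<omega> * w (\<tau> (- (y - z)) \<omega>) \<partial>M)"
    by (rule shift_expectation[where g = "\<lambda>\<omega>. w \<omega> * w (\<tau> (- (y - z)) \<omega>)"]) measurable
  finally show ?thesis by (simp add: correlation_def translate_def)
qed

lemma corr_even:
  assumes w: "bounded_rv B w"
  shows "corr w (- x) = corr w x"
  using corr_eq[OF w, of 0 x] corr_eq[OF w, of x 0] by (simp add: mult.commute)

lemma corr_zero:
  assumes w: "bounded_rv B w"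
  shows "corr w 0 = (\<integral>\<omega>. (w \<omega>)\<^sup>2 \<partial>M)"
  using shift_expectation[of "\<lambda>\<omega>. (w \<omega>)\<^sup>2" 0] corr_eq[OF w, of 0 0] bounded_rvD(1)[OF w]
  by (simp add: power2_eq_square)

lemma corr_le_zero:
  assumes w: "bounded_rv B w"
  shows "\<bar>corr w x\<bar> \<le> corr w 0"
proof -
  note [measurable] = bounded_rvD(1)[OF w]
  have i2: "integrable M (\<lambda>\<omega>. (w (\<tau> y \<omega>))\<^sup>2)" for y
    using bounded_rv_integrable[OF bounded_rv_mult[OF bounded_rv_shift[OF w] bounded_rv_shift[OF w]]]
    by (simp add: power2_eq_square)
  have "\<bar>corr w x\<bar> = \<bar>\<integral>\<omega>. w (\<tau> x \<omega>) * w (\<tau> 0 \<omega>) \<partial>M\<bar>" using corr_eq[OF w, of x 0] by simp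
  also have "\<dots> \<le> (\<integral>\<omega>. \<bar>w (\<tau> x \<omega>) * w (\<tau> 0 \<omega>)\<bar> \<partial>M)"
    using integral_norm_bound[of M "\<lambda>\<omega>. w (\<tau> x \<omega>) * w (\<tau> 0 \<omega>)"] by simp
  also have "\<dots> \<le> (\<integral>\<omega>. ((w (\<tau> x \<omega>))\<^sup>2 + (w (\<tau> 0 \<omega>))\<^sup>2) / 2 \<partial>M)"
  proof (rule integral_mono)
    show "integrable M (\<lambda>\<omega>. \<bar>w (\<tau> x \<omega>) * w (\<tau> 0 \<omega>)\<bar>)"
      by (intro integrable_abs bounded_rv_integrable[OF bounded_rv_mult[OF bounded_rv_shift[OF w] bounded_rv_shift[OF w]]])
    show "\<bar>w (\<tau> x \<omega>) * w (\<tau> 0 \<omega>)\<bar> \<le> ((w (\<tau> x \<omega>))\<^sup>2 + (w (\<tau> 0 \<omega>))\<^sup>2) / 2" for \<omega>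
      using sum_squares_bound[of "\<bar>w (\<tau> x \<omega>)\<bar>" "\<bar>w (\<tau> 0 \<omega>)\<bar>"] by (simp add: abs_mult)
  qed (use i2 in auto)
  also have "\<dots> = corr w 0"
    using i2 shift_expectation[of "\<lambda>\<omega>. (w \<omega>)\<^sup>2"] by (simp add: corr_zero[OF w])
  finally show ?thesis .
qed

lemma spectral_measure_finite: "finite_measure (spectral_measure M U f)"
  by standard (auto simp: spectral_measure_def emeasure_measure_of_conv)

lemma spectral_measure_sets [measurable_cong]: "sets (spectral_measure M U f) = sets borel"
  unfolding spectral_measure_def by (subst sets_measure_of) (auto simp: sigma_algebra.sigma_sets_eq[OF sets.sigma_algebra_axioms[of borel, simplified]])

lemma corr_spectral:
  assumes w: "bounded_rv B w"
  shows "complex_of_real (corr w x) = (\<integral>\<xi>. cis (\<xi> \<bullet> x) \<partial>spectral_measure M U (\<lambda>\<omega>. of_real (w \<omega>)))"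
proof -
  note [measurable] = bounded_rvD(1)[OF w]
  have "integrable M (\<lambda>\<omega>. (w \<omega>)\<^sup>2)"
    using bounded_rv_integrable[OF bounded_rv_mult[OF w w]] by (simp add: power2_eq_square)
  then have "(\<lambda>\<omega>. complex_of_real (w \<omega>)) \<in> L2 M" by (simp add: L2_def)
  from spectral_resolution[OF this, of x]
  have "(\<integral>\<xi>. cis (\<xi> \<bullet> x) \<partial>spectral_measure M U (\<lambda>\<omega>. of_real (w \<omega>)))
      = (\<integral>\<omega>. complex_of_real (w (\<tau> (- x) \<omega>) * w \<omega>) \<partial>M)"
    by (simp add: L2_inner_def translate_def)
  also have "\<dots> = of_real (\<integral>\<omega>. w (\<tau> (- x) \<omega>) * w \<omega> \<partial>M)" by (rule integral_complex_of_real)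
  also have "\<dots> = complex_of_real (corr w x)"
    by (simp add: correlation_def translate_def mult.commute)
  finally show ?thesis by simp
qed

text \<open>A correlation is the Fourier transform of a finite measure.\<close>

lemma corr_continuous:
  assumes w: "bounded_rv B w"
  shows "isCont (corr w) x"
  unfolding continuous_at_sequentially
proof (intro allI impI)
  fix X assume X: "X \<longlonglongrightarrow> x"
  let ?\<mu> = "spectral_measure M U (\<lambda>\<omega>. of_real (w \<omega>))"
  interpret finite_measure ?\<mu> by (rule spectral_measure_finite)
  have "(\<lambda>n. \<integral>\<xi>. cis (\<xi> \<bullet> X n) \<partial>?\<mu>) \<longlonglongrightarrow> (\<integral>\<xi>. cis (\<xi> \<bullet> x) \<partial>?\<mu>)"
  proof (rule integral_dominated_convergence[where w = "\<lambda>_. 1"])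
    show "AE \<xi> in ?\<mu>. (\<lambda>n. cis (\<xi> \<bullet> X n)) \<longlonglongrightarrow> cis (\<xi> \<bullet> x)"
      unfolding cis_conv_exp by (intro AE_I2 tendsto_intros X)
  qed auto
  then have "(\<lambda>n. complex_of_real (corr w (X n))) \<longlonglongrightarrow> complex_of_real (corr w x)"
    by (simp only: corr_spectral[OF w])
  then show "(corr w \<circ> X) \<longlonglongrightarrow> corr w x" by (simp add: comp_def tendsto_of_real_iff)
qed

lemma corr_measurable [measurable (raw)]:
  assumes w: "bounded_rv B w"
  shows "corr w \<in> borel_measurable borel"
  by (intro borel_measurable_continuous_onI continuous_at_imp_continuous_on ballI corr_continuous[OF w])

lemma avg_second_moment:
  assumes w: "bounded_rv B w" and k: "integrable lborel k" and l: "integrable lborel l"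
  shows "(\<integral>\<omega>. avg k w \<omega> * avg l w \<omega> \<partial>M) = (\<integral>z. l z * (\<integral>y. k y * corr w (y - z) \<partial>lborel) \<partial>lborel)"
    and "integrable lborel (\<lambda>z. l z * (\<integral>y. k y * corr w (y - z) \<partial>lborel))"
proof -
  have "(\<integral>\<omega>. avg k w \<omega> * w (\<tau> z \<omega>) \<partial>M) = (\<integral>y. k y * corr w (y - z) \<partial>lborel)" for z
    using avg_expectation(1)[OF bounded_rv_shift[OF w] w k, of z] corr_eq[OF w, of z] corr_even[OF w]
    by (simp add: mult.commute) (metis (no_types, lifting) minus_diff_eq)
  with avg_expectation[OF avg_bounded[OF w k] w l]
  show "(\<integral>\<omega>. avg k w \<omega> * avg l w \<omega> \<partial>M) = (\<integral>z. l z * (\<integral>y. k y * corr w (y - z) \<partial>lborel) \<partial>lborel)"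
    "integrable lborel (\<lambda>z. l z * (\<integral>y. k y * corr w (y - z) \<partial>lborel))" by simp_all
qed

text \<open>The three bounds that follow place the correlation in \<open>L\<^sup>\<infinity>\<close> or in \<open>L\<^sup>1\<close>. The first serves
  kernels of small mass, the second bounded kernels tested against a probability density, the third
  kernels in \<open>L\<^sup>2\<close>.\<close>

lemma avg_second_moment_bound:
  assumes w: "bounded_rv B w" and k: "integrable lborel k" and l: "integrable lborel l"
    and c: "\<And>z. \<bar>\<integral>y. k y * corr w (y - z) \<partial>lborel\<bar> \<le> c"
  shows "\<bar>\<integral>\<omega>. avg k w \<omega> * avg l w \<omega> \<partial>M\<bar> \<le> c * (\<integral>z. \<bar>l z\<bar> \<partial>lborel)"
proof -
  note i = avg_second_moment(2)[OF w k l]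
  have "\<bar>\<integral>\<omega>. avg k w \<omega> * avg l w \<omega> \<partial>M\<bar> \<le> (\<integral>z. \<bar>l z * (\<integral>y. k y * corr w (y - z) \<partial>lborel)\<bar> \<partial>lborel)"
    unfolding avg_second_moment(1)[OF w k l]
    using integral_norm_bound[of lborel "\<lambda>z. l z * (\<integral>y. k y * corr w (y - z) \<partial>lborel)"] by simp
  also have "\<dots> \<le> (\<integral>z. c * \<bar>l z\<bar> \<partial>lborel)"
  proof (rule integral_mono)
    show "\<bar>l z * (\<integral>y. k y * corr w (y - z) \<partial>lborel)\<bar> \<le> c * \<bar>l z\<bar>" for z
      using mult_left_mono[OF c[of z] abs_ge_zero[of "l z"]] by (simp add: abs_mult mult.commute)
  qed (use integrable_abs[OF i] l in auto)
  finally show ?thesis by simp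
qed

lemma avg_second_moment_L1:
  assumes w: "bounded_rv B w" and k: "integrable lborel k" and l: "integrable lborel l"
  shows "\<bar>\<integral>\<omega>. avg k w \<omega> * avg l w \<omega> \<partial>M\<bar> \<le> corr w 0 * (\<integral>y. \<bar>k y\<bar> \<partial>lborel) * (\<integral>z. \<bar>l z\<bar> \<partial>lborel)"
proof (rule avg_second_moment_bound[OF w k l])
  note [measurable] = corr_measurable[OF w]
  fix z
  have i: "integrable lborel (\<lambda>y. k y * corr w (y - z))"
    by (rule integrable_mult_bounded[OF k _ corr_le_zero[OF w]]) simp
  have "\<bar>\<integral>y. k y * corr w (y - z) \<partial>lborel\<bar> \<le> (\<integral>y. \<bar>k y * corr w (y - z)\<bar> \<partial>lborel)"
    using integral_norm_bound[of lborel "\<lambda>y. k y * corr w (y - z)"] by simp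
  also have "\<dots> \<le> (\<integral>y. corr w 0 * \<bar>k y\<bar> \<partial>lborel)"
  proof (rule integral_mono)
    show "\<bar>k y * corr w (y - z)\<bar> \<le> corr w 0 * \<bar>k y\<bar>" for y
      using mult_left_mono[OF corr_le_zero[OF w, of "y - z"] abs_ge_zero[of "k y"]] by (simp add: abs_mult mult.commute)
  qed (use integrable_abs[OF i] k in auto)
  finally show "\<bar>\<integral>y. k y * corr w (y - z) \<partial>lborel\<bar> \<le> corr w 0 * (\<integral>y. \<bar>k y\<bar> \<partial>lborel)" by simp
qed

lemma avg_second_moment_sup:
  assumes w: "bounded_rv B w" and k: "integrable lborel k" and l: "integrable lborel l"
    and S: "integrable lborel (corr w)" and c: "\<And>y. \<bar>k y\<bar> \<le> c"
  shows "\<bar>\<integral>\<omega>. avg k w \<omega> * avg l w \<omega> \<partial>M\<bar> \<le> c * (\<integral>x. \<bar>corr w x\<bar> \<partial>lborel) * (\<integral>z. \<bar>l z\<bar> \<partial>lborel)"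
proof (rule avg_second_moment_bound[OF w k l])
  note [measurable] = corr_measurable[OF w]
  have [measurable]: "k \<in> borel_measurable borel" using k by auto
  fix z
  have S': "integrable lborel (\<lambda>y. corr w (y - z))"
    using lborel_integrable_translate[of "corr w" "- z"] S by simp
  have i: "integrable lborel (\<lambda>y. k y * corr w (y - z))"
    by (rule integrable_mult_bounded[OF k _ corr_le_zero[OF w]]) simp
  have "\<bar>\<integral>y. k y * corr w (y - z) \<partial>lborel\<bar> \<le> (\<integral>y. \<bar>k y * corr w (y - z)\<bar> \<partial>lborel)"
    using integral_norm_bound[of lborel "\<lambda>y. k y * corr w (y - z)"] by simp
  also have "\<dots> \<le> (\<integral>y. c * \<bar>corr w (y - z)\<bar> \<partial>lborel)"
  proof (rule integral_mono)
    show "\<bar>k y * corr w (y - z)\<bar> \<le> c * \<bar>corr w (y - z)\<bar>" for y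
      using mult_right_mono[OF c[of y] abs_ge_zero[of "corr w (y - z)"]] by (simp add: abs_mult)
  qed (use integrable_abs[OF i] S' in auto)
  also have "\<dots> = c * (\<integral>x. \<bar>corr w x\<bar> \<partial>lborel)"
    using lborel_integral_translate[of "\<lambda>x. \<bar>corr w x\<bar>" "- z"] by simp
  finally show "\<bar>\<integral>y. k y * corr w (y - z) \<partial>lborel\<bar> \<le> c * (\<integral>x. \<bar>corr w x\<bar> \<partial>lborel)" .
qed

lemma avg_square_L2:
  assumes w: "bounded_rv B w" and k: "integrable lborel k" and k2: "integrable lborel (\<lambda>y. (k y)\<^sup>2)"
    and S: "integrable lborel (corr w)"
  shows "(\<integral>\<omega>. (avg k w \<omega>)\<^sup>2 \<partial>M) \<le> (\<integral>y. (k y)\<^sup>2 \<partial>lborel) * (\<integral>x. \<bar>corr w x\<bar> \<partial>lborel)"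
proof -
  note [measurable] = corr_measurable[OF w]
  have [measurable]: "k \<in> borel_measurable borel" using k by auto
  define \<sigma> where "\<sigma> = (\<integral>x. \<bar>corr w x\<bar> \<partial>lborel)"
  have S': "integrable lborel (\<lambda>y. \<bar>corr w (y - z)\<bar>)" for z
    using lborel_integrable_translate[of "\<lambda>x. \<bar>corr w x\<bar>" "- z"] S by simp
  have S'': "integrable lborel (\<lambda>z. \<bar>corr w (z - y)\<bar>)" for y by (rule S')
  have \<sigma>': "(\<integral>y. \<bar>corr w (y - z)\<bar> \<partial>lborel) = \<sigma>" for z
    using lborel_integral_translate[of "\<lambda>x. \<bar>corr w x\<bar>" "- z"] by (simp add: \<sigma>_def)
  have sym: "corr w (y - z) = corr w (z - y)" for y z using corr_even[OF w, of "y - z"] by simp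
  have sh: "integrable (lborel \<Otimes>\<^sub>M lborel) (\<lambda>(y, z). (k y)\<^sup>2 * \<bar>corr w (z - y)\<bar>)"
    using integrable_shear[OF k2, of "\<lambda>x. \<bar>corr w x\<bar>"] S by simp
  have i2: "integrable lborel (\<lambda>z. \<integral>y. (k y)\<^sup>2 * \<bar>corr w (z - y)\<bar> \<partial>lborel)"
    using lborel_pair.integrable_snd[OF sh] by simp
  have v2: "(\<integral>z. (\<integral>y. (k y)\<^sup>2 * \<bar>corr w (z - y)\<bar> \<partial>lborel) \<partial>lborel) = (\<integral>y. (k y)\<^sup>2 \<partial>lborel) * \<sigma>"
    using lborel_pair.Fubini_integral[OF sh] by (simp add: \<sigma>')
  have bk: "integrable lborel (\<lambda>y. (k y)\<^sup>2 * \<bar>corr w (z - y)\<bar>)" for z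
    by (rule integrable_mult_bounded[OF k2, where B = "corr w 0"]) (auto simp: corr_le_zero[OF w])
  have "(\<integral>\<omega>. (avg k w \<omega>)\<^sup>2 \<partial>M) = (\<integral>z. k z * (\<integral>y. k y * corr w (y - z) \<partial>lborel) \<partial>lborel)"
    using avg_second_moment(1)[OF w k k] by (simp add: power2_eq_square)
  also have "\<dots> \<le> (\<integral>z. ((k z)\<^sup>2 * \<sigma> + (\<integral>y. (k y)\<^sup>2 * \<bar>corr w (z - y)\<bar> \<partial>lborel)) / 2 \<partial>lborel)"
  proof (rule integral_mono)
    show "integrable lborel (\<lambda>z. k z * (\<integral>y. k y * corr w (y - z) \<partial>lborel))"
      by (rule avg_second_moment(2)[OF w k k])
    show "integrable lborel (\<lambda>z. ((k z)\<^sup>2 * \<sigma> + (\<integral>y. (k y)\<^sup>2 * \<bar>corr w (z - y)\<bar> \<partial>lborel)) / 2)"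
      using k2 i2 by auto
    fix z
    have "k z * (\<integral>y. k y * corr w (y - z) \<partial>lborel) = (\<integral>y. k z * (k y * corr w (y - z)) \<partial>lborel)" by simp
    also have "\<dots> \<le> (\<integral>y. ((k z)\<^sup>2 * \<bar>corr w (y - z)\<bar> + (k y)\<^sup>2 * \<bar>corr w (z - y)\<bar>) / 2 \<partial>lborel)"
    proof (rule integral_mono)
      show "integrable lborel (\<lambda>y. k z * (k y * corr w (y - z)))"
        by (intro integrable_mult_right integrable_mult_bounded[OF k _ corr_le_zero[OF w]]) simp
      show "integrable lborel (\<lambda>y. ((k z)\<^sup>2 * \<bar>corr w (y - z)\<bar> + (k y)\<^sup>2 * \<bar>corr w (z - y)\<bar>) / 2)"
        using S' bk by auto
      fix y
      have "k z * (k y * corr w (y - z)) \<le> (\<bar>k z\<bar> * \<bar>k y\<bar>) * \<bar>corr w (y - z)\<bar>"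
        by (metis abs_ge_self abs_mult mult.assoc)
      also have "\<dots> \<le> (((k z)\<^sup>2 + (k y)\<^sup>2) / 2) * \<bar>corr w (y - z)\<bar>"
        using sum_squares_bound[of "\<bar>k z\<bar>" "\<bar>k y\<bar>"] by (intro mult_right_mono) auto
      also have "\<dots> = ((k z)\<^sup>2 * \<bar>corr w (y - z)\<bar> + (k y)\<^sup>2 * \<bar>corr w (z - y)\<bar>) / 2"
        unfolding sym[of z y] by (simp add: distrib_right)
      finally show "k z * (k y * corr w (y - z)) \<le> ((k z)\<^sup>2 * \<bar>corr w (y - z)\<bar> + (k y)\<^sup>2 * \<bar>corr w (z - y)\<bar>) / 2" .
    qed
    also have "\<dots> = ((k z)\<^sup>2 * \<sigma> + (\<integral>y. (k y)\<^sup>2 * \<bar>corr w (z - y)\<bar> \<partial>lborel)) / 2"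
      using S' bk by (simp add: \<sigma>')
    finally show "k z * (\<integral>y. k y * corr w (y - z) \<partial>lborel) \<le> ((k z)\<^sup>2 * \<sigma> + (\<integral>y. (k y)\<^sup>2 * \<bar>corr w (z - y)\<bar> \<partial>lborel)) / 2" .
  qed
  also have "\<dots> = (\<integral>y. (k y)\<^sup>2 \<partial>lborel) * \<sigma>"
    using k2 i2 v2 by simp
  finally show ?thesis by (simp add: \<sigma>_def)
qed

end

section \<open>Moments of the corrector\<close>

lemma lborel_integral_scale:
  fixes f :: "'a::euclidean_space \<Rightarrow> real"
  assumes [measurable]: "f \<in> borel_measurable borel" and c: "c > 0"
  shows "(\<integral>x. f x \<partial>lborel) = c ^ DIM('a) * (\<integral>x. f (c *\<^sub>R x) \<partial>lborel)"
proof -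
  have "(\<integral>x. f x \<partial>lborel) = (\<integral>x. f x \<partial>density (distr lborel borel (\<lambda>x. 0 + c *\<^sub>R x)) (\<lambda>_. ennreal (\<bar>c\<bar> ^ DIM('a))))"
    using lborel_affine[of c "0::'a"] c by (intro arg_cong2[where f = "integral\<^sup>L"]) auto
  also have "\<dots> = c ^ DIM('a) * (\<integral>x. f (c *\<^sub>R x) \<partial>lborel)"
    using c by (subst integral_density) (auto simp: integral_distr)
  finally show ?thesis .
qed

lemma heat_scale:
  fixes x :: "real^'d"
  assumes "t > 0"
  shows "sqrt t ^ CARD('d) * heat t (sqrt t *\<^sub>R x) = heat 1 x"
proof -
  have pos: "4 * pi * t > 0" "4 * pi * 1 > (0::real)" using assms by auto
  have "sqrt t * (1 / sqrt (4 * pi * t)) = 1 / sqrt (4 * pi * 1)"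
    using assms by (simp add: real_sqrt_mult)
  then have "sqrt t ^ CARD('d) * (1 / sqrt (4 * pi * t)) ^ CARD('d) = (1 / sqrt (4 * pi * 1)) ^ CARD('d)"
    by (metis power_mult_distrib)
  moreover have "- (norm (sqrt t *\<^sub>R x))\<^sup>2 / (4 * t) = - (norm x)\<^sup>2 / (4 * 1)"
    using assms by (simp add: power_mult_distrib)
  ultimately show ?thesis
    unfolding heat_def powr_minus_half_power[OF pos(1)] powr_minus_half_power[OF pos(2)]
    by (metis mult.assoc)
qed

context ergodic_translation_group
begin

lemma avg_has_derivative:
  assumes K: "C1_kernel K P D" and w: "bounded_rv B w" and \<omega>: "\<omega> \<in> space M"
  shows "((\<lambda>x. avg K w (\<tau> (- x) \<omega>)) has_derivative
      (\<lambda>h. \<Sum>i\<in>UNIV. h $ i *\<^sub>R avg (P i) w (\<tau> (- x) \<omega>))) (at x)"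
proof -
  note [measurable] = bounded_rvD(1)[OF w] \<omega>
  have "(\<lambda>z. w (\<tau> (- z) \<omega>)) \<in> borel_measurable borel" by measurable
  from convolution_has_derivative[OF K this, of B x] bounded_rvD(3)[OF w shift_space[OF \<omega>]]
  show ?thesis unfolding avg_shift[OF \<omega>] by simp
qed

text \<open>The expectation of a stationary field does not depend on the point at which it is evaluated,
  so the expectation of a derivative vanishes.\<close>

lemma stationary_integration_by_parts:
  assumes K: "C1_kernel K P D" and L: "C1_kernel L Q D'" and w: "bounded_rv B w"
  shows "(\<integral>\<omega>. avg (P i) w \<omega> * avg L w \<omega> \<partial>M) = - (\<integral>\<omega>. avg K w \<omega> * avg (Q i) w \<omega> \<partial>M)"
proof -
  have iK: "integrable lborel K" "integrable lborel L" using K L by (auto simp: C1_kernel_def)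
  note iP = C1_kernel_partial_integrable[OF K] C1_kernel_partial_integrable[OF L]
  define F where "F x \<omega> = avg K w (\<tau> (- x) \<omega>) * avg L w (\<tau> (- x) \<omega>)" for x \<omega>
  define F' where "F' j x \<omega> = avg (P j) w (\<tau> (- x) \<omega>) * avg L w (\<tau> (- x) \<omega>)
    + avg K w (\<tau> (- x) \<omega>) * avg (Q j) w (\<tau> (- x) \<omega>)" for j x \<omega>
  define Bd where "Bd k = B * (\<integral>y. \<bar>k y\<bar> \<partial>lborel)" for k :: "real^'d \<Rightarrow> real"
  have bd: "bounded_rv (Bd k) (avg k w)" if "integrable lborel k" for k
    unfolding Bd_def by (rule avg_bounded[OF w that])
  have bF': "bounded_rv (Bd (P j) * Bd L + Bd K * Bd (Q j)) (F' j x)" for j x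
    unfolding F'_def
    by (intro bounded_rv_add(1) bounded_rv_mult bounded_rv_shift bd iK iP)
  have bF: "bounded_rv (Bd K * Bd L) (F x)" for x
    unfolding F_def by (intro bounded_rv_mult bounded_rv_shift bd iK)
  define A where "A = (\<Sum>j\<in>UNIV. Bd (P j) * Bd L + Bd K * Bd (Q j))"
  have A: "\<bar>F' j x \<omega>\<bar> \<le> A" if "\<omega> \<in> space M" for j x \<omega>
  proof -
    have "\<bar>F' j x \<omega>\<bar> \<le> Bd (P j) * Bd L + Bd K * Bd (Q j)" by (rule bounded_rvD(3)[OF bF' that])
    also have "\<dots> \<le> A" unfolding A_def
      using bounded_rvD(2)[OF bF'] by (intro member_le_sum) auto
    finally show ?thesis .
  qed
  have "((\<lambda>x. \<integral>\<omega>. F x \<omega> \<partial>M) has_derivative (\<lambda>h. \<Sum>j\<in>UNIV. h $ j *\<^sub>R (\<integral>\<omega>. F' j 0 \<omega> \<partial>M))) (at 0)"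
  proof (rule has_derivative_integral_param[where D = "\<lambda>_. A"])
    fix x \<omega> assume \<omega>: "\<omega> \<in> space M"
    show "((\<lambda>x. F x \<omega>) has_derivative (\<lambda>h. \<Sum>j\<in>UNIV. h $ j *\<^sub>R F' j x \<omega>)) (at x)"
      unfolding F_def F'_def
      by (rule has_derivative_eq_rhs[OF has_derivative_mult[OF avg_has_derivative[OF K w \<omega>] avg_has_derivative[OF L w \<omega>]]])
        (simp add: sum_distrib_left sum_distrib_right sum.distrib[symmetric] distrib_left mult_ac add_ac)
  qed (use A bounded_rv_integrable[OF bF] bounded_rvD(1)[OF bF'] in auto)
  moreover have "(\<integral>\<omega>. F x \<omega> \<partial>M) = (\<integral>\<omega>. avg K w \<omega> * avg L w \<omega> \<partial>M)" for x
  proof -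
    have "(\<lambda>\<omega>. avg K w \<omega> * avg L w \<omega>) \<in> borel_measurable M"
      using bounded_rvD(1)[OF bd[OF iK(1)]] bounded_rvD(1)[OF bd[OF iK(2)]] by measurable
    from shift_expectation[OF this, of "- x"] show ?thesis by (simp add: F_def)
  qed
  ultimately have "((\<lambda>x::real^'d. (\<integral>\<omega>. avg K w \<omega> * avg L w \<omega> \<partial>M)) has_derivative (\<lambda>h. \<Sum>j\<in>UNIV. h $ j *\<^sub>R (\<integral>\<omega>. F' j 0 \<omega> \<partial>M))) (at 0)"
    by simp
  moreover have "((\<lambda>x::real^'d. (\<integral>\<omega>. avg K w \<omega> * avg L w \<omega> \<partial>M)) has_derivative (\<lambda>h. 0)) (at 0)" by simp
  ultimately have "(\<lambda>h::real^'d. \<Sum>j\<in>UNIV. h $ j *\<^sub>R (\<integral>\<omega>. F' j 0 \<omega> \<partial>M)) = (\<lambda>h. 0)"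
    by (rule has_derivative_unique)
  then have "(\<Sum>j\<in>UNIV. (axis i 1 :: real^'d) $ j *\<^sub>R (\<integral>\<omega>. F' j 0 \<omega> \<partial>M)) = 0" by meson
  moreover have "(\<Sum>j\<in>UNIV. (axis i 1 :: real^'d) $ j *\<^sub>R (\<integral>\<omega>. F' j 0 \<omega> \<partial>M))
      = (\<Sum>j\<in>UNIV. if j = i then (\<integral>\<omega>. F' j 0 \<omega> \<partial>M) else 0)"
    by (intro sum.cong) (auto simp: axis_def)
  ultimately have "(\<integral>\<omega>. F' i 0 \<omega> \<partial>M) = 0" by simp
  moreover have "(\<integral>\<omega>. F' i 0 \<omega> \<partial>M) = (\<integral>\<omega>. avg (P i) w \<omega> * avg L w \<omega> + avg K w \<omega> * avg (Q i) w \<omega> \<partial>M)"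
    by (intro Bochner_Integration.integral_cong) (auto simp: F'_def translation_zero)
  moreover have "\<dots> = (\<integral>\<omega>. avg (P i) w \<omega> * avg L w \<omega> \<partial>M) + (\<integral>\<omega>. avg K w \<omega> * avg (Q i) w \<omega> \<partial>M)"
    by (intro Bochner_Integration.integral_add bounded_rv_integrable[OF bounded_rv_mult[OF bd bd]] iK iP)
  ultimately show ?thesis by simp
qed

lemma square_integrable_rv: "bounded_rv B w \<Longrightarrow> integrable M (\<lambda>\<omega>. (w \<omega>)\<^sup>2)"
  using bounded_rv_integrable[OF bounded_rv_mult[of B w B w]] by (simp add: power2_eq_square)

text \<open>The Green kernel is split at time \<open>1\<close>. The part of short times has mass at most \<open>1\<close>, the part of long
  times is bounded and has an \<open>L\<^sup>2\<close> norm of controlled growth. In the second claim \<open>q\<close> will be a heat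
  kernel; then no growth occurs.\<close>

lemma near_far_moments:
  assumes d: "CARD('d) \<ge> 3" and \<delta>: "0 < \<delta>" "\<delta> \<le> 1" and T: "1 \<le> T" and w: "bounded_rv B w"
    and S: "integrable lborel (corr w)"
  shows "(\<integral>\<omega>. (avg (green \<delta> T) w \<omega>)\<^sup>2 \<partial>M) \<le> 2 * corr w 0 + 12 * growth CARD('d) T * (\<integral>x. \<bar>corr w x\<bar> \<partial>lborel)"
    and "integrable lborel q \<Longrightarrow> (\<integral>y. \<bar>q y\<bar> \<partial>lborel) \<le> 1 \<Longrightarrow>
      \<bar>\<integral>\<omega>. avg (green \<delta> T) w \<omega> * avg q w \<omega> \<partial>M\<bar> \<le> corr w 0 + 2 * (\<integral>x. \<bar>corr w x\<bar> \<partial>lborel)"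
proof -
  let ?\<sigma> = "\<integral>x. \<bar>corr w x\<bar> \<partial>lborel"
  have \<sigma>: "?\<sigma> \<ge> 0" by simp
  have S0: "corr w 0 \<ge> 0" using corr_le_zero[OF w, of 0] by simp
  have g: "integrable lborel (green \<delta> 1 :: real^'d \<Rightarrow> real)" "integrable lborel (green 1 T :: real^'d \<Rightarrow> real)"
    using \<delta> T by (auto intro: green_integrable)
  have near: "(\<integral>y. \<bar>green \<delta> 1 (y :: real^'d)\<bar> \<partial>lborel) \<le> 1" "0 \<le> (\<integral>y. \<bar>green \<delta> 1 (y :: real^'d)\<bar> \<partial>lborel)"
    using \<delta> green_integral[of \<delta> 1, where 'd = 'd] by (auto simp: green_nonneg)
  note b = avg_bounded[OF w g(1)] avg_bounded[OF w g(2)]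
  have split: "avg (green \<delta> T) w \<omega> = avg (green \<delta> 1) w \<omega> + avg (green 1 T) w \<omega>" if "\<omega> \<in> space M" for \<omega>
  proof -
    have "green \<delta> T = (\<lambda>y :: real^'d. green \<delta> 1 y + green 1 T y)"
      using green_add[OF \<delta> T] by (intro ext)
    then show ?thesis using avg_add(1)[OF w g that] by simp
  qed
  have "(\<integral>\<omega>. (avg (green \<delta> T) w \<omega>)\<^sup>2 \<partial>M)
      \<le> (\<integral>\<omega>. 2 * (avg (green \<delta> 1) w \<omega>)\<^sup>2 + 2 * (avg (green 1 T) w \<omega>)\<^sup>2 \<partial>M)"
    using b[THEN square_integrable_rv] square_integrable_rv[OF avg_bounded[OF w green_integrable[of \<delta> T]]] \<delta> T
    by (intro integral_mono) (auto simp: split square_sum_le)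
  also have "\<dots> = 2 * (\<integral>\<omega>. (avg (green \<delta> 1) w \<omega>)\<^sup>2 \<partial>M) + 2 * (\<integral>\<omega>. (avg (green 1 T) w \<omega>)\<^sup>2 \<partial>M)"
    using b[THEN square_integrable_rv] by simp
  also have "\<dots> \<le> 2 * corr w 0 + 2 * (6 * growth CARD('d) T * ?\<sigma>)"
  proof (intro add_mono mult_left_mono)
    have "(\<integral>\<omega>. (avg (green \<delta> 1) w \<omega>)\<^sup>2 \<partial>M) \<le> corr w 0 * (\<integral>y. \<bar>green \<delta> 1 (y :: real^'d)\<bar> \<partial>lborel) * (\<integral>y. \<bar>green \<delta> 1 (y :: real^'d)\<bar> \<partial>lborel)"
      using avg_second_moment_L1[OF w g(1) g(1)] by (simp add: power2_eq_square)
    also have "\<dots> \<le> corr w 0 * 1 * 1" using near S0 by (intro mult_mono mult_left_mono) auto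
    finally show "(\<integral>\<omega>. (avg (green \<delta> 1) w \<omega>)\<^sup>2 \<partial>M) \<le> corr w 0" by simp
    have "(\<integral>\<omega>. (avg (green 1 T) w \<omega>)\<^sup>2 \<partial>M) \<le> (\<integral>y. (green 1 T (y :: real^'d))\<^sup>2 \<partial>lborel) * ?\<sigma>"
      by (rule avg_square_L2[OF w g(2) green_square_integrable[OF d T] S])
    also have "\<dots> \<le> 6 * growth CARD('d) T * ?\<sigma>"
      by (intro mult_right_mono green_square_integral[OF d T] \<sigma>)
    finally show "(\<integral>\<omega>. (avg (green 1 T) w \<omega>)\<^sup>2 \<partial>M) \<le> 6 * growth CARD('d) T * ?\<sigma>" .
  qed auto
  finally show "(\<integral>\<omega>. (avg (green \<delta> T) w \<omega>)\<^sup>2 \<partial>M) \<le> 2 * corr w 0 + 12 * growth CARD('d) T * ?\<sigma>"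
    by simp
  assume q: "integrable lborel q" "(\<integral>y. \<bar>q y\<bar> \<partial>lborel) \<le> 1"
  have q0: "0 \<le> (\<integral>y. \<bar>q y\<bar> \<partial>lborel)" by simp
  note bq = avg_bounded[OF w q(1)]
  have "(\<integral>\<omega>. avg (green \<delta> T) w \<omega> * avg q w \<omega> \<partial>M)
      = (\<integral>\<omega>. avg (green \<delta> 1) w \<omega> * avg q w \<omega> + avg (green 1 T) w \<omega> * avg q w \<omega> \<partial>M)"
    by (intro Bochner_Integration.integral_cong) (auto simp: split distrib_right)
  also have "\<dots> = (\<integral>\<omega>. avg (green \<delta> 1) w \<omega> * avg q w \<omega> \<partial>M) + (\<integral>\<omega>. avg (green 1 T) w \<omega> * avg q w \<omega> \<partial>M)"
    using b bq by (intro Bochner_Integration.integral_add) (auto intro: bounded_rv_integrable bounded_rv_mult)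
  also have "\<bar>\<dots>\<bar> \<le> corr w 0 * 1 * 1 + 2 * ?\<sigma> * 1"
  proof (rule order_trans[OF abs_triangle_ineq add_mono])
    show "\<bar>\<integral>\<omega>. avg (green \<delta> 1) w \<omega> * avg q w \<omega> \<partial>M\<bar> \<le> corr w 0 * 1 * 1"
      by (rule order_trans[OF avg_second_moment_L1[OF w g(1) q(1)]])
        (use near S0 q q0 in \<open>intro mult_mono; auto\<close>)
    show "\<bar>\<integral>\<omega>. avg (green 1 T) w \<omega> * avg q w \<omega> \<partial>M\<bar> \<le> 2 * ?\<sigma> * 1"
    proof (rule order_trans[OF avg_second_moment_sup[OF w g(2) q(1) S]])
      show "\<bar>green 1 T y\<bar> \<le> 2" for y :: "real^'d" using green_le[OF d T, of y] by (simp add: green_nonneg)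
      show "2 * ?\<sigma> * (\<integral>y. \<bar>q y\<bar> \<partial>lborel) \<le> 2 * ?\<sigma> * 1" using q \<sigma> by (intro mult_left_mono) auto
    qed
  qed
  finally show "\<bar>\<integral>\<omega>. avg (green \<delta> T) w \<omega> * avg q w \<omega> \<partial>M\<bar> \<le> corr w 0 + 2 * ?\<sigma>" by simp
qed

text \<open>Integrating by parts turns the second moment of the gradient of \<open>\<psi>\<close> into the correlation of \<open>\<psi>\<close> with
  \<open>- \<Delta> \<psi>\<close>, which is a difference of heat averages. The bound does not grow with \<open>T\<close> other than
  through \<open>w\<close>.\<close>

lemma corrector_gradient:
  assumes d: "CARD('d) \<ge> 3" and \<delta>: "0 < \<delta>" "\<delta> \<le> 1" and T: "1 \<le> T" and w: "bounded_rv B w"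
    and S: "integrable lborel (corr w)"
  shows "(\<Sum>i\<in>UNIV. \<integral>\<omega>. (avg (green1 \<delta> T i) w \<omega>)\<^sup>2 \<partial>M) \<le> 2 * corr w 0 + 4 * (\<integral>x. \<bar>corr w x\<bar> \<partial>lborel)"
proof -
  have T': "\<delta> \<le> T" "T > 0" using \<delta> T by auto
  obtain D where D: "C1_kernel (green \<delta> T :: real^'d \<Rightarrow> real) (green1 \<delta> T) D"
    using green_C1_kernel[OF \<delta>(1) T'(1)] by blast
  have D1: "\<exists>D. C1_kernel (green1 \<delta> T i :: real^'d \<Rightarrow> real) (green2 \<delta> T i) D" for i
    using green1_C1_kernel[OF \<delta>(1) T'(1)] by blast
  have ig: "integrable lborel (green \<delta> T :: real^'d \<Rightarrow> real)" using D by (simp add: C1_kernel_def)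
  have i2: "integrable lborel (green2 \<delta> T i j :: real^'d \<Rightarrow> real)" for i j
    using D1[of i] C1_kernel_partial_integrable by blast
  have h: "integrable lborel (heat \<delta> :: real^'d \<Rightarrow> real)" "integrable lborel (heat T :: real^'d \<Rightarrow> real)"
    using \<delta> T' by (auto intro: heat_integrable)
  have hn: "(\<integral>y. \<bar>heat \<delta> (y :: real^'d)\<bar> \<partial>lborel) \<le> 1" "(\<integral>y. \<bar>heat T (y :: real^'d)\<bar> \<partial>lborel) \<le> 1"
    using \<delta> T' by (auto simp: heat_nonneg heat_integral)
  note bg = avg_bounded[OF w ig]
  have "(\<Sum>i\<in>UNIV. \<integral>\<omega>. (avg (green1 \<delta> T i) w \<omega>)\<^sup>2 \<partial>M)
      = (\<Sum>i\<in>UNIV. - (\<integral>\<omega>. avg (green \<delta> T) w \<omega> * avg (green2 \<delta> T i i) w \<omega> \<partial>M))"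
  proof (rule sum.cong[OF refl])
    fix i
    obtain D' where "C1_kernel (green1 \<delta> T i :: real^'d \<Rightarrow> real) (green2 \<delta> T i) D'" using D1 by blast
    from stationary_integration_by_parts[OF D this w, of i]
    show "(\<integral>\<omega>. (avg (green1 \<delta> T i) w \<omega>)\<^sup>2 \<partial>M) = - (\<integral>\<omega>. avg (green \<delta> T) w \<omega> * avg (green2 \<delta> T i i) w \<omega> \<partial>M)"
      by (simp add: power2_eq_square)
  qed
  also have "\<dots> = - (\<integral>\<omega>. (\<Sum>i\<in>UNIV. avg (green \<delta> T) w \<omega> * avg (green2 \<delta> T i i) w \<omega>) \<partial>M)"
    unfolding sum_negf
    by (subst Bochner_Integration.integral_sum)
      (auto intro!: bounded_rv_integrable[OF bounded_rv_mult[OF bg avg_bounded[OF w i2]]])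
  also have "(\<integral>\<omega>. (\<Sum>i\<in>UNIV. avg (green \<delta> T) w \<omega> * avg (green2 \<delta> T i i) w \<omega>) \<partial>M)
      = (\<integral>\<omega>. avg (green \<delta> T) w \<omega> * avg (heat T) w \<omega> - avg (green \<delta> T) w \<omega> * avg (heat \<delta>) w \<omega> \<partial>M)"
  proof (intro Bochner_Integration.integral_cong refl)
    fix \<omega> assume \<omega>: "\<omega> \<in> space M"
    have "(\<Sum>i\<in>UNIV. avg (green2 \<delta> T i i) w \<omega>) = avg (\<lambda>y. \<Sum>i\<in>UNIV. green2 \<delta> T i i y) w \<omega>"
      unfolding avg_def sum_distrib_right
      by (rule Bochner_Integration.integral_sum[symmetric]) (rule avg_integrand_integrable[OF w i2 \<omega>])
    also have "\<dots> = avg (\<lambda>y. heat T y - heat \<delta> y) w \<omega>"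
      by (simp only: green_laplacian[OF \<delta>(1) T'(1)])
    also have "\<dots> = avg (heat T) w \<omega> - avg (heat \<delta>) w \<omega>" by (rule avg_add(2)[OF w h(2,1) \<omega>])
    finally show "(\<Sum>i\<in>UNIV. avg (green \<delta> T) w \<omega> * avg (green2 \<delta> T i i) w \<omega>)
        = avg (green \<delta> T) w \<omega> * avg (heat T) w \<omega> - avg (green \<delta> T) w \<omega> * avg (heat \<delta>) w \<omega>"
      unfolding sum_distrib_left[symmetric] by (simp add: right_diff_distrib)
  qed
  also have "\<dots> = (\<integral>\<omega>. avg (green \<delta> T) w \<omega> * avg (heat T) w \<omega> \<partial>M) - (\<integral>\<omega>. avg (green \<delta> T) w \<omega> * avg (heat \<delta>) w \<omega> \<partial>M)"
    by (intro Bochner_Integration.integral_diff bounded_rv_integrable[OF bounded_rv_mult[OF bg avg_bounded[OF w]]] h)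
  finally show ?thesis
    using near_far_moments(2)[OF d \<delta> T w S h(1) hn(1)] near_far_moments(2)[OF d \<delta> T w S h(2) hn(2)] by linarith
qed

lemma heat_average_square:
  assumes T: "T > 0" and w: "bounded_rv B w" and S: "integrable lborel (corr w)"
  shows "(\<integral>\<omega>. (avg (heat T) w \<omega>)\<^sup>2 \<partial>M) \<le> T powr (- (real CARD('d) / 2)) * (\<integral>x. \<bar>corr w x\<bar> \<partial>lborel)"
proof -
  have "\<bar>heat T y\<bar> \<le> T powr (- (real CARD('d) / 2))" for y :: "real^'d"
    using heat_le[OF T, of y] by (simp add: heat_nonneg)
  from avg_second_moment_sup[OF w heat_integrable[OF T] heat_integrable[OF T] S this]
  show ?thesis using heat_integral[OF T, where 'd = 'd] by (simp add: power2_eq_square heat_nonneg)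
qed

lemma heat_average_corr_tendsto:
  assumes w: "bounded_rv B w" and s: "s \<longlonglongrightarrow> 0" "\<And>n. s n > 0"
  shows "(\<lambda>n. \<integral>y. heat (s n) y * corr w y \<partial>lborel) \<longlonglongrightarrow> corr w 0"
proof -
  note [measurable] = corr_measurable[OF w]
  have "(\<integral>y. heat t y * corr w y \<partial>lborel) = (\<integral>y. heat 1 y * corr w (sqrt t *\<^sub>R y) \<partial>lborel)" if t: "t > 0" for t
  proof -
    have "(\<integral>y. heat t y * corr w y \<partial>lborel) = sqrt t ^ CARD('d) * (\<integral>y. heat t (sqrt t *\<^sub>R y) * corr w (sqrt t *\<^sub>R y) \<partial>lborel)"
      using lborel_integral_scale[of "\<lambda>y. heat t y * corr w y" "sqrt t"] t by simp
    also have "\<dots> = (\<integral>y. (sqrt t ^ CARD('d) * heat t (sqrt t *\<^sub>R y)) * corr w (sqrt t *\<^sub>R y) \<partial>lborel)"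
      by (simp only: mult.assoc Bochner_Integration.integral_mult_right_zero)
    finally show ?thesis by (simp only: heat_scale[OF t])
  qed
  then have eq: "(\<lambda>n. \<integral>y. heat (s n) y * corr w y \<partial>lborel) = (\<lambda>n. \<integral>y. heat 1 y * corr w (sqrt (s n) *\<^sub>R y) \<partial>lborel)"
    using s by simp
  have "(\<lambda>n. \<integral>y. heat 1 y * corr w (sqrt (s n) *\<^sub>R y) \<partial>lborel) \<longlonglongrightarrow> (\<integral>y. heat 1 (y :: real^'d) * corr w 0 \<partial>lborel)"
  proof (rule integral_dominated_convergence[where w = "\<lambda>y. heat 1 y * corr w 0"])
    show "AE y in lborel. (\<lambda>n. heat 1 y * corr w (sqrt (s n) *\<^sub>R y)) \<longlonglongrightarrow> heat 1 y * corr w 0"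
    proof (rule AE_I2)
      fix y :: "real^'d"
      have "(\<lambda>n. sqrt (s n) *\<^sub>R y) \<longlonglongrightarrow> sqrt 0 *\<^sub>R y" by (intro tendsto_intros s)
      then have "(\<lambda>n. sqrt (s n) *\<^sub>R y) \<longlonglongrightarrow> 0" by simp
      then show "(\<lambda>n. heat 1 y * corr w (sqrt (s n) *\<^sub>R y)) \<longlonglongrightarrow> heat 1 y * corr w 0"
        by (intro tendsto_intros isCont_tendsto_compose[OF corr_continuous[OF w]])
    qed
    show "AE y in lborel. norm (heat 1 y * corr w (sqrt (s n) *\<^sub>R y)) \<le> heat 1 y * corr w 0" for n
      using corr_le_zero[OF w] by (auto simp: abs_mult heat_nonneg intro!: mult_left_mono)
  qed (auto intro!: integrable_mult_left heat_integrable)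
  then show ?thesis unfolding eq by (simp add: heat_integral)
qed

text \<open>Expanding the square leaves \<open>2 R(0)\<close> minus twice the heat average of the correlation, at most, and the
  latter tends to \<open>R(0)\<close> by continuity.\<close>

lemma small_time_average:
  assumes w: "bounded_rv B w" and e: "e > 0" and r: "r > 0"
  obtains \<delta> where "0 < \<delta>" "\<delta> \<le> r" "(\<integral>\<omega>. (w \<omega> - avg (heat \<delta>) w \<omega>)\<^sup>2 \<partial>M) \<le> e"
proof -
  define s where "s n = r * inverse (real (Suc n))" for n
  have s: "s n > 0" "s n \<le> r" for n using r by (auto simp: s_def field_simps)
  have s0: "s \<longlonglongrightarrow> 0" unfolding s_def using tendsto_mult_right_zero[OF LIMSEQ_inverse_real_of_nat] by simp
  from heat_average_corr_tendsto[OF w s0 s(1)] e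
  have "eventually (\<lambda>n. (\<integral>y. heat (s n) y * corr w y \<partial>lborel) > corr w 0 - e / 2) sequentially"
    by (intro order_tendstoD(1)) auto
  then obtain n where n: "(\<integral>y. heat (s n) y * corr w y \<partial>lborel) > corr w 0 - e / 2"
    using eventually_happens'[OF sequentially_bot] by blast
  let ?p = "heat (s n) :: real^'d \<Rightarrow> real"
  note h = heat_integrable[OF s(1)[of n], where 'd = 'd]
  note bp = avg_bounded[OF w h]
  have "(\<integral>\<omega>. w \<omega> * avg ?p w \<omega> \<partial>M) = (\<integral>y. ?p y * corr w y \<partial>lborel)"
  proof -
    have "(\<integral>\<omega>. w \<omega> * w (\<tau> z \<omega>) \<partial>M) = corr w z" for z
    proof -
      have "(\<integral>\<omega>. w \<omega> * w (\<tau> z \<omega>) \<partial>M) = (\<integral>\<omega>. w (\<tau> 0 \<omega>) * w (\<tau> z \<omega>) \<partial>M)"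
        by (intro Bochner_Integration.integral_cong) (auto simp: translation_zero)
      also have "\<dots> = corr w z" using corr_eq[OF w, of 0 z] corr_even[OF w, of z] by simp
      finally show ?thesis .
    qed
    then show ?thesis using avg_expectation(1)[OF w w h] by simp
  qed
  moreover have "(\<integral>\<omega>. (avg ?p w \<omega>)\<^sup>2 \<partial>M) \<le> corr w 0"
    using avg_second_moment_L1[OF w h h] heat_integral[OF s(1)[of n], where 'd = 'd]
    by (simp add: power2_eq_square heat_nonneg)
  moreover have "(\<integral>\<omega>. (w \<omega> - avg ?p w \<omega>)\<^sup>2 \<partial>M)
      = (\<integral>\<omega>. (w \<omega>)\<^sup>2 \<partial>M) - 2 * (\<integral>\<omega>. w \<omega> * avg ?p w \<omega> \<partial>M) + (\<integral>\<omega>. (avg ?p w \<omega>)\<^sup>2 \<partial>M)"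
    using square_integrable_rv[OF w] square_integrable_rv[OF bp] bounded_rv_integrable[OF bounded_rv_mult[OF w bp]]
    by (simp add: power2_diff mult.assoc)
  ultimately have "(\<integral>\<omega>. (w \<omega> - avg ?p w \<omega>)\<^sup>2 \<partial>M) \<le> e"
    using n corr_zero[OF w] by linarith
  then show ?thesis using that s[of n] by blast
qed

end

section \<open>Covariance of the quadratic corrector\<close>

lemma measurable_uncurry3:
  assumes F: "(\<lambda>(x, y, z). F x y z) \<in> borel_measurable (lborel \<Otimes>\<^sub>M lborel \<Otimes>\<^sub>M lborel)"
    and f: "f \<in> N \<rightarrow>\<^sub>M lborel" and g: "g \<in> N \<rightarrow>\<^sub>M lborel" and h: "h \<in> N \<rightarrow>\<^sub>M lborel"
  shows "(\<lambda>p. F (f p) (g p) (h p)) \<in> borel_measurable N"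
  using measurable_compose[OF measurable_Pair[OF f measurable_Pair[OF g h]] F] by simp

text \<open>In each of the eight terms, the substitutions that decouple the arguments of \<open>g\<close> are translations
  and reflections, so every factor contributes its own integral.\<close>

lemma kernel_product_integral:
  fixes a k g :: "real^'d \<Rightarrow> ennreal" and c :: ennreal
  assumes [measurable]: "a \<in> borel_measurable borel" "k \<in> borel_measurable borel" "g \<in> borel_measurable borel"
  defines "A \<equiv> \<integral>\<^sup>+x. a x \<partial>lborel" and "\<kappa> \<equiv> \<integral>\<^sup>+x. k x \<partial>lborel" and "\<gamma> \<equiv> \<integral>\<^sup>+x. g x \<partial>lborel"
  shows "(\<integral>\<^sup>+x. \<integral>\<^sup>+z. \<integral>\<^sup>+y. a y * a z * c * (g x + g (z - y - x) + g (x - z) + g (x + y))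
      + (k y + k z) * (g x * g (z - y - x) + g (x - z) * g (x + y)) \<partial>lborel \<partial>lborel \<partial>lborel)
    = 4 * (c * A * A * \<gamma>) + 4 * (\<kappa> * \<gamma> * \<gamma>)"
proof -
  have g1: "(\<integral>\<^sup>+x. g (u - x) \<partial>lborel) = \<gamma>" for u
    using lborel_nn_integral_reflect[of g u] by (simp add: \<gamma>_def)
  have g2: "(\<integral>\<^sup>+x. g (u + x) \<partial>lborel) = \<gamma>" for u
    using lborel_nn_integral_translate[of g u] by (simp add: \<gamma>_def)
  have g3: "(\<integral>\<^sup>+x. g (x + u) \<partial>lborel) = \<gamma>" for u using g2[of u] by (simp add: add.commute)
  have g4: "(\<integral>\<^sup>+x. g (x - u) \<partial>lborel) = \<gamma>" for u using g3[of "- u"] by simp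
  have g5: "(\<integral>\<^sup>+y. g (u - y - v) \<partial>lborel) = \<gamma>" for u v
  proof -
    have "(\<lambda>y. g (u - y - v)) = (\<lambda>y. g ((u - v) - y))" by (simp add: algebra_simps)
    then show ?thesis using g1 by simp
  qed
  have g6: "(\<integral>\<^sup>+z. g (z - u - v) \<partial>lborel) = \<gamma>" for u v
    using g4[of "u + v"] by (simp add: diff_diff_eq)
  have g0: "(\<integral>\<^sup>+x. g x \<partial>lborel) = \<gamma>" by (simp add: \<gamma>_def)
  have k0: "(\<integral>\<^sup>+x. k x \<partial>lborel) = \<kappa>" "(\<integral>\<^sup>+x. a x \<partial>lborel) = A" by (auto simp: \<kappa>_def A_def)
  have m0: "a \<in> borel_measurable lborel" "k \<in> borel_measurable lborel" "g \<in> borel_measurable lborel" by auto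
  have mg: "(\<lambda>z. g (u - z)) \<in> borel_measurable lborel" "(\<lambda>y. g (u + y)) \<in> borel_measurable lborel"
    "(\<lambda>x. g (x - u)) \<in> borel_measurable lborel" "(\<lambda>y. g (u - y - v)) \<in> borel_measurable lborel"
    "(\<lambda>y. g (y - u - v)) \<in> borel_measurable lborel" for u v by measurable
  have cc: "(\<integral>\<^sup>+z. p * (q * f z) \<partial>lborel) = p * (q * (\<integral>\<^sup>+z. f z \<partial>lborel))"
    and cl: "(\<integral>\<^sup>+z. p * (f z * q) \<partial>lborel) = p * ((\<integral>\<^sup>+z. f z \<partial>lborel) * q)"
    if [measurable]: "f \<in> borel_measurable lborel" for p q and f :: "real^'d \<Rightarrow> ennreal"
    by (simp_all add: nn_integral_cmult nn_integral_multc)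
  note G = g0 g1 g2 g3 g4 g5 g6 k0
  let ?I = "\<lambda>F. \<integral>\<^sup>+x. \<integral>\<^sup>+z. \<integral>\<^sup>+y. F x y z \<partial>lborel \<partial>lborel \<partial>(lborel :: (real^'d) measure)"
  have swap_in: "?I F = (\<integral>\<^sup>+x. \<integral>\<^sup>+y. \<integral>\<^sup>+z. F x y z \<partial>lborel \<partial>lborel \<partial>lborel)"
    if "\<And>x. (\<lambda>(y, z). F x y z) \<in> borel_measurable (lborel \<Otimes>\<^sub>M lborel)" for F :: "real^'d \<Rightarrow> real^'d \<Rightarrow> real^'d \<Rightarrow> ennreal"
    by (rule nn_integral_cong, rule lborel_pair.Fubini', rule that)
  have swap_out: "?I F = (\<integral>\<^sup>+z. \<integral>\<^sup>+y. \<integral>\<^sup>+x. F x y z \<partial>lborel \<partial>lborel \<partial>lborel)"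
    if F: "(\<lambda>(x, y, z). F x y z) \<in> borel_measurable (lborel \<Otimes>\<^sub>M lborel \<Otimes>\<^sub>M lborel)" for F :: "real^'d \<Rightarrow> real^'d \<Rightarrow> real^'d \<Rightarrow> ennreal"
  proof -
    note [measurable (raw)] = measurable_uncurry3[OF F]
    have m: "(\<lambda>(z, x). \<integral>\<^sup>+y. F x y z \<partial>lborel) \<in> borel_measurable (lborel \<Otimes>\<^sub>M lborel)"
      by measurable
    have "?I F = (\<integral>\<^sup>+z. \<integral>\<^sup>+x. \<integral>\<^sup>+y. F x y z \<partial>lborel \<partial>lborel \<partial>lborel)"
      by (rule lborel_pair.Fubini'[OF m])
    also have "\<dots> = (\<integral>\<^sup>+z. \<integral>\<^sup>+y. \<integral>\<^sup>+x. F x y z \<partial>lborel \<partial>lborel \<partial>lborel)"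
    proof (rule nn_integral_cong)
      fix z
      have "(\<lambda>(y, x). F x y z) \<in> borel_measurable (lborel \<Otimes>\<^sub>M lborel)" by measurable
      then show "(\<integral>\<^sup>+x. \<integral>\<^sup>+y. F x y z \<partial>lborel \<partial>lborel) = (\<integral>\<^sup>+y. \<integral>\<^sup>+x. F x y z \<partial>lborel \<partial>lborel)"
        by (rule lborel_pair.Fubini')
    qed
    finally show ?thesis .
  qed
  have N: "?I (\<lambda>x y z. a y * a z * c * h x y z) = c * A * A * \<gamma>"
    if mh: "(\<lambda>(x, y, z). h x y z) \<in> borel_measurable (lborel \<Otimes>\<^sub>M lborel \<Otimes>\<^sub>M lborel)"
      and h: "\<And>y z. (\<integral>\<^sup>+x. h x y z \<partial>lborel) = \<gamma>" for h :: "real^'d \<Rightarrow> real^'d \<Rightarrow> real^'d \<Rightarrow> ennreal"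
  proof -
    have hm: "(\<lambda>x. h x y z) \<in> borel_measurable lborel" for y z
      by (rule measurable_uncurry3[OF mh]) auto
    have "(\<lambda>(x, y, z). a y * a z * c * h x y z) \<in> borel_measurable (lborel \<Otimes>\<^sub>M lborel \<Otimes>\<^sub>M lborel)"
      unfolding case_prod_beta'
      by (intro borel_measurable_times_ennreal measurable_uncurry3[OF mh]) measurable
    then have "?I (\<lambda>x y z. a y * a z * c * h x y z) = (\<integral>\<^sup>+z. \<integral>\<^sup>+y. \<integral>\<^sup>+x. a y * a z * c * h x y z \<partial>lborel \<partial>lborel \<partial>lborel)"
      by (rule swap_out)
    also have "\<dots> = (\<integral>\<^sup>+z. \<integral>\<^sup>+y. a y * (a z * c * \<gamma>) \<partial>lborel \<partial>lborel)"
      by (simp only: nn_integral_cmult[OF hm] h) (simp only: mult.assoc)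
    also have "\<dots> = (\<integral>\<^sup>+z. A * (a z * (c * \<gamma>)) \<partial>lborel)"
      by (simp only: nn_integral_multc[OF m0(1)] k0 mult.assoc)
    also have "\<dots> = A * (A * (c * \<gamma>))" by (simp only: cl[OF m0(1)] k0)
    also have "\<dots> = c * A * A * \<gamma>" by (simp only: mult_ac)
    finally show ?thesis .
  qed
  have T1: "?I (\<lambda>x y z. k y * (g x * g (z - y - x))) = \<kappa> * \<gamma> * \<gamma>"
  proof -
    have "?I (\<lambda>x y z. k y * (g x * g (z - y - x))) = (\<integral>\<^sup>+x. \<integral>\<^sup>+y. \<integral>\<^sup>+z. k y * (g x * g (z - y - x)) \<partial>lborel \<partial>lborel \<partial>lborel)"
      by (rule swap_in) measurable
    also have "\<dots> = \<kappa> * (\<gamma> * \<gamma>)"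
      by (simp only: cc[OF mg(5)] g6 nn_integral_multc[OF m0(2)] k0 cl[OF m0(3)] g0)
    finally show ?thesis by (simp only: mult.assoc)
  qed
  have T2: "?I (\<lambda>x y z. k z * (g x * g (z - y - x))) = \<kappa> * \<gamma> * \<gamma>"
    by (simp only: cc[OF mg(4)] g5 nn_integral_multc[OF m0(2)] k0 cl[OF m0(3)] g0 mult.assoc)
  have sw: "(\<integral>\<^sup>+x. \<integral>\<^sup>+y. k y * h x y \<partial>lborel \<partial>lborel) = \<kappa> * \<gamma>"
    if m: "(\<lambda>(y, x). k y * h x y) \<in> borel_measurable (lborel \<Otimes>\<^sub>M lborel)"
      and m': "\<And>y. (\<lambda>x. h x y) \<in> borel_measurable lborel"
      and h: "\<And>y. (\<integral>\<^sup>+x. h x y \<partial>lborel) = \<gamma>" for h :: "real^'d \<Rightarrow> real^'d \<Rightarrow> ennreal"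
  proof -
    have "(\<integral>\<^sup>+x. \<integral>\<^sup>+y. k y * h x y \<partial>lborel \<partial>lborel) = (\<integral>\<^sup>+y. \<integral>\<^sup>+x. k y * h x y \<partial>lborel \<partial>lborel)"
      by (rule lborel_pair.Fubini'[OF m])
    also have "\<dots> = \<kappa> * \<gamma>" by (simp only: nn_integral_cmult[OF m'] h nn_integral_multc[OF m0(2)] k0)
    finally show ?thesis .
  qed
  have T3: "?I (\<lambda>x y z. k y * (g (x - z) * g (x + y))) = \<kappa> * \<gamma> * \<gamma>"
  proof -
    have "?I (\<lambda>x y z. k y * (g (x - z) * g (x + y))) = (\<integral>\<^sup>+x. \<integral>\<^sup>+y. \<integral>\<^sup>+z. k y * (g (x - z) * g (x + y)) \<partial>lborel \<partial>lborel \<partial>lborel)"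
      by (rule swap_in) measurable
    also have "\<dots> = (\<integral>\<^sup>+x. \<integral>\<^sup>+y. \<gamma> * (k y * g (x + y)) \<partial>lborel \<partial>lborel)"
      by (simp only: cl[OF mg(1)] g1 mult.left_commute)
    also have "\<dots> = \<gamma> * (\<integral>\<^sup>+x. \<integral>\<^sup>+y. k y * g (x + y) \<partial>lborel \<partial>lborel)"
      by ((subst nn_integral_cmult, measurable)+)
    also have "(\<integral>\<^sup>+x. \<integral>\<^sup>+y. k y * g (x + y) \<partial>lborel \<partial>lborel) = \<kappa> * \<gamma>"
      by (rule sw) (measurable, rule g3)
    finally show ?thesis by (simp only: mult_ac)
  qed
  have T4: "?I (\<lambda>x y z. k z * (g (x - z) * g (x + y))) = \<kappa> * \<gamma> * \<gamma>"
  proof -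
    have "?I (\<lambda>x y z. k z * (g (x - z) * g (x + y))) = (\<integral>\<^sup>+x. \<integral>\<^sup>+z. \<gamma> * (k z * g (x - z)) \<partial>lborel \<partial>lborel)"
      by (simp only: cc[OF mg(2)] g2) (simp only: mult_ac)
    also have "\<dots> = \<gamma> * (\<integral>\<^sup>+x. \<integral>\<^sup>+z. k z * g (x - z) \<partial>lborel \<partial>lborel)"
      by ((subst nn_integral_cmult, measurable)+)
    also have "(\<integral>\<^sup>+x. \<integral>\<^sup>+z. k z * g (x - z) \<partial>lborel \<partial>lborel) = \<kappa> * \<gamma>"
      by (rule sw) (measurable, rule g4)
    finally show ?thesis by (simp only: mult_ac)
  qed
  have add: "?I (\<lambda>x y z. F x y z + H x y z) = ?I F + ?I H"
    if F: "(\<lambda>(x, y, z). F x y z) \<in> borel_measurable (lborel \<Otimes>\<^sub>M lborel \<Otimes>\<^sub>M lborel)"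
      and H: "(\<lambda>(x, y, z). H x y z) \<in> borel_measurable (lborel \<Otimes>\<^sub>M lborel \<Otimes>\<^sub>M lborel)"
    for F H :: "real^'d \<Rightarrow> real^'d \<Rightarrow> real^'d \<Rightarrow> ennreal"
  proof -
    have m1: "(\<lambda>y. f x y z) \<in> borel_measurable lborel" and m2: "(\<lambda>z. \<integral>\<^sup>+y. f x y z \<partial>lborel) \<in> borel_measurable lborel"
      and m3: "(\<lambda>x. \<integral>\<^sup>+z. \<integral>\<^sup>+y. f x y z \<partial>lborel \<partial>lborel) \<in> borel_measurable lborel"
      if f: "(\<lambda>(x, y, z). f x y z) \<in> borel_measurable (lborel \<Otimes>\<^sub>M lborel \<Otimes>\<^sub>M lborel)"
      for x z and f :: "real^'d \<Rightarrow> real^'d \<Rightarrow> real^'d \<Rightarrow> ennreal"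
    proof -
      show "(\<lambda>y. f x y z) \<in> borel_measurable lborel" by (rule measurable_uncurry3[OF f]) auto
      show "(\<lambda>z. \<integral>\<^sup>+y. f x y z \<partial>lborel) \<in> borel_measurable lborel"
        by (rule lborel.borel_measurable_nn_integral, unfold case_prod_beta', rule measurable_uncurry3[OF f]) auto
      have "(\<lambda>p. \<integral>\<^sup>+y. f (fst p) y (snd p) \<partial>lborel) \<in> borel_measurable (lborel \<Otimes>\<^sub>M lborel)"
        by (rule lborel.borel_measurable_nn_integral, unfold case_prod_beta', rule measurable_uncurry3[OF f]) auto
      then show "(\<lambda>x. \<integral>\<^sup>+z. \<integral>\<^sup>+y. f x y z \<partial>lborel \<partial>lborel) \<in> borel_measurable lborel"
        by (intro lborel.borel_measurable_nn_integral[of "\<lambda>x z. \<integral>\<^sup>+y. f x y z \<partial>lborel"]) (simp add: case_prod_beta')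
    qed
    show ?thesis
      by (simp only: nn_integral_add[OF m1[OF F] m1[OF H]] nn_integral_add[OF m2[OF F] m2[OF H]] nn_integral_add[OF m3[OF F] m3[OF H]])
  qed
  have mN: "(\<lambda>(x, y, z). g x) \<in> borel_measurable (lborel \<Otimes>\<^sub>M lborel \<Otimes>\<^sub>M lborel)"
    "(\<lambda>(x, y, z). g (z - y - x)) \<in> borel_measurable (lborel \<Otimes>\<^sub>M lborel \<Otimes>\<^sub>M lborel)"
    "(\<lambda>(x, y, z). g (x - z)) \<in> borel_measurable (lborel \<Otimes>\<^sub>M lborel \<Otimes>\<^sub>M lborel)"
    "(\<lambda>(x, y, z). g (x + y)) \<in> borel_measurable (lborel \<Otimes>\<^sub>M lborel \<Otimes>\<^sub>M lborel)"
    by measurable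
  have g1': "(\<integral>\<^sup>+x. g (z - y - x) \<partial>lborel) = \<gamma>" for y z by (rule g1)
  let ?n = "c * A * A * \<gamma>" and ?t = "\<kappa> * \<gamma> * \<gamma>"
  have "?I (\<lambda>x y z. a y * a z * c * (g x + g (z - y - x) + g (x - z) + g (x + y))
      + (k y + k z) * (g x * g (z - y - x) + g (x - z) * g (x + y)))
    = ?I (\<lambda>x y z. (((a y * a z * c * g x + a y * a z * c * g (z - y - x)) + (a y * a z * c * g (x - z) + a y * a z * c * g (x + y))))
      + ((k y * (g x * g (z - y - x)) + k z * (g x * g (z - y - x))) + (k y * (g (x - z) * g (x + y)) + k z * (g (x - z) * g (x + y)))))"
    by (simp add: distrib_left distrib_right add_ac)
  also have "\<dots> = ((?n + ?n) + (?n + ?n)) + ((?t + ?t) + (?t + ?t))"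
    by (subst add, measurable)+ (simp only: N[OF mN(1) g0] N[OF mN(2) g1'] N[OF mN(3) g4] N[OF mN(4) g3] T1 T2 T3 T4)
  also have "\<dots> = 4 * ?n + 4 * ?t"
  proof -
    have "(4 :: ennreal) = (1 + 1) + (1 + 1)" by simp
    then have "4 * q = (q + q) + (q + q)" for q :: ennreal by (simp only: distrib_right mult_1_left)
    then show ?thesis by (simp only:)
  qed
  finally show ?thesis .
qed

text \<open>A quantity that is bounded by \<open>2 C\<^sup>2\<close> and by \<open>a b + c d\<close> is at most their geometric mean, and that is at
  most a linear expression in \<open>a, b, c, d\<close>. The gain is that a linear expression is integrable over one variable only.\<close>

lemma min_product_le_sum:
  fixes q a b c d C :: real
  assumes q: "0 \<le> q" "q \<le> 2 * C\<^sup>2" "q \<le> a * b + c * d" and "0 \<le> a" "0 \<le> b" "0 \<le> c" "0 \<le> d" "0 \<le> C"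
  shows "q \<le> C * (a + b + c + d)"
proof -
  let ?s = "a + b + c + d"
  have "4 * (a * b) \<le> (a + b)\<^sup>2" "4 * (c * d) \<le> (c + d)\<^sup>2"
    using sum_squares_bound[of a b] sum_squares_bound[of c d] by (auto simp: power2_sum)
  moreover have "(a + b)\<^sup>2 + (c + d)\<^sup>2 \<le> ?s\<^sup>2"
    using mult_nonneg_nonneg[of "a + b" "c + d"] assms by (simp add: power2_eq_square algebra_simps)
  ultimately have "4 * q \<le> ?s\<^sup>2" using q by linarith
  have "q\<^sup>2 \<le> (2 * C\<^sup>2) * q" using q by (simp add: power2_eq_square mult_right_mono)
  also have "\<dots> \<le> (2 * C\<^sup>2) * (?s\<^sup>2 / 4)" using \<open>4 * q \<le> ?s\<^sup>2\<close> by (intro mult_left_mono) auto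
  also have "\<dots> \<le> (C * ?s)\<^sup>2" by (simp add: power_mult_distrib)
  finally show ?thesis using assms by (intro power2_le_imp_le[of q]) auto
qed

context ergodic_translation_group
begin

lemma corr_as_expectation:
  assumes w: "bounded_rv B w"
  shows "(\<integral>\<omega>. w \<omega> * w (\<tau> z \<omega>) \<partial>M) = corr w z"
proof -
  have "(\<integral>\<omega>. w \<omega> * w (\<tau> z \<omega>) \<partial>M) = (\<integral>\<omega>. w (\<tau> 0 \<omega>) * w (\<tau> z \<omega>) \<partial>M)"
    by (intro Bochner_Integration.integral_cong) (auto simp: translation_zero)
  also have "\<dots> = corr w z" using corr_eq[OF w, of 0 z] corr_even[OF w, of z] by simp
  finally show ?thesis .
qed

text \<open>The covariance of \<open>v \<phi>\<close> at two points unfolds into fourth moments of \<open>v\<close>, averaged over the kernel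
  twice; subtracting \<open>m\<^sup>2\<close> subtracts the product of correlations that pairs each \<open>v\<close> with its own \<open>\<phi>\<close>.\<close>

lemma corrector_covariance_formula:
  assumes v: "bounded_rv B v" and K: "integrable lborel K"
  defines "m \<equiv> \<integral>y. K y * corr v y \<partial>lborel"
  defines "W \<equiv> \<lambda>\<omega>. v \<omega> * avg K v \<omega> - m"
  defines "Q \<equiv> \<lambda>x y z. (\<integral>\<omega>. v \<omega> * v (\<tau> y \<omega>) * v (\<tau> (- x) \<omega>) * v (\<tau> (z - x) \<omega>) \<partial>M)"
  shows "corr W x = (\<integral>z. K z * (\<integral>y. K y * (Q x y z - corr v y * corr v z) \<partial>lborel) \<partial>lborel)"
    and "integrable lborel (\<lambda>z. K z * (\<integral>y. K y * (Q x y z - corr v y * corr v z) \<partial>lborel))"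
    and "integrable lborel (\<lambda>y. K y * (Q x y z - corr v y * corr v z))"
    and "(\<integral>\<omega>. v \<omega> * avg K v \<omega> \<partial>M) = m"
proof -
  note [measurable] = corr_measurable[OF v]
  define \<phi> where "\<phi> = avg K v"
  define Y where "Y \<omega> = v \<omega> * \<phi> \<omega>" for \<omega>
  have b\<phi>: "bounded_rv (B * (\<integral>y. \<bar>K y\<bar> \<partial>lborel)) \<phi>" unfolding \<phi>_def by (rule avg_bounded[OF v K])
  note bY = bounded_rv_mult[OF v b\<phi>, folded Y_def]
  have tau: "\<tau> a (\<tau> b \<omega>) = \<tau> (a + b) \<omega>" if "\<omega> \<in> space M" for a b \<omega>
    using translation_add[OF that, of a b] by simp
  show EY: "(\<integral>\<omega>. v \<omega> * avg K v \<omega> \<partial>M) = m"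
    using avg_expectation(1)[OF v v K] corr_as_expectation[OF v] by (simp add: m_def)
  then have EY': "(\<integral>\<omega>. Y \<omega> \<partial>M) = m" by (simp add: Y_def \<phi>_def)
  have KS: "integrable lborel (\<lambda>y. K y * corr v y)"
    by (rule integrable_mult_bounded[OF K _ corr_le_zero[OF v]]) simp
  define X where "X z \<omega> = v \<omega> * v (\<tau> (- x) \<omega>) * v (\<tau> (z - x) \<omega>)" for z \<omega>
  have bX: "bounded_rv (B * B * B) (X z)" for z
    unfolding X_def by (intro bounded_rv_mult bounded_rv_shift v)
  have Q: "(\<integral>\<omega>. X z \<omega> * v (\<tau> y \<omega>) \<partial>M) = Q x y z" for y z
    unfolding Q_def X_def by (intro Bochner_Integration.integral_cong) (auto simp: mult_ac)
  have inner: "(\<integral>\<omega>. X z \<omega> * \<phi> \<omega> \<partial>M) = (\<integral>y. K y * Q x y z \<partial>lborel)" "integrable lborel (\<lambda>y. K y * Q x y z)" for z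
    using avg_expectation[OF bX v K, of z] by (auto simp: \<phi>_def Q)
  define Z where "Z \<omega> = Y \<omega> * v (\<tau> (- x) \<omega>)" for \<omega>
  note bZ = bounded_rv_mult[OF bY bounded_rv_shift[OF v, of "- x"], folded Z_def]
  have Zv: "(\<integral>\<omega>. Z \<omega> * v (\<tau> (- x) (\<tau> z \<omega>)) \<partial>M) = (\<integral>y. K y * Q x y z \<partial>lborel)" for z
    unfolding inner(1)[symmetric]
    by (intro Bochner_Integration.integral_cong) (auto simp: tau Z_def Y_def X_def mult_ac)
  have shift_avg: "avg K (\<lambda>\<omega>. v (\<tau> (- x) \<omega>)) \<omega> = \<phi> (\<tau> (- x) \<omega>)" if "\<omega> \<in> space M" for \<omega>
    unfolding avg_def \<phi>_def by (simp add: tau that)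
  have outer: "(\<integral>\<omega>. Z \<omega> * \<phi> (\<tau> (- x) \<omega>) \<partial>M) = (\<integral>z. K z * (\<integral>y. K y * Q x y z \<partial>lborel) \<partial>lborel)"
    "integrable lborel (\<lambda>z. K z * (\<integral>y. K y * Q x y z \<partial>lborel))"
  proof -
    have "(\<integral>\<omega>. Z \<omega> * \<phi> (\<tau> (- x) \<omega>) \<partial>M) = (\<integral>\<omega>. Z \<omega> * avg K (\<lambda>\<omega>. v (\<tau> (- x) \<omega>)) \<omega> \<partial>M)"
      by (intro Bochner_Integration.integral_cong) (auto simp: shift_avg)
    then show "(\<integral>\<omega>. Z \<omega> * \<phi> (\<tau> (- x) \<omega>) \<partial>M) = (\<integral>z. K z * (\<integral>y. K y * Q x y z \<partial>lborel) \<partial>lborel)"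
      using avg_expectation(1)[OF bZ bounded_rv_shift[OF v, of "- x"] K] by (simp add: Zv)
    show "integrable lborel (\<lambda>z. K z * (\<integral>y. K y * Q x y z \<partial>lborel))"
      using avg_expectation(2)[OF bZ bounded_rv_shift[OF v, of "- x"] K] by (simp add: Zv)
  qed
  have "corr W x = (\<integral>\<omega>. (Y \<omega> - m) * (Y (\<tau> (- x) \<omega>) - m) \<partial>M)"
    by (simp add: correlation_def translate_def W_def Y_def \<phi>_def)
  also have "\<dots> = (\<integral>\<omega>. Y \<omega> * Y (\<tau> (- x) \<omega>) - m * Y \<omega> - m * Y (\<tau> (- x) \<omega>) + m * m \<partial>M)"
    by (simp add: algebra_simps)
  also have "\<dots> = (\<integral>\<omega>. Y \<omega> * Y (\<tau> (- x) \<omega>) \<partial>M) - m * m"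
    using bounded_rv_integrable[OF bounded_rv_mult[OF bY bounded_rv_shift[OF bY, of "- x"]]] bounded_rv_integrable[OF bY]
      bounded_rv_integrable[OF bounded_rv_shift[OF bY, of "- x"]] shift_expectation[OF bounded_rvD(1)[OF bY], of "- x"]
    by (simp add: EY' prob_space)
  also have "(\<integral>\<omega>. Y \<omega> * Y (\<tau> (- x) \<omega>) \<partial>M) = (\<integral>\<omega>. Z \<omega> * \<phi> (\<tau> (- x) \<omega>) \<partial>M)"
    by (intro Bochner_Integration.integral_cong) (auto simp: Z_def Y_def mult_ac)
  finally have W: "corr W x = (\<integral>z. K z * (\<integral>y. K y * Q x y z \<partial>lborel) \<partial>lborel) - m * m"
    by (simp add: outer)
  have e: "(\<integral>y. K y * (Q x y z - corr v y * corr v z) \<partial>lborel) = (\<integral>y. K y * Q x y z \<partial>lborel) - m * corr v z" for z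
  proof -
    have "(\<integral>y. K y * (Q x y z - corr v y * corr v z) \<partial>lborel) = (\<integral>y. K y * Q x y z - (K y * corr v y) * corr v z \<partial>lborel)"
      by (simp add: algebra_simps)
    then show ?thesis using inner(2) KS by (simp add: m_def)
  qed
  have e2: "K z * ((\<integral>y. K y * Q x y z \<partial>lborel) - m * corr v z) = K z * (\<integral>y. K y * Q x y z \<partial>lborel) - m * (K z * corr v z)" for z
    by (simp add: algebra_simps)
  show "corr W x = (\<integral>z. K z * (\<integral>y. K y * (Q x y z - corr v y * corr v z) \<partial>lborel) \<partial>lborel)"
    unfolding W e e2 using outer(2) KS by (simp add: m_def)
  show "integrable lborel (\<lambda>z. K z * (\<integral>y. K y * (Q x y z - corr v y * corr v z) \<partial>lborel))"
    unfolding e e2 using outer(2) KS by simp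
  have "(\<lambda>y. K y * (Q x y z - corr v y * corr v z)) = (\<lambda>y. K y * Q x y z - (K y * corr v y) * corr v z)"
    by (simp add: algebra_simps)
  then show "integrable lborel (\<lambda>y. K y * (Q x y z - corr v y * corr v z))"
    using inner(2) KS by simp
qed

text \<open>The product of the two Green kernels is at most a product of two kernels of mass at most \<open>1\<close> plus
  a sum of functions of one variable, namely \<open>2 a + f\<^sup>2 / 2\<close>, where \<open>a\<close> and \<open>f\<close> are the parts of short and long
  times. For the former the fourth moment bound is used in its linear form, which leaves one free
  variable for \<open>g\<close> to integrate; for the latter in its quadratic form, which leaves two. The mass of
  \<open>f\<^sup>2\<close> is what grows with \<open>T\<close>.\<close>

lemma corrector_covariance:
  assumes d: "CARD('d) \<ge> 3" and \<delta>: "0 < \<delta>" "\<delta> \<le> 1" and T: "1 \<le> T" and v: "bounded_rv B v"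
    and g: "integrable lborel g" "\<And>x. g x \<ge> 0"
    and four: "\<And>x y z. \<bar>(\<integral>\<omega>. v \<omega> * v (\<tau> y \<omega>) * v (\<tau> (- x) \<omega>) * v (\<tau> (z - x) \<omega>) \<partial>M) - corr v y * corr v z\<bar>
       \<le> g x * g (z - y - x) + g (x - z) * g (x + y)"
  defines "W \<equiv> \<lambda>\<omega>. v \<omega> * avg (green \<delta> T) v \<omega> - (\<integral>y. green \<delta> T y * corr v y \<partial>lborel)"
  shows "integrable lborel (corr W)"
    and "(\<integral>x. \<bar>corr W x\<bar> \<partial>lborel)
      \<le> (4 * B\<^sup>2 * (\<integral>x. g x \<partial>lborel) + 20 * (\<integral>x. g x \<partial>lborel)\<^sup>2) * growth CARD('d) T"
proof -
  let ?K = "green \<delta> T :: real^'d \<Rightarrow> real" and ?a = "green \<delta> 1 :: real^'d \<Rightarrow> real" and ?f = "green 1 T :: real^'d \<Rightarrow> real"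
  define k where "k y = 2 * ?a y + (?f y)\<^sup>2 / 2" for y
  define \<gamma> where "\<gamma> = (\<integral>x. g x \<partial>lborel)"
  define Q where "Q x y z = (\<integral>\<omega>. v \<omega> * v (\<tau> y \<omega>) * v (\<tau> (- x) \<omega>) * v (\<tau> (z - x) \<omega>) \<partial>M) - corr v y * corr v z" for x y z
  have T': "\<delta> \<le> T" using \<delta> T by simp
  have B: "B \<ge> 0" by (rule bounded_rvD(2)[OF v])
  have [measurable]: "g \<in> borel_measurable borel" using g by auto
  note [measurable] = bounded_rvD(1)[OF v]
  have iK: "integrable lborel ?K" by (rule green_integrable[OF \<delta>(1) T'])
  note F = corrector_covariance_formula[OF v iK, folded Q_def W_def]
  have bW: "\<exists>C. bounded_rv C W"
    unfolding W_def using bounded_rv_add(2)[OF bounded_rv_mult[OF v avg_bounded[OF v iK]] bounded_rv_const] by blast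
  then have [measurable]: "corr W \<in> borel_measurable borel" using corr_measurable by blast
  have G: "g x \<ge> 0" for x by (rule g)
  have Kle: "?K y * ?K z \<le> ?a y * ?a z + (k y + k z)" for y z
  proof -
    have K: "?K y = ?a y + ?f y" for y by (rule green_add[OF \<delta> T])
    have "?a y * ?f z \<le> ?a y * 2" "?f y * ?a z \<le> 2 * ?a z"
      using green_le[OF d T] green_nonneg by (auto intro!: mult_left_mono mult_right_mono)
    moreover have "?f y * ?f z \<le> (?f y)\<^sup>2 / 2 + (?f z)\<^sup>2 / 2" using sum_squares_bound[of "?f y" "?f z"] by simp
    ultimately show ?thesis unfolding K k_def by (simp add: algebra_simps)
  qed
  have k0: "k y \<ge> 0" "?a y \<ge> 0" for y using green_nonneg[of \<delta> 1 y] by (auto simp: k_def green_nonneg)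
  have Qle: "\<bar>Q x y z\<bar> \<le> B\<^sup>2 * (g x + g (z - y - x) + g (x - z) + g (x + y))" for x y z
  proof (rule min_product_le_sum)
    have "bounded_rv (B * B * B * B) (\<lambda>\<omega>. v \<omega> * v (\<tau> y \<omega>) * v (\<tau> (- x) \<omega>) * v (\<tau> (z - x) \<omega>))"
      by (intro bounded_rv_mult bounded_rv_shift v)
    from bounded_rv_expectation_bound[OF this]
    have "\<bar>\<integral>\<omega>. v \<omega> * v (\<tau> y \<omega>) * v (\<tau> (- x) \<omega>) * v (\<tau> (z - x) \<omega>) \<partial>M\<bar> \<le> B * B * B * B" .
    moreover have "corr v 0 \<le> B * B"
      using bounded_rv_expectation_bound[OF bounded_rv_mult[OF v v]] corr_zero[OF v] by (simp add: power2_eq_square)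
    then have "\<bar>corr v y\<bar> * \<bar>corr v z\<bar> \<le> (B * B) * (B * B)"
      using corr_le_zero[OF v] by (intro mult_mono order_trans[OF corr_le_zero[OF v]]) auto
    ultimately show "\<bar>Q x y z\<bar> \<le> 2 * (B\<^sup>2)\<^sup>2"
      unfolding Q_def by (simp add: power2_eq_square abs_mult[symmetric])
  qed (use four[of y x z] G in \<open>auto simp: Q_def\<close>)
  define H where "H x y z = ?a y * ?a z * B\<^sup>2 * (g x + g (z - y - x) + g (x - z) + g (x + y))
      + (k y + k z) * (g x * g (z - y - x) + g (x - z) * g (x + y))" for x y z
  have KQ: "\<bar>?K z * (?K y * Q x y z)\<bar> \<le> H x y z" for x y z
  proof -
    have "\<bar>?K z * (?K y * Q x y z)\<bar> = (?K y * ?K z) * \<bar>Q x y z\<bar>"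
      by (simp add: abs_mult green_nonneg)
    also have "\<dots> \<le> (?a y * ?a z + (k y + k z)) * \<bar>Q x y z\<bar>" by (intro mult_right_mono Kle) auto
    also have "\<dots> = (?a y * ?a z) * \<bar>Q x y z\<bar> + (k y + k z) * \<bar>Q x y z\<bar>" by (simp add: distrib_right)
    also have "\<dots> \<le> (?a y * ?a z) * (B\<^sup>2 * (g x + g (z - y - x) + g (x - z) + g (x + y)))
        + (k y + k z) * (g x * g (z - y - x) + g (x - z) * g (x + y))"
      using four[of y x z] k0 Qle by (intro add_mono mult_left_mono) (auto simp: Q_def)
    finally show ?thesis by (simp add: H_def mult.assoc)
  qed
  have "ennreal \<bar>corr W x\<bar> \<le> (\<integral>\<^sup>+z. \<integral>\<^sup>+y. ennreal (H x y z) \<partial>lborel \<partial>lborel)" for x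
  proof -
    have "ennreal \<bar>corr W x\<bar> \<le> (\<integral>\<^sup>+z. ennreal \<bar>?K z * (\<integral>y. ?K y * Q x y z \<partial>lborel)\<bar> \<partial>lborel)"
      unfolding F(1) using integral_norm_bound_ennreal[OF F(2)] by simp
    also have "\<dots> = (\<integral>\<^sup>+z. ennreal \<bar>\<integral>y. ?K z * (?K y * Q x y z) \<partial>lborel\<bar> \<partial>lborel)" by simp
    also have "\<dots> \<le> (\<integral>\<^sup>+z. \<integral>\<^sup>+y. ennreal \<bar>?K z * (?K y * Q x y z)\<bar> \<partial>lborel \<partial>lborel)"
      using integral_norm_bound_ennreal[OF integrable_mult_right[OF F(3)]]
      by (intro nn_integral_mono) (simp only: real_norm_def)
    also have "\<dots> \<le> (\<integral>\<^sup>+z. \<integral>\<^sup>+y. ennreal (H x y z) \<partial>lborel \<partial>lborel)"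
      using KQ by (intro nn_integral_mono ennreal_leI)
    finally show ?thesis .
  qed
  then have "(\<integral>\<^sup>+x. ennreal \<bar>corr W x\<bar> \<partial>lborel) \<le> (\<integral>\<^sup>+x. \<integral>\<^sup>+z. \<integral>\<^sup>+y. ennreal (H x y z) \<partial>lborel \<partial>lborel \<partial>lborel)"
    by (intro nn_integral_mono)
  also have "\<dots> = (\<integral>\<^sup>+x. \<integral>\<^sup>+z. \<integral>\<^sup>+y. ennreal (?a y) * ennreal (?a z) * ennreal (B\<^sup>2) * (ennreal (g x) + ennreal (g (z - y - x)) + ennreal (g (x - z)) + ennreal (g (x + y)))
      + (ennreal (k y) + ennreal (k z)) * (ennreal (g x) * ennreal (g (z - y - x)) + ennreal (g (x - z)) * ennreal (g (x + y))) \<partial>lborel \<partial>lborel \<partial>lborel)"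
    unfolding H_def using G k0 B
    by (intro nn_integral_cong) (simp add: ennreal_plus[symmetric] ennreal_mult[symmetric] del: ennreal_plus)
  also have "\<dots> = 4 * (ennreal (B\<^sup>2) * (\<integral>\<^sup>+x. ennreal (?a x) \<partial>lborel) * (\<integral>\<^sup>+x. ennreal (?a x) \<partial>lborel) * (\<integral>\<^sup>+x. ennreal (g x) \<partial>lborel))
      + 4 * ((\<integral>\<^sup>+x. ennreal (k x) \<partial>lborel) * (\<integral>\<^sup>+x. ennreal (g x) \<partial>lborel) * (\<integral>\<^sup>+x. ennreal (g x) \<partial>lborel))"
    by (rule kernel_product_integral) (unfold k_def, measurable)
  also have "\<dots> \<le> 4 * (ennreal (B\<^sup>2) * 1 * 1 * ennreal \<gamma>) + 4 * (ennreal (5 * growth CARD('d) T) * ennreal \<gamma> * ennreal \<gamma>)"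
  proof -
    have a: "(\<integral>\<^sup>+x. ennreal (?a x) \<partial>lborel) \<le> 1"
      using \<delta> green_integral[OF \<delta>, where 'd = 'd] green_integrable[OF \<delta>, where 'd = 'd]
      by (subst nn_integral_eq_integral) (auto simp: green_nonneg)
    have gg: "(\<integral>\<^sup>+x. ennreal (g x) \<partial>lborel) = ennreal \<gamma>"
      unfolding \<gamma>_def using g by (intro nn_integral_eq_integral) auto
    have ik: "integrable lborel k"
      unfolding k_def[abs_def] using green_integrable[OF \<delta>, where 'd = 'd] green_square_integrable[OF d T] by simp
    have "(\<integral>x. k x \<partial>lborel) = 2 * (1 - \<delta>) + (\<integral>x. (?f x)\<^sup>2 \<partial>lborel) / 2"
      unfolding k_def using green_integrable[OF \<delta>, where 'd = 'd] green_square_integrable[OF d T] green_integral[OF \<delta>, where 'd = 'd] by simp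
    also have "\<dots> \<le> 5 * growth CARD('d) T"
    proof -
      have "(\<integral>x. (?f x)\<^sup>2 \<partial>lborel) / 2 \<le> 3 * growth CARD('d) T" using green_square_integral[OF d T] by simp
      moreover have "2 * (1 - \<delta>) \<le> 2 * growth CARD('d) T" using growth_ge_1[OF T, of "CARD('d)"] \<delta> by simp
      ultimately show ?thesis by simp
    qed
    finally have "(\<integral>\<^sup>+x. ennreal (k x) \<partial>lborel) \<le> ennreal (5 * growth CARD('d) T)"
      using ik k0 by (subst nn_integral_eq_integral) (auto intro: ennreal_leI)
    then show ?thesis unfolding gg using a by (intro add_mono mult_mono) auto
  qed
  also have "\<dots> = ennreal (4 * B\<^sup>2 * \<gamma> + 20 * \<gamma>\<^sup>2 * growth CARD('d) T)"
  proof -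
    have "\<gamma> \<ge> 0" unfolding \<gamma>_def using G by simp
    moreover have "growth CARD('d) T \<ge> 0" using growth_ge_1[OF T, of "CARD('d)"] by simp
    moreover have aux: "ennreal (4 * (b * h) + 4 * (p * h * h)) = ennreal 4 * (ennreal b * ennreal h) + ennreal 4 * (ennreal p * ennreal h * ennreal h)"
      if "b \<ge> 0" "p \<ge> 0" "h \<ge> 0" for b p h :: real
      using that by (subst ennreal_plus) (auto simp: ennreal_mult simp del: ennreal_numeral)
    ultimately have "ennreal (4 * (B\<^sup>2 * \<gamma>) + 4 * (5 * growth CARD('d) T * \<gamma> * \<gamma>))
        = ennreal 4 * (ennreal (B\<^sup>2) * ennreal \<gamma>) + ennreal 4 * (ennreal (5 * growth CARD('d) T) * ennreal \<gamma> * ennreal \<gamma>)"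
      by (intro aux) auto
    moreover have "4 * (B\<^sup>2 * \<gamma>) + 4 * (5 * growth CARD('d) T * \<gamma> * \<gamma>) = 4 * B\<^sup>2 * \<gamma> + 20 * \<gamma>\<^sup>2 * growth CARD('d) T"
      by (simp add: power2_eq_square)
    ultimately show ?thesis by (simp only: ennreal_numeral mult_1_right)
  qed
  also have "\<dots> \<le> ennreal ((4 * B\<^sup>2 * \<gamma> + 20 * \<gamma>\<^sup>2) * growth CARD('d) T)"
  proof (rule ennreal_leI)
    have "\<gamma> \<ge> 0" unfolding \<gamma>_def using G by simp
    then have "4 * B\<^sup>2 * \<gamma> * 1 \<le> 4 * B\<^sup>2 * \<gamma> * growth CARD('d) T"
      using growth_ge_1[OF T, of "CARD('d)"] by (intro mult_left_mono) auto
    then show "4 * B\<^sup>2 * \<gamma> + 20 * \<gamma>\<^sup>2 * growth CARD('d) T \<le> (4 * B\<^sup>2 * \<gamma> + 20 * \<gamma>\<^sup>2) * growth CARD('d) T"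
      by (simp add: distrib_right)
  qed
  finally have n: "(\<integral>\<^sup>+x. ennreal \<bar>corr W x\<bar> \<partial>lborel) \<le> ennreal ((4 * B\<^sup>2 * \<gamma> + 20 * \<gamma>\<^sup>2) * growth CARD('d) T)" .
  show i: "integrable lborel (corr W)"
    unfolding integrable_iff_bounded using n by (auto intro: order_le_less_trans)
  have "0 \<le> (4 * B\<^sup>2 * \<gamma> + 20 * \<gamma>\<^sup>2) * growth CARD('d) T"
    using growth_ge_1[OF T, of "CARD('d)"] Bochner_Integration.integral_nonneg[of lborel g, OF G] unfolding \<gamma>_def[symmetric] by simp
  moreover have "ennreal (\<integral>x. \<bar>corr W x\<bar> \<partial>lborel) \<le> ennreal ((4 * B\<^sup>2 * \<gamma> + 20 * \<gamma>\<^sup>2) * growth CARD('d) T)"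
    using n nn_integral_eq_integral[of lborel "\<lambda>x. \<bar>corr W x\<bar>"] i by simp
  ultimately show "(\<integral>x. \<bar>corr W x\<bar> \<partial>lborel) \<le> (4 * B\<^sup>2 * (\<integral>x. g x \<partial>lborel) + 20 * (\<integral>x. g x \<partial>lborel)\<^sup>2) * growth CARD('d) T"
    by (simp add: \<gamma>_def ennreal_le_iff)
qed

end

section \<open>The effective potential\<close>

context ergodic_translation_group
begin

text \<open>Damping the Fourier integral by a Gaussian turns it into a Gaussian average of the spectral
  measure, which is nonnegative.\<close>

lemma power_spectrum_nonneg:
  assumes w: "bounded_rv B w" and R: "integrable lborel (corr w)"
  shows "Im (power_spectrum (corr w) \<xi>) = 0" "Re (power_spectrum (corr w) \<xi>) \<ge> 0"
proof -
  note [measurable] = corr_measurable[OF w]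
  let ?\<mu> = "spectral_measure M U (\<lambda>\<omega>. of_real (w \<omega>))"
  let ?P = "\<integral>x. cis (- (\<xi> \<bullet> x)) * complex_of_real (corr w x) \<partial>lborel"
  interpret \<mu>: finite_measure ?\<mu> by (rule spectral_measure_finite)
  interpret P: pair_sigma_finite "lborel :: (real^'d) measure" ?\<mu> by standard
  have RC: "integrable lborel (\<lambda>x. complex_of_real (corr w x))" using R by simp
  define s where "s n = inverse (real (Suc n))" for n
  have s: "s n > 0" for n by (simp add: s_def)
  define D where "D n = (\<integral>x. cis (- (\<xi> \<bullet> x)) * complex_of_real (corr w x) * of_real (exp (- s n * (norm x)\<^sup>2)) \<partial>lborel)" for n
  have lim: "D \<longlonglongrightarrow> ?P"
    unfolding D_def
  proof (rule integral_dominated_convergence[where w = "\<lambda>x. \<bar>corr w x\<bar>"])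
    show "AE x in lborel. (\<lambda>n. cis (- (\<xi> \<bullet> x)) * complex_of_real (corr w x) * of_real (exp (- s n * (norm x)\<^sup>2)))
        \<longlonglongrightarrow> cis (- (\<xi> \<bullet> x)) * complex_of_real (corr w x)"
    proof (rule AE_I2)
      fix x :: "real^'d"
      have "(\<lambda>n. cis (- (\<xi> \<bullet> x)) * complex_of_real (corr w x) * of_real (exp (- s n * (norm x)\<^sup>2)))
        \<longlonglongrightarrow> cis (- (\<xi> \<bullet> x)) * complex_of_real (corr w x) * of_real (exp (- 0 * (norm x)\<^sup>2))"
        unfolding s_def by (intro tendsto_intros LIMSEQ_inverse_real_of_nat)
      then show "(\<lambda>n. cis (- (\<xi> \<bullet> x)) * complex_of_real (corr w x) * of_real (exp (- s n * (norm x)\<^sup>2)))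
        \<longlonglongrightarrow> cis (- (\<xi> \<bullet> x)) * complex_of_real (corr w x)" by simp
    qed
    show "AE x in lborel. norm (cis (- (\<xi> \<bullet> x)) * complex_of_real (corr w x) * of_real (exp (- s n * (norm x)\<^sup>2))) \<le> \<bar>corr w x\<bar>" for n
    proof (rule AE_I2)
      fix x :: "real^'d"
      have "exp (- s n * (norm x)\<^sup>2) \<le> 1" using s[of n] by simp
      then show "norm (cis (- (\<xi> \<bullet> x)) * complex_of_real (corr w x) * of_real (exp (- s n * (norm x)\<^sup>2))) \<le> \<bar>corr w x\<bar>"
        by (simp add: norm_mult mult_left_le)
    qed
  qed (use R in auto)
  have D: "D n = of_real (\<integral>\<zeta>. sqrt (pi / s n) ^ CARD('d) * exp (- (norm (\<zeta> - \<xi>))\<^sup>2 / (4 * s n)) \<partial>?\<mu>)" for n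
  proof -
    let ?g = "\<lambda>x :: real^'d. complex_of_real (exp (- s n * (norm x)\<^sup>2))"
    have gi: "integrable lborel ?g"
      by (rule integrable_of_real[OF gaussian_integrable[OF s]])
    have g1: "norm (cis a * ?g x) \<le> 1" for a x using less_imp_le[OF s[of n]] by (simp add: norm_mult)
    have I: "integrable (lborel \<Otimes>\<^sub>M ?\<mu>) (\<lambda>(x, \<zeta>). cis ((\<zeta> - \<xi>) \<bullet> x) * ?g x)"
    proof (rule P.Fubini_integrable)
      show "integrable lborel (\<lambda>x. \<integral>\<zeta>. norm (case (x, \<zeta>) of (x, \<zeta>) \<Rightarrow> cis ((\<zeta> - \<xi>) \<bullet> x) * ?g x) \<partial>?\<mu>)"
      proof -
        have "norm (case (x, \<zeta>) of (x, \<zeta>) \<Rightarrow> cis ((\<zeta> - \<xi>) \<bullet> x) * ?g x) = exp (- s n * (norm x)\<^sup>2)" for x \<zeta> :: "real^'d"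
          by (simp add: norm_mult)
        then show ?thesis
          using integrable_mult_right[OF gaussian_integrable[OF s[of n], where 'a = "real^'d"]] by simp
      qed
      show "AE x in lborel. integrable ?\<mu> (\<lambda>\<zeta>. case (x, \<zeta>) of (x, \<zeta>) \<Rightarrow> cis ((\<zeta> - \<xi>) \<bullet> x) * ?g x)"
        unfolding prod.case by (intro AE_I2 \<mu>.integrable_const_bound[where B = 1] g1) measurable
    qed measurable
    have "cis (- (\<xi> \<bullet> x)) * complex_of_real (corr w x) * ?g x = (\<integral>\<zeta>. cis ((\<zeta> - \<xi>) \<bullet> x) * ?g x \<partial>?\<mu>)" for x
    proof -
      have "cis ((\<zeta> - \<xi>) \<bullet> x) * ?g x = cis (- (\<xi> \<bullet> x)) * ?g x * cis (\<zeta> \<bullet> x)" for \<zeta>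
      proof -
        have "(\<zeta> - \<xi>) \<bullet> x = - (\<xi> \<bullet> x) + \<zeta> \<bullet> x" by (simp add: inner_diff_left)
        then show ?thesis by (simp only: cis_mult[symmetric] mult_ac)
      qed
      then show ?thesis
        by (simp only: Bochner_Integration.integral_mult_right_zero corr_spectral[OF w]) (simp only: mult_ac)
    qed
    then have "D n = (\<integral>x. (\<integral>\<zeta>. cis ((\<zeta> - \<xi>) \<bullet> x) * ?g x \<partial>?\<mu>) \<partial>lborel)" unfolding D_def by (simp only:)
    also have "\<dots> = (\<integral>\<zeta>. (\<integral>x. cis ((\<zeta> - \<xi>) \<bullet> x) * ?g x \<partial>lborel) \<partial>?\<mu>)"
      by (rule P.Fubini_integral[OF I, symmetric])
    also have "\<dots> = (\<integral>\<zeta>. of_real (sqrt (pi / s n) ^ CARD('d) * exp (- (norm (\<zeta> - \<xi>))\<^sup>2 / (4 * s n))) \<partial>?\<mu>)"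
      by (simp only: gaussian_fourier[OF s] DIM_cart DIM_real mult_1_right)
    finally show ?thesis by (simp only: integral_complex_of_real)
  qed
  have "Re (D n) \<ge> 0" "Im (D n) = 0" for n
    using less_imp_le[OF s[of n]] by (auto simp: D intro!: Bochner_Integration.integral_nonneg)
  then have "Re ?P \<ge> 0" "Im ?P = 0"
    using tendsto_Re[OF lim] tendsto_Im[OF lim] by (auto intro: LIMSEQ_le_const simp: LIMSEQ_const_iff)
  then show "Im (power_spectrum (corr w) \<xi>) = 0" "Re (power_spectrum (corr w) \<xi>) \<ge> 0"
    by (simp_all add: power_spectrum_def Re_divide_of_real Im_divide_of_real del: of_real_power of_real_mult)
qed

text \<open>Plancherel's formula for the Gaussian, by Fubini.\<close>

lemma heat_corr_fourier:
  assumes w: "bounded_rv B w" and R: "integrable lborel (corr w)" and t: "t > 0"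
  shows "integrable lborel (\<lambda>\<xi>. exp (- t * (norm \<xi>)\<^sup>2) * Re (power_spectrum (corr w) \<xi>))"
    and "(\<integral>\<xi>. exp (- t * (norm \<xi>)\<^sup>2) * Re (power_spectrum (corr w) \<xi>) \<partial>lborel) = (\<integral>x. heat t x * corr w x \<partial>lborel)"
proof -
  note [measurable] = corr_measurable[OF w]
  let ?c = "(2 * pi) ^ CARD('d)"
  have c: "?c > 0" by simp
  have I: "integrable (lborel \<Otimes>\<^sub>M lborel) (\<lambda>(x, \<xi>). complex_of_real (corr w x) * (cis (- (\<xi> \<bullet> x)) * of_real (exp (- t * (norm \<xi>)\<^sup>2))))"
  proof (rule lborel_pair.Fubini_integrable)
    have g: "integrable lborel (\<lambda>\<xi>::real^'d. exp (- t * (norm \<xi>)\<^sup>2))" by (rule gaussian_integrable[OF t])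
    show "integrable lborel (\<lambda>x. \<integral>\<xi>. norm (case (x, \<xi>) of (x, \<xi>) \<Rightarrow> complex_of_real (corr w x) * (cis (- (\<xi> \<bullet> x)) * of_real (exp (- t * (norm \<xi>)\<^sup>2)))) \<partial>lborel)"
      using R by (simp add: norm_mult)
    have "integrable lborel (\<lambda>\<xi>. cis (- (\<xi> \<bullet> x)) * of_real (exp (- t * (norm \<xi>)\<^sup>2)))" for x :: "real^'d"
      by (rule Bochner_Integration.integrable_bound[OF g]) (auto simp: norm_mult)
    then show "AE x in lborel. integrable lborel (\<lambda>\<xi>. case (x, \<xi>) of (x, \<xi>) \<Rightarrow> complex_of_real (corr w x) * (cis (- (\<xi> \<bullet> x)) * of_real (exp (- t * (norm \<xi>)\<^sup>2))))"
      by (auto intro: integrable_mult_right)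
  qed measurable
  have inner: "(\<integral>x. complex_of_real (corr w x) * (cis (- (\<xi> \<bullet> x)) * of_real (exp (- t * (norm \<xi>)\<^sup>2))) \<partial>lborel)
      = of_real (?c * (exp (- t * (norm \<xi>)\<^sup>2) * Re (power_spectrum (corr w) \<xi>)))" for \<xi>
  proof -
    have "power_spectrum (corr w) \<xi> = of_real (Re (power_spectrum (corr w) \<xi>))"
      using power_spectrum_nonneg(1)[OF w R, of \<xi>] by (simp add: complex_eq_iff)
    moreover have "power_spectrum (corr w) \<xi> * of_real ?c = (\<integral>x. cis (- (\<xi> \<bullet> x)) * complex_of_real (corr w x) \<partial>lborel)"
      unfolding power_spectrum_def using c by (simp del: of_real_power of_real_mult)
    ultimately have p: "(\<integral>x. cis (- (\<xi> \<bullet> x)) * complex_of_real (corr w x) \<partial>lborel) = of_real (?c * Re (power_spectrum (corr w) \<xi>))"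
      by (metis mult.commute of_real_mult)
    have "(\<integral>x. complex_of_real (corr w x) * (cis (- (\<xi> \<bullet> x)) * of_real (exp (- t * (norm \<xi>)\<^sup>2))) \<partial>lborel)
        = (\<integral>x. cis (- (\<xi> \<bullet> x)) * complex_of_real (corr w x) \<partial>lborel) * of_real (exp (- t * (norm \<xi>)\<^sup>2))"
      by (subst Bochner_Integration.integral_mult_left_zero[symmetric]) (simp add: mult_ac)
    then show ?thesis unfolding p by (simp add: mult_ac)
  qed
  have "integrable lborel (\<lambda>\<xi>. complex_of_real (?c * (exp (- t * (norm \<xi>)\<^sup>2) * Re (power_spectrum (corr w) \<xi>))))"
    using lborel_pair.integrable_snd[OF I] unfolding inner .
  then have "integrable lborel (\<lambda>\<xi>. ?c * (exp (- t * (norm \<xi>)\<^sup>2) * Re (power_spectrum (corr w) \<xi>)))"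
    by (simp only: complex_of_real_integrable_eq)
  then show "integrable lborel (\<lambda>\<xi>. exp (- t * (norm \<xi>)\<^sup>2) * Re (power_spectrum (corr w) \<xi>))"
    using c by simp
  have "of_real (?c * (\<integral>\<xi>. exp (- t * (norm \<xi>)\<^sup>2) * Re (power_spectrum (corr w) \<xi>) \<partial>lborel))
      = (\<integral>\<xi>. complex_of_real (?c * (exp (- t * (norm \<xi>)\<^sup>2) * Re (power_spectrum (corr w) \<xi>))) \<partial>lborel)"
    by (simp only: integral_complex_of_real Bochner_Integration.integral_mult_right_zero)
  also have "\<dots> = (\<integral>x. (\<integral>\<xi>. complex_of_real (corr w x) * (cis (- (\<xi> \<bullet> x)) * of_real (exp (- t * (norm \<xi>)\<^sup>2))) \<partial>lborel) \<partial>lborel)"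
    using lborel_pair.Fubini_integral[OF I] unfolding inner by simp
  also have "\<dots> = (\<integral>x. complex_of_real (?c * (heat t x * corr w x)) \<partial>lborel)"
  proof -
    have "(\<integral>\<xi>. complex_of_real (corr w x) * (cis (- (\<xi> \<bullet> x)) * of_real (exp (- t * (norm \<xi>)\<^sup>2))) \<partial>lborel)
        = complex_of_real (?c * (heat t x * corr w x))" for x
      by (simp only: Bochner_Integration.integral_mult_right_zero heat_fourier[OF t] of_real_mult) (simp only: mult_ac)
    then show ?thesis by (simp only:)
  qed
  also have "\<dots> = of_real (?c * (\<integral>x. heat t x * corr w x \<partial>lborel))"
    by (simp only: integral_complex_of_real Bochner_Integration.integral_mult_right_zero)
  finally have "?c * (\<integral>\<xi>. exp (- t * (norm \<xi>)\<^sup>2) * Re (power_spectrum (corr w) \<xi>) \<partial>lborel) = ?c * (\<integral>x. heat t x * corr w x \<partial>lborel)"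
    by (simp only: of_real_eq_iff)
  then show "(\<integral>\<xi>. exp (- t * (norm \<xi>)\<^sup>2) * Re (power_spectrum (corr w) \<xi>) \<partial>lborel) = (\<integral>x. heat t x * corr w x \<partial>lborel)"
    using c by simp
qed

lemma nn_integral_exp_decay:
  assumes q: "q > (0::real)"
  shows "(\<integral>\<^sup>+t. ennreal (exp (- t * q)) * indicator {0..} t \<partial>lborel) = ennreal (1 / q)"
proof -
  have "(\<integral>\<^sup>+t. ennreal (exp (- t * q)) * indicator {0..} t \<partial>lborel) = ennreal (0 - (- exp (- 0 * q) / q))"
  proof (rule nn_integral_FTC_atLeast)
    show "((\<lambda>t. - exp (- t * q) / q) has_real_derivative exp (- t * q)) (at t)" for t
      using q by (auto intro!: derivative_eq_intros)
    have "filterlim (\<lambda>t. t * q) at_top at_top"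
      using q by (intro filterlim_at_top_mult_tendsto_pos[OF tendsto_const] filterlim_ident | simp add: mult.commute)+
    then have "((\<lambda>t. exp (- (t * q))) \<longlongrightarrow> 0) at_top"
      by (intro filterlim_compose[OF exp_at_bot] filterlim_compose[OF filterlim_uminus_at_bot_at_top])
    then have "((\<lambda>t. - exp (- (t * q)) / q) \<longlongrightarrow> - 0 / q) at_top" by (intro tendsto_intros) (use q in auto)
    then show "((\<lambda>t. - exp (- t * q) / q) \<longlongrightarrow> 0) at_top" by simp
  qed auto
  then show ?thesis by simp
qed

text \<open>By the heat semigroup, \<open>1 / |\<xi>|\<^sup>2\<close> is the integral of \<open>exp (- t |\<xi>|\<^sup>2)\<close> over all times, so
  the effective potential is the integral over all times of the heat averages of the correlation;
  the truncated Green kernel keeps the times between \<open>\<delta>\<close> and \<open>T\<close>.\<close>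

lemma effective_potential_approx:
  assumes d: "CARD('d) \<ge> 3" and w: "bounded_rv B w" and R: "integrable lborel (corr w)"
  obtains \<rho> where "effective_potential (corr w) = of_real \<rho>"
    "\<And>\<delta> T. 0 < \<delta> \<Longrightarrow> \<delta> \<le> 1 \<Longrightarrow> 1 \<le> T \<Longrightarrow>
      \<bar>\<rho> - (\<integral>y. green \<delta> T y * corr w y \<partial>lborel)\<bar>
        \<le> \<delta> * corr w 0 + 2 * (\<integral>x. \<bar>corr w x\<bar> \<partial>lborel) * T powr (- (1 / 2))"
proof -
  note [measurable] = corr_measurable[OF w]
  define r where "r \<xi> = Re (power_spectrum (corr w) \<xi>)" for \<xi>
  define h where "h t = (\<integral>x. heat t x * corr w x \<partial>lborel)" for t
  let ?\<sigma> = "\<integral>x. \<bar>corr w x\<bar> \<partial>lborel"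
  have r0: "r \<xi> \<ge> 0" for \<xi> using power_spectrum_nonneg(2)[OF w R] by (simp add: r_def)
  have r: "power_spectrum (corr w) \<xi> = of_real (r \<xi>)" for \<xi>
    using power_spectrum_nonneg(1)[OF w R, of \<xi>] by (simp add: complex_eq_iff r_def)
  have [measurable]: "r \<in> borel_measurable borel" unfolding r_def power_spectrum_def by measurable
  have [measurable]: "h \<in> borel_measurable borel" unfolding h_def by measurable
  note hf = heat_corr_fourier[OF w R, folded r_def h_def]
  have h0: "h t \<ge> 0" if "t > 0" for t unfolding hf(2)[OF that, symmetric] using r0 by simp
  have hR: "integrable lborel (\<lambda>x. heat t x * corr w x)" if "t > 0" for t
    by (rule integrable_mult_bounded[OF heat_integrable[OF that] _ corr_le_zero[OF w]]) simp
  have h1: "h t \<le> corr w 0" if t: "t > 0" for t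
  proof -
    have "h t \<le> (\<integral>x. heat t (x :: real^'d) * corr w 0 \<partial>lborel)"
      unfolding h_def using hR[OF t] heat_integrable[OF t, where 'd = 'd] corr_le_zero[OF w] abs_le_D1
      by (intro integral_mono mult_left_mono) (auto simp: heat_nonneg)
    then show ?thesis using t by (simp add: heat_integral)
  qed
  have h2: "h t \<le> ?\<sigma> * t powr (- (3 / 2))" if t: "t \<ge> 1" for t
  proof -
    have "heat t x \<le> t powr (- (3 / 2))" for x :: "real^'d"
    proof -
      have "heat t x \<le> t powr (- decay CARD('d))" by (rule heat_decay[OF d t])
      also have "\<dots> \<le> t powr (- (3 / 2))" using t by (intro powr_mono) (auto simp: decay_def)
      finally show ?thesis .
    qed
    then have "heat t x * corr w x \<le> t powr (- (3 / 2)) * \<bar>corr w x\<bar>" for x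
      using mult_mono[of "heat t x" "t powr (- (3 / 2))" "corr w x" "\<bar>corr w x\<bar>"]
        mult_right_mono[of "heat t x" "t powr (- (3 / 2))" "\<bar>corr w x\<bar>"] heat_nonneg[of t x]
      by (smt (verit) mult_left_mono abs_ge_self)
    then have "h t \<le> (\<integral>x. t powr (- (3 / 2)) * \<bar>corr w x\<bar> \<partial>lborel)"
      unfolding h_def using hR t R by (intro integral_mono) auto
    then show ?thesis by (simp add: mult.commute)
  qed
  have S0: "corr w 0 \<ge> 0" using corr_le_zero[OF w, of 0] by simp
  have total: "(\<integral>\<^sup>+\<xi>. ennreal (r \<xi> / (norm \<xi>)\<^sup>2) \<partial>lborel) = (\<integral>\<^sup>+t. ennreal (h t) * indicator {0<..} t \<partial>lborel)"
  proof -
    have "(\<integral>\<^sup>+\<xi>. ennreal (r \<xi> / (norm \<xi>)\<^sup>2) \<partial>lborel)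
        = (\<integral>\<^sup>+\<xi>. (\<integral>\<^sup>+t. ennreal (exp (- t * (norm \<xi>)\<^sup>2) * r \<xi>) * indicator {0<..} t \<partial>lborel) \<partial>lborel)"
    proof (rule nn_integral_cong_AE)
      have "AE \<xi> in lborel. \<xi> \<noteq> (0 :: real^'d)" by (rule AE_lborel_singleton)
      then show "AE \<xi> in lborel. ennreal (r \<xi> / (norm \<xi>)\<^sup>2)
          = (\<integral>\<^sup>+t. ennreal (exp (- t * (norm \<xi>)\<^sup>2) * r \<xi>) * indicator {0<..} t \<partial>lborel)"
      proof eventually_elim
        case (elim \<xi>)
        then have q: "(norm \<xi>)\<^sup>2 > 0" by simp
        have "(\<integral>\<^sup>+t. ennreal (exp (- t * (norm \<xi>)\<^sup>2) * r \<xi>) * indicator {0<..} t \<partial>lborel)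
            = (\<integral>\<^sup>+t. ennreal (r \<xi>) * (ennreal (exp (- t * (norm \<xi>)\<^sup>2)) * indicator {0..} t) \<partial>lborel)"
        proof (rule nn_integral_cong_AE)
          have "AE t in lborel. t \<noteq> (0 :: real)" by (rule AE_lborel_singleton)
          then show "AE t in lborel. ennreal (exp (- t * (norm \<xi>)\<^sup>2) * r \<xi>) * indicator {0<..} t
              = ennreal (r \<xi>) * (ennreal (exp (- t * (norm \<xi>)\<^sup>2)) * indicator {0..} t)"
            by eventually_elim (auto simp: indicator_def ennreal_mult'' r0 mult.commute)
        qed
        also have "\<dots> = ennreal (r \<xi>) * ennreal (1 / (norm \<xi>)\<^sup>2)"
          by (subst nn_integral_cmult) (measurable, simp only: nn_integral_exp_decay[OF q])
        also have "\<dots> = ennreal (r \<xi> / (norm \<xi>)\<^sup>2)"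
          by (subst ennreal_mult'[symmetric]) (auto simp: r0)
        finally show ?case by simp
      qed
    qed
    also have "\<dots> = (\<integral>\<^sup>+t. (\<integral>\<^sup>+\<xi>. ennreal (exp (- t * (norm \<xi>)\<^sup>2) * r \<xi>) * indicator {0<..} t \<partial>lborel) \<partial>lborel)"
      by (rule lborel_pair.Fubini') measurable
    also have "\<dots> = (\<integral>\<^sup>+t. ennreal (h t) * indicator {0<..} t \<partial>lborel)"
    proof (rule nn_integral_cong)
      fix t :: real
      show "(\<integral>\<^sup>+\<xi>. ennreal (exp (- t * (norm \<xi>)\<^sup>2) * r \<xi>) * indicator {0<..} t \<partial>lborel) = ennreal (h t) * indicator {0<..} t"
      proof (cases "t > 0")
        case True
        have "(\<integral>\<^sup>+\<xi>. ennreal (exp (- t * (norm \<xi>)\<^sup>2) * r \<xi>) \<partial>lborel) = ennreal (h t)"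
          using hf[OF True] r0 by (subst nn_integral_eq_integral) auto
        then show ?thesis using True by simp
      qed simp
    qed
    finally show ?thesis .
  qed
  define \<rho> where "\<rho> = (\<integral>\<xi>. r \<xi> / (norm \<xi>)\<^sup>2 \<partial>lborel)"
  have eff: "effective_potential (corr w) = of_real \<rho>"
    unfolding effective_potential_def \<rho>_def r
    by (simp only: of_real_divide[symmetric] integral_complex_of_real)
  show ?thesis
  proof (rule that[OF eff])
    fix \<delta> T :: real assume \<delta>: "0 < \<delta>" "\<delta> \<le> 1" and T: "1 \<le> T"
    let ?m = "\<integral>y. green \<delta> T y * corr w y \<partial>lborel"
    let ?J = "\<lambda>A. \<integral>\<^sup>+t. ennreal (h t) * indicator A t \<partial>lborel"
    have mid: "?J {\<delta>..T} = ennreal ?m" and m0: "?m \<ge> 0"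
    proof -
      have I: "integrable (lborel \<Otimes>\<^sub>M lborel) (\<lambda>(t, x). indicator {\<delta>..T} t * heat t x * corr w x)"
      proof (rule lborel_pair.Fubini_integrable)
        show "integrable lborel (\<lambda>t. \<integral>x. norm (case (t, x) of (t, x) \<Rightarrow> indicator {\<delta>..T} t * heat t x * corr w x) \<partial>lborel)"
        proof (rule Bochner_Integration.integrable_bound)
          show "integrable lborel (\<lambda>t. indicator {\<delta>..T} t * corr w 0)"
            by (intro integrable_mult_left integrable_real_indicator) (auto simp: emeasure_lborel_Icc_eq)
          show "AE t in lborel. norm (\<integral>x. norm (case (t, x) of (t, x) \<Rightarrow> indicator {\<delta>..T} t * heat t x * corr w x) \<partial>lborel)
              \<le> norm (indicator {\<delta>..T} t * corr w 0)"
          proof (rule AE_I2)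
            fix t :: real
            show "norm (\<integral>x. norm (case (t, x) of (t, x) \<Rightarrow> indicator {\<delta>..T} t * heat t x * corr w x) \<partial>lborel)
              \<le> norm (indicator {\<delta>..T} t * corr w 0)"
            proof (cases "t \<in> {\<delta>..T}")
              case True
              then have t: "t > 0" using \<delta> by auto
              have "(\<integral>x. \<bar>heat t x * corr w x\<bar> \<partial>lborel) \<le> (\<integral>x. heat t (x :: real^'d) * corr w 0 \<partial>lborel)"
                using hR[OF t] heat_integrable[OF t, where 'd = 'd] corr_le_zero[OF w]
                by (intro integral_mono integrable_abs) (auto simp: abs_mult heat_nonneg intro!: mult_left_mono)
              then show ?thesis using True t S0 by (simp add: heat_integral)
            qed simp
          qed
        qed measurable
        have "integrable lborel (\<lambda>x. indicator {\<delta>..T} t * heat t x * corr w x)" for t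
          using hR[of t] \<delta> by (cases "t \<in> {\<delta>..T}") auto
        then show "AE t in lborel. integrable lborel (\<lambda>x. case (t, x) of (t, x) \<Rightarrow> indicator {\<delta>..T} t * heat t x * corr w x)"
          by simp
      qed measurable
      have hh: "(\<integral>x. indicator {\<delta>..T} t * heat t x * corr w x \<partial>lborel) = indicator {\<delta>..T} t * h t" for t
        unfolding h_def by (simp add: mult.assoc)
      have i: "integrable lborel (\<lambda>t. indicator {\<delta>..T} t * h t)"
        using lborel_pair.integrable_fst[OF I] unfolding hh .
      have m: "(\<integral>t. indicator {\<delta>..T} t * h t \<partial>lborel) = ?m"
        using lborel_pair.Fubini_integral[OF I] unfolding hh by (simp add: green_def)
      have pos: "indicator {\<delta>..T} t * h t \<ge> 0" for t
        using h0[of t] \<delta> by (auto simp: indicator_def)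
      show "?m \<ge> 0" unfolding m[symmetric] by (intro Bochner_Integration.integral_nonneg pos)
      have "?J {\<delta>..T} = (\<integral>\<^sup>+t. ennreal (indicator {\<delta>..T} t * h t) \<partial>lborel)"
        by (intro nn_integral_cong) (auto simp: indicator_def)
      also have "\<dots> = ennreal ?m" unfolding m[symmetric] by (intro nn_integral_eq_integral i AE_I2 pos)
      finally show "?J {\<delta>..T} = ennreal ?m" .
    qed
    have lower: "?J {0<..<\<delta>} \<le> ennreal (\<delta> * corr w 0)"
    proof -
      have "?J {0<..<\<delta>} \<le> (\<integral>\<^sup>+t. ennreal (corr w 0) * indicator {0<..<\<delta>} t \<partial>lborel)"
        using h1 by (intro nn_integral_mono) (auto simp: indicator_def intro: ennreal_leI)
      also have "\<dots> = ennreal (\<delta> * corr w 0)" using \<delta> S0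
        by (subst nn_integral_cmult_indicator) (auto simp: ennreal_mult'' mult.commute)
      finally show ?thesis .
    qed
    have upper: "?J {T<..} \<le> ennreal (2 * ?\<sigma> * T powr (- (1 / 2)))"
    proof -
      have "?J {T<..} \<le> (\<integral>\<^sup>+t. ennreal (?\<sigma> * t powr (- (3 / 2))) * indicator {T..} t \<partial>lborel)"
        using h2 T by (intro nn_integral_mono) (auto simp: indicator_def intro!: ennreal_leI)
      also have "\<dots> = ennreal (0 - (- 2 * ?\<sigma> * T powr (- (1 / 2))))"
      proof (rule nn_integral_FTC_atLeast)
        fix t assume "T \<le> t"
        then have t: "t > 0" using T by simp
        show "((\<lambda>t. - 2 * ?\<sigma> * t powr (- (1 / 2))) has_real_derivative ?\<sigma> * t powr (- (3 / 2))) (at t)"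
          using DERIV_cmult[OF has_real_derivative_powr[OF t, of "- (1 / 2)"], of "- 2 * ?\<sigma>"] by simp
        show "0 \<le> ?\<sigma> * t powr (- (3 / 2))" by simp
      next
        have "((\<lambda>t :: real. t powr (- (1 / 2))) \<longlongrightarrow> 0) at_top"
          by (rule tendsto_neg_powr) (auto simp: filterlim_ident)
        then show "((\<lambda>t. - 2 * ?\<sigma> * t powr (- (1 / 2))) \<longlongrightarrow> 0) at_top"
          by (rule tendsto_mult_right_zero)
      qed measurable
      finally show ?thesis by simp
    qed
    have split: "?J {0<..} = ?J {0<..<\<delta>} + ?J {\<delta>..T} + ?J {T<..}"
    proof -
      have "?J {0<..} = (\<integral>\<^sup>+t. ennreal (h t) * indicator {0<..<\<delta>} t + ennreal (h t) * indicator {\<delta>..T} t + ennreal (h t) * indicator {T<..} t \<partial>lborel)"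
        using \<delta> T by (intro nn_integral_cong) (auto simp: indicator_def)
      then show ?thesis by (simp add: nn_integral_add)
    qed
    define err where "err = \<delta> * corr w 0 + 2 * ?\<sigma> * T powr (- (1 / 2))"
    have err0: "err \<ge> 0" using \<delta> S0 by (simp add: err_def)
    have le: "?J {0<..} \<le> ennreal (?m + err)"
    proof -
      have "?J {0<..} \<le> ennreal (\<delta> * corr w 0) + ennreal ?m + ennreal (2 * ?\<sigma> * T powr (- (1 / 2)))"
        unfolding split mid using lower upper by (intro add_mono) auto
      also have "\<dots> = ennreal (?m + err)"
        using \<delta> S0 m0 by (simp add: err_def ennreal_plus[symmetric] add_ac del: ennreal_plus)
      finally show ?thesis .
    qed
    have ge: "ennreal ?m \<le> ?J {0<..}" unfolding split mid by (simp add: add.commute add.left_commute)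
    have fin: "(\<integral>\<^sup>+\<xi>. ennreal (r \<xi> / (norm \<xi>)\<^sup>2) \<partial>lborel) < \<infinity>"
      unfolding total using le by (auto intro: order_le_less_trans)
    have i: "integrable lborel (\<lambda>\<xi>. r \<xi> / (norm \<xi>)\<^sup>2)"
      by (rule integrableI_nonneg) (use r0 fin in auto)
    have \<rho>0: "\<rho> \<ge> 0" unfolding \<rho>_def using r0 by simp
    have \<rho>J: "?J {0<..} = ennreal \<rho>"
      unfolding total[symmetric] \<rho>_def using r0 by (intro nn_integral_eq_integral i) auto
    have "\<rho> \<le> ?m + err" "?m \<le> \<rho>"
      using le ge m0 err0 \<rho>0 unfolding \<rho>J by (auto simp: ennreal_le_iff simp del: ennreal_plus)
    then show "\<bar>\<rho> - ?m\<bar> \<le> \<delta> * corr w 0 + 2 * ?\<sigma> * T powr (- (1 / 2))"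
      unfolding err_def[symmetric] by simp
  qed
qed

end

section \<open>The pathwise two-scale expansion\<close>

definition weak_equation ::
    "(real^'d \<Rightarrow> complex) \<Rightarrow> (real^'d \<Rightarrow> complex) \<Rightarrow> (real^'d \<Rightarrow> complex) \<Rightarrow> ('d \<Rightarrow> real^'d \<Rightarrow> complex) \<Rightarrow> bool" where
  "weak_equation q f u G \<longleftrightarrow> (\<forall>v H. H1_with_gradient v H \<longrightarrow>
     (\<Sum>i\<in>UNIV. L2_inner lborel (G i) (H i)) + L2_inner lborel (\<lambda>x. q x * u x) v = L2_inner lborel f v)"

lemma H1_solution_iff:
  "H1_solution q f u \<longleftrightarrow> (\<exists>G. H1_with_gradient u G \<and> weak_equation q f u G)"
  by (simp add: H1_solution_def weak_equation_def)

text \<open>For \<open>F = \<nabla>\<Phi>\<close> the first term on the right carries the Laplacian of \<open>\<Phi>\<close>. This is how an oscillating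
  potential is exchanged for the gradient of its corrector.\<close>

lemma H1_partial_field_by_parts:
  fixes u e :: "real^'d \<Rightarrow> complex" and F :: "'d \<Rightarrow> real^'d \<Rightarrow> real"
  assumes F: "\<And>i. C1_bounded (\<lambda>x. of_real (F i x)) (\<lambda>j x. of_real (D i j x))"
    and u: "H1_with_gradient u G" and e: "H1_with_gradient e E"
  shows "(\<Sum>i\<in>UNIV. L2_inner lborel (\<lambda>x. of_real (F i x) * u x) (E i))
    = - L2_inner lborel (\<lambda>x. of_real (\<Sum>i\<in>UNIV. D i i x) * u x) e
      - (\<Sum>i\<in>UNIV. L2_inner lborel (\<lambda>x. of_real (F i x) * G i x) e)"
proof -
  have L: "u \<in> L2 lborel" "e \<in> L2 lborel" "\<And>i. G i \<in> L2 lborel"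
    using u e by (auto simp: H1_with_gradient_def)
  have m: "(\<lambda>x. of_real (F i x) * w x) \<in> L2 lborel" "(\<lambda>x. of_real (D i i x) * w x) \<in> L2 lborel"
    if w: "w \<in> L2 lborel" for i w
  proof -
    obtain B where B: "B \<ge> 0" "\<And>x. cmod (of_real (F i x)) \<le> B" "\<And>j x. cmod (of_real (D i j x)) \<le> B"
      using C1_bounded_bounds[OF F[of i]] by metis
    note [measurable] = C1_bounded_measurable[OF F[of i]]
    show "(\<lambda>x. of_real (F i x) * w x) \<in> L2 lborel" using B by (intro L2_bounded_mult[OF w, where B = B]) auto
    show "(\<lambda>x. of_real (D i i x) * w x) \<in> L2 lborel" using B by (intro L2_bounded_mult[OF w, where B = B]) auto
  qed
  have "L2_inner lborel (\<lambda>x. of_real (F i x) * u x) (E i)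
      = - L2_inner lborel (\<lambda>x. of_real (D i i x) * u x) e - L2_inner lborel (\<lambda>x. of_real (F i x) * G i x) e" for i
    unfolding H1_integration_by_parts[OF H1_mult[OF F u] e]
    by (subst L2_inner_add_left) (use m L in auto)
  then have "(\<Sum>i\<in>UNIV. L2_inner lborel (\<lambda>x. of_real (F i x) * u x) (E i))
      = - (\<Sum>i\<in>UNIV. L2_inner lborel (\<lambda>x. of_real (D i i x) * u x) e)
      - (\<Sum>i\<in>UNIV. L2_inner lborel (\<lambda>x. of_real (F i x) * G i x) e)"
    by (simp add: sum_subtractf sum_negf)
  also have "(\<Sum>i\<in>UNIV. L2_inner lborel (\<lambda>x. of_real (D i i x) * u x) e)
      = L2_inner lborel (\<lambda>x. of_real (\<Sum>i\<in>UNIV. D i i x) * u x) e"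
    by (subst L2_inner_sum_left[symmetric]) (use m L in \<open>auto simp: sum_distrib_right\<close>)
  finally show ?thesis .
qed

text \<open>The quadratic form with potential \<open>q\<close> has as real part the full \<open>H\<^sup>1\<close> norm of \<open>e\<close>, and the right hand
  side is absorbed into it by the weighted Cauchy-Schwarz inequality.\<close>

lemma energy_bound:
  assumes e: "e \<in> L2 N" and E: "\<And>i. E i \<in> L2 N" and r: "r \<in> L2 N" and s: "\<And>i. s i \<in> L2 N"
    and q: "\<And>x. Re (q x) = 1"
    and id: "(\<Sum>i\<in>(UNIV :: 'd::finite set). L2_inner N (E i) (E i)) + L2_inner N (\<lambda>x. q x * e x) e
      = L2_inner N r e + (\<Sum>i\<in>UNIV. L2_inner N (s i) (E i))"
    and qe: "(\<lambda>x. q x * e x) \<in> L2 N"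
  shows "(\<integral>x. (cmod (e x))\<^sup>2 \<partial>N) \<le> (\<integral>x. (cmod (r x))\<^sup>2 \<partial>N) + (\<Sum>i\<in>UNIV. \<integral>x. (cmod (s i x))\<^sup>2 \<partial>N)"
proof -
  let ?n = "\<lambda>f. \<integral>x. (cmod (f x))\<^sup>2 \<partial>N"
  have b: "Re (L2_inner N f g) \<le> (?n f + ?n g) / 2" if "f \<in> L2 N" "g \<in> L2 N" for f g
    using order_trans[OF complex_Re_le_cmod L2_inner_bound_weighted[OF that, of 1]] by simp
  have "Re (q x * e x * cnj (e x)) = (cmod (e x))\<^sup>2" for x
  proof -
    have "q x * e x * cnj (e x) = q x * of_real ((cmod (e x))\<^sup>2)"
      by (simp only: mult.assoc complex_norm_square)
    then have "Re (q x * e x * cnj (e x)) = Re (q x * of_real ((cmod (e x))\<^sup>2))" by (simp only:)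
    also have "\<dots> = (cmod (e x))\<^sup>2" by (simp add: q del: of_real_power)
    finally show ?thesis .
  qed
  then have "Re (L2_inner N (\<lambda>x. q x * e x) e) = ?n e"
    unfolding L2_inner_def using L2_inner_integrable[OF qe e]
    by (subst integral_Re[symmetric]) auto
  then have "(\<Sum>i\<in>UNIV. ?n (E i)) + ?n e = Re (L2_inner N r e + (\<Sum>i\<in>UNIV. L2_inner N (s i) (E i)))"
    unfolding id[symmetric] by (simp add: L2_inner_self)
  also have "\<dots> = Re (L2_inner N r e) + (\<Sum>i\<in>UNIV. Re (L2_inner N (s i) (E i)))" by simp
  also have "\<dots> \<le> (?n r + ?n e) / 2 + (\<Sum>i\<in>UNIV. (?n (s i) + ?n (E i)) / 2)"
    by (intro add_mono sum_mono b e E r s)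
  also have "\<dots> = (?n r + ?n e + (\<Sum>i\<in>UNIV. ?n (s i)) + (\<Sum>i\<in>UNIV. ?n (E i))) / 2"
    by (simp add: sum_divide_distrib[symmetric] sum.distrib add_divide_distrib)
  finally have "(\<Sum>i\<in>UNIV. ?n (E i)) + ?n e \<le> ?n r + (\<Sum>i\<in>UNIV. ?n (s i))" by (simp add: field_simps)
  moreover have "(\<Sum>i\<in>UNIV. ?n (E i)) \<ge> 0" by (intro sum_nonneg) simp
  ultimately show ?thesis by linarith
qed

text \<open>Here \<open>\<Phi>\<close> and \<open>\<Psi>\<close> are the correctors in the macroscopic variable, so their Laplacians carry the factor
  \<open>1 / \<epsilon>\<^sup>2\<close>; \<open>a1 - a2\<close> and \<open>b1 - b2\<close> approximate the potential and the fluctuation \<open>V \<Phi> - m\<close>. The identity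
  combines five relations: the two weak equations tested with \<open>e\<close>, the limit equation tested with \<open>\<Phi> e\<close>,
  and the integrations by parts for \<open>\<nabla>\<Phi>\<close> and for \<open>\<nabla>\<Psi>\<close>.\<close>

lemma two_scale_identity:
  fixes u UU f :: "real^'d \<Rightarrow> complex" and \<Phi> \<Psi> V a1 a2 b1 b2 :: "real^'d \<Rightarrow> real" and m \<rho> :: real
  assumes \<epsilon>: "\<epsilon> > 0"
    and u: "H1_with_gradient u G"
    and ueq: "weak_equation (\<lambda>x. 1 + of_real \<rho>) f u G"
    and U: "H1_with_gradient UU GU"
    and Ueq: "weak_equation (\<lambda>x. 1 - \<i> / of_real \<epsilon> * of_real (V x)) f UU GU"
    and f: "f \<in> L2 lborel"
    and \<Phi>: "C1_bounded (\<lambda>x. of_real (\<Phi> x)) (\<lambda>i x. of_real (\<Phi>1 i x))"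
    and \<Phi>1: "\<And>i. C1_bounded (\<lambda>x. of_real (\<Phi>1 i x)) (\<lambda>j x. of_real (\<Phi>2 i j x))"
    and \<Phi>2: "\<And>x. (\<Sum>i\<in>UNIV. \<Phi>2 i i x) = - (a1 x - a2 x) / \<epsilon>\<^sup>2"
    and \<Psi>1: "\<And>i. C1_bounded (\<lambda>x. of_real (\<Psi>1 i x)) (\<lambda>j x. of_real (\<Psi>2 i j x))"
    and \<Psi>2: "\<And>x. (\<Sum>i\<in>UNIV. \<Psi>2 i i x) = - (b1 x - b2 x) / \<epsilon>\<^sup>2"
    and meas [measurable]: "V \<in> borel_measurable borel" "a1 \<in> borel_measurable borel" "a2 \<in> borel_measurable borel"
      "b1 \<in> borel_measurable borel" "b2 \<in> borel_measurable borel"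
    and bd: "\<And>x. \<bar>V x\<bar> \<le> B" "\<And>x. \<bar>a1 x\<bar> \<le> B" "\<And>x. \<bar>a2 x\<bar> \<le> B" "\<And>x. \<bar>b1 x\<bar> \<le> B" "\<And>x. \<bar>b2 x\<bar> \<le> B"
  defines "e \<equiv> \<lambda>x. UU x - u x - \<i> * of_real \<epsilon> * (of_real (\<Phi> x) * u x)"
    and "E \<equiv> \<lambda>i x. GU i x - G i x - \<i> * of_real \<epsilon> * (of_real (\<Phi>1 i x) * u x + of_real (\<Phi> x) * G i x)"
    and "q \<equiv> \<lambda>x. 1 - \<i> / of_real \<epsilon> * of_real (V x)"
    and "r \<equiv> \<lambda>x. of_real (\<rho> - m) * u x - of_real (V x * \<Phi> x - m - b1 x) * u x - of_real (b2 x) * u x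
        - of_real (\<epsilon>\<^sup>2) * (\<Sum>i\<in>UNIV. of_real (\<Psi>1 i x) * G i x)
        + \<i> / of_real \<epsilon> * (of_real (V x - a1 x) * u x) + \<i> / of_real \<epsilon> * (of_real (a2 x) * u x)
        - \<i> * of_real \<epsilon> * (of_real (\<Phi> x) * u x)
        + \<i> * of_real \<epsilon> * (of_real (\<Phi> x) * (f x - (1 + of_real \<rho>) * u x))"
    and "s \<equiv> \<lambda>i x. - 2 * \<i> * of_real \<epsilon> * (of_real (\<Phi> x) * G i x) - of_real (\<epsilon>\<^sup>2) * (of_real (\<Psi>1 i x) * u x)"
  shows "e \<in> L2 lborel" "E i \<in> L2 lborel" "r \<in> L2 lborel" "s i \<in> L2 lborel"
    and "(\<lambda>x. q x * e x) \<in> L2 lborel"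
    and "(\<Sum>i\<in>UNIV. L2_inner lborel (E i) (E i)) + L2_inner lborel (\<lambda>x. q x * e x) e
      = L2_inner lborel r e + (\<Sum>i\<in>UNIV. L2_inner lborel (s i) (E i))"
proof -
  let ?I = "\<lambda>a b. L2_inner lborel a (b :: real^'d \<Rightarrow> complex)"
  \<comment> \<open>With these abbreviations, \<open>j h = - 1\<close> is the cancellation between the corrector and the potential.\<close>
  define j h t where "j = \<i> * complex_of_real \<epsilon>" and "h = \<i> / complex_of_real \<epsilon>" and "t = complex_of_real (\<epsilon>\<^sup>2)"
  have jh: "j * h = - 1" and th: "t * h = j" and t0: "t \<noteq> 0"
    using \<epsilon> by (simp_all add: j_def h_def t_def power2_eq_square)
  note fold = j_def[symmetric] h_def[symmetric] t_def[symmetric]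
  have Lu: "u \<in> L2 lborel" "UU \<in> L2 lborel" "\<And>i. G i \<in> L2 lborel" "\<And>i. GU i \<in> L2 lborel"
    using u U by (auto simp: H1_with_gradient_def)
  obtain C where C: "C \<ge> 0" "\<And>x. cmod (of_real (\<Phi> x)) \<le> C" "\<And>i x. cmod (of_real (\<Phi>1 i x)) \<le> C"
    using C1_bounded_bounds[OF \<Phi>] by metis
  have mm [measurable]: "(\<lambda>x. complex_of_real (\<Phi> x)) \<in> borel_measurable borel" "\<And>i. (\<lambda>x. complex_of_real (\<Phi>1 i x)) \<in> borel_measurable borel"
      "\<And>i. (\<lambda>x. complex_of_real (\<Psi>1 i x)) \<in> borel_measurable borel"
    by (rule C1_bounded_measurable[OF \<Phi>] C1_bounded_measurable(1)[OF \<Psi>1])+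
  have L\<Phi>: "(\<lambda>x. of_real (\<Phi> x) * w x) \<in> L2 lborel" if "w \<in> L2 lborel" for w :: "real^'d \<Rightarrow> complex"
    using C by (intro L2_bounded_mult[OF that, where B = C]) auto
  have L\<Phi>1: "(\<lambda>x. of_real (\<Phi>1 i x) * w x) \<in> L2 lborel" if "w \<in> L2 lborel" for i and w :: "real^'d \<Rightarrow> complex"
    using C by (intro L2_bounded_mult[OF that, where B = C]) auto
  have L\<Psi>1: "(\<lambda>x. of_real (\<Psi>1 i x) * w x) \<in> L2 lborel" if "w \<in> L2 lborel" for i and w :: "real^'d \<Rightarrow> complex"
  proof -
    obtain C' where "C' \<ge> 0" "\<And>x. cmod (of_real (\<Psi>1 i x)) \<le> C'" "\<And>j x. cmod (of_real (\<Psi>2 i j x)) \<le> C'"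
      using C1_bounded_bounds[OF \<Psi>1[of i]] by metis
    then show ?thesis by (intro L2_bounded_mult[OF that, where B = C']) auto
  qed
  have Lb: "(\<lambda>x. of_real (k x) * w x) \<in> L2 lborel" if "w \<in> L2 lborel" "k \<in> {V, a1, a2, b1, b2}"
    for k :: "real^'d \<Rightarrow> real" and w :: "real^'d \<Rightarrow> complex"
    using bd that(2) by (intro L2_bounded_mult[OF that(1), where B = B]) auto
  have Lk: "(\<lambda>x. of_real (V x) * w x) \<in> L2 lborel" "(\<lambda>x. of_real (a1 x) * w x) \<in> L2 lborel"
     "(\<lambda>x. of_real (a2 x) * w x) \<in> L2 lborel" "(\<lambda>x. of_real (b1 x) * w x) \<in> L2 lborel"
     "(\<lambda>x. of_real (b2 x) * w x) \<in> L2 lborel" if "w \<in> L2 lborel" for w :: "real^'d \<Rightarrow> complex"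
    using Lb[OF that] by auto
  have L\<Sigma>: "(\<lambda>x. \<Sum>i\<in>UNIV. of_real (\<Psi>1 i x) * G i x) \<in> L2 lborel" by (intro L2_sum L\<Psi>1 Lu)
  note L = Lu f L\<Phi> L\<Phi>1 L\<Psi>1 Lk L\<Sigma> L2_add L2_diff L2_scale
  have HE: "H1_with_gradient e E"
    unfolding e_def E_def by (intro H1_diff H1_scale U u H1_mult[OF \<Phi>])
  have eL [simp]: "e \<in> L2 lborel" and EL [simp]: "E i \<in> L2 lborel" for i using HE by (auto simp: H1_with_gradient_def)
  then show "e \<in> L2 lborel" "E i \<in> L2 lborel" by auto
  have r_alt: "r = (\<lambda>x. of_real \<rho> * u x - (of_real (V x) * (of_real (\<Phi> x) * u x) - of_real (b1 x) * u x) - of_real (b2 x) * u x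
        - t * (\<Sum>i\<in>UNIV. of_real (\<Psi>1 i x) * G i x)
        + h * (of_real (V x) * u x - of_real (a1 x) * u x) + h * (of_real (a2 x) * u x)
        - j * (of_real (\<Phi> x) * u x)
        + j * (of_real (\<Phi> x) * f x - (1 + of_real \<rho>) * (of_real (\<Phi> x) * u x)))"
    unfolding r_def fold by (simp add: algebra_simps)
  show rL: "r \<in> L2 lborel" unfolding r_alt by (intro L)
  have s_alt: "s i = (\<lambda>x. - 2 * j * (of_real (\<Phi> x) * G i x) - t * (of_real (\<Psi>1 i x) * u x))" for i
    unfolding s_def fold by (simp add: j_def mult.assoc)
  show "s i \<in> L2 lborel" unfolding s_alt by (intro L)
  have E_alt: "E i = (\<lambda>x. GU i x - G i x - j * (of_real (\<Phi>1 i x) * u x + of_real (\<Phi> x) * G i x))" for i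
    by (simp add: E_def j_def)
  have qU_L: "(\<lambda>x. q x * UU x) \<in> L2 lborel"
  proof -
    have "(\<lambda>x. q x * UU x) = (\<lambda>x. UU x - h * (of_real (V x) * UU x))" by (auto simp: q_def h_def algebra_simps)
    moreover have "(\<lambda>x. UU x - h * (of_real (V x) * UU x)) \<in> L2 lborel" by (intro L)
    ultimately show ?thesis by (simp only:)
  qed
  have qe: "(\<lambda>x. q x * e x) = (\<lambda>x. q x * UU x - u x + h * (of_real (V x) * u x) - j * (of_real (\<Phi> x) * u x) - of_real (V x) * (of_real (\<Phi> x) * u x))"
  proof
    fix x
    show "q x * e x = q x * UU x - u x + h * (of_real (V x) * u x) - j * (of_real (\<Phi> x) * u x) - of_real (V x) * (of_real (\<Phi> x) * u x)"
      unfolding q_def e_def fold using jh by algebra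
  qed
  show "(\<lambda>x. q x * e x) \<in> L2 lborel" unfolding qe by (intro L qU_L)
  define a vu \<phi> w gu g S1 S2 S3 A1 A2 B1 B2 P1 P3 fp fe qU where
    "a = ?I u e" and "vu = ?I (\<lambda>x. of_real (V x) * u x) e" and "\<phi> = ?I (\<lambda>x. of_real (\<Phi> x) * u x) e"
    and "w = ?I (\<lambda>x. of_real (V x) * (of_real (\<Phi> x) * u x)) e"
    and "gu = (\<Sum>i\<in>UNIV. ?I (GU i) (E i))" and "g = (\<Sum>i\<in>UNIV. ?I (G i) (E i))"
    and "S1 = (\<Sum>i\<in>UNIV. ?I (\<lambda>x. of_real (\<Phi>1 i x) * u x) (E i))"
    and "S2 = (\<Sum>i\<in>UNIV. ?I (\<lambda>x. of_real (\<Phi> x) * G i x) (E i))"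
    and "S3 = (\<Sum>i\<in>UNIV. ?I (\<lambda>x. of_real (\<Phi>1 i x) * G i x) e)"
    and "A1 = ?I (\<lambda>x. of_real (a1 x) * u x) e" and "A2 = ?I (\<lambda>x. of_real (a2 x) * u x) e"
    and "B1 = ?I (\<lambda>x. of_real (b1 x) * u x) e" and "B2 = ?I (\<lambda>x. of_real (b2 x) * u x) e"
    and "P1 = (\<Sum>i\<in>UNIV. ?I (\<lambda>x. of_real (\<Psi>1 i x) * u x) (E i))"
    and "P3 = (\<Sum>i\<in>UNIV. ?I (\<lambda>x. of_real (\<Psi>1 i x) * G i x) e)"
    and "fp = ?I (\<lambda>x. of_real (\<Phi> x) * f x) e" and "fe = ?I f e" and "qU = ?I (\<lambda>x. q x * UU x) e"
  note defs = a_def vu_def \<phi>_def w_def gu_def g_def S1_def S2_def S3_def A1_def A2_def B1_def B2_def P1_def P3_def fp_def fe_def qU_def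
  have F1: "gu + qU = fe" using Ueq[unfolded weak_equation_def, rule_format, OF HE] unfolding defs q_def .
  have F2: "g + (1 + of_real \<rho>) * a = fe" using ueq[unfolded weak_equation_def, rule_format, OF HE] unfolding defs L2_inner_scale_left by simp
  have F3: "S3 + S2 + (1 + of_real \<rho>) * \<phi> = fp"
  proof -
    have c: "?I k (\<lambda>x. of_real (F x) * e x + of_real (F' x) * E i x)
       = ?I (\<lambda>x. of_real (F x) * k x) e + ?I (\<lambda>x. of_real (F' x) * k x) (E i)"
      if "k \<in> L2 lborel" "(\<lambda>x. of_real (F x) * e x) \<in> L2 lborel" "(\<lambda>x. of_real (F' x) * E i x) \<in> L2 lborel" for k F F' i
      using that by (simp add: L2_inner_add_right L2_inner_move_real)
    have "(\<Sum>i\<in>UNIV. ?I (G i) (\<lambda>x. of_real (\<Phi>1 i x) * e x + of_real (\<Phi> x) * E i x)) = S3 + S2"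
      unfolding defs sum.distrib[symmetric] by (intro sum.cong refl c L eL EL)
    then show ?thesis using ueq[unfolded weak_equation_def, rule_format, OF H1_mult[OF \<Phi> HE]]
      unfolding L2_inner_scale_left by (simp add: defs L2_inner_move_real)
  qed
  have lap: "?I (\<lambda>x. of_real (- (k x - l x) / \<epsilon>\<^sup>2) * u x) e = - (?I (\<lambda>x. of_real (k x) * u x) e - ?I (\<lambda>x. of_real (l x) * u x) e) / t"
    if "(\<lambda>x. of_real (k x) * u x) \<in> L2 lborel" "(\<lambda>x. of_real (l x) * u x) \<in> L2 lborel" for k l :: "real^'d \<Rightarrow> real"
  proof -
    have eq: "(\<lambda>x. of_real (- (k x - l x) / \<epsilon>\<^sup>2) * u x) = (\<lambda>x. (- 1 / t) * (of_real (k x) * u x - of_real (l x) * u x))"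
      unfolding t_def using \<epsilon> by (intro ext) (simp add: divide_simps, simp add: algebra_simps)
    have c: "(- 1 / t) * z = - z / t" for z by simp
    show ?thesis unfolding eq L2_inner_scale_left by (simp only: L2_inner_diff_left that eL c)
  qed
  have F4: "S1 = (A1 - A2) / t - S3"
    using H1_partial_field_by_parts[where F = \<Phi>1 and D = \<Phi>2, OF \<Phi>1 u HE] unfolding \<Phi>2 lap[OF Lk(2)[OF Lu(1)] Lk(3)[OF Lu(1)]] defs
    by (simp only: minus_divide_left minus_minus)
  have F5: "P1 = (B1 - B2) / t - P3"
    using H1_partial_field_by_parts[where F = \<Psi>1 and D = \<Psi>2, OF \<Psi>1 u HE] unfolding \<Psi>2 lap[OF Lk(4)[OF Lu(1)] Lk(5)[OF Lu(1)]] defs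
    by (simp only: minus_divide_left minus_minus)
  have EE: "(\<Sum>i\<in>UNIV. ?I (E i) (E i)) = gu - g - j * (S1 + S2)"
  proof -
    have "?I (E i) (E i) = ?I (GU i) (E i) - ?I (G i) (E i)
        - j * (?I (\<lambda>x. of_real (\<Phi>1 i x) * u x) (E i) + ?I (\<lambda>x. of_real (\<Phi> x) * G i x) (E i))" for i
    proof -
      have "?I (\<lambda>x. GU i x - G i x - j * (of_real (\<Phi>1 i x) * u x + of_real (\<Phi> x) * G i x)) k = ?I (GU i) k - ?I (G i) k
        - j * (?I (\<lambda>x. of_real (\<Phi>1 i x) * u x) k + ?I (\<lambda>x. of_real (\<Phi> x) * G i x) k)" if "k \<in> L2 lborel" for k
        using that by (simp add: L2_inner_diff_left L2_inner_add_left L2_inner_scale_left L)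
      from this[OF EL[of i]] show ?thesis unfolding E_alt[symmetric] .
    qed
    then show ?thesis by (simp add: defs sum_subtractf sum.distrib sum_distrib_left[symmetric] distrib_left)
  qed
  have QE: "?I (\<lambda>x. q x * e x) e = qU - a + h * vu - j * \<phi> - w"
    unfolding qe defs by (simp add: L2_inner_diff_left L2_inner_add_left L2_inner_scale_left L qU_L)
  have RE: "?I r e = of_real \<rho> * a - (w - B1) - B2 - t * P3 + h * (vu - A1) + h * A2 - j * \<phi> + j * (fp - (1 + of_real \<rho>) * \<phi>)"
    unfolding r_alt defs by (simp add: L2_inner_diff_left L2_inner_add_left L2_inner_scale_left L2_inner_sum_left L)
  have SE: "(\<Sum>i\<in>UNIV. ?I (s i) (E i)) = - 2 * j * S2 - t * P1"
  proof -
    have "?I (s i) (E i) = - 2 * j * ?I (\<lambda>x. of_real (\<Phi> x) * G i x) (E i) - t * ?I (\<lambda>x. of_real (\<Psi>1 i x) * u x) (E i)" for i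
      unfolding s_alt by (subst L2_inner_diff_left) (intro L EL | simp only: L2_inner_scale_left)+
    then show ?thesis unfolding defs by (simp only: sum_subtractf sum_distrib_left)
  qed
  have "t * S1 = A1 - A2 - t * S3" "t * P1 = B1 - B2 - t * P3" unfolding F4 F5 using t0 by (simp_all add: field_simps)
  moreover have "j * S1 = h * (A1 - A2) - j * S3"
  proof -
    have "j * S1 = h * (t * S1)" unfolding th[symmetric] by (simp add: mult_ac)
    also have "\<dots> = h * (A1 - A2) - j * S3" unfolding \<open>t * S1 = _\<close> th[symmetric] by (simp add: algebra_simps)
    finally show ?thesis .
  qed
  ultimately show "(\<Sum>i\<in>UNIV. L2_inner lborel (E i) (E i)) + L2_inner lborel (\<lambda>x. q x * e x) e
      = L2_inner lborel r e + (\<Sum>i\<in>UNIV. L2_inner lborel (s i) (E i))"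
    unfolding EE QE RE SE using F1 F2 F3 by algebra
qed

lemma sum8_square_le:
  fixes a1 a2 a3 a4 a5 a6 a7 a8 :: complex
  shows "(cmod (a1 - a2 - a3 - a4 + a5 + a6 - a7 + a8))\<^sup>2
    \<le> 8 * ((cmod a1)\<^sup>2 + (cmod a2)\<^sup>2 + (cmod a3)\<^sup>2 + (cmod a4)\<^sup>2 + (cmod a5)\<^sup>2 + (cmod a6)\<^sup>2 + (cmod a7)\<^sup>2 + (cmod a8)\<^sup>2)"
proof -
  have eq: "a1 - a2 - a3 - a4 + a5 + a6 - a7 + a8 = ((a1 + (- a2)) + (- a3 + (- a4))) + ((a5 + a6) + (- a7 + a8))"
    by simp
  have "(cmod (a1 - a2 - a3 - a4 + a5 + a6 - a7 + a8))\<^sup>2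
      \<le> 2 * (cmod ((a1 + (- a2)) + (- a3 + (- a4))))\<^sup>2 + 2 * (cmod ((a5 + a6) + (- a7 + a8)))\<^sup>2"
    unfolding eq by (rule cmod_add_square_le)
  moreover have "(cmod ((a1 + (- a2)) + (- a3 + (- a4))))\<^sup>2 \<le> 2 * (cmod (a1 + (- a2)))\<^sup>2 + 2 * (cmod (- a3 + (- a4)))\<^sup>2"
    "(cmod ((a5 + a6) + (- a7 + a8)))\<^sup>2 \<le> 2 * (cmod (a5 + a6))\<^sup>2 + 2 * (cmod (- a7 + a8))\<^sup>2"
    by (rule cmod_add_square_le)+
  moreover have "(cmod (a1 + (- a2)))\<^sup>2 \<le> 2 * (cmod a1)\<^sup>2 + 2 * (cmod (- a2))\<^sup>2"
    "(cmod (- a3 + (- a4)))\<^sup>2 \<le> 2 * (cmod (- a3))\<^sup>2 + 2 * (cmod (- a4))\<^sup>2"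
    "(cmod (a5 + a6))\<^sup>2 \<le> 2 * (cmod a5)\<^sup>2 + 2 * (cmod a6)\<^sup>2"
    "(cmod (- a7 + a8))\<^sup>2 \<le> 2 * (cmod (- a7))\<^sup>2 + 2 * (cmod a8)\<^sup>2"
    by (rule cmod_add_square_le)+
  ultimately show ?thesis by simp
qed

lemma cmod_sum_mult_square_le:
  fixes a :: "'i \<Rightarrow> real" and z :: "'i \<Rightarrow> complex"
  shows "(cmod (\<Sum>i\<in>I. of_real (a i) * z i))\<^sup>2 \<le> (\<Sum>i\<in>I. (a i)\<^sup>2) * (\<Sum>i\<in>I. (cmod (z i))\<^sup>2)"
proof -
  have "cmod (\<Sum>i\<in>I. of_real (a i) * z i) \<le> (\<Sum>i\<in>I. \<bar>a i\<bar> * cmod (z i))"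
    by (rule order_trans[OF norm_sum]) (simp add: norm_mult)
  then have "(cmod (\<Sum>i\<in>I. of_real (a i) * z i))\<^sup>2 \<le> (\<Sum>i\<in>I. \<bar>a i\<bar> * cmod (z i))\<^sup>2"
    by (rule power_mono) simp
  also have "\<dots> \<le> (\<Sum>i\<in>I. \<bar>a i\<bar>\<^sup>2) * (\<Sum>i\<in>I. (cmod (z i))\<^sup>2)"
    by (rule Cauchy_Schwarz_ineq_sum)
  finally show ?thesis by simp
qed

text \<open>The constants come from eight summands in the residual and two in each flux, doubled when
  \<open>e\<close> is compared with the difference of the solutions. The bound is kept in the form of a sum of three
  products of a deterministic density with a random factor, ready for taking expectations.\<close>

lemma two_scale_estimate:
  fixes u UU f :: "real^'d \<Rightarrow> complex" and \<Phi> \<Psi> V a1 a2 b1 b2 :: "real^'d \<Rightarrow> real" and m \<rho> :: real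
  assumes \<epsilon>: "\<epsilon> > 0"
    and u: "H1_with_gradient u G"
    and ueq: "weak_equation (\<lambda>x. 1 + of_real \<rho>) f u G"
    and U: "H1_solution (\<lambda>x. 1 - \<i> / of_real \<epsilon> * of_real (V x)) f UU"
    and f: "f \<in> L2 lborel"
    and \<Phi>: "C1_bounded (\<lambda>x. of_real (\<Phi> x)) (\<lambda>i x. of_real (\<Phi>1 i x))"
    and \<Phi>1: "\<And>i. C1_bounded (\<lambda>x. of_real (\<Phi>1 i x)) (\<lambda>j x. of_real (\<Phi>2 i j x))"
    and \<Phi>2: "\<And>x. (\<Sum>i\<in>UNIV. \<Phi>2 i i x) = - (a1 x - a2 x) / \<epsilon>\<^sup>2"
    and \<Psi>1: "\<And>i. C1_bounded (\<lambda>x. of_real (\<Psi>1 i x)) (\<lambda>j x. of_real (\<Psi>2 i j x))"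
    and \<Psi>2: "\<And>x. (\<Sum>i\<in>UNIV. \<Psi>2 i i x) = - (b1 x - b2 x) / \<epsilon>\<^sup>2"
    and meas [measurable]: "V \<in> borel_measurable borel" "a1 \<in> borel_measurable borel" "a2 \<in> borel_measurable borel"
      "b1 \<in> borel_measurable borel" "b2 \<in> borel_measurable borel"
    and bd: "\<And>x. \<bar>V x\<bar> \<le> B" "\<And>x. \<bar>a1 x\<bar> \<le> B" "\<And>x. \<bar>a2 x\<bar> \<le> B" "\<And>x. \<bar>b1 x\<bar> \<le> B" "\<And>x. \<bar>b2 x\<bar> \<le> B"
  shows "(\<integral>\<^sup>+x. ennreal ((cmod (UU x - u x))\<^sup>2) \<partial>lborel) \<le>
    (\<integral>\<^sup>+x. ennreal ((cmod (u x))\<^sup>2 * (16 * ((\<rho> - m)\<^sup>2 + (V x * \<Phi> x - m - b1 x)\<^sup>2 + (b2 x)\<^sup>2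
            + ((V x - a1 x) / \<epsilon>)\<^sup>2 + (a2 x / \<epsilon>)\<^sup>2) + 18 * (\<epsilon> * \<Phi> x)\<^sup>2 + 4 * (\<Sum>i\<in>UNIV. (\<epsilon>\<^sup>2 * \<Psi>1 i x)\<^sup>2))
        + (\<Sum>i\<in>UNIV. (cmod (G i x))\<^sup>2) * (16 * (\<epsilon> * \<Phi> x)\<^sup>2 + 16 * (\<Sum>i\<in>UNIV. (\<epsilon>\<^sup>2 * \<Psi>1 i x)\<^sup>2))
        + (cmod (f x - (1 + of_real \<rho>) * u x))\<^sup>2 * (16 * (\<epsilon> * \<Phi> x)\<^sup>2)) \<partial>lborel)"
proof -
  obtain GU where GU: "H1_with_gradient UU GU" "weak_equation (\<lambda>x. 1 - \<i> / of_real \<epsilon> * of_real (V x)) f UU GU"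
    using U unfolding H1_solution_iff by blast
  define e where "e = (\<lambda>x. UU x - u x - \<i> * of_real \<epsilon> * (of_real (\<Phi> x) * u x))"
  define E where "E = (\<lambda>i x. GU i x - G i x - \<i> * of_real \<epsilon> * (of_real (\<Phi>1 i x) * u x + of_real (\<Phi> x) * G i x))"
  define q where "q = (\<lambda>x. 1 - \<i> / of_real \<epsilon> * of_real (V x))"
  define r where "r = (\<lambda>x. of_real (\<rho> - m) * u x - of_real (V x * \<Phi> x - m - b1 x) * u x - of_real (b2 x) * u x
        - of_real (\<epsilon>\<^sup>2) * (\<Sum>i\<in>UNIV. of_real (\<Psi>1 i x) * G i x)
        + \<i> / of_real \<epsilon> * (of_real (V x - a1 x) * u x) + \<i> / of_real \<epsilon> * (of_real (a2 x) * u x)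
        - \<i> * of_real \<epsilon> * (of_real (\<Phi> x) * u x)
        + \<i> * of_real \<epsilon> * (of_real (\<Phi> x) * (f x - (1 + of_real \<rho>) * u x)))"
  define s where "s = (\<lambda>i x. - 2 * \<i> * of_real \<epsilon> * (of_real (\<Phi> x) * G i x) - of_real (\<epsilon>\<^sup>2) * (of_real (\<Psi>1 i x) * u x))"
  note two = two_scale_identity(1,2,4,5)[OF \<epsilon> u ueq GU f \<Phi> \<Phi>1 \<Phi>2 \<Psi>1 \<Psi>2 meas bd]
    two_scale_identity(3,6)[where m = m, OF \<epsilon> u ueq GU f \<Phi> \<Phi>1 \<Phi>2 \<Psi>1 \<Psi>2 meas bd]
  have L: "e \<in> L2 lborel" "\<And>i. E i \<in> L2 lborel" "r \<in> L2 lborel" "\<And>i. s i \<in> L2 lborel" "(\<lambda>x. q x * e x) \<in> L2 lborel"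
    and id: "(\<Sum>i\<in>UNIV. L2_inner lborel (E i) (E i)) + L2_inner lborel (\<lambda>x. q x * e x) e
      = L2_inner lborel r e + (\<Sum>i\<in>UNIV. L2_inner lborel (s i) (E i))"
    unfolding e_def E_def r_def s_def q_def by (rule two)+
  have "Re (q x) = 1" for x by (simp add: q_def Re_divide)
  from energy_bound[where E = E and s = s, OF L(1) L(2) L(3) L(4) this id L(5)]
  have main: "(\<integral>x. (cmod (e x))\<^sup>2 \<partial>lborel) \<le> (\<integral>x. (cmod (r x))\<^sup>2 \<partial>lborel) + (\<Sum>i\<in>UNIV. \<integral>x. (cmod (s i x))\<^sup>2 \<partial>lborel)" .
  have [measurable]: "u \<in> borel_measurable borel" "f \<in> borel_measurable borel" "\<And>i. G i \<in> borel_measurable borel"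
    "e \<in> borel_measurable borel" "r \<in> borel_measurable borel" "\<And>i. s i \<in> borel_measurable borel"
  proof -
    have "u \<in> L2 lborel" "\<And>i. G i \<in> L2 lborel" using u by (auto simp: H1_with_gradient_def)
    then show "u \<in> borel_measurable borel" "f \<in> borel_measurable borel" "\<And>i. G i \<in> borel_measurable borel"
      "e \<in> borel_measurable borel" "r \<in> borel_measurable borel" "\<And>i. s i \<in> borel_measurable borel"
      using L(1,3,4) f by (simp_all only: L2_def mem_Collect_eq measurable_lborel2)
  qed
  have "(\<lambda>x. Re (complex_of_real (\<Phi> x))) \<in> borel_measurable borel" 
    by (rule measurable_compose[OF C1_bounded_measurable(1)[OF \<Phi>]]) measurable
  then have [measurable]: "\<Phi> \<in> borel_measurable borel" by simp
  have n: "(\<integral>\<^sup>+x. ennreal ((cmod (k x))\<^sup>2) \<partial>lborel) = ennreal (\<integral>x. (cmod (k x))\<^sup>2 \<partial>lborel)" if "k \<in> L2 lborel" for k :: "real^'d \<Rightarrow> complex"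
    by (rule nn_integral_eq_integral[OF L2_square_integrable[OF that]]) simp
  have "(\<integral>\<^sup>+x. ennreal ((cmod (UU x - u x))\<^sup>2) \<partial>lborel)
      \<le> (\<integral>\<^sup>+x. 2 * ennreal ((cmod (e x))\<^sup>2) + ennreal (2 * (\<epsilon> * \<Phi> x)\<^sup>2 * (cmod (u x))\<^sup>2) \<partial>lborel)"
  proof (rule nn_integral_mono)
    fix x
    have "(cmod (UU x - u x))\<^sup>2 = (cmod (e x + \<i> * of_real \<epsilon> * (of_real (\<Phi> x) * u x)))\<^sup>2" by (simp add: e_def)
    also have "\<dots> \<le> 2 * (cmod (e x))\<^sup>2 + 2 * (cmod (\<i> * of_real \<epsilon> * (of_real (\<Phi> x) * u x)))\<^sup>2" by (rule cmod_add_square_le)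
    also have "2 * (cmod (\<i> * of_real \<epsilon> * (of_real (\<Phi> x) * u x)))\<^sup>2 = 2 * (\<epsilon> * \<Phi> x)\<^sup>2 * (cmod (u x))\<^sup>2"
      by (simp add: norm_mult power_mult_distrib)
    finally have "ennreal ((cmod (UU x - u x))\<^sup>2) \<le> ennreal (2 * (cmod (e x))\<^sup>2 + 2 * (\<epsilon> * \<Phi> x)\<^sup>2 * (cmod (u x))\<^sup>2)" by (rule ennreal_leI)
    also have "\<dots> = 2 * ennreal ((cmod (e x))\<^sup>2) + ennreal (2 * (\<epsilon> * \<Phi> x)\<^sup>2 * (cmod (u x))\<^sup>2)"
      by (simp add: ennreal_mult)
    finally show "ennreal ((cmod (UU x - u x))\<^sup>2) \<le> \<dots>" .
  qed
  also have "\<dots> = 2 * ennreal (\<integral>x. (cmod (e x))\<^sup>2 \<partial>lborel) + (\<integral>\<^sup>+x. ennreal (2 * (\<epsilon> * \<Phi> x)\<^sup>2 * (cmod (u x))\<^sup>2) \<partial>lborel)"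
    by (subst nn_integral_add) (simp_all add: nn_integral_cmult n[OF L(1)])
  also have "\<dots> \<le> 2 * ennreal ((\<integral>x. (cmod (r x))\<^sup>2 \<partial>lborel) + (\<Sum>i\<in>UNIV. \<integral>x. (cmod (s i x))\<^sup>2 \<partial>lborel))
      + (\<integral>\<^sup>+x. ennreal (2 * (\<epsilon> * \<Phi> x)\<^sup>2 * (cmod (u x))\<^sup>2) \<partial>lborel)"
    using main by (intro add_mono mult_left_mono ennreal_leI) auto
  also have "ennreal ((\<integral>x. (cmod (r x))\<^sup>2 \<partial>lborel) + (\<Sum>i\<in>UNIV. \<integral>x. (cmod (s i x))\<^sup>2 \<partial>lborel))
      = (\<integral>\<^sup>+x. ennreal ((cmod (r x))\<^sup>2 + (\<Sum>i\<in>UNIV. (cmod (s i x))\<^sup>2)) \<partial>lborel)"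
    using L2_square_integrable[OF L(3)] L2_square_integrable[OF L(4)]
    by (subst nn_integral_eq_integral) (auto simp: sum_nonneg)
  also have "2 * \<dots> + (\<integral>\<^sup>+x. ennreal (2 * (\<epsilon> * \<Phi> x)\<^sup>2 * (cmod (u x))\<^sup>2) \<partial>lborel)
      = (\<integral>\<^sup>+x. ennreal (2 * ((cmod (r x))\<^sup>2 + (\<Sum>i\<in>UNIV. (cmod (s i x))\<^sup>2)) + 2 * (\<epsilon> * \<Phi> x)\<^sup>2 * (cmod (u x))\<^sup>2) \<partial>lborel)"
    by (subst nn_integral_cmult[symmetric], simp, subst nn_integral_add[symmetric])
      (auto simp: ennreal_mult sum_nonneg intro!: nn_integral_cong)
  also have "\<dots> \<le> (\<integral>\<^sup>+x. ennreal ((cmod (u x))\<^sup>2 * (16 * ((\<rho> - m)\<^sup>2 + (V x * \<Phi> x - m - b1 x)\<^sup>2 + (b2 x)\<^sup>2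
            + ((V x - a1 x) / \<epsilon>)\<^sup>2 + (a2 x / \<epsilon>)\<^sup>2) + 18 * (\<epsilon> * \<Phi> x)\<^sup>2 + 4 * (\<Sum>i\<in>UNIV. (\<epsilon>\<^sup>2 * \<Psi>1 i x)\<^sup>2))
        + (\<Sum>i\<in>UNIV. (cmod (G i x))\<^sup>2) * (16 * (\<epsilon> * \<Phi> x)\<^sup>2 + 16 * (\<Sum>i\<in>UNIV. (\<epsilon>\<^sup>2 * \<Psi>1 i x)\<^sup>2))
        + (cmod (f x - (1 + of_real \<rho>) * u x))\<^sup>2 * (16 * (\<epsilon> * \<Phi> x)\<^sup>2)) \<partial>lborel)"
  proof (intro nn_integral_mono ennreal_leI)
    fix x
    define P where "P = (\<Sum>i\<in>UNIV. (\<epsilon>\<^sup>2 * \<Psi>1 i x)\<^sup>2)"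
    define Q where "Q = (\<Sum>i\<in>UNIV. (cmod (G i x))\<^sup>2)"
    define N where "N = (cmod (u x))\<^sup>2"
    define F where "F = (cmod (f x - (1 + of_real \<rho>) * u x))\<^sup>2"
    have s: "(cmod (s i x))\<^sup>2 \<le> 8 * (\<epsilon> * \<Phi> x)\<^sup>2 * (cmod (G i x))\<^sup>2 + 2 * (\<epsilon>\<^sup>2 * \<Psi>1 i x)\<^sup>2 * N" for i
    proof -
      have "(cmod (s i x))\<^sup>2 \<le> 2 * (cmod (- 2 * \<i> * of_real \<epsilon> * (of_real (\<Phi> x) * G i x)))\<^sup>2
          + 2 * (cmod (- (of_real (\<epsilon>\<^sup>2) * (of_real (\<Psi>1 i x) * u x))))\<^sup>2"
        using cmod_add_square_le[of "- 2 * \<i> * of_real \<epsilon> * (of_real (\<Phi> x) * G i x)" "- (of_real (\<epsilon>\<^sup>2) * (of_real (\<Psi>1 i x) * u x))"]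
        unfolding s_def by simp
      also have "\<dots> = 8 * (\<epsilon> * \<Phi> x)\<^sup>2 * (cmod (G i x))\<^sup>2 + 2 * (\<epsilon>\<^sup>2 * \<Psi>1 i x)\<^sup>2 * N"
        by (simp add: norm_mult power_mult_distrib N_def norm_power)
      finally show ?thesis .
    qed
    have "(\<Sum>i\<in>UNIV. (cmod (s i x))\<^sup>2) \<le> (\<Sum>i\<in>UNIV. 8 * (\<epsilon> * \<Phi> x)\<^sup>2 * (cmod (G i x))\<^sup>2 + 2 * (\<epsilon>\<^sup>2 * \<Psi>1 i x)\<^sup>2 * N)"
      by (intro sum_mono s)
    also have "\<dots> = 8 * (\<epsilon> * \<Phi> x)\<^sup>2 * Q + 2 * P * N"
      by (simp add: sum.distrib sum_distrib_left sum_distrib_right P_def Q_def)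
    finally have S: "(\<Sum>i\<in>UNIV. (cmod (s i x))\<^sup>2) \<le> 8 * (\<epsilon> * \<Phi> x)\<^sup>2 * Q + 2 * P * N" .
    have PG: "(cmod (of_real (\<epsilon>\<^sup>2) * (\<Sum>i\<in>UNIV. of_real (\<Psi>1 i x) * G i x)))\<^sup>2 \<le> P * Q"
    proof -
      have "of_real (\<epsilon>\<^sup>2) * (\<Sum>i\<in>UNIV. of_real (\<Psi>1 i x) * G i x) = (\<Sum>i\<in>UNIV. of_real (\<epsilon>\<^sup>2 * \<Psi>1 i x) * G i x)"
        by (simp add: sum_distrib_left mult.assoc)
      then show ?thesis unfolding P_def Q_def using cmod_sum_mult_square_le by metis
    qed
    have "(cmod (r x))\<^sup>2 \<le> 8 * ((\<rho> - m)\<^sup>2 * N + (V x * \<Phi> x - m - b1 x)\<^sup>2 * N + (b2 x)\<^sup>2 * N + P * Q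
        + ((V x - a1 x) / \<epsilon>)\<^sup>2 * N + (a2 x / \<epsilon>)\<^sup>2 * N + (\<epsilon> * \<Phi> x)\<^sup>2 * N + (\<epsilon> * \<Phi> x)\<^sup>2 * F)"
    proof -
      have c: "(cmod (of_real a * z))\<^sup>2 = a\<^sup>2 * (cmod z)\<^sup>2" "(cmod (\<i> / of_real \<epsilon> * (of_real a * z)))\<^sup>2 = (a / \<epsilon>)\<^sup>2 * (cmod z)\<^sup>2"
         "(cmod (\<i> * of_real \<epsilon> * (of_real a * z)))\<^sup>2 = (\<epsilon> * a)\<^sup>2 * (cmod z)\<^sup>2" for a z
        using \<epsilon> by (simp_all add: norm_mult norm_divide power_mult_distrib power_divide)
      show ?thesis
        unfolding r_def
        by (rule order_trans[OF sum8_square_le]) (use PG in \<open>simp only: c N_def F_def, simp\<close>)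
    qed
    then show "2 * ((cmod (r x))\<^sup>2 + (\<Sum>i\<in>UNIV. (cmod (s i x))\<^sup>2)) + 2 * (\<epsilon> * \<Phi> x)\<^sup>2 * (cmod (u x))\<^sup>2
      \<le> (cmod (u x))\<^sup>2 * (16 * ((\<rho> - m)\<^sup>2 + (V x * \<Phi> x - m - b1 x)\<^sup>2 + (b2 x)\<^sup>2
            + ((V x - a1 x) / \<epsilon>)\<^sup>2 + (a2 x / \<epsilon>)\<^sup>2) + 18 * (\<epsilon> * \<Phi> x)\<^sup>2 + 4 * (\<Sum>i\<in>UNIV. (\<epsilon>\<^sup>2 * \<Psi>1 i x)\<^sup>2))
        + (\<Sum>i\<in>UNIV. (cmod (G i x))\<^sup>2) * (16 * (\<epsilon> * \<Phi> x)\<^sup>2 + 16 * (\<Sum>i\<in>UNIV. (\<epsilon>\<^sup>2 * \<Psi>1 i x)\<^sup>2))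
        + (cmod (f x - (1 + of_real \<rho>) * u x))\<^sup>2 * (16 * (\<epsilon> * \<Phi> x)\<^sup>2)"
      using S unfolding P_def[symmetric] Q_def[symmetric] N_def[symmetric] F_def[symmetric]
      by (simp add: algebra_simps)
  qed
  finally show ?thesis .
qed

section \<open>The expected error\<close>

context ergodic_translation_group
begin

lemma bounded_rv_mono: "bounded_rv A w \<Longrightarrow> A \<le> B \<Longrightarrow> bounded_rv B w"
  by (force simp: bounded_rv_def)

lemma rescaled_average_C1:
  assumes K: "C1_kernel K P D" and w: "bounded_rv B w" and \<omega>: "\<omega> \<in> space M"
  shows "C1_bounded (\<lambda>x. of_real (a * translate \<tau> (x /\<^sub>R \<epsilon>) (avg K w) \<omega>))
    (\<lambda>i x. of_real (a / \<epsilon> * translate \<tau> (x /\<^sub>R \<epsilon>) (avg (P i) w) \<omega>))"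
  unfolding C1_bounded_def
proof (intro conjI allI)
  have Ki: "integrable lborel K" using K by (simp add: C1_kernel_def)
  note bK = avg_bounded[OF w Ki] and bP = avg_bounded[OF w C1_kernel_partial_integrable[OF K]]
  show "((\<lambda>x. complex_of_real (a * translate \<tau> (x /\<^sub>R \<epsilon>) (avg K w) \<omega>)) has_derivative
      (\<lambda>h. \<Sum>i\<in>UNIV. h $ i *\<^sub>R complex_of_real (a / \<epsilon> * translate \<tau> (x /\<^sub>R \<epsilon>) (avg (P i) w) \<omega>))) (at x)" for x
  proof -
    have s: "((\<lambda>x :: real^'d. x /\<^sub>R \<epsilon>) has_derivative (\<lambda>h. h /\<^sub>R \<epsilon>)) (at x)"
      by (auto intro!: derivative_eq_intros)
    have "((\<lambda>x. avg K w (\<tau> (- (x /\<^sub>R \<epsilon>)) \<omega>)) has_derivative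
        (\<lambda>h. \<Sum>i\<in>UNIV. (h /\<^sub>R \<epsilon>) $ i *\<^sub>R avg (P i) w (\<tau> (- (x /\<^sub>R \<epsilon>)) \<omega>))) (at x)"
      by (rule has_derivative_compose[OF s avg_has_derivative[OF K w \<omega>]])
    from has_derivative_of_real[OF has_derivative_mult_right[OF this, of a], where 'a = complex]
    show ?thesis
      unfolding translate_def
      by (rule has_derivative_eq_rhs) (simp add: sum_distrib_left scaleR_conv_of_real[where 'a = complex] divide_inverse mult_ac)
  qed
  have [measurable]: "avg (P i) w \<in> borel_measurable M" for i using bounded_rvD(1)[OF bP] .
  show "(\<lambda>x. complex_of_real (a / \<epsilon> * translate \<tau> (x /\<^sub>R \<epsilon>) (avg (P i) w) \<omega>)) \<in> borel_measurable borel" for i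
    unfolding translate_def using \<omega> by measurable
  let ?K = "B * (\<integral>y. \<bar>K y\<bar> \<partial>lborel)" and ?P = "\<lambda>i. B * (\<integral>y. \<bar>P i y\<bar> \<partial>lborel)"
  show "\<exists>C. \<forall>x. cmod (of_real (a * translate \<tau> (x /\<^sub>R \<epsilon>) (avg K w) \<omega>)) \<le> C \<and>
      (\<forall>i. cmod (of_real (a / \<epsilon> * translate \<tau> (x /\<^sub>R \<epsilon>) (avg (P i) w) \<omega>)) \<le> C)"
  proof (intro exI[of _ "\<bar>a\<bar> * ?K + (\<Sum>i\<in>UNIV. \<bar>a / \<epsilon>\<bar> * ?P i)"] allI conjI)
    fix x :: "real^'d" and i
    have nP: "\<bar>a / \<epsilon>\<bar> * ?P j \<ge> 0" for j by (rule mult_nonneg_nonneg[OF abs_ge_zero bounded_rvD(2)[OF bP]])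
    have nK: "\<bar>a\<bar> * ?K \<ge> 0" by (rule mult_nonneg_nonneg[OF abs_ge_zero bounded_rvD(2)[OF bK]])
    have sp: "\<tau> (- (x /\<^sub>R \<epsilon>)) \<omega> \<in> space M" by (rule shift_space[OF \<omega>])
    have "\<bar>a\<bar> * \<bar>avg K w (\<tau> (- (x /\<^sub>R \<epsilon>)) \<omega>)\<bar> \<le> \<bar>a\<bar> * ?K"
      by (intro mult_left_mono bounded_rvD(3)[OF bK sp]) simp
    moreover have "(\<Sum>i\<in>UNIV. \<bar>a / \<epsilon>\<bar> * ?P i) \<ge> 0" by (intro sum_nonneg nP)
    ultimately show "cmod (of_real (a * translate \<tau> (x /\<^sub>R \<epsilon>) (avg K w) \<omega>)) \<le> \<bar>a\<bar> * ?K + (\<Sum>i\<in>UNIV. \<bar>a / \<epsilon>\<bar> * ?P i)"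
      unfolding norm_of_real translate_def abs_mult by linarith
    have "\<bar>a / \<epsilon>\<bar> * \<bar>avg (P i) w (\<tau> (- (x /\<^sub>R \<epsilon>)) \<omega>)\<bar> \<le> \<bar>a / \<epsilon>\<bar> * ?P i"
      by (intro mult_left_mono bounded_rvD(3)[OF bP sp]) simp
    also have "\<dots> \<le> (\<Sum>i\<in>UNIV. \<bar>a / \<epsilon>\<bar> * ?P i)" by (rule member_le_sum) (use nP in auto)
    finally show "cmod (of_real (a / \<epsilon> * translate \<tau> (x /\<^sub>R \<epsilon>) (avg (P i) w) \<omega>)) \<le> \<bar>a\<bar> * ?K + (\<Sum>i\<in>UNIV. \<bar>a / \<epsilon>\<bar> * ?P i)"
      using nK unfolding norm_of_real translate_def abs_mult by linarith
  qed
qed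

lemma avg_green_laplacian:
  assumes a: "0 < a" "a \<le> b" and w: "bounded_rv B w" and \<omega>: "\<omega> \<in> space M"
  shows "(\<Sum>i\<in>UNIV. avg (green2 a b i i) w \<omega>) = - (avg (heat a) w \<omega> - avg (heat b) w \<omega>)"
proof -
  have b: "0 < b" using a by simp
  have I: "integrable lborel (green2 a b i i :: real^'d \<Rightarrow> real)" for i
    using green1_C1_kernel[OF a, of i] C1_kernel_partial_integrable by blast
  have "(\<Sum>i\<in>UNIV. avg (green2 a b i i) w \<omega>) = (\<integral>y. (\<Sum>i\<in>UNIV. green2 a b i i y * w (\<tau> y \<omega>)) \<partial>lborel)"
    unfolding avg_def by (rule Bochner_Integration.integral_sum[symmetric]) (rule avg_integrand_integrable[OF w I \<omega>])
  also have "\<dots> = avg (\<lambda>y. heat b y - heat a y) w \<omega>"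
    unfolding avg_def sum_distrib_right[symmetric] green_laplacian[OF a] ..
  also have "\<dots> = avg (heat b) w \<omega> - avg (heat a) w \<omega>"
    by (rule avg_add(2)[OF w heat_integrable[OF b] heat_integrable[OF a(1)] \<omega>])
  finally show ?thesis by simp
qed

text \<open>The law of a stationary field at \<open>x / \<epsilon>\<close> does not depend on \<open>x\<close>.\<close>

lemma stationary_tonelli:
  fixes k :: "real^'d \<Rightarrow> real"
  assumes [measurable]: "X \<in> borel_measurable M" "k \<in> borel_measurable borel" and k: "\<And>x. k x \<ge> 0"
  shows "(\<integral>\<^sup>+\<omega>. (\<integral>\<^sup>+x. ennreal (k x * translate \<tau> (x /\<^sub>R \<epsilon>) X \<omega>) \<partial>lborel) \<partial>M)
    = (\<integral>\<^sup>+x. ennreal (k x) \<partial>lborel) * (\<integral>\<^sup>+\<omega>. ennreal (X \<omega>) \<partial>M)"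
proof -
  interpret P: pair_sigma_finite "lborel :: (real^'d) measure" M ..
  have shift: "(\<integral>\<^sup>+\<omega>. ennreal (X (\<tau> y \<omega>)) \<partial>M) = (\<integral>\<^sup>+\<omega>. ennreal (X \<omega>) \<partial>M)" for y
    by (subst (2) invariant[of y, symmetric], subst nn_integral_distr) auto
  have "(\<integral>\<^sup>+\<omega>. (\<integral>\<^sup>+x. ennreal (k x * translate \<tau> (x /\<^sub>R \<epsilon>) X \<omega>) \<partial>lborel) \<partial>M)
      = (\<integral>\<^sup>+x. (\<integral>\<^sup>+\<omega>. ennreal (k x * translate \<tau> (x /\<^sub>R \<epsilon>) X \<omega>) \<partial>M) \<partial>lborel)"
    unfolding translate_def by (rule P.Fubini') measurable
  also have "\<dots> = (\<integral>\<^sup>+x. ennreal (k x) * (\<integral>\<^sup>+\<omega>. ennreal (X \<omega>) \<partial>M) \<partial>lborel)"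
  proof (rule nn_integral_cong)
    fix x :: "real^'d"
    show "(\<integral>\<^sup>+\<omega>. ennreal (k x * translate \<tau> (x /\<^sub>R \<epsilon>) X \<omega>) \<partial>M) = ennreal (k x) * (\<integral>\<^sup>+\<omega>. ennreal (X \<omega>) \<partial>M)"
      unfolding translate_def shift[of "- (x /\<^sub>R \<epsilon>)", symmetric]
      by (subst nn_integral_cmult[symmetric]) (auto simp: ennreal_mult' k)
  qed
  also have "\<dots> = (\<integral>\<^sup>+x. ennreal (k x) \<partial>lborel) * (\<integral>\<^sup>+\<omega>. ennreal (X \<omega>) \<partial>M)"
    by (rule nn_integral_multc) measurable
  finally show ?thesis .
qed

text \<open>With \<open>T = 1 / \<epsilon>\<^sup>2\<close>, the first bound still leaves a factor \<open>\<epsilon>\<^sup>2\<close> after division by \<open>\<epsilon>\<^sup>2\<close>. It is an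
  equality in dimension three.\<close>

lemma heat_average_rate:
  assumes d: "CARD('d) \<ge> 3" and T: "T \<ge> 1"
  shows "T powr (- (real CARD('d) / 2)) \<le> growth CARD('d) T / T\<^sup>2" "T powr (- (real CARD('d) / 2)) \<le> 1 / T"
proof -
  have e: "T powr (- (real CARD('d) / 2)) = T powr (2 - real CARD('d) / 2) / T\<^sup>2"
  proof -
    have "T powr (2 - real CARD('d) / 2) = T powr 2 * T powr (- (real CARD('d) / 2))"
      by (simp add: powr_add[symmetric])
    then show ?thesis using T by simp
  qed
  have "T powr (2 - real CARD('d) / 2) \<le> growth CARD('d) T"
  proof (cases "CARD('d) = 3")
    case True
    then show ?thesis using T by (simp add: growth_def powr_half_sqrt)
  next
    case False
    have "T powr (2 - real CARD('d) / 2) \<le> T powr 0" using d False T by (intro powr_mono) auto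
    also have "\<dots> \<le> growth CARD('d) T" using growth_ge_1[OF T] T by simp
    finally show ?thesis .
  qed
  then show "T powr (- (real CARD('d) / 2)) \<le> growth CARD('d) T / T\<^sup>2"
    unfolding e by (intro divide_right_mono) auto
  have "T powr (- (real CARD('d) / 2)) \<le> T powr (- 1)" using d T by (intro powr_mono) auto
  then show "T powr (- (real CARD('d) / 2)) \<le> 1 / T" using T by (simp add: powr_minus_divide)
qed

text \<open>Collects the second moments that enter the error, as multiples of \<open>\<epsilon>\<^sup>2\<close> times the growth of the Green
  function, for one choice of the two small times and of the mean \<open>m\<close>. Residuals that are divided by \<open>\<epsilon>\<close> in
  the expansion carry an extra factor \<open>\<epsilon>\<^sup>2\<close>.\<close>

definition corrector_error_bounds :: "('w \<Rightarrow> real) \<Rightarrow> real \<Rightarrow> real \<Rightarrow> real \<Rightarrow> bool" where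
  "corrector_error_bounds v \<rho> C \<epsilon> \<longleftrightarrow> (\<exists>\<delta> \<delta>' m. \<exists>w.
      0 < \<delta> \<and> \<delta> \<le> 1 \<and> 0 < \<delta>' \<and> \<delta>' \<le> 1 \<and>
      w = (\<lambda>\<omega>. v \<omega> * avg (green \<delta> (1 / \<epsilon>\<^sup>2)) v \<omega> - m) \<and> (\<exists>A. bounded_rv A w) \<and>
      (\<rho> - m)\<^sup>2 \<le> C * (\<epsilon>\<^sup>2 * growth CARD('d) (1 / \<epsilon>\<^sup>2)) \<and>
      (\<integral>\<omega>. (avg (green \<delta> (1 / \<epsilon>\<^sup>2)) v \<omega>)\<^sup>2 \<partial>M) \<le> C * growth CARD('d) (1 / \<epsilon>\<^sup>2) \<and>
      (\<integral>\<omega>. (v \<omega> - avg (heat \<delta>) v \<omega>)\<^sup>2 \<partial>M) \<le> \<epsilon>\<^sup>2 * (C * (\<epsilon>\<^sup>2 * growth CARD('d) (1 / \<epsilon>\<^sup>2))) \<and>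
      (\<integral>\<omega>. (avg (heat (1 / \<epsilon>\<^sup>2)) v \<omega>)\<^sup>2 \<partial>M) \<le> \<epsilon>\<^sup>2 * (C * (\<epsilon>\<^sup>2 * growth CARD('d) (1 / \<epsilon>\<^sup>2))) \<and>
      (\<integral>\<omega>. (w \<omega> - avg (heat \<delta>') w \<omega>)\<^sup>2 \<partial>M) \<le> C * (\<epsilon>\<^sup>2 * growth CARD('d) (1 / \<epsilon>\<^sup>2)) \<and>
      (\<integral>\<omega>. (avg (heat (1 / \<epsilon>\<^sup>2)) w \<omega>)\<^sup>2 \<partial>M) \<le> C * (\<epsilon>\<^sup>2 * growth CARD('d) (1 / \<epsilon>\<^sup>2)) \<and>
      (\<Sum>i\<in>UNIV. \<integral>\<omega>. (avg (green1 \<delta>' (1 / \<epsilon>\<^sup>2) i) w \<omega>)\<^sup>2 \<partial>M) \<le> C * growth CARD('d) (1 / \<epsilon>\<^sup>2))"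

text \<open>The small times are chosen after \<open>\<epsilon>\<close>: nothing in the other bounds depends on how small they are. The
  second one is chosen last, because the fluctuation \<open>w\<close> depends on the first. The variance of \<open>w\<close> is
  bounded through \<open>|v \<phi>| \<le> B |\<phi>|\<close>, the integral of its correlation by the fourth moments.\<close>

lemma corrector_moments:
  assumes d: "CARD('d) \<ge> 3" and v: "bounded_rv B v" and R: "integrable lborel (corr v)"
    and g: "integrable lborel g" "\<And>x. g x \<ge> 0"
    and four: "\<And>x y z. \<bar>(\<integral>\<omega>. v \<omega> * v (\<tau> y \<omega>) * v (\<tau> (- x) \<omega>) * v (\<tau> (z - x) \<omega>) \<partial>M) - corr v y * corr v z\<bar>
       \<le> g x * g (z - y - x) + g (x - z) * g (x + y)"
    and \<rho>: "\<forall>\<delta> T. 0 < \<delta> \<longrightarrow> \<delta> \<le> 1 \<longrightarrow> 1 \<le> T \<longrightarrow>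
      \<bar>\<rho> - (\<integral>y. green \<delta> T y * corr v y \<partial>lborel)\<bar>
        \<le> \<delta> * corr v 0 + 2 * (\<integral>x. \<bar>corr v x\<bar> \<partial>lborel) * T powr (- (1 / 2))"
  shows "\<exists>C\<ge>0. \<forall>\<epsilon>. 0 < \<epsilon> \<longrightarrow> \<epsilon> \<le> 1 \<longrightarrow> corrector_error_bounds v \<rho> C \<epsilon>"
proof -
  define S \<sigma> \<gamma> where "S = corr v 0" and "\<sigma> = (\<integral>x. \<bar>corr v x\<bar> \<partial>lborel)" and "\<gamma> = (\<integral>x. g x \<partial>lborel)"
  define C1 C2 where "C1 = 2 * S + 12 * \<sigma>" and "C2 = 4 * B\<^sup>2 * \<gamma> + 20 * \<gamma>\<^sup>2"
  define C where "C = (S + 2 * \<sigma>)\<^sup>2 + C1 + 1 + \<sigma> + C2 + (2 * (B\<^sup>2 * C1) + 4 * C2)"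
  have S0: "S \<ge> 0" using corr_le_zero[OF v, of 0] by (simp add: S_def)
  have s0: "\<sigma> \<ge> 0" "\<gamma> \<ge> 0" using g by (simp_all add: \<sigma>_def \<gamma>_def)
  have C12: "C1 \<ge> 0" "C2 \<ge> 0" "B\<^sup>2 * C1 \<ge> 0" using S0 s0 by (auto simp: C1_def C2_def)
  have Cge: "C \<ge> 0" "(S + 2 * \<sigma>)\<^sup>2 \<le> C" "C1 \<le> C" "1 \<le> C" "\<sigma> \<le> C" "C2 \<le> C" "2 * (B\<^sup>2 * C1) + 4 * C2 \<le> C"
    unfolding C_def using C12 s0 zero_le_power2[of "S + 2 * \<sigma>"] by linarith+
  show ?thesis
  proof (intro exI[of _ C] conjI Cge(1) allI impI)
    fix \<epsilon> :: real assume \<epsilon>: "0 < \<epsilon>" "\<epsilon> \<le> 1"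
    define T where "T = 1 / \<epsilon>\<^sup>2"
    define h where "h = growth CARD('d) T"
    have T: "1 \<le> T" "0 < T" using \<epsilon> by (simp_all add: T_def power_le_one)
    have T\<epsilon>: "1 / T = \<epsilon>\<^sup>2" "1 / T\<^sup>2 = \<epsilon>\<^sup>2 * \<epsilon>\<^sup>2" "T powr (- (1 / 2)) = \<epsilon>"
    proof -
      show "1 / T = \<epsilon>\<^sup>2" "1 / T\<^sup>2 = \<epsilon>\<^sup>2 * \<epsilon>\<^sup>2" by (simp_all add: T_def power_divide power2_eq_square)
      show "T powr (- (1 / 2)) = \<epsilon>" using \<epsilon> T
        by (simp add: powr_minus_divide powr_half_sqrt T_def real_sqrt_divide)
    qed
    have h: "1 \<le> h" unfolding h_def by (rule growth_ge_1[OF T(1)])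
    have up: "c * (\<epsilon>\<^sup>2 * h) \<le> C * (\<epsilon>\<^sup>2 * h)" "c * h \<le> C * h" if "c \<le> C" for c
      using that h by (auto intro!: mult_right_mono)
    have e1: "\<epsilon>\<^sup>2 \<le> 1 * (\<epsilon>\<^sup>2 * h)" using h mult_left_mono[of 1 h "\<epsilon>\<^sup>2"] by simp
    have "\<epsilon>\<^sup>2 * \<epsilon>\<^sup>2 > 0" using \<epsilon> by simp
    then obtain \<delta> where \<delta>: "0 < \<delta>" "\<delta> \<le> \<epsilon>" "(\<integral>\<omega>. (v \<omega> - avg (heat \<delta>) v \<omega>)\<^sup>2 \<partial>M) \<le> \<epsilon>\<^sup>2 * \<epsilon>\<^sup>2"
      using small_time_average[OF v _ \<epsilon>(1)] by metis
    have \<delta>1: "\<delta> \<le> 1" using \<delta> \<epsilon> by simp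
    then have \<delta>T: "\<delta> \<le> T" using T by simp
    note K = green_integrable[OF \<delta>(1) \<delta>T, where 'd = 'd]
    define \<phi> where "\<phi> = avg (green \<delta> T) v"
    define m where "m = (\<integral>y. green \<delta> T y * corr v y \<partial>lborel)"
    define w where "w = (\<lambda>\<omega>. v \<omega> * \<phi> \<omega> - m)"
    have \<phi>: "bounded_rv (B * (\<integral>y. \<bar>green \<delta> T (y :: real^'d)\<bar> \<partial>lborel)) \<phi>"
      unfolding \<phi>_def by (rule avg_bounded[OF v K])
    note v\<phi> = bounded_rv_mult[OF v \<phi>]
    have "\<exists>A. bounded_rv A w" unfolding w_def using bounded_rv_add(2)[OF v\<phi> bounded_rv_const] by blast
    then obtain A where w: "bounded_rv A w" ..
    have cW: "integrable lborel (corr w)" "(\<integral>x. \<bar>corr w x\<bar> \<partial>lborel) \<le> C2 * h"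
      using corrector_covariance[OF d \<delta>(1) \<delta>1 T(1) v g four]
      unfolding w_def \<phi>_def m_def C2_def h_def \<gamma>_def by auto
    have E\<phi>: "(\<integral>\<omega>. (\<phi> \<omega>)\<^sup>2 \<partial>M) \<le> C1 * h"
    proof -
      have "(\<integral>\<omega>. (\<phi> \<omega>)\<^sup>2 \<partial>M) \<le> 2 * S + 12 * h * \<sigma>"
        unfolding \<phi>_def S_def h_def \<sigma>_def by (rule near_far_moments(1)[OF d \<delta>(1) \<delta>1 T(1) v R])
      moreover have "S * 1 \<le> S * h" using h S0 by (rule mult_left_mono)
      ultimately show ?thesis by (simp add: C1_def algebra_simps)
    qed
    have W0: "corr w 0 \<le> B\<^sup>2 * C1 * h"
    proof -
      have m: "(\<integral>\<omega>. v \<omega> * \<phi> \<omega> \<partial>M) = m" unfolding \<phi>_def m_def by (rule corrector_covariance_formula(4)[OF v K])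
      note i1 = bounded_rv_integrable[OF v\<phi>] and i2 = square_integrable_rv[OF v\<phi>] and i3 = square_integrable_rv[OF \<phi>]
      have "corr w 0 = (\<integral>\<omega>. (v \<omega> * \<phi> \<omega>)\<^sup>2 - 2 * m * (v \<omega> * \<phi> \<omega>) + m\<^sup>2 \<partial>M)"
        unfolding corr_zero[OF w] by (simp add: w_def power2_diff algebra_simps)
      also have "\<dots> = (\<integral>\<omega>. (v \<omega> * \<phi> \<omega>)\<^sup>2 \<partial>M) - 2 * m * (\<integral>\<omega>. v \<omega> * \<phi> \<omega> \<partial>M) + m\<^sup>2"
        using i1 i2 by (simp add: prob_space)
      also have "\<dots> \<le> (\<integral>\<omega>. (v \<omega> * \<phi> \<omega>)\<^sup>2 \<partial>M)" unfolding m by (simp add: power2_eq_square)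
      also have "\<dots> \<le> (\<integral>\<omega>. B\<^sup>2 * (\<phi> \<omega>)\<^sup>2 \<partial>M)"
      proof (rule integral_mono)
        fix \<omega> assume "\<omega> \<in> space M"
        then have "\<bar>v \<omega>\<bar>\<^sup>2 \<le> B\<^sup>2" by (intro power_mono bounded_rvD(3)[OF v]) auto
        then show "(v \<omega> * \<phi> \<omega>)\<^sup>2 \<le> B\<^sup>2 * (\<phi> \<omega>)\<^sup>2"
          unfolding power_mult_distrib by (intro mult_right_mono) auto
      qed (use i2 i3 in auto)
      also have "\<dots> \<le> B\<^sup>2 * (C1 * h)" using E\<phi> by (simp add: mult_left_mono)
      finally show ?thesis by (simp add: mult.assoc)
    qed
    have "\<epsilon>\<^sup>2 > 0" using \<epsilon> by simp
    then obtain \<delta>' where \<delta>': "0 < \<delta>'" "\<delta>' \<le> 1" "(\<integral>\<omega>. (w \<omega> - avg (heat \<delta>') w \<omega>)\<^sup>2 \<partial>M) \<le> \<epsilon>\<^sup>2"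
      using small_time_average[OF w _ zero_less_one] by metis
    have b1: "(\<rho> - m)\<^sup>2 \<le> C * (\<epsilon>\<^sup>2 * h)"
    proof -
      have "\<bar>\<rho> - m\<bar> \<le> \<delta> * S + 2 * \<sigma> * \<epsilon>"
        using \<rho>[rule_format, OF \<delta>(1) \<delta>1 T(1)] unfolding m_def S_def \<sigma>_def T\<epsilon>(3) .
      also have "\<dots> \<le> (S + 2 * \<sigma>) * \<epsilon>" using mult_right_mono[OF \<delta>(2) S0] by (simp add: algebra_simps)
      finally have "\<bar>\<rho> - m\<bar>\<^sup>2 \<le> ((S + 2 * \<sigma>) * \<epsilon>)\<^sup>2" by (rule power_mono) simp
      also have "\<dots> = (S + 2 * \<sigma>)\<^sup>2 * \<epsilon>\<^sup>2" by (simp add: power_mult_distrib)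
      also have "\<dots> \<le> (S + 2 * \<sigma>)\<^sup>2 * (\<epsilon>\<^sup>2 * h)" using e1 by (intro mult_left_mono) auto
      also have "\<dots> \<le> C * (\<epsilon>\<^sup>2 * h)" by (rule up(1)[OF Cge(2)])
      finally show ?thesis by simp
    qed
    have b2: "(\<integral>\<omega>. (\<phi> \<omega>)\<^sup>2 \<partial>M) \<le> C * h" using E\<phi> up(2)[OF Cge(3)] by (rule order_trans)
    have b3: "(\<integral>\<omega>. (v \<omega> - avg (heat \<delta>) v \<omega>)\<^sup>2 \<partial>M) \<le> \<epsilon>\<^sup>2 * (C * (\<epsilon>\<^sup>2 * h))"
      by (rule order_trans[OF \<delta>(3) mult_left_mono[OF order_trans[OF e1 up(1)[OF Cge(4)]]]]) simp
    have b4: "(\<integral>\<omega>. (avg (heat T) v \<omega>)\<^sup>2 \<partial>M) \<le> \<epsilon>\<^sup>2 * (C * (\<epsilon>\<^sup>2 * h))"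
    proof -
      have "(\<integral>\<omega>. (avg (heat T) v \<omega>)\<^sup>2 \<partial>M) \<le> T powr (- (real CARD('d) / 2)) * \<sigma>"
        unfolding \<sigma>_def by (rule heat_average_square[OF T(2) v R])
      also have "\<dots> \<le> h / T\<^sup>2 * \<sigma>" using heat_average_rate(1)[OF d T(1)] s0(1) unfolding h_def by (rule mult_right_mono)
      also have "\<dots> = \<epsilon>\<^sup>2 * (\<sigma> * (\<epsilon>\<^sup>2 * h))" using T\<epsilon>(2) by (simp add: divide_inverse mult_ac)
      also have "\<dots> \<le> \<epsilon>\<^sup>2 * (C * (\<epsilon>\<^sup>2 * h))" by (intro mult_left_mono up(1) Cge) simp
      finally show ?thesis .
    qed
    have b5: "(\<integral>\<omega>. (w \<omega> - avg (heat \<delta>') w \<omega>)\<^sup>2 \<partial>M) \<le> C * (\<epsilon>\<^sup>2 * h)"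
      using \<delta>'(3) order_trans[OF e1 up(1)[OF Cge(4)]] by (rule order_trans)
    have b6: "(\<integral>\<omega>. (avg (heat T) w \<omega>)\<^sup>2 \<partial>M) \<le> C * (\<epsilon>\<^sup>2 * h)"
    proof -
      have "(\<integral>\<omega>. (avg (heat T) w \<omega>)\<^sup>2 \<partial>M) \<le> T powr (- (real CARD('d) / 2)) * (\<integral>x. \<bar>corr w x\<bar> \<partial>lborel)"
        by (rule heat_average_square[OF T(2) w cW(1)])
      also have "\<dots> \<le> (1 / T) * (C2 * h)" using heat_average_rate(2)[OF d T(1)] cW(2) T by (intro mult_mono) auto
      also have "\<dots> = C2 * (\<epsilon>\<^sup>2 * h)" unfolding T\<epsilon>(1) by (simp add: mult_ac)
      also have "\<dots> \<le> C * (\<epsilon>\<^sup>2 * h)" by (rule up(1)[OF Cge(6)])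
      finally show ?thesis .
    qed
    have b7: "(\<Sum>i\<in>UNIV. \<integral>\<omega>. (avg (green1 \<delta>' T i) w \<omega>)\<^sup>2 \<partial>M) \<le> C * h"
    proof -
      have "(\<Sum>i\<in>UNIV. \<integral>\<omega>. (avg (green1 \<delta>' T i) w \<omega>)\<^sup>2 \<partial>M) \<le> 2 * corr w 0 + 4 * (\<integral>x. \<bar>corr w x\<bar> \<partial>lborel)"
        by (rule corrector_gradient[OF d \<delta>'(1,2) T(1) w cW(1)])
      also have "\<dots> \<le> 2 * (B\<^sup>2 * C1 * h) + 4 * (C2 * h)" using W0 cW(2) by (intro add_mono mult_left_mono) auto
      also have "\<dots> = (2 * (B\<^sup>2 * C1) + 4 * C2) * h" by (simp add: algebra_simps)
      also have "\<dots> \<le> C * h" by (rule up(2)[OF Cge(7)])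
      finally show ?thesis .
    qed
    show "corrector_error_bounds v \<rho> C \<epsilon>"
      unfolding corrector_error_bounds_def
      unfolding T_def[symmetric] h_def[symmetric]
      by (rule exI[of _ \<delta>], rule exI[of _ \<delta>'], rule exI[of _ m], rule exI[of _ w])
        (intro conjI \<delta>(1) \<delta>1 \<delta>'(1,2) exI[of _ A] w b1 b2[unfolded \<phi>_def] b3 b4 b5 b6 b7 w_def[unfolded \<phi>_def])
  qed
qed

text \<open>The pathwise bound is a sum of three densities times stationary factors \<open>X1\<close>, \<open>X2\<close>, \<open>X3\<close>; the
  expectation of each factor is at most \<open>16 \<cdot> 5 + 18 + 4 = 102\<close> times the common bound of the second
  moments.\<close>

lemma homogenization_estimate:
  fixes g :: "real^'d \<Rightarrow> real"
  assumes d: "CARD('d) \<ge> 3" and v: "bounded_rv B v" and R: "integrable lborel (corr v)"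
    and g: "integrable lborel g" "\<And>x. g x \<ge> 0"
    and four: "\<And>x y z. \<bar>(\<integral>\<omega>. v \<omega> * v (\<tau> y \<omega>) * v (\<tau> (- x) \<omega>) * v (\<tau> (z - x) \<omega>) \<partial>M) - corr v y * corr v z\<bar>
       \<le> g x * g (z - y - x) + g (x - z) * g (x + y)"
    and f: "f \<in> L2 lborel" and u: "H1_solution (\<lambda>x. 1 + effective_potential (corr v)) f u"
  obtains C where "C \<ge> 0" "\<And>\<epsilon> U. 0 < \<epsilon> \<Longrightarrow> \<epsilon> \<le> 1 \<Longrightarrow>
      AE \<omega> in M. H1_solution (\<lambda>x. 1 - \<i> / of_real \<epsilon> * of_real (translate \<tau> (x /\<^sub>R \<epsilon>) v \<omega>)) f (\<lambda>x. U x \<omega>) \<Longrightarrow>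
      (\<integral>\<^sup>+\<omega>. (\<integral>\<^sup>+x. ennreal ((cmod (U x \<omega> - u x))\<^sup>2) \<partial>lborel) \<partial>M)
        \<le> ennreal (C * (\<epsilon>\<^sup>2 * growth CARD('d) (1 / \<epsilon>\<^sup>2)))"
proof -
  obtain \<rho> where \<rho>: "effective_potential (corr v) = of_real \<rho>"
    "\<forall>\<delta> T. 0 < \<delta> \<longrightarrow> \<delta> \<le> 1 \<longrightarrow> 1 \<le> T \<longrightarrow>
      \<bar>\<rho> - (\<integral>y. green \<delta> T y * corr v y \<partial>lborel)\<bar>
        \<le> \<delta> * corr v 0 + 2 * (\<integral>x. \<bar>corr v x\<bar> \<partial>lborel) * T powr (- (1 / 2))"
  proof (rule effective_potential_approx[OF d v R])
    fix \<rho> assume "effective_potential (corr v) = of_real \<rho>"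
      "\<And>\<delta> T. 0 < \<delta> \<Longrightarrow> \<delta> \<le> 1 \<Longrightarrow> 1 \<le> T \<Longrightarrow>
      \<bar>\<rho> - (\<integral>y. green \<delta> T y * corr v y \<partial>lborel)\<bar>
        \<le> \<delta> * corr v 0 + 2 * (\<integral>x. \<bar>corr v x\<bar> \<partial>lborel) * T powr (- (1 / 2))"
    then show thesis by (intro that) auto
  qed
  obtain C where C: "C \<ge> 0" and mom: "\<And>\<epsilon>. 0 < \<epsilon> \<Longrightarrow> \<epsilon> \<le> 1 \<Longrightarrow> corrector_error_bounds v \<rho> C \<epsilon>"
    using corrector_moments[OF d v R g four \<rho>(2)] by blast
  obtain G where uG: "H1_with_gradient u G" and ueq: "weak_equation (\<lambda>x. 1 + of_real \<rho>) f u G"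
    using u unfolding H1_solution_iff \<rho> by blast
  have L: "u \<in> L2 lborel" "\<And>i. G i \<in> L2 lborel" using uG by (auto simp: H1_with_gradient_def)
  define F where "F x = f x - (1 + of_real \<rho>) * u x" for x
  have F: "F \<in> L2 lborel" unfolding F_def by (intro L2_diff L2_scale L f)
  define ku kG kF where "ku x = (cmod (u x))\<^sup>2" and "kG x = (\<Sum>i\<in>UNIV. (cmod (G i x))\<^sup>2)" and "kF x = (cmod (F x))\<^sup>2" for x
  have k: "integrable lborel ku" "integrable lborel kG" "integrable lborel kF"
    unfolding ku_def kG_def kF_def by (intro L2_square_integrable L F Bochner_Integration.integrable_sum)+
  have k0: "ku x \<ge> 0" "kG x \<ge> 0" "kF x \<ge> 0" for x by (auto simp: ku_def kG_def kF_def sum_nonneg)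
  have km [measurable]: "ku \<in> borel_measurable borel" "kG \<in> borel_measurable borel" "kF \<in> borel_measurable borel"
    using k by (auto dest: borel_measurable_integrable)
  define N where "N = (\<integral>x. ku x \<partial>lborel) + (\<integral>x. kG x \<partial>lborel) + (\<integral>x. kF x \<partial>lborel)"
  have N: "N \<ge> 0" unfolding N_def using k0 by (intro add_nonneg_nonneg Bochner_Integration.integral_nonneg)
  show ?thesis
  proof (rule that[of "102 * C * N"])
    show "102 * C * N \<ge> 0" using C N by simp
  next
    fix \<epsilon> :: real and U
    assume \<epsilon>: "0 < \<epsilon>" "\<epsilon> \<le> 1" and U: "AE \<omega> in M. H1_solution (\<lambda>x. 1 - \<i> / of_real \<epsilon> * of_real (translate \<tau> (x /\<^sub>R \<epsilon>) v \<omega>)) f (\<lambda>x. U x \<omega>)"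
    define T where "T = 1 / \<epsilon>\<^sup>2"
    define b where "b = C * (\<epsilon>\<^sup>2 * growth CARD('d) T)"
    have T: "1 \<le> T" using \<epsilon> by (simp add: T_def power_le_one)
    obtain \<delta> \<delta>' m w A where \<delta>: "0 < \<delta>" "\<delta> \<le> 1" "0 < \<delta>'" "\<delta>' \<le> 1"
      and w_eq: "w = (\<lambda>\<omega>. v \<omega> * avg (green \<delta> T) v \<omega> - m)" and w: "bounded_rv A w"
      and b1: "(\<rho> - m)\<^sup>2 \<le> b" and b2: "(\<integral>\<omega>. (avg (green \<delta> T) v \<omega>)\<^sup>2 \<partial>M) \<le> C * growth CARD('d) T"
      and b3: "(\<integral>\<omega>. (v \<omega> - avg (heat \<delta>) v \<omega>)\<^sup>2 \<partial>M) \<le> \<epsilon>\<^sup>2 * b"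
      and b4: "(\<integral>\<omega>. (avg (heat T) v \<omega>)\<^sup>2 \<partial>M) \<le> \<epsilon>\<^sup>2 * b"
      and b5: "(\<integral>\<omega>. (w \<omega> - avg (heat \<delta>') w \<omega>)\<^sup>2 \<partial>M) \<le> b"
      and b6: "(\<integral>\<omega>. (avg (heat T) w \<omega>)\<^sup>2 \<partial>M) \<le> b"
      and b7: "(\<Sum>i\<in>UNIV. \<integral>\<omega>. (avg (green1 \<delta>' T i) w \<omega>)\<^sup>2 \<partial>M) \<le> C * growth CARD('d) T"
      using mom[OF \<epsilon>] unfolding corrector_error_bounds_def T_def[symmetric] b_def[symmetric]
      by (elim exE conjE) (rule that)
    have \<delta>T: "\<delta> \<le> T" "\<delta>' \<le> T" "0 < T" using \<delta> T by auto
    have kernels: "\<exists>D. C1_kernel (green s T :: real^'d \<Rightarrow> real) (green1 s T) D"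
        "\<exists>D. \<forall>i. C1_kernel (green1 s T i :: real^'d \<Rightarrow> real) (green2 s T i) (D i)" if "0 < s" "s \<le> T" for s
      using green_C1_kernel[OF that] choice[OF allI, OF green1_C1_kernel[OF that]] by simp_all
    obtain D where D: "C1_kernel (green \<delta> T :: real^'d \<Rightarrow> real) (green1 \<delta> T) D"
      using kernels(1)[OF \<delta>(1) \<delta>T(1)] ..
    obtain D1 where D1: "\<forall>i. C1_kernel (green1 \<delta> T i :: real^'d \<Rightarrow> real) (green2 \<delta> T i) (D1 i)"
      using kernels(2)[OF \<delta>(1) \<delta>T(1)] ..
    obtain D' where D': "C1_kernel (green \<delta>' T :: real^'d \<Rightarrow> real) (green1 \<delta>' T) D'"
      using kernels(1)[OF \<delta>(3) \<delta>T(2)] ..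
    obtain D1' where D1': "\<forall>i. C1_kernel (green1 \<delta>' T i :: real^'d \<Rightarrow> real) (green2 \<delta>' T i) (D1' i)"
      using kernels(2)[OF \<delta>(3) \<delta>T(2)] ..
    define \<phi> a1 a2 b1f b2f \<psi> where "\<phi> = avg (green \<delta> T) v" and "a1 = avg (heat \<delta>) v" and "a2 = avg (heat T) v"
      and "b1f = avg (heat \<delta>') w" and "b2f = avg (heat T) w" and "\<psi> i = avg (green1 \<delta>' T i) w" for i
    have ex: "\<exists>B. bounded_rv B \<phi>" "\<exists>B. bounded_rv B a1" "\<exists>B. bounded_rv B a2" "\<exists>B. bounded_rv B b1f" "\<exists>B. bounded_rv B b2f"
      "\<And>i. \<exists>B. bounded_rv B (\<psi> i)"
      unfolding \<phi>_def a1_def a2_def b1f_def b2f_def \<psi>_def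
      using avg_bounded[OF v green_integrable[OF \<delta>(1) \<delta>T(1)]] avg_bounded[OF v heat_integrable[OF \<delta>(1)]]
        avg_bounded[OF v heat_integrable[OF \<delta>T(3)]] avg_bounded[OF w heat_integrable[OF \<delta>(3)]]
        avg_bounded[OF w heat_integrable[OF \<delta>T(3)]] avg_bounded[OF w C1_kernel_partial_integrable[OF D']] by blast+
    obtain B0 B1 B2 B3 B4 B5 where rv: "bounded_rv B0 \<phi>" "bounded_rv B1 a1" "bounded_rv B2 a2"
      "bounded_rv B3 b1f" "bounded_rv B4 b2f" "\<And>i. bounded_rv (B5 i) (\<psi> i)"
      using ex by metis
    note [measurable] = rv[THEN bounded_rvD(1)] bounded_rvD(1)[OF v] bounded_rvD(1)[OF w]
    define X1 X2 X3 where "X1 \<omega> = 16 * ((\<rho> - m)\<^sup>2 + (w \<omega> - b1f \<omega>)\<^sup>2 + (b2f \<omega>)\<^sup>2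
            + (v \<omega> - a1 \<omega>)\<^sup>2 / \<epsilon>\<^sup>2 + (a2 \<omega>)\<^sup>2 / \<epsilon>\<^sup>2) + 18 * (\<epsilon>\<^sup>2 * (\<phi> \<omega>)\<^sup>2) + 4 * (\<epsilon>\<^sup>2 * (\<Sum>i\<in>UNIV. (\<psi> i \<omega>)\<^sup>2))"
      and "X2 \<omega> = 16 * (\<epsilon>\<^sup>2 * (\<phi> \<omega>)\<^sup>2) + 16 * (\<epsilon>\<^sup>2 * (\<Sum>i\<in>UNIV. (\<psi> i \<omega>)\<^sup>2))" and "X3 \<omega> = 16 * (\<epsilon>\<^sup>2 * (\<phi> \<omega>)\<^sup>2)" for \<omega>
    have Xm [measurable]: "X1 \<in> borel_measurable M" "X2 \<in> borel_measurable M" "X3 \<in> borel_measurable M"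
      unfolding X1_def X2_def X3_def by measurable
    have X0: "X1 \<omega> \<ge> 0" "X2 \<omega> \<ge> 0" "X3 \<omega> \<ge> 0" for \<omega>
      unfolding X1_def X2_def X3_def by (auto intro!: add_nonneg_nonneg sum_nonneg mult_nonneg_nonneg)
    note sq = square_integrable_rv[OF rv(1)] square_integrable_rv[OF rv(3)] square_integrable_rv[OF rv(5)] square_integrable_rv[OF rv(6)]
      square_integrable_rv[OF bounded_rv_add(2)[OF v rv(2)]] square_integrable_rv[OF bounded_rv_add(2)[OF w rv(4)]]
    have b0: "b \<ge> 0" using b1 by (rule order_trans[rotated]) simp
    have q1: "\<epsilon>\<^sup>2 * (\<integral>\<omega>. (\<phi> \<omega>)\<^sup>2 \<partial>M) \<le> b" "\<epsilon>\<^sup>2 * (\<Sum>i\<in>UNIV. \<integral>\<omega>. (\<psi> i \<omega>)\<^sup>2 \<partial>M) \<le> b"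
      using mult_left_mono[OF b2, of "\<epsilon>\<^sup>2"] mult_left_mono[OF b7, of "\<epsilon>\<^sup>2"]
      unfolding \<phi>_def \<psi>_def b_def by (simp_all add: mult_ac)
    have q2: "(\<integral>\<omega>. (v \<omega> - a1 \<omega>)\<^sup>2 \<partial>M) / \<epsilon>\<^sup>2 \<le> b" "(\<integral>\<omega>. (a2 \<omega>)\<^sup>2 \<partial>M) / \<epsilon>\<^sup>2 \<le> b"
      using b3 b4 \<epsilon> unfolding a1_def a2_def by (simp_all add: pos_divide_le_eq mult.commute)
    have q3: "(\<integral>\<omega>. (w \<omega> - b1f \<omega>)\<^sup>2 \<partial>M) \<le> b" "(\<integral>\<omega>. (b2f \<omega>)\<^sup>2 \<partial>M) \<le> b"
      using b5 b6 unfolding b1f_def b2f_def .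
    have EX: "(\<integral>\<^sup>+\<omega>. ennreal (X1 \<omega>) \<partial>M) \<le> ennreal (102 * b)" "(\<integral>\<^sup>+\<omega>. ennreal (X2 \<omega>) \<partial>M) \<le> ennreal (102 * b)"
      "(\<integral>\<^sup>+\<omega>. ennreal (X3 \<omega>) \<partial>M) \<le> ennreal (102 * b)"
    proof -
      have i: "integrable M X1" "integrable M X2" "integrable M X3" unfolding X1_def X2_def X3_def using sq by auto
      have "(\<integral>\<omega>. X1 \<omega> \<partial>M) = 16 * ((\<rho> - m)\<^sup>2 + (\<integral>\<omega>. (w \<omega> - b1f \<omega>)\<^sup>2 \<partial>M) + (\<integral>\<omega>. (b2f \<omega>)\<^sup>2 \<partial>M)
            + (\<integral>\<omega>. (v \<omega> - a1 \<omega>)\<^sup>2 \<partial>M) / \<epsilon>\<^sup>2 + (\<integral>\<omega>. (a2 \<omega>)\<^sup>2 \<partial>M) / \<epsilon>\<^sup>2)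
            + 18 * (\<epsilon>\<^sup>2 * (\<integral>\<omega>. (\<phi> \<omega>)\<^sup>2 \<partial>M)) + 4 * (\<epsilon>\<^sup>2 * (\<Sum>i\<in>UNIV. \<integral>\<omega>. (\<psi> i \<omega>)\<^sup>2 \<partial>M))"
        unfolding X1_def using sq by (simp add: prob_space Bochner_Integration.integral_sum)
      then have 1: "(\<integral>\<omega>. X1 \<omega> \<partial>M) \<le> 102 * b" using b1 q1 q2 q3 by argo
      have "(\<integral>\<omega>. X2 \<omega> \<partial>M) = 16 * (\<epsilon>\<^sup>2 * (\<integral>\<omega>. (\<phi> \<omega>)\<^sup>2 \<partial>M)) + 16 * (\<epsilon>\<^sup>2 * (\<Sum>i\<in>UNIV. \<integral>\<omega>. (\<psi> i \<omega>)\<^sup>2 \<partial>M))"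
        unfolding X2_def using sq by (simp add: Bochner_Integration.integral_sum)
      then have 2: "(\<integral>\<omega>. X2 \<omega> \<partial>M) \<le> 102 * b" using q1 b0 by argo
      have "(\<integral>\<omega>. X3 \<omega> \<partial>M) = 16 * (\<epsilon>\<^sup>2 * (\<integral>\<omega>. (\<phi> \<omega>)\<^sup>2 \<partial>M))" unfolding X3_def by simp
      then have 3: "(\<integral>\<omega>. X3 \<omega> \<partial>M) \<le> 102 * b" using q1 b0 by argo
      have n: "(\<integral>\<^sup>+\<omega>. ennreal (X \<omega>) \<partial>M) \<le> ennreal (102 * b)"
        if "integrable M X" "\<And>\<omega>. X \<omega> \<ge> 0" "(\<integral>\<omega>. X \<omega> \<partial>M) \<le> 102 * b" for X
        using that by (subst nn_integral_eq_integral) (auto intro: ennreal_leI)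
      show "(\<integral>\<^sup>+\<omega>. ennreal (X1 \<omega>) \<partial>M) \<le> ennreal (102 * b)" by (rule n[OF i(1) X0(1) 1])
      show "(\<integral>\<^sup>+\<omega>. ennreal (X2 \<omega>) \<partial>M) \<le> ennreal (102 * b)" by (rule n[OF i(2) X0(2) 2])
      show "(\<integral>\<^sup>+\<omega>. ennreal (X3 \<omega>) \<partial>M) \<le> ennreal (102 * b)" by (rule n[OF i(3) X0(3) 3])
    qed
    let ?t = "\<lambda>X \<omega> x. translate \<tau> (x /\<^sub>R \<epsilon>) X \<omega>"
    have path: "(\<integral>\<^sup>+x. ennreal ((cmod (U x \<omega> - u x))\<^sup>2) \<partial>lborel)
        \<le> (\<integral>\<^sup>+x. ennreal (ku x * ?t X1 \<omega> x) + ennreal (kG x * ?t X2 \<omega> x) + ennreal (kF x * ?t X3 \<omega> x) \<partial>lborel)"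
      if \<omega>: "\<omega> \<in> space M" and sol: "H1_solution (\<lambda>x. 1 - \<i> / of_real \<epsilon> * of_real (?t v \<omega> x)) f (\<lambda>x. U x \<omega>)" for \<omega>
    proof -
      define Bm where "Bm = B + B1 + B2 + B3 + B4"
      note nn = bounded_rvD(2)[OF v] rv(2-5)[THEN bounded_rvD(2)]
      have mono: "bounded_rv Bm v" "bounded_rv Bm a1" "bounded_rv Bm a2" "bounded_rv Bm b1f" "bounded_rv Bm b2f"
        by (rule bounded_rv_mono[OF v] bounded_rv_mono[OF rv(2)] bounded_rv_mono[OF rv(3)]
            bounded_rv_mono[OF rv(4)] bounded_rv_mono[OF rv(5)], use nn in \<open>simp add: Bm_def\<close>)+
      have bd: "\<bar>?t X \<omega> x\<bar> \<le> Bm" if "bounded_rv Bm X" for X x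
        unfolding translate_def by (rule bounded_rvD(3)[OF that shift_space[OF \<omega>]])
      have mt: "(\<lambda>x. ?t X \<omega> x) \<in> borel_measurable borel" if [measurable]: "X \<in> borel_measurable M" for X
        unfolding translate_def using \<omega> by measurable
      have lap: "(\<Sum>i\<in>UNIV. (1 / \<epsilon>) / \<epsilon> * ?t (avg (green2 s T i i) z) \<omega> x)
          = - (?t (avg (heat s) z) \<omega> x - ?t (avg (heat T) z) \<omega> x) / \<epsilon>\<^sup>2"
        if "0 < s" "s \<le> T" "bounded_rv E z" for s z E x
        using avg_green_laplacian[OF that shift_space[OF \<omega>], of "- (x /\<^sub>R \<epsilon>)"]
        unfolding translate_def sum_distrib_left[symmetric] by (simp add: power2_eq_square)
      have C\<Phi>: "C1_bounded (\<lambda>x. of_real (?t \<phi> \<omega> x)) (\<lambda>i x. of_real (1 / \<epsilon> * ?t (avg (green1 \<delta> T i) v) \<omega> x))"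
        using rescaled_average_C1[OF D v \<omega>, of 1 \<epsilon>] unfolding \<phi>_def by simp
      have C\<Phi>1: "C1_bounded (\<lambda>x. of_real (1 / \<epsilon> * ?t (avg (green1 \<delta> T i) v) \<omega> x))
          (\<lambda>j x. of_real (1 / \<epsilon> / \<epsilon> * ?t (avg (green2 \<delta> T i j) v) \<omega> x))" for i
        by (rule rescaled_average_C1[OF D1[rule_format] v \<omega>])
      have C\<Psi>1: "C1_bounded (\<lambda>x. of_real (1 / \<epsilon> * ?t (\<psi> i) \<omega> x))
          (\<lambda>j x. of_real (1 / \<epsilon> / \<epsilon> * ?t (avg (green2 \<delta>' T i j) w) \<omega> x))" for i
        unfolding \<psi>_def by (rule rescaled_average_C1[OF D1'[rule_format] w \<omega>])
      note lap1 = lap[OF \<delta>(1) \<delta>T(1) v, folded a1_def a2_def]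
      note lap2 = lap[OF \<delta>(3) \<delta>T(2) w, folded b1f_def b2f_def]
      have m1: "?t v \<omega> \<in> borel_measurable borel" "?t a1 \<omega> \<in> borel_measurable borel" "?t a2 \<omega> \<in> borel_measurable borel"
        "?t b1f \<omega> \<in> borel_measurable borel" "?t b2f \<omega> \<in> borel_measurable borel"
        by (rule mt, measurable)+
      note est = two_scale_estimate[where m = m, OF \<epsilon>(1) uG ueq sol f C\<Phi> C\<Phi>1 lap1 C\<Psi>1 lap2 m1 bd[OF mono(1)] bd[OF mono(2)] bd[OF mono(3)] bd[OF mono(4)] bd[OF mono(5)]]
      show ?thesis
      proof (rule order_trans[OF est], rule nn_integral_mono)
        fix x :: "real^'d"
        let ?s = "\<tau> (- (x /\<^sub>R \<epsilon>)) \<omega>"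
        have p: "(\<epsilon>\<^sup>2 * (1 / \<epsilon> * \<psi> i ?s))\<^sup>2 = \<epsilon>\<^sup>2 * (\<psi> i ?s)\<^sup>2" for i
          using \<epsilon> by (simp add: power2_eq_square)
        have wv: "v ?s * \<phi> ?s - m - b1f ?s = w ?s - b1f ?s" by (simp add: w_eq \<phi>_def)
        have "(cmod (u x))\<^sup>2 * (16 * ((\<rho> - m)\<^sup>2 + (?t v \<omega> x * ?t \<phi> \<omega> x - m - ?t b1f \<omega> x)\<^sup>2 + (?t b2f \<omega> x)\<^sup>2
            + ((?t v \<omega> x - ?t a1 \<omega> x) / \<epsilon>)\<^sup>2 + (?t a2 \<omega> x / \<epsilon>)\<^sup>2) + 18 * (\<epsilon> * ?t \<phi> \<omega> x)\<^sup>2 + 4 * (\<Sum>i\<in>UNIV. (\<epsilon>\<^sup>2 * (1 / \<epsilon> * ?t (\<psi> i) \<omega> x))\<^sup>2))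
          + (\<Sum>i\<in>UNIV. (cmod (G i x))\<^sup>2) * (16 * (\<epsilon> * ?t \<phi> \<omega> x)\<^sup>2 + 16 * (\<Sum>i\<in>UNIV. (\<epsilon>\<^sup>2 * (1 / \<epsilon> * ?t (\<psi> i) \<omega> x))\<^sup>2))
          + (cmod (f x - (1 + of_real \<rho>) * u x))\<^sup>2 * (16 * (\<epsilon> * ?t \<phi> \<omega> x)\<^sup>2)
          = ku x * ?t X1 \<omega> x + kG x * ?t X2 \<omega> x + kF x * ?t X3 \<omega> x"
          unfolding translate_def p wv X1_def X2_def X3_def ku_def kG_def kF_def F_def
          by (simp only: power_divide power_mult_distrib sum_distrib_left)
        then show "ennreal ((cmod (u x))\<^sup>2 * (16 * ((\<rho> - m)\<^sup>2 + (?t v \<omega> x * ?t \<phi> \<omega> x - m - ?t b1f \<omega> x)\<^sup>2 + (?t b2f \<omega> x)\<^sup>2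
            + ((?t v \<omega> x - ?t a1 \<omega> x) / \<epsilon>)\<^sup>2 + (?t a2 \<omega> x / \<epsilon>)\<^sup>2) + 18 * (\<epsilon> * ?t \<phi> \<omega> x)\<^sup>2 + 4 * (\<Sum>i\<in>UNIV. (\<epsilon>\<^sup>2 * (1 / \<epsilon> * ?t (\<psi> i) \<omega> x))\<^sup>2))
          + (\<Sum>i\<in>UNIV. (cmod (G i x))\<^sup>2) * (16 * (\<epsilon> * ?t \<phi> \<omega> x)\<^sup>2 + 16 * (\<Sum>i\<in>UNIV. (\<epsilon>\<^sup>2 * (1 / \<epsilon> * ?t (\<psi> i) \<omega> x))\<^sup>2))
          + (cmod (f x - (1 + of_real \<rho>) * u x))\<^sup>2 * (16 * (\<epsilon> * ?t \<phi> \<omega> x)\<^sup>2))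
          \<le> ennreal (ku x * ?t X1 \<omega> x) + ennreal (kG x * ?t X2 \<omega> x) + ennreal (kF x * ?t X3 \<omega> x)"
          using k0 X0 by (simp only:) (simp add: translate_def)
      qed
    qed
    have "(\<integral>\<^sup>+\<omega>. (\<integral>\<^sup>+x. ennreal ((cmod (U x \<omega> - u x))\<^sup>2) \<partial>lborel) \<partial>M)
        \<le> (\<integral>\<^sup>+\<omega>. (\<integral>\<^sup>+x. ennreal (ku x * ?t X1 \<omega> x) + ennreal (kG x * ?t X2 \<omega> x) + ennreal (kF x * ?t X3 \<omega> x) \<partial>lborel) \<partial>M)"
    proof (rule nn_integral_mono_AE)
      show "AE \<omega> in M. (\<integral>\<^sup>+x. ennreal ((cmod (U x \<omega> - u x))\<^sup>2) \<partial>lborel)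
          \<le> (\<integral>\<^sup>+x. ennreal (ku x * ?t X1 \<omega> x) + ennreal (kG x * ?t X2 \<omega> x) + ennreal (kF x * ?t X3 \<omega> x) \<partial>lborel)"
        using AE_space U by eventually_elim (rule path)
    qed
    also have "\<dots> = (\<integral>\<^sup>+\<omega>. (\<integral>\<^sup>+x. ennreal (ku x * ?t X1 \<omega> x) \<partial>lborel) + (\<integral>\<^sup>+x. ennreal (kG x * ?t X2 \<omega> x) \<partial>lborel)
        + (\<integral>\<^sup>+x. ennreal (kF x * ?t X3 \<omega> x) \<partial>lborel) \<partial>M)"
      unfolding translate_def by (intro nn_integral_cong) (subst nn_integral_add, measurable, subst nn_integral_add, measurable)
    also have "\<dots> = (\<integral>\<^sup>+\<omega>. (\<integral>\<^sup>+x. ennreal (ku x * ?t X1 \<omega> x) \<partial>lborel) \<partial>M) + (\<integral>\<^sup>+\<omega>. (\<integral>\<^sup>+x. ennreal (kG x * ?t X2 \<omega> x) \<partial>lborel) \<partial>M)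
        + (\<integral>\<^sup>+\<omega>. (\<integral>\<^sup>+x. ennreal (kF x * ?t X3 \<omega> x) \<partial>lborel) \<partial>M)"
      unfolding translate_def by (subst nn_integral_add, measurable, subst nn_integral_add, measurable)
    also have "\<dots> \<le> ennreal (\<integral>x. ku x \<partial>lborel) * ennreal (102 * b) + ennreal (\<integral>x. kG x \<partial>lborel) * ennreal (102 * b)
        + ennreal (\<integral>x. kF x \<partial>lborel) * ennreal (102 * b)"
      unfolding stationary_tonelli[OF Xm(1) km(1) k0(1)] stationary_tonelli[OF Xm(2) km(2) k0(2)] stationary_tonelli[OF Xm(3) km(3) k0(3)]
      using k k0 by (intro add_mono mult_mono EX) (auto simp: nn_integral_eq_integral)
    also have "\<dots> = ennreal (N * (102 * b))"
      unfolding N_def using k0 b0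
      by (simp add: ennreal_mult[symmetric] ennreal_plus[symmetric] distrib_right Bochner_Integration.integral_nonneg del: ennreal_plus)
    also have "N * (102 * b) = 102 * C * N * (\<epsilon>\<^sup>2 * growth CARD('d) (1 / \<epsilon>\<^sup>2))"
      by (simp add: b_def T_def)
    finally show "(\<integral>\<^sup>+\<omega>. (\<integral>\<^sup>+x. ennreal ((cmod (U x \<omega> - u x))\<^sup>2) \<partial>lborel) \<partial>M)
        \<le> ennreal (102 * C * N * (\<epsilon>\<^sup>2 * growth CARD('d) (1 / \<epsilon>\<^sup>2)))" .
  qed
qed

end

section \<open>The rate of convergence\<close>

lemma (in prob_space) L2_field_norm_bound:
  fixes F :: "real^'d \<Rightarrow> 'a \<Rightarrow> complex"
  assumes F: "(\<lambda>(x, \<omega>). F x \<omega>) \<in> borel_measurable (lborel \<Otimes>\<^sub>M M)"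
    and c: "c \<ge> 0" "(\<integral>\<^sup>+\<omega>. (\<integral>\<^sup>+x. ennreal ((cmod (F x \<omega>))\<^sup>2) \<partial>lborel) \<partial>M) \<le> ennreal c"
  shows "F \<in> L2_field M" "L2_field_norm M F \<le> sqrt c"
proof -
  interpret P: pair_sigma_finite "lborel :: (real^'d) measure" M ..
  have m [measurable]: "(\<lambda>(x, \<omega>). (cmod (F x \<omega>))\<^sup>2) \<in> borel_measurable (lborel \<Otimes>\<^sub>M M)"
    using measurable_compose[OF F, of "\<lambda>z. (cmod z)\<^sup>2"] by (simp add: case_prod_beta')
  have n: "(\<integral>\<^sup>+p. ennreal (case p of (x, \<omega>) \<Rightarrow> (cmod (F x \<omega>))\<^sup>2) \<partial>(lborel \<Otimes>\<^sub>M M)) \<le> ennreal c"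
    using P.nn_integral_snd[of "\<lambda>p. ennreal (case p of (x, \<omega>) \<Rightarrow> (cmod (F x \<omega>))\<^sup>2)"] c(2) by simp
  have I: "integrable (lborel \<Otimes>\<^sub>M M) (\<lambda>(x, \<omega>). (cmod (F x \<omega>))\<^sup>2)"
  proof (rule integrableI_nonneg[OF m])
    show "AE p in lborel \<Otimes>\<^sub>M M. 0 \<le> (case p of (x, \<omega>) \<Rightarrow> (cmod (F x \<omega>))\<^sup>2)" by (simp add: case_prod_beta')
    show "(\<integral>\<^sup>+p. ennreal (case p of (x, \<omega>) \<Rightarrow> (cmod (F x \<omega>))\<^sup>2) \<partial>(lborel \<Otimes>\<^sub>M M)) < \<infinity>"
      by (rule order_le_less_trans[OF n]) simp
  qed
  then show "F \<in> L2_field M" using F by (simp add: L2_field_def L2_def case_prod_beta')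
  have "ennreal (\<integral>\<omega>. (\<integral>x. (cmod (F x \<omega>))\<^sup>2 \<partial>lborel) \<partial>M) \<le> ennreal c"
    using n unfolding P.integral_snd[OF I] nn_integral_eq_integral[OF I, simplified case_prod_beta'] 
    by (subst (asm) nn_integral_eq_integral[OF I]) (auto simp: case_prod_beta')
  then have "(\<integral>\<omega>. (\<integral>x. (cmod (F x \<omega>))\<^sup>2 \<partial>lborel) \<partial>M) \<le> c" using c(1) by (simp add: ennreal_le_iff)
  then show "L2_field_norm M F \<le> sqrt c" unfolding L2_field_norm_def by simp
qed

definition rate :: "nat \<Rightarrow> real \<Rightarrow> real" where
  "rate d \<epsilon> = (if d = 3 then sqrt \<epsilon> else if d = 4 then \<epsilon> * sqrt \<bar>ln \<epsilon>\<bar> else \<epsilon>)"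

text \<open>The restriction on \<open>\<epsilon>\<close> makes \<open>|ln \<epsilon>| \<ge> 1\<close>, so that the constant in \<open>1 + ln (1 / \<epsilon>\<^sup>2)\<close> is absorbed by
  the logarithm.\<close>

lemma growth_rate:
  assumes \<epsilon>: "0 < \<epsilon>" "\<epsilon> \<le> exp (- 1)"
  shows "\<epsilon> * sqrt (growth d (1 / \<epsilon>\<^sup>2)) \<le> 2 * rate d \<epsilon>"
proof -
  have "ln \<epsilon> \<le> ln (exp (- 1))" using \<epsilon> by (subst ln_le_cancel_iff) auto
  then have l: "ln \<epsilon> \<le> - 1" by simp
  consider "d = 3" | "d = 4" | "d \<noteq> 3" "d \<noteq> 4" by blast
  then show ?thesis
  proof cases
    case 1
    have "\<epsilon> * sqrt (1 / \<epsilon>) = sqrt \<epsilon>" using \<epsilon>(1) by (simp add: real_sqrt_divide real_div_sqrt)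
    moreover have "sqrt (1 / \<epsilon>\<^sup>2) = 1 / \<epsilon>" using \<epsilon>(1) by (simp add: real_sqrt_divide)
    ultimately show ?thesis using 1 \<epsilon>(1) by (simp add: growth_def rate_def)
  next
    case 2
    have "1 + ln (1 / \<epsilon>\<^sup>2) = 1 - 2 * ln \<epsilon>" using \<epsilon>(1) by (simp add: ln_div ln_realpow)
    also have "\<dots> \<le> 2\<^sup>2 * \<bar>ln \<epsilon>\<bar>" using l by simp
    finally have "sqrt (1 + ln (1 / \<epsilon>\<^sup>2)) \<le> sqrt (2\<^sup>2 * \<bar>ln \<epsilon>\<bar>)" by (rule real_sqrt_le_mono)
    also have "\<dots> = 2 * sqrt \<bar>ln \<epsilon>\<bar>" by (simp add: real_sqrt_mult)
    finally have "\<epsilon> * sqrt (1 + ln (1 / \<epsilon>\<^sup>2)) \<le> \<epsilon> * (2 * sqrt \<bar>ln \<epsilon>\<bar>)" using \<epsilon>(1) by (intro mult_left_mono) auto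
    then show ?thesis using 2 by (simp add: growth_def rate_def)
  next
    case 3
    then show ?thesis using \<epsilon>(1) by (simp add: growth_def rate_def)
  qed
qed

lemma rate_le_sqrt:
  assumes \<epsilon>: "0 < \<epsilon>" "\<epsilon> \<le> 1"
  shows "rate d \<epsilon> \<le> sqrt \<epsilon>"
proof -
  have s: "\<epsilon> = sqrt \<epsilon> * sqrt \<epsilon>" using \<epsilon> by simp
  have "sqrt \<epsilon> * sqrt \<epsilon> \<le> sqrt \<epsilon> * 1" using \<epsilon> by (intro mult_left_mono) auto
  then have a: "\<epsilon> \<le> sqrt \<epsilon>" using s by simp
  have "\<epsilon> * \<bar>ln \<epsilon>\<bar> \<le> 1"
  proof -
    have "ln (1 / \<epsilon>) \<le> 1 / \<epsilon>" using \<epsilon> ln_bound[of "1 / \<epsilon>"] by simp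
    then have "\<bar>ln \<epsilon>\<bar> \<le> 1 / \<epsilon>" using \<epsilon> by (simp add: ln_div)
    then have "\<epsilon> * \<bar>ln \<epsilon>\<bar> \<le> \<epsilon> * (1 / \<epsilon>)" using \<epsilon> by (intro mult_left_mono) auto
    then show ?thesis using \<epsilon> by simp
  qed
  then have "sqrt \<epsilon> * sqrt \<bar>ln \<epsilon>\<bar> \<le> 1" by (simp add: real_sqrt_mult[symmetric] real_sqrt_le_1_iff)
  then have "sqrt \<epsilon> * (sqrt \<epsilon> * sqrt \<bar>ln \<epsilon>\<bar>) \<le> sqrt \<epsilon> * 1" using \<epsilon> by (intro mult_left_mono) auto
  then have "\<epsilon> * sqrt \<bar>ln \<epsilon>\<bar> \<le> sqrt \<epsilon>" using s by (simp add: mult.assoc[symmetric])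
  with a show ?thesis by (simp add: rate_def)
qed

theorem theorem1p2:
  fixes M :: "'w measure"
    and \<tau> :: "real^'d \<Rightarrow> 'w \<Rightarrow> 'w"
    and U :: "(real^'d) set \<Rightarrow> ('w \<Rightarrow> complex) \<Rightarrow> 'w \<Rightarrow> complex"
    and v :: "'w \<Rightarrow> real"
    and V :: "real^'d \<Rightarrow> 'w \<Rightarrow> real"
    and R :: "real^'d \<Rightarrow> real"
    and \<eta> :: "real \<Rightarrow> real"
    and f u :: "real^'d \<Rightarrow> complex"
    and u\<^sub>\<epsilon> :: "real \<Rightarrow> real^'d \<Rightarrow> 'w \<Rightarrow> complex"
  assumes dimension: "CARD('d) \<ge> 3"
    and setting: "ergodic_translation_group M \<tau> U"
    and v_measurable: "v \<in> borel_measurable M"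
    and v_bounded: "\<exists>B. \<forall>\<omega>\<in>space M. \<bar>v \<omega>\<bar> \<le> B"
    and v_mean_zero: "(\<integral>\<omega>. v \<omega> \<partial>M) = 0"
    and V_def: "V = (\<lambda>x. translate \<tau> x v)"
    and R_def: "R = correlation M \<tau> v"
    and R_integrable: "integrable lborel R"
    and \<eta>_nonneg: "\<And>r. r \<ge> 0 \<Longrightarrow> \<eta> r \<ge> 0"
    and \<eta>_integrable: "integrable lborel (\<lambda>x :: real^'d. \<eta> (norm x))"
    and fourth_moments: "\<And>x\<^sub>1 x\<^sub>2 x\<^sub>3 x\<^sub>4.
          \<bar>(\<integral>\<omega>. V x\<^sub>1 \<omega> * V x\<^sub>2 \<omega> * V x\<^sub>3 \<omega> * V x\<^sub>4 \<omega> \<partial>M) - R (x\<^sub>1 - x\<^sub>2) * R (x\<^sub>3 - x\<^sub>4)\<bar>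
            \<le> \<eta> (norm (x\<^sub>1 - x\<^sub>3)) * \<eta> (norm (x\<^sub>2 - x\<^sub>4))
              + \<eta> (norm (x\<^sub>1 - x\<^sub>4)) * \<eta> (norm (x\<^sub>2 - x\<^sub>3))"
    and f_L2: "f \<in> L2 lborel"
    and u\<^sub>\<epsilon>_measurable: "\<And>\<epsilon>. \<epsilon> > 0 \<Longrightarrow>
          (\<lambda>(x, \<omega>). u\<^sub>\<epsilon> \<epsilon> x \<omega>) \<in> borel_measurable (lborel \<Otimes>\<^sub>M M)"
    and u\<^sub>\<epsilon>_solution: "\<And>\<epsilon>. \<epsilon> > 0 \<Longrightarrow> AE \<omega> in M.
          H1_solution (\<lambda>x. 1 - \<i> / of_real \<epsilon> * of_real (V (x /\<^sub>R \<epsilon>) \<omega>)) f (\<lambda>x. u\<^sub>\<epsilon> \<epsilon> x \<omega>)"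
    and u_solution: "H1_solution (\<lambda>x. 1 + effective_potential R) f u"
  shows "(\<forall>\<^sub>F \<epsilon> in at_right 0. (\<lambda>x \<omega>. u\<^sub>\<epsilon> \<epsilon> x \<omega> - u x) \<in> L2_field M) \<and>
    ((\<lambda>\<epsilon>. L2_field_norm M (\<lambda>x \<omega>. u\<^sub>\<epsilon> \<epsilon> x \<omega> - u x)) \<longlongrightarrow> 0) (at_right 0) \<and>
    (\<exists>C. \<forall>\<^sub>F \<epsilon> in at_right 0.
       L2_field_norm M (\<lambda>x \<omega>. u\<^sub>\<epsilon> \<epsilon> x \<omega> - u x)
         \<le> C * (if CARD('d) = 3 then sqrt \<epsilon>
                else if CARD('d) = 4 then \<epsilon> * sqrt \<bar>ln \<epsilon>\<bar>
                else \<epsilon>))"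
proof -
  interpret ergodic_translation_group M \<tau> U by (rule setting)
  obtain B where B: "\<And>\<omega>. \<omega> \<in> space M \<Longrightarrow> \<bar>v \<omega>\<bar> \<le> B" using v_bounded by blast
  have v: "bounded_rv \<bar>B\<bar> v" unfolding bounded_rv_def using v_measurable B by force
  have R: "integrable lborel (correlation M \<tau> v)" using R_integrable by (simp add: R_def)
  let ?g = "\<lambda>x :: real^'d. \<eta> (norm x)"
  have four: "\<bar>(\<integral>\<omega>. v \<omega> * v (\<tau> y \<omega>) * v (\<tau> (- x) \<omega>) * v (\<tau> (z - x) \<omega>) \<partial>M) - correlation M \<tau> v y * correlation M \<tau> v z\<bar>
      \<le> ?g x * ?g (z - y - x) + ?g (x - z) * ?g (x + y)" for x y z
  proof -
    have "(\<integral>\<omega>. V 0 \<omega> * V (- y) \<omega> * V x \<omega> * V (x - z) \<omega> \<partial>M)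
        = (\<integral>\<omega>. v \<omega> * v (\<tau> y \<omega>) * v (\<tau> (- x) \<omega>) * v (\<tau> (z - x) \<omega>) \<partial>M)"
      by (rule Bochner_Integration.integral_cong) (simp_all add: V_def translate_def translation_zero)
    moreover have "norm (- y - (x - z)) = norm (z - y - x)" "norm (- y - x) = norm (x + y)" "norm (0 - x) = norm x"
        "norm (0 - (x - z)) = norm (x - z)"
      by (simp_all add: algebra_simps norm_minus_commute)
    ultimately show ?thesis
      \<comment> \<open>The points are those of \<open>v \<phi>\<close> at \<open>0\<close> and at \<open>x\<close>, each with its own integration variable.\<close>
      using fourth_moments[of 0 "- y" x "x - z"] unfolding R_def by simp
  qed
  obtain C where C: "C \<ge> 0" and est: "\<And>\<epsilon> W. 0 < \<epsilon> \<Longrightarrow> \<epsilon> \<le> 1 \<Longrightarrow>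
      AE \<omega> in M. H1_solution (\<lambda>x. 1 - \<i> / of_real \<epsilon> * of_real (translate \<tau> (x /\<^sub>R \<epsilon>) v \<omega>)) f (\<lambda>x. W x \<omega>) \<Longrightarrow>
      (\<integral>\<^sup>+\<omega>. (\<integral>\<^sup>+x. ennreal ((cmod (W x \<omega> - u x))\<^sup>2) \<partial>lborel) \<partial>M)
        \<le> ennreal (C * (\<epsilon>\<^sup>2 * growth CARD('d) (1 / \<epsilon>\<^sup>2)))"
  proof (rule homogenization_estimate[OF dimension v R \<eta>_integrable _ four f_L2])
    show "\<eta> (norm x) \<ge> 0" for x :: "real^'d" by (rule \<eta>_nonneg) simp
    show "H1_solution (\<lambda>x. 1 + effective_potential (correlation M \<tau> v)) f u" using u_solution by (simp add: R_def)
  qed (rule that)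
  let ?e = "\<lambda>\<epsilon> x \<omega>. u\<^sub>\<epsilon> \<epsilon> x \<omega> - u x"
  have u_meas: "u \<in> borel_measurable borel"
    using u_solution by (auto simp: H1_solution_def H1_with_gradient_def L2_def)
  have main: "?e \<epsilon> \<in> L2_field M" "L2_field_norm M (?e \<epsilon>) \<le> sqrt C * 2 * rate CARD('d) \<epsilon>"
    if \<epsilon>: "0 < \<epsilon>" "\<epsilon> < exp (- 1)" for \<epsilon>
  proof -
    have \<epsilon>1: "\<epsilon> \<le> 1" using \<epsilon>(2) order_less_trans[of \<epsilon> "exp (- 1)" 1] by simp
    let ?h = "growth CARD('d) (1 / \<epsilon>\<^sup>2)"
    have h: "?h \<ge> 0" using growth_ge_1[of "1 / \<epsilon>\<^sup>2" "CARD('d)"] \<epsilon> \<epsilon>1 by (simp add: power_le_one)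
    have m: "(\<lambda>(x, \<omega>). ?e \<epsilon> x \<omega>) \<in> borel_measurable (lborel \<Otimes>\<^sub>M M)"
      using borel_measurable_diff[OF u\<^sub>\<epsilon>_measurable[OF \<epsilon>(1)], of "\<lambda>p. u (fst p)"] u_meas
      by (simp add: case_prod_beta')
    have n: "(\<integral>\<^sup>+\<omega>. (\<integral>\<^sup>+x. ennreal ((cmod (?e \<epsilon> x \<omega>))\<^sup>2) \<partial>lborel) \<partial>M) \<le> ennreal (C * (\<epsilon>\<^sup>2 * ?h))"
      using est[OF \<epsilon>(1) \<epsilon>1, of "u\<^sub>\<epsilon> \<epsilon>"] u\<^sub>\<epsilon>_solution[OF \<epsilon>(1)] by (simp add: V_def)
    have c: "C * (\<epsilon>\<^sup>2 * ?h) \<ge> 0" using C h by simp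
    show "?e \<epsilon> \<in> L2_field M" by (rule L2_field_norm_bound(1)[OF m c n])
    have "L2_field_norm M (?e \<epsilon>) \<le> sqrt (C * (\<epsilon>\<^sup>2 * ?h))" by (rule L2_field_norm_bound(2)[OF m c n])
    also have "\<dots> = sqrt C * (\<epsilon> * sqrt ?h)" using \<epsilon> by (simp add: real_sqrt_mult)
    also have "\<dots> \<le> sqrt C * (2 * rate CARD('d) \<epsilon>)"
      using growth_rate[of \<epsilon> "CARD('d)"] \<epsilon> C by (intro mult_left_mono) auto
    finally show "L2_field_norm M (?e \<epsilon>) \<le> sqrt C * 2 * rate CARD('d) \<epsilon>" by simp
  qed
  have small: "\<forall>\<^sub>F \<epsilon> in at_right (0 :: real). 0 < \<epsilon> \<and> \<epsilon> < exp (- 1)"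
    by (auto simp: eventually_at_right_field intro!: exI[of _ "exp (- 1)"])
  have "((\<lambda>\<epsilon>. L2_field_norm M (?e \<epsilon>)) \<longlongrightarrow> 0) (at_right 0)"
  proof (rule tendsto_sandwich)
    show "\<forall>\<^sub>F \<epsilon> in at_right 0. 0 \<le> L2_field_norm M (?e \<epsilon>)"
      by (simp add: L2_field_norm_def)
    show "\<forall>\<^sub>F \<epsilon> in at_right 0. L2_field_norm M (?e \<epsilon>) \<le> sqrt C * 2 * sqrt \<epsilon>"
      using small
    proof eventually_elim
      case (elim \<epsilon>)
      then have "\<epsilon> \<le> 1" using order_less_trans[of \<epsilon> "exp (- 1)" 1] by simp
      then have "sqrt C * 2 * rate CARD('d) \<epsilon> \<le> sqrt C * 2 * sqrt \<epsilon>"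
        using elim C by (intro mult_left_mono rate_le_sqrt) auto
      then show ?case using main(2)[of \<epsilon>] elim by linarith
    qed
    show "((\<lambda>\<epsilon>. sqrt C * 2 * sqrt \<epsilon>) \<longlongrightarrow> 0) (at_right 0)"
      by (rule tendsto_eq_rhs[OF tendsto_mult[OF tendsto_const tendsto_real_sqrt[OF tendsto_ident_at]]]) simp
  qed simp
  moreover have "\<forall>\<^sub>F \<epsilon> in at_right 0. ?e \<epsilon> \<in> L2_field M"
    using small by eventually_elim (rule main(1), auto)
  moreover have "\<forall>\<^sub>F \<epsilon> in at_right 0. L2_field_norm M (?e \<epsilon>) \<le> sqrt C * 2 * rate CARD('d) \<epsilon>"
    using small by eventually_elim (rule main(2), auto)
  ultimately show ?thesis unfolding rate_def by blast
qed

end
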